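(* Let $g\in\mathbb Q(q)\otimes H_n(q)$ and let $Y_q(g)=\sum_{\lambda\vdash n}\epsilon_q^\lambda(g)m_\lambda\in\mathbb Q(q)\otimes\Lambda_n$. Then $Y_q(g)$ is equal to $$\sum_{\lambda\vdash n}\eta_q^\lambda(g)f_\lambda=\sum_{\lambda\vdash n}\frac{(-1)^{n-\ell(\lambda)}\psi_q^\lambda(g)}{z_\lambda}p_\lambda=\sum_{\lambda\vdash n}\chi_q^{\lambda^\top}(g)s_\lambda=\sum_{\lambda\vdash n}\phi_q^\lambda(g)e_\lambda=\sum_{\lambda\vdash n}\gamma_q^\lambda(g)h_\lambda;$$ equivalently, $\omega Y_q(g)$ is equal to $$\sum_{\lambda\vdash n}\epsilon_q^\lambda(g)f_\lambda=\sum_{\lambda\vdash n}\eta_q^\lambda(g)m_\lambda=\sum_{\lambda\vdash n}\frac{\psi_q^\lambda(g)}{z_\lambda}p_\lambda=\sum_{\lambda\vdash n}\chi_q^\lambda(g)s_\lambda=\sum_{\lambda\vdash n}\phi_q^\lambda(g)h_\lambda=\sum_{\lambda\vdash n}\gamma_q^\lambda(g)e_\lambda.$$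
   Context: $\Lambda_n$ is the $\mathbb Z$-module of homogeneous degree-$n$ symmetric functions, with bases monomial $m_\lambda$, elementary $e_\lambda$, complete homogeneous $h_\lambda$, power sum $p_\lambda$ (over $\mathbb Q$), Schur $s_\lambda$, and forgotten $f_\lambda=\omega(m_\lambda)$, where $\omega$ is the involutive automorphism with $\omega(e_k)=h_k$. $\ell(\lambda)$ is the number of parts of $\lambda$, $\lambda^\top$ the transpose partition, $z_\lambda=\lambda_1\cdots\lambda_\ell\,\alpha_1!\cdots\alpha_n!$ with $\alpha_i$ the number of parts equal to $i$. $H_n(q)$ is the type $A$ Hecke algebra with generators $T_{s_1},\dots,T_{s_{n-1}}$ and relations $T_{s_i}^2=(q-1)T_{s_i}+q$, $T_{s_i}T_{s_j}=T_{s_j}T_{s_i}$ for $|i-j|\ge2$, $T_{s_i}T_{s_j}T_{s_i}=T_{s_j}T_{s_i}T_{s_j}$ for $|i-j|=1$, with natural basis $\{T_w: w\in\mathfrak S_n\}$, $T_w=T_{s_{i_1}}\cdots T_{s_{i_\ell}}$ for a reduced expression $w=s_{i_1}\cdots s_{i_\ell}$. $\mathbb Q(q)\otimes H_n(q)$ is this algebra over $\mathbb Q(q)$ (with $\mathbb Q(q)$-basis $\{T_w\}$). Traces are linear functionals $\theta_q$ with $\theta_q(gh)=\theta_q(hg)$, extended $\mathbb Q(q)$-linearly. $\chi_q^\lambda$ is the irreducible character of $H_n(q)$ whose $q^{1/2}=1$ specialization is the irreducible $\mathfrak S_n$-character $\chi^\lambda$ ($\chi^{n}$ trivial). $\epsilon_q^\lambda$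 and $\eta_q^\lambda$ are the characters of $H_n(q)$ induced from the sign character ($T_w\mapsto(-1)^{\ell(w)}$), respectively the trivial character ($T_w\mapsto q^{\ell(w)}$), of the parabolic subalgebra $H_\lambda(q)$ corresponding to the Young subgroup $\mathfrak S_\lambda$. The power sum, monomial and forgotten traces are $$\psi_q^\lambda=\sum_\mu\chi^\mu(\lambda)\chi_q^\mu,\qquad\phi_q^\lambda=\sum_\mu K^{-1}_{\lambda,\mu}\chi_q^\mu,\qquad\gamma_q^\lambda=\sum_\mu K^{-1}_{\lambda,\mu^\top}\chi_q^\mu,$$ where $\chi^\mu(\lambda)$ is the value of $\chi^\mu$ at a permutation of cycle type $\lambda$, and $K^{-1}_{\lambda,\mu}$ are the inverse Kostka numbers, defined by $m_\lambda=\sum_\mu K^{-1}_{\lambda,\mu}s_\mu$. *)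

theory Defs
  imports
    "HOL-Library.Poly_Mapping"
    "HOL-Library.FuncSet"
    "HOL-Combinatorics.Combinatorics"
    "HOL-Computational_Algebra.Polynomial"
    "HOL-Computational_Algebra.Fraction_Field"
    "Jordan_Normal_Form.Matrix"
begin

section \<open>Partitions\<close>

definition partitions :: "nat \<Rightarrow> nat list set" where
  "partitions n = {la. sorted_wrt (\<ge>) la \<and> (\<forall>x\<in>set la. 0 < x) \<and> sum_list la = n}"

definition transpose_partition :: "nat list \<Rightarrow> nat list" where
  "transpose_partition la =
     (case la of [] \<Rightarrow> [] | a # _ \<Rightarrow> map (\<lambda>j. length (filter (\<lambda>x. j < x) la)) [0..<a])"

definition z_partition :: "nat list \<Rightarrow> nat" where
  "z_partition la = prod_list la * (\<Prod>i = 1..sum_list la. fact (count_list la i))"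


section \<open>Formal power series in variables indexed by the natural numbers\<close>

text \<open>A monomial is its exponent vector, of type \<^typ>\<open>nat \<Rightarrow>\<^sub>0 nat\<close>.\<close>

typedef 'a mseries = "UNIV :: ((nat \<Rightarrow>\<^sub>0 nat) \<Rightarrow> 'a) set"
  morphisms coeff_ms Abs_ms ..

setup_lifting type_definition_mseries

lemma mseries_eqI: "(\<And>al. coeff_ms f al = coeff_ms g al) \<Longrightarrow> f = g"
  by transfer auto

definition splits :: "(nat \<Rightarrow>\<^sub>0 nat) \<Rightarrow> ((nat \<Rightarrow>\<^sub>0 nat) \<times> (nat \<Rightarrow>\<^sub>0 nat)) set" where
  "splits al = {(be, ga). be + ga = al}"

lemma finite_splits: "finite (splits al)"
proof -
  let ?M = "Max (insert 0 (Poly_Mapping.lookup al ` Poly_Mapping.keys al))"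
  let ?F = "{f::nat \<Rightarrow> nat. \<forall>x. (x \<in> Poly_Mapping.keys al \<longrightarrow> f x \<in> {..?M}) \<and>
                                   (x \<notin> Poly_Mapping.keys al \<longrightarrow> f x = 0)}"
  have fin: "finite ?F" by (rule finite_set_of_finite_funs) auto
  have le: "Poly_Mapping.lookup be i \<le> Poly_Mapping.lookup al i" if "be + ga = al" for be ga i
    using that by (auto simp: lookup_add)
  have mem: "Poly_Mapping.lookup be \<in> ?F" if "be + ga = al" for be ga
  proof -
    have "Poly_Mapping.lookup be x \<le> ?M" if "x \<in> Poly_Mapping.keys al" for x
    proof -
      have "Poly_Mapping.lookup al x \<le> ?M" using that by (intro Max_ge) auto
      then show ?thesis using le[OF \<open>be + ga = al\<close>, of x] by linarith
    qed
    moreover have "Poly_Mapping.lookup be x = 0" if "x \<notin> Poly_Mapping.keys al" for x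
      using le[OF \<open>be + ga = al\<close>, of x] that by (simp add: in_keys_iff)
    ultimately show ?thesis by auto
  qed
  have "(Poly_Mapping.lookup ` (fst ` splits al)) \<subseteq> ?F"
    using mem by (auto simp: splits_def)
  then have "finite (Poly_Mapping.lookup ` (fst ` splits al))" by (rule finite_subset[OF _ fin])
  then have f1: "finite (fst ` splits al)"
    by (rule finite_imageD) (auto intro: inj_onI poly_mapping_eqI)
  have "inj_on fst (splits al)" by (auto simp: inj_on_def splits_def)
  with f1 show ?thesis by (rule finite_imageD)
qed

instantiation mseries :: (comm_ring_1) comm_ring_1
begin

lift_definition zero_mseries :: "'a mseries" is "\<lambda>_. 0" .
lift_definition one_mseries :: "'a mseries" is "\<lambda>al. if al = 0 then 1 else 0" .
lift_definition plus_mseries :: "'a mseries \<Rightarrow> 'a mseries \<Rightarrow> 'a mseries"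
  is "\<lambda>f g al. f al + g al" .
lift_definition minus_mseries :: "'a mseries \<Rightarrow> 'a mseries \<Rightarrow> 'a mseries"
  is "\<lambda>f g al. f al - g al" .
lift_definition uminus_mseries :: "'a mseries \<Rightarrow> 'a mseries"
  is "\<lambda>f al. - f al" .
lift_definition times_mseries :: "'a mseries \<Rightarrow> 'a mseries \<Rightarrow> 'a mseries"
  is "\<lambda>f g al. \<Sum>(be, ga)\<in>splits al. f be * g ga" .

instance
proof
  fix a b c :: "'a mseries"
  show "a * b * c = a * (b * c)"
  proof (transfer, rule ext)
    fix a b c :: "(nat \<Rightarrow>\<^sub>0 nat) \<Rightarrow> 'a" and al
    have "(\<Sum>(be, ga)\<in>splits al. (\<Sum>(de, ep)\<in>splits be. a de * b ep) * c ga) =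
          (\<Sum>x\<in>splits al. \<Sum>y\<in>splits (fst x). a (fst y) * b (snd y) * c (snd x))"
      by (simp add: case_prod_beta sum_distrib_right)
    also have "\<dots> = (\<Sum>(x, y)\<in>Sigma (splits al) (\<lambda>x. splits (fst x)).
                        a (fst y) * b (snd y) * c (snd x))"
      by (rule sum.Sigma) (auto simp: finite_splits)
    also have "\<dots> = (\<Sum>(x, y)\<in>Sigma (splits al) (\<lambda>x. splits (snd x)).
                        a (fst x) * (b (fst y) * c (snd y)))"
      by (rule sum.reindex_bij_witness
            [where i = "\<lambda>(x, y). ((fst x + fst y, snd y), (fst x, fst y))"
               and j = "\<lambda>(x, y). ((fst y, snd y + snd x), (snd y, snd x))"])
         (auto simp: splits_def add.assoc mult.assoc)
    also have "\<dots> = (\<Sum>x\<in>splits al. \<Sum>y\<in>splits (snd x). a (fst x) * (b (fst y) * c (snd y)))"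
      by (rule sum.Sigma[symmetric]) (auto simp: finite_splits)
    also have "\<dots> = (\<Sum>(be, ga)\<in>splits al. a be * (\<Sum>(de, ep)\<in>splits ga. b de * c ep))"
      by (simp add: case_prod_beta sum_distrib_left)
    finally show "(\<Sum>(be, ga)\<in>splits al. (\<Sum>(de, ep)\<in>splits be. a de * b ep) * c ga) =
                  (\<Sum>(be, ga)\<in>splits al. a be * (\<Sum>(de, ep)\<in>splits ga. b de * c ep))" .
  qed
  show "a * b = b * a"
  proof (transfer, rule ext)
    fix a b :: "(nat \<Rightarrow>\<^sub>0 nat) \<Rightarrow> 'a" and al
    show "(\<Sum>(be, ga)\<in>splits al. a be * b ga) = (\<Sum>(be, ga)\<in>splits al. b be * a ga)"
      by (rule sum.reindex_bij_witness[where i = prod.swap and j = prod.swap])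
         (auto simp: splits_def add.commute mult.commute)
  qed
  show "1 * a = a"
  proof (transfer, rule ext)
    fix a :: "(nat \<Rightarrow>\<^sub>0 nat) \<Rightarrow> 'a" and al
    have mem: "(0, al) \<in> splits al" by (simp add: splits_def)
    have "(\<Sum>x\<in>splits al. (if fst x = 0 then 1 else 0) * a (snd x)) =
          (\<Sum>x\<in>splits al. if x = (0, al) then a al else 0)"
      by (rule sum.cong) (auto simp: splits_def split: if_splits)
    also have "\<dots> = a al"
      using mem by (subst sum.delta) (auto simp: finite_splits)
    finally show "(\<Sum>(be, ga)\<in>splits al. (if be = 0 then 1 else 0) * a ga) = a al"
      by (simp add: case_prod_beta)
  qed
  show "(a + b) * c = a * c + b * c"
    by transfer (auto simp: case_prod_beta distrib_right sum.distrib)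
  show "a + b + c = a + (b + c)" by transfer (auto simp: add.assoc)
  show "a + b = b + a" by transfer (auto simp: add.commute)
  show "0 + a = a" by transfer auto
  show "- a + a = 0" by transfer auto
  show "a - b = a + - b" by transfer auto
  show "(0::'a mseries) \<noteq> 1" by transfer (auto simp: fun_eq_iff)
qed

end

lift_definition smult_ms :: "'a::comm_ring_1 \<Rightarrow> 'a mseries \<Rightarrow> 'a mseries"
  is "\<lambda>c f al. c * f al" .


section \<open>Symmetric functions\<close>

definition monom_degree :: "(nat \<Rightarrow>\<^sub>0 nat) \<Rightarrow> nat" where
  "monom_degree al = (\<Sum>i\<in>Poly_Mapping.keys al. Poly_Mapping.lookup al i)"

definition sym_functions :: "'a::comm_ring_1 mseries set" where
  "sym_functions =
     {f. (\<forall>\<sigma> al be. bij \<sigma> \<and> Poly_Mapping.lookup be = Poly_Mapping.lookup al \<circ> \<sigma> \<longrightarrow>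
           coeff_ms f be = coeff_ms f al) \<and>
         (\<exists>d. \<forall>al. coeff_ms f al \<noteq> 0 \<longrightarrow> monom_degree al \<le> d)}"

definition sym_m :: "nat list \<Rightarrow> 'a::comm_ring_1 mseries" where
  "sym_m la = Abs_ms (\<lambda>al.
     if image_mset (Poly_Mapping.lookup al) (mset_set (Poly_Mapping.keys al)) = mset la then 1 else 0)"

definition elem_sym :: "nat \<Rightarrow> 'a::comm_ring_1 mseries" where
  "elem_sym k = Abs_ms (\<lambda>al.
     if (\<forall>i. Poly_Mapping.lookup al i \<le> 1) \<and> monom_degree al = k then 1 else 0)"

definition complete_sym :: "nat \<Rightarrow> 'a::comm_ring_1 mseries" where
  "complete_sym k = Abs_ms (\<lambda>al. if monom_degree al = k then 1 else 0)"

text \<open>Only used for \<open>k > 0\<close>.\<close>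

definition power_sum :: "nat \<Rightarrow> 'a::comm_ring_1 mseries" where
  "power_sum k = Abs_ms (\<lambda>al. if \<exists>i. al = Poly_Mapping.single i k then 1 else 0)"

definition sym_e :: "nat list \<Rightarrow> 'a::comm_ring_1 mseries" where
  "sym_e la = prod_list (map elem_sym la)"

definition sym_h :: "nat list \<Rightarrow> 'a::comm_ring_1 mseries" where
  "sym_h la = prod_list (map complete_sym la)"

definition sym_p :: "nat list \<Rightarrow> 'a::comm_ring_1 mseries" where
  "sym_p la = prod_list (map power_sum la)"

definition young_diagram :: "nat list \<Rightarrow> (nat \<times> nat) set" where
  "young_diagram la = {(i, j). i < length la \<and> j < la ! i}"

definition ssyt :: "nat list \<Rightarrow> (nat \<times> nat \<Rightarrow> nat) set" where
  "ssyt la = {t \<in> extensional (young_diagram la).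
     (\<forall>i j. (i, Suc j) \<in> young_diagram la \<longrightarrow> t (i, j) \<le> t (i, Suc j)) \<and>
     (\<forall>i j. (Suc i, j) \<in> young_diagram la \<longrightarrow> t (i, j) < t (Suc i, j))}"

definition sym_s :: "nat list \<Rightarrow> 'a::comm_ring_1 mseries" where
  "sym_s la = Abs_ms (\<lambda>al.
     of_nat (card {t \<in> ssyt la. \<forall>k.
       card {c \<in> young_diagram la. t c = k} = Poly_Mapping.lookup al k}))"

text \<open>These conditions determine \<open>\<omega>\<close> on \<^const>\<open>sym_functions\<close>; its values elsewhere are irrelevant.\<close>

definition is_omega :: "('a::comm_ring_1 mseries \<Rightarrow> 'a mseries) \<Rightarrow> bool" where
  "is_omega \<omega> \<longleftrightarrow>
     (\<forall>f\<in>sym_functions. \<omega> f \<in> sym_functions \<and> \<omega> (\<omega> f) = f) \<and>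
     (\<forall>f\<in>sym_functions. \<forall>g\<in>sym_functions. \<omega> (f + g) = \<omega> f + \<omega> g \<and> \<omega> (f * g) = \<omega> f * \<omega> g) \<and>
     (\<forall>c. \<forall>f\<in>sym_functions. \<omega> (smult_ms c f) = smult_ms c (\<omega> f)) \<and>
     \<omega> 1 = 1 \<and>
     (\<forall>k. \<omega> (elem_sym k) = complete_sym k)"

definition sym_omega :: "'a::comm_ring_1 mseries \<Rightarrow> 'a mseries" where
  "sym_omega = (SOME \<omega>. is_omega \<omega>)"

definition sym_f :: "nat list \<Rightarrow> 'a::comm_ring_1 mseries" where
  "sym_f la = sym_omega (sym_m la)"

text \<open>\<open>inv_kostka la mu\<close> is the coefficient of \<open>s\<^bsub>mu\<^esub>\<close> in \<open>m\<^bsub>la\<^esub>\<close>.\<close>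

definition inv_kostka :: "nat list \<Rightarrow> nat list \<Rightarrow> int" where
  "inv_kostka la = (THE c.
     (\<forall>mu. mu \<notin> partitions (sum_list la) \<longrightarrow> c mu = 0) \<and>
     sym_m la = (\<Sum>mu\<in>partitions (sum_list la). smult_ms (c mu) (sym_s mu)))"


section \<open>Traces\<close>

context vector_space
begin

text \<open>The trace of the endomorphism of \<open>V / U\<close> induced by \<open>f\<close>, where \<open>V\<close> is a
  finite-dimensional subspace and \<open>U \<subseteq> V\<close>, and \<open>f\<close> maps \<open>V\<close> to \<open>V\<close> and \<open>U\<close> to \<open>U\<close>: here \<open>B\<close>
  is a basis of \<open>U\<close> and \<open>C\<close> a basis of \<open>V\<close> extending it.\<close>

definition trace_on_quotient :: "'b set \<Rightarrow> 'b set \<Rightarrow> ('b \<Rightarrow> 'b) \<Rightarrow> 'a" where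
  "trace_on_quotient V U f =
     (let (B, C) = (SOME (B, C). B \<subseteq> C \<and> independent C \<and> span B = U \<and> span C = V)
      in \<Sum>b\<in>C - B. representation C (f b) b)"

end

definition mat_trace :: "'a::comm_monoid_add mat \<Rightarrow> 'a" where
  "mat_trace A = (\<Sum>i<dim_row A. A $$ (i, i))"


section \<open>The symmetric group and its irreducible characters\<close>

text \<open>\<open>\<SS>\<^sub>n\<close> is the set of \<open>w\<close> with \<open>w permutes {1..n}\<close>.\<close>

definition adj_transp :: "nat \<Rightarrow> nat \<Rightarrow> nat" where
  "adj_transp i = transpose i (Suc i)"

definition word_perm :: "nat list \<Rightarrow> nat \<Rightarrow> nat" where
  "word_perm ws = foldr (\<lambda>i w. adj_transp i \<circ> w) ws id"

definition perm_length :: "nat \<Rightarrow> (nat \<Rightarrow> nat) \<Rightarrow> nat" where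
  "perm_length n w = (LEAST k. \<exists>ws. set ws \<subseteq> {1..<n} \<and> word_perm ws = w \<and> length ws = k)"

definition reduced_word :: "nat \<Rightarrow> nat list \<Rightarrow> bool" where
  "reduced_word n ws \<longleftrightarrow> set ws \<subseteq> {1..<n} \<and> length ws = perm_length n (word_perm ws)"

definition has_cycle_type :: "nat \<Rightarrow> (nat \<Rightarrow> nat) \<Rightarrow> nat list \<Rightarrow> bool" where
  "has_cycle_type n w la \<longleftrightarrow>
     w permutes {1..n} \<and> image_mset card (mset_set (orbit w ` {1..n})) = mset la"

text \<open>Rows and columns of the tableau of shape \<open>la\<close> that is filled with \<open>1, 2, \<dots>\<close> row by row.\<close>

definition row_block :: "nat list \<Rightarrow> nat \<Rightarrow> nat set" where
  "row_block la i = {sum_list (take i la)<..sum_list (take (Suc i) la)}"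

definition column_block :: "nat list \<Rightarrow> nat \<Rightarrow> nat set" where
  "column_block la j = {sum_list (take i la) + Suc j | i. i < length la \<and> j < la ! i}"

definition young_subgroup :: "nat list \<Rightarrow> (nat \<Rightarrow> nat) set" where
  "young_subgroup la =
     {w. w permutes {1..sum_list la} \<and> (\<forall>i<length la. w ` row_block la i = row_block la i)}"

definition column_group :: "nat list \<Rightarrow> (nat \<Rightarrow> nat) set" where
  "column_group la =
     {w. w permutes {1..sum_list la} \<and> (\<forall>j. w ` column_block la j = column_block la j)}"

text \<open>Elements of the group algebra of \<open>\<SS>\<^sub>n\<close> over the rationals are finitely supported functions on
  permutations; \<open>left_translate w\<close> is left multiplication by \<open>w\<close>.\<close>

definition scale_ga :: "rat \<Rightarrow> ((nat \<Rightarrow> nat) \<Rightarrow>\<^sub>0 rat) \<Rightarrow> ((nat \<Rightarrow> nat) \<Rightarrow>\<^sub>0 rat)" where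
  "scale_ga c x = Poly_Mapping.map ((*) c) x"

definition left_translate ::
    "(nat \<Rightarrow> nat) \<Rightarrow> ((nat \<Rightarrow> nat) \<Rightarrow>\<^sub>0 rat) \<Rightarrow> ((nat \<Rightarrow> nat) \<Rightarrow>\<^sub>0 rat)" where
  "left_translate w x = 
     (\<Sum>u\<in>Poly_Mapping.keys x. Poly_Mapping.single (w \<circ> u) (Poly_Mapping.lookup x u))"

definition young_symmetrizer :: "nat list \<Rightarrow> (nat \<Rightarrow> nat) \<Rightarrow>\<^sub>0 rat" where
  "young_symmetrizer la =
     (\<Sum>p\<in>young_subgroup la. \<Sum>r\<in>column_group la. Poly_Mapping.single (p \<circ> r) (of_int (sign r)))"

definition specht_module :: "nat list \<Rightarrow> ((nat \<Rightarrow> nat) \<Rightarrow>\<^sub>0 rat) set" where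
  "specht_module la = module.span scale_ga
     {left_translate w (young_symmetrizer la) | w. w permutes {1..sum_list la}}"

text \<open>\<open>sn_char la\<close> is \<open>\<chi>\<^bsup>la\<^esup>\<close>; with this convention \<open>\<chi>\<^bsup>(n)\<^esup>\<close> is the trivial character.\<close>

definition sn_char :: "nat list \<Rightarrow> (nat \<Rightarrow> nat) \<Rightarrow> rat" where
  "sn_char la w = vector_space.trace_on_quotient scale_ga (specht_module la) {0} (left_translate w)"

definition sn_char_value :: "nat list \<Rightarrow> nat list \<Rightarrow> rat" where
  "sn_char_value mu la = sn_char mu (SOME w. has_cycle_type (sum_list la) w la)"

lemma lookup_scale_ga: "Poly_Mapping.lookup (scale_ga c x) u = c * Poly_Mapping.lookup x u"
  by (simp add: scale_ga_def map.rep_eq when_def)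

interpretation ga: vector_space scale_ga
  by unfold_locales
     (rule poly_mapping_eqI; simp add: lookup_scale_ga lookup_add algebra_simps)+


section \<open>The Hecke algebra over the field of rational functions\<close>

type_synonym ratfun = "rat poly fract"

definition q_rf :: ratfun where
  "q_rf = Fract [:0, 1:] 1"

definition const_rf :: "rat \<Rightarrow> ratfun" where
  "const_rf c = Fract [:c:] 1"

text \<open>\<open>x\<close> is regular at \<open>q = 1\<close> with value \<open>c\<close> there.\<close>

definition specializes_at_1 :: "ratfun \<Rightarrow> rat \<Rightarrow> bool" where
  "specializes_at_1 x c \<longleftrightarrow>
     (\<exists>a b. poly b 1 \<noteq> 0 \<and> x = Fract a b \<and> c = poly a 1 / poly b 1)"

text \<open>The algebra, given by its generators \<open>T (adj_transp i)\<close>, relations and natural basis, is the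
  whole type \<open>'h\<close>. By Matsumoto's theorem the product in \<open>T_reduced\<close> only depends on the
  permutation. The presentation together with the basis determines the algebra up to isomorphism.\<close>

locale hecke_algebra = vector_space scale
  for scale :: "ratfun \<Rightarrow> 'h::ring_1 \<Rightarrow> 'h" (infixr \<open>*s\<close> 75) +
  fixes n :: nat and T :: "(nat \<Rightarrow> nat) \<Rightarrow> 'h"
  assumes scale_mult_left: "(c *s x) * y = c *s (x * y)"
    and scale_mult_right: "x * (c *s y) = c *s (x * y)"
    and quadratic: "i \<in> {1..<n} \<Longrightarrow>
      T (adj_transp i) * T (adj_transp i) = (q_rf - 1) *s T (adj_transp i) + q_rf *s 1"
    and far_commute: "\<lbrakk>i \<in> {1..<n}; j \<in> {1..<n}; \<bar>int i - int j\<bar> \<ge> 2\<rbrakk> \<Longrightarrow>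
      T (adj_transp i) * T (adj_transp j) = T (adj_transp j) * T (adj_transp i)"
    and braid: "\<lbrakk>i \<in> {1..<n}; j \<in> {1..<n}; \<bar>int i - int j\<bar> = 1\<rbrakk> \<Longrightarrow>
      T (adj_transp i) * T (adj_transp j) * T (adj_transp i) =
      T (adj_transp j) * T (adj_transp i) * T (adj_transp j)"
    and T_reduced: "reduced_word n ws \<Longrightarrow>
      T (word_perm ws) = prod_list (map (\<lambda>i. T (adj_transp i)) ws)"
    and T_inj: "inj_on T {w. w permutes {1..n}}"
    and T_independent: "independent (T ` {w. w permutes {1..n}})"
    and T_span: "span (T ` {w. w permutes {1..n}}) = UNIV"
begin

definition is_rep :: "nat \<Rightarrow> ('h \<Rightarrow> ratfun mat) \<Rightarrow> bool" where
  "is_rep d R \<longleftrightarrow>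
     (\<forall>g. R g \<in> carrier_mat d d) \<and> R 1 = 1\<^sub>m d \<and>
     (\<forall>g h. R (g + h) = R g + R h) \<and> (\<forall>g h. R (g * h) = R g * R h) \<and>
     (\<forall>c g. R (c *s g) = c \<cdot>\<^sub>m R g)"

definition invariant_subspace :: "nat \<Rightarrow> ('h \<Rightarrow> ratfun mat) \<Rightarrow> ratfun vec set \<Rightarrow> bool" where
  "invariant_subspace d R W \<longleftrightarrow>
     W \<subseteq> carrier_vec d \<and> 0\<^sub>v d \<in> W \<and> (\<forall>v\<in>W. \<forall>w\<in>W. v + w \<in> W) \<and>
     (\<forall>c. \<forall>v\<in>W. c \<cdot>\<^sub>v v \<in> W) \<and> (\<forall>g. \<forall>v\<in>W. R g *\<^sub>v v \<in> W)"

definition irreducible_rep :: "nat \<Rightarrow> ('h \<Rightarrow> ratfun mat) \<Rightarrow> bool" where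
  "irreducible_rep d R \<longleftrightarrow> is_rep d R \<and> 0 < d \<and>
     (\<forall>W. invariant_subspace d R W \<longrightarrow> W = {0\<^sub>v d} \<or> W = carrier_vec d)"

definition irreducible_char :: "('h \<Rightarrow> ratfun) \<Rightarrow> bool" where
  "irreducible_char \<theta> \<longleftrightarrow> (\<exists>d R. irreducible_rep d R \<and> \<theta> = (\<lambda>g. mat_trace (R g)))"

definition chi_q :: "nat list \<Rightarrow> 'h \<Rightarrow> ratfun" where
  "chi_q la = (THE \<theta>. irreducible_char \<theta> \<and>
     (\<forall>w. w permutes {1..n} \<longrightarrow> specializes_at_1 (\<theta> (T w)) (sn_char la w)))"

definition parabolic :: "nat list \<Rightarrow> 'h set" where
  "parabolic la = span (T ` young_subgroup la)"

text \<open>The linear functional with \<open>T w \<mapsto> c w\<close>.\<close>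

definition T_functional :: "((nat \<Rightarrow> nat) \<Rightarrow> ratfun) \<Rightarrow> 'h \<Rightarrow> ratfun" where
  "T_functional c x =
     (\<Sum>w | w permutes {1..n}. representation (T ` {w. w permutes {1..n}}) x (T w) * c w)"

definition sign_functional :: "'h \<Rightarrow> ratfun" where
  "sign_functional = T_functional (\<lambda>w. (- 1) ^ perm_length n w)"

definition trivial_functional :: "'h \<Rightarrow> ratfun" where
  "trivial_functional = T_functional (\<lambda>w. q_rf ^ perm_length n w)"

text \<open>For a one-dimensional character \<open>\<theta>\<close> of a subalgebra \<open>P\<close>, the induced module
  \<open>H \<otimes>\<^bsub>P\<^esub> \<theta>\<close> is the quotient of \<open>H\<close> by all \<open>x b \<otimes> 1 - x \<otimes> b 1 = x b - \<theta>(b) x\<close>.\<close>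

definition induced_char :: "'h set \<Rightarrow> ('h \<Rightarrow> ratfun) \<Rightarrow> 'h \<Rightarrow> ratfun" where
  "induced_char P \<theta> g =
     trace_on_quotient UNIV (span {x * b - \<theta> b *s x | x b. b \<in> P}) (\<lambda>x. g * x)"

definition epsilon_q :: "nat list \<Rightarrow> 'h \<Rightarrow> ratfun" where
  "epsilon_q la = induced_char (parabolic la) sign_functional"

definition eta_q :: "nat list \<Rightarrow> 'h \<Rightarrow> ratfun" where
  "eta_q la = induced_char (parabolic la) trivial_functional"

definition psi_q :: "nat list \<Rightarrow> 'h \<Rightarrow> ratfun" where
  "psi_q la g = (\<Sum>mu\<in>partitions n. const_rf (sn_char_value mu la) * chi_q mu g)"

definition phi_q :: "nat list \<Rightarrow> 'h \<Rightarrow> ratfun" where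
  "phi_q la g = (\<Sum>mu\<in>partitions n. of_int (inv_kostka la mu) * chi_q mu g)"

definition gamma_q :: "nat list \<Rightarrow> 'h \<Rightarrow> ratfun" where
  "gamma_q la g =
     (\<Sum>mu\<in>partitions n. of_int (inv_kostka la (transpose_partition mu)) * chi_q mu g)"

definition Y_q :: "'h \<Rightarrow> ratfun mseries" where
  "Y_q g = (\<Sum>la\<in>partitions n. smult_ms (epsilon_q la g) (sym_m la))"

end

end

theory Submission
  imports Defs "HOL-Computational_Algebra.Formal_Power_Series"
begin

text \<open>
  Once the induced characters are known to be \<open>\<eta>\<^sub>q\<^sup>\<lambda> = \<Sum>\<^sub>\<nu> K\<^bsub>\<nu>,\<lambda>\<^esub> \<chi>\<^sub>q\<^sup>\<nu>\<close> and
  \<open>\<epsilon>\<^sub>q\<^sup>\<lambda> = \<Sum>\<^sub>\<nu> K\<^bsub>\<nu>\<^sup>T,\<lambda>\<^esub> \<chi>\<^sub>q\<^sup>\<nu>\<close>, all expansions follow from changes of basis, \<open>\<omega> s\<^bsub>\<nu>\<^esub> = s\<^bsub>\<nu>\<^sup>T\<^esub>\<close>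
  and Frobenius' formula \<open>s\<^bsub>\<mu>\<^esub> = \<Sum>\<^sub>\<lambda> \<chi>\<^sup>\<mu>(\<lambda>) p\<^bsub>\<lambda>\<^esub> / z\<^bsub>\<lambda>\<^esub>\<close>.

  To decompose the induced characters, \<open>\<eta>\<^sub>q\<^sup>\<lambda>\<close> and \<open>\<epsilon>\<^sub>q\<^sup>\<lambda>\<close> are realized on the left ideals generated by the
  normalized (anti)symmetrizers \<open>E\<^bsub>\<lambda>\<^esub>\<close> and \<open>F\<^bsub>\<lambda>\<^esub>\<close> of the parabolic subalgebras. For idempotents \<open>e\<close>, \<open>f\<close>
  the map \<open>x \<mapsto> e x f\<close> is a projection, so its trace is a rank and can be computed at \<open>q = 1\<close>,
  where it counts double cosets: \<open>E\<^bsub>\<lambda>\<^esub>\<close> and \<open>E\<^bsub>\<mu>\<^esub>\<close> pair to \<open>\<Sum>\<^sub>\<nu> K\<^bsub>\<nu>,\<lambda>\<^esub> K\<^bsub>\<nu>,\<mu>\<^esub>\<close>,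
  \<open>E\<^bsub>\<lambda>\<^esub>\<close> and \<open>F\<^bsub>\<mu>\<^esub>\<close> to \<open>\<Sum>\<^sub>\<nu> K\<^bsub>\<nu>,\<lambda>\<^esub> K\<^bsub>\<nu>\<^sup>T,\<mu>\<^esub>\<close>. As \<open>\<rat>(q)\<close> is an ordered field with \<open>q > 0\<close>,
  the anti-automorphism \<open>T\<^sub>w \<mapsto> T\<^bsub>w\<^sup>-\<^sup>1\<^esub>\<close> is positive definite and replaces semisimplicity. Since
  \<open>E\<^bsub>\<nu>\<^esub>\<close> and \<open>F\<^bsub>\<nu>\<^sup>T\<^esub>\<close> pair to \<open>1\<close>, their corner yields a primitive idempotent \<open>D\<^bsub>\<nu>\<^esub>\<close>, and an induction along the
  dominance order gives \<open>E\<^bsub>\<lambda>\<^esub> \<sim> \<Oplus>\<^sub>\<nu> K\<^bsub>\<nu>,\<lambda>\<^esub> D\<^bsub>\<nu>\<^esub>\<close>. The same construction in the group algebra produces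
  the Specht modules, which identifies the character of the ideal of \<open>D\<^bsub>\<nu>\<^esub>\<close> as \<open>\<chi>\<^sub>q\<^sup>\<nu>\<close>.
\<close>

section \<open>Pieri rules and Kostka numbers\<close>

text \<open>Two facts shape the development. \<open>chi_q\<close> is a definite description over all
  irreducible characters, so a module with the right specialization is not enough: the irreducible
  characters have to be classified. This rests on the two-sided ideal generated by the
  \<open>D nu\<close> containing 1. Moreover, neither a splitting field nor a deformation theorem is
  invoked. The corner of E_nu and F_nu^T is one-dimensional over the base field itself, and so is
  the corner of the idempotent made from it. The decomposition is wanted twice, for the Hecke
  algebra and for the rational group algebra that contains the Specht modules. It is therefore
  carried out for an abstract parameter q and an abstract relation \<open>sp\<close> for taking
  values at q = 1; in the group algebra q = 1 and \<open>sp\<close> is equality. The order of the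
  field enters through the coefficient of \<open>T id\<close> in \<open>star x * x\<close>, which is
  the sum of all q^l(w) x_w^2 and vanishes only for x = 0. Within this first section partitions are
  eventually zero functions, so that adding and removing strips needs no bookkeeping of lengths;
  \<open>part_fun\<close> translates from lists.\<close>

definition shapes :: "(nat \<Rightarrow> nat) set" where
  "shapes = {l. antimono l \<and> finite {i. l i \<noteq> 0}}"

definition cells :: "(nat \<Rightarrow> nat) \<Rightarrow> (nat \<times> nat) set" where
  "cells l = {(i, j). j < l i}"

definition hstrip :: "(nat \<Rightarrow> nat) \<Rightarrow> (nat \<Rightarrow> nat) \<Rightarrow> bool" where
  "hstrip mu la \<longleftrightarrow> (\<forall>i. mu i \<le> la i \<and> la (Suc i) \<le> mu i)"

definition vstrip :: "(nat \<Rightarrow> nat) \<Rightarrow> (nat \<Rightarrow> nat) \<Rightarrow> bool" where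
  "vstrip mu la \<longleftrightarrow> (\<forall>i. mu i \<le> la i \<and> la i \<le> Suc (mu i))"

definition h_up :: "nat \<Rightarrow> (nat \<Rightarrow> nat) \<Rightarrow> (nat \<Rightarrow> nat) set" where
  "h_up r mu = {nu \<in> shapes. hstrip mu nu \<and> card (cells nu) = card (cells mu) + r}"

definition h_down :: "nat \<Rightarrow> (nat \<Rightarrow> nat) \<Rightarrow> (nat \<Rightarrow> nat) set" where
  "h_down r nu = {mu \<in> shapes. hstrip mu nu \<and> card (cells nu) = card (cells mu) + r}"

text \<open>These are the Kostka numbers with arbitrary content \<open>al\<close>, counted as chains
  of shapes in which step i adds a horizontal strip of \<open>al i\<close> cells
  (\<open>card_tabs\<close>). The recursion on the number of variables is what the proof of the
  Pieri rule runs on.\<close>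

primrec kchain :: "nat \<Rightarrow> (nat \<Rightarrow> nat) \<Rightarrow> (nat \<Rightarrow> nat) \<Rightarrow> nat" where
  "kchain 0 al la = (if la = (\<lambda>_. 0) then 1 else 0)"
| "kchain (Suc k) al la = (\<Sum>mu\<in>h_down (al k) la. kchain k al mu)"

lemma finite_functions_below:
  fixes b :: "nat \<Rightarrow> nat"
  assumes "finite {i. b i \<noteq> 0}"
  shows "finite {f. \<forall>i. f i \<le> b i}"
proof -
  let ?S = "{i. b i \<noteq> 0}"
  let ?M = "Max (insert 0 (b ` ?S))"
  have le: "b i \<le> ?M" for i
    using assms by (cases "b i = 0") (auto intro!: Max_ge)
  have "finite {f::nat \<Rightarrow> nat. \<forall>x. (x \<in> ?S \<longrightarrow> f x \<in> {..?M}) \<and> (x \<notin> ?S \<longrightarrow> f x = 0)}"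
    by (rule finite_set_of_finite_funs) (use assms in auto)
  then show ?thesis
  proof (rule rev_finite_subset, intro subsetI CollectI allI conjI impI)
    fix f i assume "f \<in> {f. \<forall>i. f i \<le> b i}"
    then have *: "f i \<le> b i" by simp
    from order_trans[OF * le] show "f i \<in> {..?M}" by simp
    assume "i \<notin> ?S"
    with * show "f i = 0" by simp
  qed
qed

lemma shapes_bound: "l \<in> shapes \<Longrightarrow> \<exists>N. \<forall>i\<ge>N. l i = 0"
proof -
  assume "l \<in> shapes"
  then obtain m where "\<And>i. l i \<noteq> 0 \<Longrightarrow> i < m"
    unfolding shapes_def finite_nat_set_iff_bounded by auto
  then show ?thesis using not_less by blast
qed

lemma shapesI: "\<lbrakk>\<And>i. l (Suc i) \<le> l i; \<And>i. i \<ge> N \<Longrightarrow> l i = 0\<rbrakk> \<Longrightarrow> l \<in> shapes"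
  unfolding shapes_def finite_nat_set_iff_bounded
  by (auto intro!: exI[of _ N] simp: antimono_iff_le_Suc not_le intro: ccontr)

lemma shapes_Suc: "l \<in> shapes \<Longrightarrow> l (Suc i) \<le> l i"
  by (simp add: shapes_def antimono_iff_le_Suc)

lemma shapes_antimono: "l \<in> shapes \<Longrightarrow> i \<le> j \<Longrightarrow> l j \<le> l i"
  by (simp add: shapes_def antimonoD)

lemma zero_shape [simp]: "(\<lambda>_. 0) \<in> shapes"
  by (simp add: shapes_def monotone_def)

lemma cells_eq_Sigma: "(\<And>i. i \<ge> N \<Longrightarrow> l i = 0) \<Longrightarrow> cells l = Sigma {..<N} (\<lambda>i. {..<l i})"
  unfolding cells_def by auto (metis not_le not_less_zero)

lemma card_cells: "(\<And>i. i \<ge> N \<Longrightarrow> l i = 0) \<Longrightarrow> card (cells l) = (\<Sum>i<N. l i)"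
  by (subst cells_eq_Sigma) auto

lemma finite_cells [simp]: "l \<in> shapes \<Longrightarrow> finite (cells l)"
  using shapes_bound[of l] cells_eq_Sigma[of _ l] by (metis finite_SigmaI finite_lessThan)

lemma cells_mono: "(\<And>i. mu i \<le> la i) \<Longrightarrow> cells mu \<subseteq> cells la"
  by (auto simp: cells_def intro: less_le_trans)

lemma card_cells_mono: "la \<in> shapes \<Longrightarrow> (\<And>i. mu i \<le> la i) \<Longrightarrow> card (cells mu) \<le> card (cells la)"
  by (intro card_mono cells_mono) auto

lemma cells_inj: "cells l = cells m \<Longrightarrow> l = m"
proof
  fix i assume eq: "cells l = cells m"
  have "{..<l i} = {..<m i}" using eq unfolding cells_def by (auto simp: set_eq_iff)
  then show "l i = m i" by (simp add: lessThan_eq_iff)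
qed

lemma cells_zero [simp]: "cells (\<lambda>_. 0) = {}"
  by (simp add: cells_def)

lemma card_cells_0_iff: "l \<in> shapes \<Longrightarrow> card (cells l) = 0 \<longleftrightarrow> l = (\<lambda>_. 0)"
  using cells_inj[of l "\<lambda>_. 0"] by auto

lemma shape_le_card: "l \<in> shapes \<Longrightarrow> l i \<le> card (cells l)"
proof -
  assume l: "l \<in> shapes"
  have "card ((\<lambda>j. (i, j)) ` {..<l i}) \<le> card (cells l)"
    by (intro card_mono) (auto simp: l, simp add: cells_def)
  then show ?thesis by (simp add: card_image inj_on_def)
qed

lemma hstripD: "hstrip mu la \<Longrightarrow> mu i \<le> la i" "hstrip mu la \<Longrightarrow> la (Suc i) \<le> mu i"
  by (auto simp: hstrip_def)

lemma h_downD: "mu \<in> h_down r nu \<Longrightarrow> mu \<in> shapes \<and> hstrip mu nu \<and> card (cells nu) = card (cells mu) + r"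
  by (simp add: h_down_def)

lemma finite_h_down [simp]: "la \<in> shapes \<Longrightarrow> finite (h_down r la)"
  by (rule finite_subset[of _ "{mu. \<forall>i. mu i \<le> la i}"], blast dest: hstripD h_downD)
     (rule finite_functions_below, simp add: shapes_def)

lemma finite_shape_range: "finite {l \<in> shapes. card (cells l) = n}"
proof -
  let ?b = "\<lambda>i. if i < n then n else 0"
  have "l i \<le> ?b i" if l: "l \<in> shapes" and n: "card (cells l) = n" for l i
  proof (cases "i < n")
    case False
    have "l i = 0"
    proof (rule ccontr)
      assume "l i \<noteq> 0"
      then have "k \<le> i \<Longrightarrow> 0 < l k" for k using shapes_antimono[OF l, of k i] by linarith
      then have "(\<lambda>k. (k, 0)) ` {..i} \<subseteq> cells l" by (auto simp: cells_def)
      from card_mono[OF finite_cells[OF l] this] have "Suc i \<le> n"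
        by (simp add: card_image inj_on_def n)
      with False show False by simp
    qed
    then show ?thesis by simp
  qed (use shape_le_card[OF l, of i] n in auto)
  then have "{l \<in> shapes. card (cells l) = n} \<subseteq> {l. \<forall>i. l i \<le> ?b i}" by blast
  then show ?thesis by (rule finite_subset) (intro finite_functions_below, auto)
qed

lemma finite_h_up [simp]: "finite (h_up r mu)"
  by (rule finite_subset[OF _ finite_shape_range[of "card (cells mu) + r"]]) (auto simp: h_up_def)

text \<open>Fomin's local rule: \<open>(i, ka)\<close> corresponds to \<open>nu = strip_glue la mu i ka\<close>.\<close>

definition strip_glue :: "(nat \<Rightarrow> nat) \<Rightarrow> (nat \<Rightarrow> nat) \<Rightarrow> nat \<Rightarrow> (nat \<Rightarrow> nat) \<Rightarrow> nat \<Rightarrow> nat" where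
  "strip_glue la mu i ka j = (case j of 0 \<Rightarrow> max (la 0) (mu 0) + i
     | Suc j \<Rightarrow> max (la (Suc j)) (mu (Suc j)) + (min (la j) (mu j) - ka j))"

definition strip_meet :: "(nat \<Rightarrow> nat) \<Rightarrow> (nat \<Rightarrow> nat) \<Rightarrow> (nat \<Rightarrow> nat) \<Rightarrow> nat \<Rightarrow> nat" where
  "strip_meet la mu nu j = max (la (Suc j)) (mu (Suc j)) + (min (la j) (mu j) - nu (Suc j))"

text \<open>The strip conditions confine \<open>ka j\<close> and \<open>nu (Suc j)\<close> to the
  same interval, from the larger of \<open>la (Suc j)\<close>, \<open>mu (Suc j)\<close> to the
  smaller of \<open>la j\<close>, \<open>mu j\<close>. The rule reflects this interval and is
  therefore invertible row by row. The first row of the glued shape has no upper bound; its excess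
  over both shapes is the free parameter i.\<close>

lemma strip_glue:
  assumes la: "la \<in> shapes" and mu: "mu \<in> shapes" and ka: "ka \<in> shapes"
    and h: "hstrip ka la" "hstrip ka mu"
  shows "strip_glue la mu i ka \<in> shapes" "hstrip la (strip_glue la mu i ka)"
    "hstrip mu (strip_glue la mu i ka)"
    "card (cells (strip_glue la mu i ka)) + card (cells ka) = card (cells la) + card (cells mu) + i"
    "strip_meet la mu (strip_glue la mu i ka) = ka"
    "strip_glue la mu i ka 0 - max (la 0) (mu 0) = i"
proof -
  let ?nu = "strip_glue la mu i ka"
  obtain N where N: "\<And>j. j \<ge> N \<Longrightarrow> la j = 0" "\<And>j. j \<ge> N \<Longrightarrow> mu j = 0" "\<And>j. j \<ge> N \<Longrightarrow> ka j = 0"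
  proof -
    from shapes_bound[OF la] shapes_bound[OF mu] shapes_bound[OF ka]
    obtain A B C where "\<forall>j\<ge>A. la j = 0" "\<forall>j\<ge>B. mu j = 0" "\<forall>j\<ge>C. ka j = 0" by auto
    then show ?thesis by (intro that[of "max A (max B C)"]) auto
  qed
  have k: "ka j \<le> la j" "la (Suc j) \<le> ka j" "ka j \<le> mu j" "mu (Suc j) \<le> ka j" for j
    using h by (auto simp: hstrip_def)
  have a: "?nu (Suc j) \<le> la j" "?nu (Suc j) \<le> mu j" for j
    using k[of j] by (auto simp: strip_glue_def max_def min_def)
  have b: "la j \<le> ?nu j" "mu j \<le> ?nu j" for j
    by (auto simp: strip_glue_def split: nat.split)
  have z: "?nu j = 0" if "j \<ge> Suc N" for j
    using a[of "j - 1"] N[of "j - 1"] that by (cases j) auto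
  show "?nu \<in> shapes"
    by (rule shapesI[OF _ z]) (use a b in \<open>auto intro: order_trans\<close>)
  show "hstrip la ?nu" "hstrip mu ?nu" using a b by (auto simp: hstrip_def)
  show "strip_meet la mu ?nu = ka"
  proof
    fix j show "strip_meet la mu ?nu j = ka j"
      using k[of j] by (auto simp: strip_meet_def strip_glue_def max_def min_def)
  qed
  show "?nu 0 - max (la 0) (mu 0) = i" by (simp add: strip_glue_def)
  let ?M = "\<lambda>j. max (la j) (mu j)" and ?m = "\<lambda>j. min (la j) (mu j)"
  have "(\<Sum>j<N. ?nu (Suc j)) + (\<Sum>j<N. ka j) = (\<Sum>j<N. ?M (Suc j)) + (\<Sum>j<N. ?m j)"
    unfolding sum.distrib[symmetric]
  proof (rule sum.cong)
    fix j
    have "ka j \<le> ?m j" using k[of j] by simp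
    then show "?nu (Suc j) + ka j = ?M (Suc j) + ?m j" by (simp only: strip_glue_def nat.case)
  qed simp
  moreover have "(\<Sum>j<N. ?M j) + ?M N = ?M 0 + (\<Sum>j<N. ?M (Suc j))"
    using sum.lessThan_Suc_shift[of ?M N] by simp
  moreover have "(\<Sum>j<N. ?M j) + (\<Sum>j<N. ?m j) = (\<Sum>j<N. la j) + (\<Sum>j<N. mu j)"
    unfolding sum.distrib[symmetric] by (rule sum.cong) auto
  moreover have "card (cells ?nu) = ?nu 0 + (\<Sum>j<N. ?nu (Suc j))"
    by (subst card_cells[OF z], assumption) (simp only: sum.lessThan_Suc_shift)
  moreover have "?nu 0 = ?M 0 + i" "?M N = 0"
    using N[of N] by (simp_all add: strip_glue_def)
  ultimately show "card (cells ?nu) + card (cells ka) = card (cells la) + card (cells mu) + i"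
    using card_cells[of N la] card_cells[of N mu] card_cells[of N ka] N by simp
qed

lemma strip_meet:
  assumes la: "la \<in> shapes" and mu: "mu \<in> shapes" and nu: "nu \<in> shapes"
    and h: "hstrip la nu" "hstrip mu nu"
  shows "strip_meet la mu nu \<in> shapes" "hstrip (strip_meet la mu nu) la"
    "hstrip (strip_meet la mu nu) mu"
    "strip_glue la mu (nu 0 - max (la 0) (mu 0)) (strip_meet la mu nu) = nu"
proof -
  let ?ka = "strip_meet la mu nu"
  have k: "la j \<le> nu j" "nu (Suc j) \<le> la j" "mu j \<le> nu j" "nu (Suc j) \<le> mu j" for j
    using h by (auto simp: hstrip_def)
  have a: "?ka j \<le> la j" "?ka j \<le> mu j" "la (Suc j) \<le> ?ka j" "mu (Suc j) \<le> ?ka j" for j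
    using k[of j] k[of "Suc j"] by (auto simp: strip_meet_def max_def min_def)
  obtain N where N: "\<And>j. j \<ge> N \<Longrightarrow> la j = 0" using shapes_bound[OF la] by auto
  show "?ka \<in> shapes"
  proof (rule shapesI)
    show "?ka (Suc i) \<le> ?ka i" for i by (rule order_trans[OF a(1) a(3)])
    show "?ka i = 0" if "i \<ge> N" for i using a(1)[of i] N[OF that] by simp
  qed
  show "hstrip ?ka la" "hstrip ?ka mu" using a by (auto simp: hstrip_def)
  show "strip_glue la mu (nu 0 - max (la 0) (mu 0)) ?ka = nu"
  proof
    fix j show "strip_glue la mu (nu 0 - max (la 0) (mu 0)) ?ka j = nu j"
      using k[of j] k[of "j - 1"] k[of "Suc (j - 1)"]
      by (cases j) (auto simp: strip_meet_def strip_glue_def max_def min_def)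
  qed
qed

text \<open>The commutation relation of the operators that add and remove horizontal strips. By the
  local rule a shape above both \<open>mu\<close> and \<open>la\<close> amounts to a number i and a
  shape below both, and the size equation of \<open>strip_glue\<close> makes both strips smaller by
  i.\<close>

lemma h_up_down_commute:
  fixes f :: "(nat \<Rightarrow> nat) \<Rightarrow> nat"
  assumes mu: "mu \<in> shapes"
  shows "(\<Sum>nu\<in>h_up r mu. \<Sum>la\<in>h_down a nu. f la) =
    (\<Sum>i\<le>min r a. \<Sum>ka\<in>h_down (a - i) mu. \<Sum>la\<in>h_up (r - i) ka. f la)"
proof -
  have sh: "nu \<in> h_up r mu \<Longrightarrow> nu \<in> shapes" "nu \<in> h_down r mu \<Longrightarrow> nu \<in> shapes" for nu r mu
    by (auto simp: h_up_def h_down_def)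
  have "(\<Sum>nu\<in>h_up r mu. \<Sum>la\<in>h_down a nu. f la) =
      (\<Sum>(nu, la)\<in>Sigma (h_up r mu) (h_down a). f la)"
    by (rule sum.Sigma) (auto dest: sh)
  also have "\<dots> = (\<Sum>(i, ka, la)\<in>Sigma {..min r a} (\<lambda>i. Sigma (h_down (a - i) mu) (h_up (r - i))). f la)"
  proof (rule sum.reindex_bij_witness[where
      i = "\<lambda>(i, ka, la). (strip_glue la mu i ka, la)" and
      j = "\<lambda>(nu, la). (nu 0 - max (la 0) (mu 0), strip_meet la mu nu, la)"], goal_cases)
    case (1 x)
    then obtain nu la where x: "x = (nu, la)" and *: "nu \<in> shapes" "la \<in> shapes" "hstrip la nu" "hstrip mu nu"
      by (auto simp: h_up_def h_down_def)
    from strip_meet(4)[OF *(2) mu *(1) *(3,4)] x show ?case by simp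
  next
    case (2 x)
    then obtain nu la where x: "x = (nu, la)" and *: "nu \<in> shapes" "la \<in> shapes" "hstrip la nu" "hstrip mu nu"
      "card (cells nu) = card (cells mu) + r" "card (cells nu) = card (cells la) + a"
      by (auto simp: h_up_def h_down_def)
    define i where "i = nu 0 - max (la 0) (mu 0)"
    note sm = strip_meet[OF *(2) mu *(1) *(3,4), folded i_def]
    note sg = strip_glue[OF *(2) mu sm(1-3), of i]
    have le: "card (cells (strip_meet la mu nu)) \<le> card (cells la)"
      "card (cells (strip_meet la mu nu)) \<le> card (cells mu)"
      using sm *(2) mu by (auto intro!: card_cells_mono simp: hstrip_def)
    have "i \<le> r" "i \<le> a"
      "card (cells mu) = card (cells (strip_meet la mu nu)) + (a - i)"
      "card (cells la) = card (cells (strip_meet la mu nu)) + (r - i)"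
      using sg(4) *(5,6) le unfolding sm(4) by linarith+
    then show ?case using x sm * unfolding x prod.case i_def[symmetric]
      by (simp add: h_up_def h_down_def)
  next
    case (3 x)
    then obtain i ka la where x: "x = (i, ka, la)" and *: "la \<in> shapes" "ka \<in> shapes" "hstrip ka la" "hstrip ka mu"
      by (auto simp: h_up_def h_down_def)
    from strip_glue(5,6)[OF *(1) mu *(2-4)] x show ?case by simp
  next
    case (4 x)
    then obtain i ka la where x: "x = (i, ka, la)" and *: "la \<in> shapes" "ka \<in> shapes" "hstrip ka la" "hstrip ka mu"
       "i \<le> r" "i \<le> a" "card (cells mu) = card (cells ka) + (a - i)" "card (cells la) = card (cells ka) + (r - i)"
      by (auto simp: h_up_def h_down_def)
    from strip_glue[OF *(1) mu *(2-4), of i] * x show ?case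
      by (auto simp: h_up_def h_down_def)
  qed auto
  also have "\<dots> = (\<Sum>i\<le>min r a. \<Sum>(ka, la)\<in>Sigma (h_down (a - i) mu) (h_up (r - i)). f la)"
    by (rule sum.Sigma[symmetric]) (simp_all add: mu finite_SigmaI)
  also have "\<dots> = (\<Sum>i\<le>min r a. \<Sum>ka\<in>h_down (a - i) mu. \<Sum>la\<in>h_up (r - i) ka. f la)"
    by (rule sum.cong[OF refl], rule sum.Sigma[symmetric]) (simp_all add: mu)
  finally show ?thesis .
qed

text \<open>The exponent vectors that remain when a monomial of degree r is divided out of the one
  with exponents \<open>al\<close>; they index the terms of a product with h_r.\<close>

definition below :: "nat \<Rightarrow> (nat \<Rightarrow> nat) \<Rightarrow> nat \<Rightarrow> (nat \<Rightarrow> nat) set" where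
  "below k al r = {be. (\<forall>i<k. be i \<le> al i) \<and> (\<forall>i\<ge>k. be i = 0) \<and> (\<Sum>i<k. al i) = (\<Sum>i<k. be i) + r}"

lemma below_0: "below 0 al r = (if r = 0 then {\<lambda>_. 0} else {})"
  unfolding below_def by (simp add: fun_eq_iff set_eq_iff)

lemma finite_below [simp]: "finite (below k al r)"
  by (rule finite_subset[OF _ finite_functions_below[of "\<lambda>i. if i < k then al i else 0"]])
     (auto simp: below_def)

lemma kchain_cong: "(\<And>i. i < k \<Longrightarrow> al i = be i) \<Longrightarrow> kchain k al la = kchain k be la"
  by (induction k arbitrary: la) auto

lemma sum_below_Suc:
  "(\<Sum>be\<in>below (Suc k) al r. F be) =
    (\<Sum>i\<le>min r (al k). \<Sum>be\<in>below k al (r - i). F (be(k := al k - i)))"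
proof -
  have "(\<Sum>be\<in>below (Suc k) al r. F be) =
     (\<Sum>(i, be)\<in>Sigma {..min r (al k)} (\<lambda>i. below k al (r - i)). F (be(k := al k - i)))"
  proof (rule sum.reindex_bij_witness[where i = "\<lambda>(i, be). be(k := al k - i)" and
        j = "\<lambda>be. (al k - be k, be(k := 0))"], goal_cases)
    case (2 be)
    then have *: "\<forall>i<Suc k. be i \<le> al i" "\<forall>i\<ge>Suc k. be i = 0"
      "(\<Sum>i<k. al i) + al k = (\<Sum>i<k. be i) + be k + r" by (auto simp: below_def)
    have "(\<Sum>i<k. be i) \<le> (\<Sum>i<k. al i)" by (rule sum_mono) (use * in auto)
    moreover have "be k \<le> al k" using * by auto
    ultimately show ?case using * by (auto simp: below_def)
  next
    case (4 x)
    then show ?case by (cases x) (auto simp: below_def less_Suc_eq)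
  qed (auto simp: below_def fun_eq_iff)
  also have "\<dots> = (\<Sum>i\<le>min r (al k). \<Sum>be\<in>below k al (r - i). F (be(k := al k - i)))"
    by (subst sum.Sigma) (auto simp: case_prod_beta)
  finally show ?thesis .
qed

text \<open>The Pieri rule on coefficients. The added strip is commuted past the last removed one,
  which shortens the chain; the i of the local rule is the share of the last variable in the
  monomial that is divided out. For k = 0 the added strip can only be empty.\<close>

lemma kchain_pieri:
  assumes "mu \<in> shapes"
  shows "(\<Sum>nu\<in>h_up r mu. kchain k al nu) = (\<Sum>be\<in>below k al r. kchain k be mu)"
  using assms
proof (induction k arbitrary: mu r)
  case 0
  have "(\<Sum>nu\<in>h_up r mu. kchain 0 al nu) = (\<Sum>nu\<in>h_up r mu. if nu = (\<lambda>_. 0) then 1 else 0)"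
    by simp
  also have "\<dots> = (if (\<lambda>_. 0) \<in> h_up r mu then 1 else 0)"
    by simp
  also have "(\<lambda>_. 0) \<in> h_up r mu \<longleftrightarrow> r = 0 \<and> mu = (\<lambda>_. 0)"
    using card_cells_0_iff[OF "0.prems"] by (auto simp: h_up_def hstrip_def)
  finally show ?case by (simp add: below_0)
next
  case (Suc k)
  have "(\<Sum>nu\<in>h_up r mu. kchain (Suc k) al nu) =
     (\<Sum>i\<le>min r (al k). \<Sum>ka\<in>h_down (al k - i) mu. \<Sum>la\<in>h_up (r - i) ka. kchain k al la)"
    by (simp add: h_up_down_commute Suc.prems)
  also have "\<dots> = (\<Sum>i\<le>min r (al k). \<Sum>ka\<in>h_down (al k - i) mu. \<Sum>be\<in>below k al (r - i). kchain k be ka)"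
    by (intro sum.cong refl Suc.IH) (auto simp: h_down_def)
  also have "\<dots> = (\<Sum>i\<le>min r (al k). \<Sum>be\<in>below k al (r - i). kchain (Suc k) (be(k := al k - i)) mu)"
    by (subst sum.swap) (auto intro!: sum.cong kchain_cong)
  finally show ?case by (simp only: sum_below_Suc)
qed

section \<open>Semistandard tableaux as chains of horizontal strips\<close>

definition tabs :: "(nat \<Rightarrow> nat) \<Rightarrow> (nat \<Rightarrow> nat) \<Rightarrow> (nat \<times> nat \<Rightarrow> nat) set" where
  "tabs l al = {t \<in> extensional (cells l).
     (\<forall>i j. (i, Suc j) \<in> cells l \<longrightarrow> t (i, j) \<le> t (i, Suc j)) \<and>
     (\<forall>i j. (Suc i, j) \<in> cells l \<longrightarrow> t (i, j) < t (Suc i, j)) \<and>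
     (\<forall>k. card {c \<in> cells l. t c = k} = al k)}"

lemma tabs_row_mono:
  assumes "t \<in> tabs l al" "j \<le> j'" "j' < l i"
  shows "t (i, j) \<le> t (i, j')"
  using assms(2,3)
proof (induction j' rule: dec_induct)
  case (step m)
  have "t (i, m) \<le> t (i, Suc m)" using assms(1) step by (auto simp: tabs_def cells_def)
  with step show ?case by simp
qed simp

lemma tabs_content_pos:
  assumes "t \<in> tabs l al" "l \<in> shapes" "c \<in> cells l"
  shows "al (t c) > 0"
proof -
  have "card {c' \<in> cells l. t c' = t c} = al (t c)" using assms(1) by (auto simp: tabs_def)
  moreover have "card {c' \<in> cells l. t c' = t c} > 0"
    unfolding card_gt_0_iff
  proof
    show "{c' \<in> cells l. t c' = t c} \<noteq> {}" using assms(3) by blast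
    show "finite {c' \<in> cells l. t c' = t c}" using finite_cells[OF assms(2)] by simp
  qed
  ultimately show ?thesis by simp
qed

lemma finite_tabs:
  assumes "l \<in> shapes" "\<And>i. i \<ge> k \<Longrightarrow> al i = 0"
  shows "finite (tabs l al)"
proof (rule finite_subset)
  show "tabs l al \<subseteq> cells l \<rightarrow>\<^sub>E {..<k}"
  proof (intro subsetI PiE_I)
    fix t c assume t: "t \<in> tabs l al" and c: "c \<in> cells l"
    from tabs_content_pos[OF t assms(1) c] assms(2)[of "t c"] show "t c \<in> {..<k}"
      by (cases "t c < k") auto
  qed (auto simp: tabs_def extensional_def)
  show "finite (cells l \<rightarrow>\<^sub>E {..<k})" by (intro finite_PiE) (auto simp: assms)
qed

definition sub_shape :: "(nat \<Rightarrow> nat) \<Rightarrow> nat \<Rightarrow> (nat \<times> nat \<Rightarrow> nat) \<Rightarrow> nat \<Rightarrow> nat" where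
  "sub_shape l k t i = card {j. j < l i \<and> t (i, j) < k}"

lemma down_closed_eq_lessThan:
  fixes A :: "nat set"
  assumes "finite A" "\<And>i j. j \<in> A \<Longrightarrow> i \<le> j \<Longrightarrow> i \<in> A"
  shows "A = {..<card A}"
  using assms
proof (cases "A = {}")
  case False
  have "A = {..Max A}" using assms(1) assms(2)[OF Max_in[OF assms(1) False]] by auto
  then have "A = {..<Suc (Max A)}" by (simp add: lessThan_Suc_atMost)
  then show ?thesis by (metis card_lessThan)
qed simp

lemma cells_sub_shape:
  assumes "t \<in> tabs l al"
  shows "cells (sub_shape l k t) = {c \<in> cells l. t c < k}"
proof -
  have "{j. j < l i \<and> t (i, j) < k} = {..<sub_shape l k t i}" for i
    unfolding sub_shape_def
    by (rule down_closed_eq_lessThan) (auto intro: le_less_trans tabs_row_mono[OF assms])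
  then have "j < sub_shape l k t i \<longleftrightarrow> j < l i \<and> t (i, j) < k" for i j
    by (metis (mono_tags, lifting) lessThan_iff mem_Collect_eq)
  then show ?thesis by (auto simp: cells_def)
qed

text \<open>Column strictness makes the cells with entry k a horizontal strip: a cell that has
  another one below it carries a smaller entry than that one, hence an entry below k.\<close>

lemma sub_shape_props:
  assumes t: "t \<in> tabs l al" and l: "l \<in> shapes" and z: "\<And>i. i \<ge> Suc k \<Longrightarrow> al i = 0"
  shows "sub_shape l k t \<in> h_down (al k) l"
    "restrict t (cells (sub_shape l k t)) \<in> tabs (sub_shape l k t) (al(k := 0))"
proof -
  let ?m = "sub_shape l k t"
  note cm = cells_sub_shape[OF t, of k]
  have cmi: "j < ?m i \<longleftrightarrow> j < l i \<and> t (i, j) < k" for i j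
    using cm by (auto simp: cells_def set_eq_iff)
  have le: "?m i \<le> l i" for i
    using cmi[of "l i" i] by (auto simp: not_less[symmetric])
  have tk: "t c \<le> k" if "c \<in> cells l" for c
    using tabs_content_pos[OF t l that] z[of "t c"] by (cases "t c \<le> k") auto
  have col: "t (i, j) < t (Suc i, j)" if "j < l (Suc i)" for i j
    using t that by (auto simp: tabs_def cells_def)
  have up: "j < ?m i" if "j < l (Suc i)" for i j
    using that shapes_Suc[OF l, of i] col[OF that] tk[of "(Suc i, j)"] unfolding cmi
    by (auto simp: cells_def)
  have hs: "l (Suc i) \<le> ?m i" for i
    using up[where j = "?m i"] by (auto simp: not_less[symmetric])
  obtain N where N: "\<forall>i\<ge>N. l i = 0" using shapes_bound[OF l] by auto
  have sh: "?m \<in> shapes"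
  proof (rule shapesI)
    show "?m (Suc i) \<le> ?m i" for i using le[of "Suc i"] hs[of i] by simp
    show "?m i = 0" if "i \<ge> N" for i using le[of i] N that by auto
  qed
  have "cells l = cells ?m \<union> {c \<in> cells l. t c = k}" using cm tk by (auto simp: le_less)
  then have "card (cells l) = card (cells ?m \<union> {c \<in> cells l. t c = k})" by simp
  also have "\<dots> = card (cells ?m) + al k"
    using t l sh cm by (subst card_Un_disjoint) (auto simp: tabs_def)
  finally show "?m \<in> h_down (al k) l" using sh le hs by (auto simp: h_down_def hstrip_def)
  have "card {c \<in> cells ?m. restrict t (cells ?m) c = i} = (al(k := 0)) i" for i
  proof -
    have "{c \<in> cells ?m. restrict t (cells ?m) c = i} = (if i < k then {c \<in> cells l. t c = i} else {})"
      unfolding cm by auto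
    then show ?thesis using t z[of i] by (auto simp: tabs_def)
  qed
  moreover have "restrict t (cells ?m) (i, j) \<le> restrict t (cells ?m) (i, Suc j)"
    if "(i, Suc j) \<in> cells ?m" for i j
    using that tabs_row_mono[OF t, of j "Suc j" i] le[of i] by (auto simp: cells_def)
  moreover have "restrict t (cells ?m) (i, j) < restrict t (cells ?m) (Suc i, j)"
    if "(Suc i, j) \<in> cells ?m" for i j
    using that col[of j i] le[of "Suc i"] shapes_Suc[OF sh, of i] by (auto simp: cells_def)
  ultimately show "restrict t (cells ?m) \<in> tabs ?m (al(k := 0))"
    by (auto simp: tabs_def)
qed

definition extend_tab :: "(nat \<Rightarrow> nat) \<Rightarrow> nat \<Rightarrow> (nat \<Rightarrow> nat) \<Rightarrow> (nat \<times> nat \<Rightarrow> nat) \<Rightarrow> nat \<times> nat \<Rightarrow> nat" where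
  "extend_tab l k mu t = restrict (\<lambda>c. if c \<in> cells mu then t c else k) (cells l)"

lemma extend_tab:
  assumes l: "l \<in> shapes" and mu: "mu \<in> h_down (al k) l" and t: "t \<in> tabs mu (al(k := 0))"
    and z: "\<And>i. i \<ge> Suc k \<Longrightarrow> al i = 0"
  shows "extend_tab l k mu t \<in> tabs l al" "sub_shape l k (extend_tab l k mu t) = mu"
    "restrict (extend_tab l k mu t) (cells mu) = t"
proof -
  let ?e = "extend_tab l k mu t"
  have m: "mu \<in> shapes" "\<And>i. mu i \<le> l i" "\<And>i. l (Suc i) \<le> mu i" "card (cells l) = card (cells mu) + al k"
    using mu by (auto simp: h_down_def hstrip_def)
  have sub: "cells mu \<subseteq> cells l" by (rule cells_mono[OF m(2)])
  have tk: "t c < k" if "c \<in> cells mu" for c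
    using tabs_content_pos[OF t m(1) that] z[of "t c"]
    by (cases "t c = k"; cases "Suc k \<le> t c") auto
  have ek: "{c \<in> cells l. ?e c = i} = (if i = k then cells l - cells mu else {c \<in> cells mu. t c = i})" for i
    using tk sub by (auto simp: extend_tab_def)
  have "card {c \<in> cells l. ?e c = i} = al i" for i
    using t m l sub unfolding ek by (auto simp: tabs_def card_Diff_subset finite_subset)
  moreover have "?e (i, j) \<le> ?e (i, Suc j)" if "(i, Suc j) \<in> cells l" for i j
    using that t tk[of "(i, j)"] by (auto simp: extend_tab_def tabs_def cells_def)
  moreover have "?e (i, j) < ?e (Suc i, j)" if "(Suc i, j) \<in> cells l" for i j
    using that t tk[of "(i, j)"] m(3)[of i] m(2)[of i] shapes_Suc[OF l, of i]
    by (auto simp: extend_tab_def tabs_def cells_def)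
  ultimately show e: "?e \<in> tabs l al" by (auto simp: tabs_def extend_tab_def)
  have "cells (sub_shape l k ?e) = cells mu"
    unfolding cells_sub_shape[OF e] using tk sub by (auto simp: extend_tab_def)
  then show "sub_shape l k ?e = mu" by (rule cells_inj)
  show "restrict ?e (cells mu) = t"
    using t sub by (auto simp: extend_tab_def fun_eq_iff tabs_def extensional_def simp del: split_paired_All)
qed

text \<open>Cutting off the cells with the largest possible entry k and filling a horizontal strip
  with k again are inverse to each other, which is the recursion of \<open>kchain\<close>.\<close>

lemma card_tabs:
  assumes "l \<in> shapes" "\<And>i. i \<ge> k \<Longrightarrow> al i = 0"
  shows "card (tabs l al) = kchain k al l"
  using assms
proof (induction k arbitrary: l al)
  case 0
  show ?case
  proof (cases "l = (\<lambda>_. 0)")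
    case True
    then have "tabs l al = {\<lambda>_. undefined}" using 0(2) by (auto simp: tabs_def extensional_def)
    with True show ?thesis by simp
  next
    case False
    then have "cells l \<noteq> {}" using cells_inj[of l "\<lambda>_. 0"] by auto
    then have "tabs l al = {}" using tabs_content_pos[OF _ 0(1)] 0(2) by fastforce
    with False show ?thesis by simp
  qed
next
  case (Suc k)
  let ?S = "Sigma (h_down (al k) l) (\<lambda>mu. tabs mu (al(k := 0)))"
  have z: "(al(k := 0)) i = 0" if "i \<ge> k" for i using Suc.prems(2)[of i] that by (cases "i = k") auto
  have sh: "mu \<in> h_down (al k) l \<Longrightarrow> mu \<in> shapes" for mu by (auto simp: h_down_def)
  have "bij_betw (\<lambda>t. (sub_shape l k t, restrict t (cells (sub_shape l k t)))) (tabs l al) ?S"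
  proof (rule bij_betw_byWitness[where f' = "\<lambda>(mu, t). extend_tab l k mu t"], goal_cases)
    case 1
    have "extend_tab l k (sub_shape l k t) (restrict t (cells (sub_shape l k t))) = t"
      if t: "t \<in> tabs l al" for t
    proof
      fix c
      have "t c \<le> k" if "c \<in> cells l"
        using tabs_content_pos[OF t Suc.prems(1) that] Suc.prems(2)[of "t c"] by (cases "t c \<le> k") auto
      with t show "extend_tab l k (sub_shape l k t) (restrict t (cells (sub_shape l k t))) c = t c"
        unfolding extend_tab_def cells_sub_shape[OF t] by (auto simp: tabs_def extensional_def simp del: split_paired_All)
    qed
    then show ?case by simp
  next
    case 2
    then show ?case using extend_tab[OF Suc.prems(1) _ _ Suc.prems(2)] by auto
  next
    case 3
    then show ?case using sub_shape_props[OF _ Suc.prems] by auto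
  next
    case 4
    then show ?case using extend_tab[OF Suc.prems(1) _ _ Suc.prems(2)] by auto
  qed
  then have "card (tabs l al) = card ?S" by (rule bij_betw_same_card)
  also have "\<dots> = (\<Sum>mu\<in>h_down (al k) l. card (tabs mu (al(k := 0))))"
    by (rule card_SigmaI) (auto intro!: finite_tabs[OF sh z] simp: Suc.prems)
  also have "\<dots> = (\<Sum>mu\<in>h_down (al k) l. kchain k al mu)"
  proof (rule sum.cong[OF refl])
    fix mu assume "mu \<in> h_down (al k) l"
    then have "card (tabs mu (al(k := 0))) = kchain k (al(k := 0)) mu" by (intro Suc.IH sh z)
    also have "\<dots> = kchain k al mu" by (rule kchain_cong) simp
    finally show "card (tabs mu (al(k := 0))) = kchain k al mu" .
  qed
  finally show ?case by simp
qed

section \<open>Schur series and the Pieri rule\<close>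

definition schur :: "(nat \<Rightarrow> nat) \<Rightarrow> 'a::comm_ring_1 mseries" where
  "schur l = Abs_ms (\<lambda>al. of_nat (card (tabs l (Poly_Mapping.lookup al))))"

definition part_fun :: "nat list \<Rightarrow> nat \<Rightarrow> nat" where
  "part_fun la i = (if i < length la then la ! i else 0)"

lemma coeff_Abs_ms [simp]: "coeff_ms (Abs_ms f) = f"
  by (simp add: Abs_ms_inverse)

lemma sym_s_eq_schur: "sym_s la = schur (part_fun la)"
proof -
  have "young_diagram la = cells (part_fun la)"
    by (auto simp: young_diagram_def cells_def part_fun_def split: if_splits)
  then show ?thesis
    unfolding sym_s_def schur_def by (intro arg_cong[of _ _ Abs_ms] ext) (simp add: tabs_def ssyt_def conj_assoc)
qed

lemma coeff_zero [simp]: "coeff_ms 0 al = 0" by transfer simp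
lemma coeff_one: "coeff_ms 1 al = (if al = 0 then 1 else 0)" by transfer simp
lemma coeff_add [simp]: "coeff_ms (f + g) al = coeff_ms f al + coeff_ms g al" by transfer simp
lemma coeff_uminus [simp]: "coeff_ms (- f) al = - coeff_ms f al" by transfer simp
lemma coeff_smult [simp]: "coeff_ms (smult_ms c f) al = c * coeff_ms f al" by transfer simp
lemma coeff_mult: "coeff_ms (f * g) al = (\<Sum>(be, ga)\<in>splits al. coeff_ms f be * coeff_ms g ga)"
  by transfer simp
lemma coeff_sum [simp]: "coeff_ms (sum f A) al = (\<Sum>x\<in>A. coeff_ms (f x) al)"
  by (induction A rule: infinite_finite_induct) auto
lemma smult_ms_eq_mult: "smult_ms c f = smult_ms c 1 * f"
proof (rule mseries_eqI)
  fix al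
  have "coeff_ms (smult_ms c 1 * f) al = (\<Sum>x\<in>splits al. if x = (0, al) then c * coeff_ms f al else 0)"
    unfolding coeff_mult by (rule sum.cong) (auto simp: coeff_one splits_def split: if_splits)
  also have "\<dots> = c * coeff_ms f al" by (subst sum.delta[OF finite_splits]) (auto simp: splits_def)
  finally show "coeff_ms (smult_ms c f) al = coeff_ms (smult_ms c 1 * f) al" by simp
qed

lemma smult_mult_left: "smult_ms c f * g = smult_ms c (f * g)"
  by (metis smult_ms_eq_mult mult.assoc)
lemma smult_mult_right: "f * smult_ms c g = smult_ms c (f * g)"
  by (metis smult_mult_left mult.commute)
lemma smult_sum_right: "smult_ms c (sum f A) = (\<Sum>x\<in>A. smult_ms c (f x))"
  by (rule mseries_eqI) (simp add: sum_distrib_left)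
lemma smult_sum_left: "smult_ms (sum c A) f = (\<Sum>x\<in>A. smult_ms (c x) f)"
  by (rule mseries_eqI) (simp add: sum_distrib_right)
lemma smult_smult [simp]: "smult_ms c (smult_ms d f) = smult_ms (c * d) f"
  by (rule mseries_eqI) (simp add: mult.assoc)
lemma smult_one [simp]: "smult_ms 1 f = f" by (rule mseries_eqI) simp
lemma smult_zero [simp]: "smult_ms 0 f = 0" "smult_ms c 0 = 0" by (rule mseries_eqI, simp)+
lemma smult_add_left: "smult_ms (c + d) f = smult_ms c f + smult_ms d f"
  by (rule mseries_eqI) (simp add: algebra_simps)
lemma smult_add_right: "smult_ms c (f + g) = smult_ms c f + smult_ms c g"
  by (rule mseries_eqI) (simp add: algebra_simps)
lemma smult_neg: "smult_ms (- 1) f = - f" by (rule mseries_eqI) simp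

lemma lookup_bound: "\<exists>k. \<forall>i\<ge>k. Poly_Mapping.lookup (al :: nat \<Rightarrow>\<^sub>0 nat) i = 0"
proof -
  obtain m where "\<forall>i\<in>Poly_Mapping.keys al. i < m"
    using finite_keys finite_nat_set_iff_bounded by blast
  then show ?thesis by (metis in_keys_iff not_less)
qed

lemma monom_degree_bound:
  "(\<And>i. i \<ge> k \<Longrightarrow> Poly_Mapping.lookup al i = 0) \<Longrightarrow> monom_degree al = (\<Sum>i<k. Poly_Mapping.lookup al i)"
  unfolding monom_degree_def
  by (rule sum.mono_neutral_left) (auto simp: in_keys_iff not_less[symmetric])

lemma monom_degree_add: "monom_degree (al + be) = monom_degree al + monom_degree be"
proof -
  obtain k where k: "\<forall>i\<ge>k. Poly_Mapping.lookup al i = 0" using lookup_bound by blast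
  obtain m where m: "\<forall>i\<ge>m. Poly_Mapping.lookup be i = 0" using lookup_bound by blast
  have "monom_degree ga = (\<Sum>i<max k m. Poly_Mapping.lookup ga i)" if "ga \<in> {al, be, al + be}" for ga
    using that k m by (intro monom_degree_bound) (auto simp: lookup_add)
  then show ?thesis by (simp add: lookup_add sum.distrib)
qed

lemma monom_degree_eq_0 [simp]: "monom_degree al = 0 \<longleftrightarrow> al = 0"
  by (auto simp: monom_degree_def in_keys_iff poly_mapping_eqI)

lemma monom_degree_zero [simp]: "monom_degree 0 = 0"
  by simp

lemma coeff_schur:
  assumes "l \<in> shapes" "\<And>i. i \<ge> k \<Longrightarrow> Poly_Mapping.lookup al i = 0"
  shows "coeff_ms (schur l) al = of_nat (kchain k (Poly_Mapping.lookup al) l)"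
  using card_tabs[OF assms] by (simp add: schur_def)

lemma lookup_Abs_bounded:
  "(\<And>i. i \<ge> k \<Longrightarrow> f i = 0) \<Longrightarrow> Poly_Mapping.lookup (Abs_poly_mapping f) = (f :: nat \<Rightarrow> nat)"
  by (rule lookup_Abs_poly_mapping, rule finite_subset[of _ "{..<k}"]) (auto, rule ccontr, simp)

text \<open>In k variables that contain the support of the monomial this is
  \<open>kchain_pieri\<close>: the exponent of the Schur factor runs through \<open>below k\<close>,
  and the complementary monomial has coefficient 1 in the complete factor.\<close>

lemma pieri:
  assumes mu: "mu \<in> shapes"
  shows "complete_sym r * schur mu = (\<Sum>nu\<in>h_up r mu. schur nu :: 'a::comm_ring_1 mseries)"
proof (rule mseries_eqI)
  fix al :: "nat \<Rightarrow>\<^sub>0 nat"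
  let ?l = "Poly_Mapping.lookup"
  obtain k where k: "\<And>i. i \<ge> k \<Longrightarrow> ?l al i = 0" using lookup_bound by blast
  have z: "?l be i = 0" "?l ga i = 0" if "be + ga = al" "i \<ge> k" for be ga i
    using that k[of i] by (auto simp: lookup_add)
  have "coeff_ms (complete_sym r * schur mu :: 'a mseries) al =
      (\<Sum>x\<in>splits al. if monom_degree (fst x) = r then of_nat (kchain k (?l (snd x)) mu) else 0)"
    unfolding coeff_mult
    by (rule sum.cong) (auto simp: complete_sym_def splits_def coeff_schur[OF mu z(2)])
  also have "\<dots> = (\<Sum>x\<in>{x\<in>splits al. monom_degree (fst x) = r}. of_nat (kchain k (?l (snd x)) mu))"
    by (rule sum.inter_filter[symmetric]) (simp add: finite_splits)
  also have "\<dots> = (\<Sum>be\<in>below k (?l al) r. of_nat (kchain k be mu))"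
  proof (rule sum.reindex_bij_witness[where i = "\<lambda>g. (al - Abs_poly_mapping g, Abs_poly_mapping g)"
        and j = "\<lambda>x. ?l (snd x)"], goal_cases)
    case (1 x)
    then show ?case by (auto simp: splits_def)
  next
    case (2 x)
    then obtain be ga where x: "x = (be, ga)" "be + ga = al" "monom_degree be = r"
      by (auto simp: splits_def)
    from x(3) monom_degree_bound[OF z(1)[OF x(2)]] have "r = (\<Sum>i<k. ?l be i)" by simp
    then show ?case using z[OF x(2)] x by (auto simp: below_def lookup_add sum.distrib)
  next
    case (3 g)
    then show ?case by (simp add: lookup_Abs_bounded[of k] below_def)
  next
    case (4 g)
    then have g: "\<And>i. i < k \<Longrightarrow> g i \<le> ?l al i" "\<And>i. i \<ge> k \<Longrightarrow> g i = 0"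
      "(\<Sum>i<k. ?l al i) = (\<Sum>i<k. g i) + r" by (auto simp: below_def)
    note lg = lookup_Abs_bounded[OF g(2)]
    have s: "al - Abs_poly_mapping g + Abs_poly_mapping g = al"
    proof (rule poly_mapping_eqI)
      fix i show "?l (al - Abs_poly_mapping g + Abs_poly_mapping g) i = ?l al i"
        using g(1)[of i] g(2)[of i] by (cases "i < k") (auto simp: lookup_add lookup_minus lg)
    qed
    have "monom_degree al = (\<Sum>i<k. ?l al i)" by (rule monom_degree_bound[OF k])
    moreover have "monom_degree (Abs_poly_mapping g) = (\<Sum>i<k. g i)"
      using monom_degree_bound[of k "Abs_poly_mapping g"] g(2) by (simp add: lg)
    moreover have "monom_degree al = monom_degree (al - Abs_poly_mapping g) + monom_degree (Abs_poly_mapping g)"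
      by (metis monom_degree_add s)
    ultimately show ?case using s g(3) by (auto simp: splits_def)
  qed auto
  also have "\<dots> = of_nat (\<Sum>nu\<in>h_up r mu. kchain k (?l al) nu)"
    by (simp only: kchain_pieri[OF mu] of_nat_sum)
  also have "\<dots> = coeff_ms (\<Sum>nu\<in>h_up r mu. schur nu :: 'a mseries) al"
    unfolding coeff_sum of_nat_sum
    by (rule sum.cong) (auto simp: coeff_schur[OF _ k] h_up_def)
  finally show "coeff_ms (complete_sym r * schur mu :: 'a mseries) al =
    coeff_ms (\<Sum>nu\<in>h_up r mu. schur nu) al" .
qed

lemma sum_Pow_neg_one_card: "finite S \<Longrightarrow> (\<Sum>X\<in>Pow S. (- 1) ^ card X) = (if S = {} then 1 else 0 :: 'a::comm_ring_1)"
proof -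
  assume S: "finite S"
  have "(\<Prod>x\<in>S. - 1 + 1 :: 'a) = (\<Sum>X\<in>Pow S. (\<Prod>x\<in>X. - 1) * (\<Prod>x\<in>S - X. 1))"
    by (rule prod_add[OF S])
  with S show ?thesis by (auto simp: power_0_left)
qed

text \<open>In the coefficient of a monomial the elementary factor picks a subset of the support and
  the complete factor takes the rest, so what remains is the signed count of the subsets of the
  support.\<close>

lemma elem_complete:
  "(\<Sum>i\<le>n. (- 1) ^ i * elem_sym i * complete_sym (n - i)) = (if n = 0 then 1 else 0 :: 'a::comm_ring_1 mseries)"
proof (rule mseries_eqI)
  fix al :: "nat \<Rightarrow>\<^sub>0 nat"
  let ?l = "Poly_Mapping.lookup" and ?d = monom_degree
  let ?E = "\<lambda>be. \<forall>i. ?l be i \<le> 1"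
  have sgn: "(- 1) ^ i * elem_sym i * g = smult_ms ((- 1) ^ i) (elem_sym i * g)" for i and g :: "'a mseries"
  proof -
    have "(- 1) ^ i = (smult_ms ((- 1) ^ i) 1 :: 'a mseries)"
      by (cases "even i") (auto simp: smult_neg)
    then show ?thesis by (simp add: smult_mult_left)
  qed
  have "coeff_ms (\<Sum>i\<le>n. (- 1) ^ i * elem_sym i * complete_sym (n - i) :: 'a mseries) al
     = (\<Sum>i\<le>n. \<Sum>x\<in>splits al. if ?E (fst x) \<and> ?d (fst x) = i \<and> ?d (snd x) = n - i then (- 1) ^ i else 0)"
    unfolding coeff_sum sgn coeff_smult coeff_mult sum_distrib_left
    by (intro sum.cong) (auto simp: elem_sym_def complete_sym_def)
  also have "\<dots> = (\<Sum>x\<in>splits al. \<Sum>i\<le>n. if ?E (fst x) \<and> ?d (fst x) = i \<and> ?d (snd x) = n - i then (- 1) ^ i else 0)"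
    by (rule sum.swap)
  also have "\<dots> = (\<Sum>x\<in>splits al. if ?E (fst x) \<and> ?d al = n then (- 1) ^ ?d (fst x) else 0)"
  proof (rule sum.cong[OF refl])
    fix x assume "x \<in> splits al"
    then have d: "?d al = ?d (fst x) + ?d (snd x)" by (auto simp: splits_def monom_degree_add)
    have "(\<Sum>i\<le>n. if ?E (fst x) \<and> ?d (fst x) = i \<and> ?d (snd x) = n - i then (- 1) ^ i else 0)
       = (\<Sum>i\<le>n. if i = ?d (fst x) then (if ?E (fst x) \<and> ?d al = n then (- 1) ^ i else 0) else 0 :: 'a)"
      by (rule sum.cong) (auto simp: d)
    also have "\<dots> = (if ?E (fst x) \<and> ?d al = n then (- 1) ^ ?d (fst x) else 0)"
      using d by auto
    finally show "(\<Sum>i\<le>n. if ?E (fst x) \<and> ?d (fst x) = i \<and> ?d (snd x) = n - i then (- 1) ^ i else 0)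
       = (if ?E (fst x) \<and> ?d al = n then (- 1) ^ ?d (fst x) else 0 :: 'a)" .
  qed
  also have "\<dots> = (if ?d al = n then (\<Sum>x\<in>{x\<in>splits al. ?E (fst x)}. (- 1) ^ ?d (fst x)) else 0)"
    by (simp add: sum.inter_filter finite_splits)
  also have "(\<Sum>x\<in>{x\<in>splits al. ?E (fst x)}. (- 1) ^ ?d (fst x)) = (\<Sum>X\<in>Pow (Poly_Mapping.keys al). (- 1) ^ card X :: 'a)"
  proof -
    let ?f = "\<lambda>X i. if i \<in> X then 1 else 0 :: nat"
    let ?A = "\<lambda>X. Abs_poly_mapping (?f X)"
    have lA: "?l (?A X) = ?f X" if "X \<subseteq> Poly_Mapping.keys al" for X
      by (rule lookup_Abs_poly_mapping) (use that in \<open>auto intro: finite_subset\<close>)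
    show ?thesis
    proof (rule sum.reindex_bij_witness[where i = "\<lambda>X. (?A X, al - ?A X)" and j = "\<lambda>x. Poly_Mapping.keys (fst x)"], goal_cases)
      case (1 x)
      then obtain be ga where x: "x = (be, ga)" "be + ga = al" and E: "\<And>i. ?l be i \<le> 1"
        by (auto simp: splits_def)
      have "?A (Poly_Mapping.keys be) = be"
      proof (rule poly_mapping_eqI)
        fix i
        have "Poly_Mapping.keys be \<subseteq> Poly_Mapping.keys al" using x by (auto simp: in_keys_iff lookup_add)
        from lA[OF this] show "?l (?A (Poly_Mapping.keys be)) i = ?l be i"
          using E[of i] by (auto simp: in_keys_iff)
      qed
      with x show ?case by auto
    next
      case (2 x)
      then show ?case by (auto simp: splits_def in_keys_iff lookup_add)
    next
      case (3 X)
      then show ?case using lA[of X] by (auto simp: in_keys_iff split: if_splits)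
    next
      case (4 X)
      then have X: "X \<subseteq> Poly_Mapping.keys al" by simp
      have "?A X + (al - ?A X) = al"
        by (rule poly_mapping_eqI) (use X in \<open>auto simp: lookup_add lookup_minus lA[OF X] in_keys_iff\<close>)
      then show ?case by (auto simp: splits_def lA[OF X])
    next
      case (5 x)
      then have E: "?l (fst x) i \<le> 1" for i by auto
      have "?l (fst x) i = 1" if "i \<in> Poly_Mapping.keys (fst x)" for i
        using that E[of i] by (auto simp: in_keys_iff)
      then have "?d (fst x) = card (Poly_Mapping.keys (fst x))" by (simp add: monom_degree_def)
      then show ?case by simp
    qed
  qed
  also have "\<dots> = (if al = 0 then 1 else 0)" by (subst sum_Pow_neg_one_card) auto
  finally show "coeff_ms (\<Sum>i\<le>n. (- 1) ^ i * elem_sym i * complete_sym (n - i) :: 'a mseries) al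
     = coeff_ms (if n = 0 then 1 else 0) al"
    by (auto simp: coeff_one simp del: coeff_sum)
qed

section \<open>Conjugate shapes, vertical strips and the dual Pieri rule\<close>

definition conj_shape :: "(nat \<Rightarrow> nat) \<Rightarrow> nat \<Rightarrow> nat" where
  "conj_shape l j = card {i. j < l i}"

lemma less_conj_shape_iff:
  assumes "l \<in> shapes"
  shows "i < conj_shape l j \<longleftrightarrow> j < l i"
proof -
  have "{i. j < l i} = {..<conj_shape l j}"
    unfolding conj_shape_def
  proof (rule down_closed_eq_lessThan)
    show "finite {i. j < l i}"
      using assms by (auto simp: shapes_def elim: rev_finite_subset)
  qed (use shapes_antimono[OF assms] in \<open>auto intro: less_le_trans\<close>)
  then show ?thesis by (metis lessThan_iff mem_Collect_eq)
qed

lemma le_conj_shape_iff: "l \<in> shapes \<Longrightarrow> conj_shape l j \<le> i \<longleftrightarrow> l i \<le> j"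
  using less_conj_shape_iff[of l i j] by (simp flip: not_less)

lemma conj_shape [simp]: "l \<in> shapes \<Longrightarrow> conj_shape l \<in> shapes"
proof -
  assume l: "l \<in> shapes"
  have "conj_shape l (Suc j) \<le> conj_shape l j" for j
    using le_conj_shape_iff[OF l, of j "conj_shape l j"] le_conj_shape_iff[OF l, of "Suc j" "conj_shape l j"]
    by simp
  moreover have "conj_shape l j = 0" if "j \<ge> l 0" for j
    using le_conj_shape_iff[OF l, of j 0] that by simp
  ultimately show ?thesis by (rule shapesI)
qed

lemma conj_conj [simp]: "l \<in> shapes \<Longrightarrow> conj_shape (conj_shape l) = l"
proof
  fix i assume l: "l \<in> shapes"
  have "j < conj_shape (conj_shape l) i \<longleftrightarrow> j < l i" for j
    using less_conj_shape_iff[OF l] less_conj_shape_iff[OF conj_shape[OF l]] by simp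
  then show "conj_shape (conj_shape l) i = l i" by (metis nat_neq_iff)
qed

lemma card_cells_conj [simp]: "l \<in> shapes \<Longrightarrow> card (cells (conj_shape l)) = card (cells l)"
proof -
  assume l: "l \<in> shapes"
  have "cells (conj_shape l) = prod.swap ` cells l"
    unfolding cells_def using less_conj_shape_iff[OF l] by (auto simp: image_iff)
  then show ?thesis by (simp add: card_image)
qed

lemma hstrip_conj:
  assumes "mu \<in> shapes" "la \<in> shapes"
  shows "hstrip (conj_shape mu) (conj_shape la) \<longleftrightarrow> vstrip mu la"
proof
  assume h: "hstrip (conj_shape mu) (conj_shape la)"
  have "mu i \<le> la i" for i
    using less_conj_shape_iff[OF assms(1), of i] less_conj_shape_iff[OF assms(2), of i] hstripD(1)[OF h]
    by (meson less_irrefl not_le order_less_le_trans)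
  moreover have "la i \<le> Suc (mu i)" for i
    using le_conj_shape_iff[OF assms(1), of "mu i" i] le_conj_shape_iff[OF assms(2), of "Suc (mu i)" i]
      hstripD(2)[OF h, of "mu i"] by simp
  ultimately show "vstrip mu la" by (simp add: vstrip_def)
next
  assume v: "vstrip mu la"
  have "conj_shape mu j \<le> conj_shape la j" for j
    using le_conj_shape_iff[OF assms(1), of j "conj_shape la j"] le_conj_shape_iff[OF assms(2), of j "conj_shape la j"] v
    by (auto simp: vstrip_def intro: order_trans)
  moreover have "conj_shape la (Suc j) \<le> conj_shape mu j" for j
  proof -
    have "mu (conj_shape mu j) \<le> j" using le_conj_shape_iff[OF assms(1), of j "conj_shape mu j"] by simp
    then have "la (conj_shape mu j) \<le> Suc j" using v unfolding vstrip_def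
      by (metis Suc_le_mono order_trans)
    then show ?thesis using le_conj_shape_iff[OF assms(2)] by simp
  qed
  ultimately show "hstrip (conj_shape mu) (conj_shape la)" by (simp add: hstrip_def)
qed

definition shapes_of :: "nat \<Rightarrow> (nat \<Rightarrow> nat) set" where
  "shapes_of n = {l \<in> shapes. card (cells l) = n}"

lemma finite_shapes_of [simp]: "finite (shapes_of n)"
  unfolding shapes_of_def by (rule finite_shape_range)

lemma h_up_alt: "mu \<in> shapes_of n \<Longrightarrow> h_up r mu = {nu. nu \<in> shapes_of (n + r) \<and> hstrip mu nu}"
  by (auto simp: h_up_def shapes_of_def)

lemma h_down_alt: "nu \<in> shapes_of (n + r) \<Longrightarrow> h_down r nu = {mu. mu \<in> shapes_of n \<and> hstrip mu nu}"
  by (auto simp: h_down_def shapes_of_def)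

definition v_up :: "nat \<Rightarrow> (nat \<Rightarrow> nat) \<Rightarrow> (nat \<Rightarrow> nat) set" where
  "v_up r mu = {nu \<in> shapes. vstrip mu nu \<and> card (cells nu) = card (cells mu) + r}"

lemma v_up_alt: "mu \<in> shapes_of n \<Longrightarrow> v_up r mu = {nu. nu \<in> shapes_of (n + r) \<and> vstrip mu nu}"
  by (auto simp: v_up_def shapes_of_def)

lemma finite_v_up [simp]: "finite (v_up r mu)"
  by (rule finite_subset[OF _ finite_shapes_of[of "card (cells mu) + r"]]) (auto simp: v_up_def shapes_of_def)

lemma card_cells_update:
  assumes "l \<in> shapes"
  shows "card (cells (l(i := Suc (l i)))) = Suc (card (cells l))"
proof -
  have "cells (l(i := Suc (l i))) = insert (i, l i) (cells l)"
    by (auto simp: cells_def less_Suc_eq split: if_splits)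
  then show ?thesis using assms by (simp add: cells_def finite_cells[unfolded cells_def])
qed

lemma between_shape:
  assumes "la \<in> shapes" "\<And>i. nu i \<le> la i \<and> la (Suc i) \<le> nu i"
  shows "nu \<in> shapes"
proof -
  obtain N where N: "\<And>i. i \<ge> N \<Longrightarrow> la i = 0" using shapes_bound[OF assms(1)] by auto
  show ?thesis
  proof (rule shapesI)
    show "nu (Suc i) \<le> nu i" for i using assms(2)[of "Suc i"] assms(2)[of i] by linarith
    show "nu i = 0" if "i \<ge> N" for i using N[OF that] assms(2)[of i] by simp
  qed
qed

text \<open>In the last row where \<open>mu\<close> and \<open>la\<close> differ, both \<open>mu i\<close> and \<open>mu i + 1\<close> are admissible; switching
  between them is a sign-reversing involution.\<close>

lemma strip_sign_sum:
  assumes mu: "mu \<in> shapes" and la: "la \<in> shapes"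
  shows "(\<Sum>nu | nu \<in> shapes \<and> vstrip mu nu \<and> hstrip nu la. (- 1) ^ card (cells nu)) =
    (if la = mu then (- 1) ^ card (cells mu) else 0 :: int)"
proof -
  let ?V = "{nu. nu \<in> shapes \<and> vstrip mu nu \<and> hstrip nu la}"
  show ?thesis
  proof (cases "la = mu")
    case True
    have "nu = mu" if "vstrip mu nu" "hstrip nu mu" for nu
      using that by (intro ext antisym) (auto simp: vstrip_def hstrip_def)
    moreover have "vstrip mu mu" "hstrip mu mu" using mu by (auto simp: vstrip_def hstrip_def shapes_Suc)
    ultimately have "?V = {mu}" using mu True by blast
    with True show ?thesis by simp
  next
    case False
    show ?thesis
    proof (cases "?V = {}")
      case False
      then have le: "mu i \<le> la i" for i by (auto simp: vstrip_def hstrip_def intro: order_trans)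
      let ?D = "{i. mu i \<noteq> la i}"
      have "finite ?D"
        by (rule finite_subset[of _ "{i. mu i \<noteq> 0} \<union> {i. la i \<noteq> 0}"]) (use mu la in \<open>auto simp: shapes_def\<close>)
      moreover have "?D \<noteq> {}" using \<open>la \<noteq> mu\<close> by auto
      ultimately have "Max ?D \<in> ?D" and mx: "\<And>i. i \<in> ?D \<Longrightarrow> i \<le> Max ?D" by (metis Max_in, auto)
      define m where "m = Max ?D"
      have m1: "mu m < la m" using \<open>Max ?D \<in> ?D\<close> le[of m] by (simp add: m_def)
      have m2: "la (Suc m) \<le> mu m"
        using mx[of "Suc m"] shapes_Suc[OF mu, of m] by (cases "mu (Suc m) = la (Suc m)") (auto simp: m_def)
      define f where "f nu = nu(m := if nu m = mu m then Suc (mu m) else mu m)" for nu :: "nat \<Rightarrow> nat"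
      have V: "nu \<in> ?V \<longleftrightarrow> (\<forall>i. mu i \<le> nu i \<and> nu i \<le> Suc (mu i) \<and> nu i \<le> la i \<and> la (Suc i) \<le> nu i)" for nu
        using between_shape[OF la, of nu] by (auto simp: vstrip_def hstrip_def)
      have fV: "f nu \<in> ?V" if "nu \<in> ?V" for nu
        using that m1 m2 unfolding V f_def by auto
      have ff: "f (f nu) = nu" if "nu \<in> ?V" for nu
      proof -
        have "nu m = mu m \<or> nu m = Suc (mu m)" using that unfolding V by (meson antisym not_less_eq_eq)
        then show ?thesis by (auto simp: f_def fun_eq_iff)
      qed
      have sg: "(- 1) ^ card (cells (f nu)) = - ((- 1) ^ card (cells nu) :: int)" if nu: "nu \<in> ?V" for nu
      proof -
        have *: "nu m = mu m \<or> nu m = Suc (mu m)" using nu unfolding V by (meson antisym not_less_eq_eq)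
        show ?thesis
        proof (cases "nu m = mu m")
          case True
          then have "f nu = nu(m := Suc (nu m))" by (simp add: f_def)
          then show ?thesis using card_cells_update[of nu m] nu by simp
        next
          case False
          then have "nu = (f nu)(m := Suc (f nu m))" using * by (auto simp: f_def fun_eq_iff)
          moreover have "f nu \<in> shapes" using fV[OF nu] by simp
          ultimately have "card (cells nu) = Suc (card (cells (f nu)))" using card_cells_update[of "f nu" m] by metis
          then show ?thesis by simp
        qed
      qed
      have "(\<Sum>nu\<in>?V. (- 1) ^ card (cells nu)) = (\<Sum>nu\<in>?V. - ((- 1) ^ card (cells nu)) :: int)"
      proof (rule sum.reindex_bij_witness[where i = f and j = f])
        show "- ((- 1) ^ card (cells (f nu))) = ((- 1) ^ card (cells nu) :: int)" if "nu \<in> ?V" for nu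
          using sg[OF that] by simp
      qed (fact ff fV)+
      then show ?thesis using \<open>la \<noteq> mu\<close> by (simp add: sum_negf)
    next
      case True
      then show ?thesis using False by (simp only: sum.empty if_False)
    qed
  qed
qed

text \<open>Adding vertical strips satisfies the same recursion against the complete functions as
  multiplication by the elementary ones does by \<open>elem_complete\<close>. After an application
  of the Pieri rule the terms are grouped by their final shape, and \<open>strip_sign_sum\<close>
  cancels all shapes but \<open>mu\<close>.\<close>

lemma dual_pieri_signed:
  assumes mu: "mu \<in> shapes_of N"
  shows "(\<Sum>i\<le>m. (- 1) ^ i * complete_sym (m - i) * (\<Sum>nu\<in>v_up i mu. schur nu)) =
    (if m = 0 then schur mu else 0 :: 'a::comm_ring_1 mseries)"
proof -
  have mu': "mu \<in> shapes" "card (cells mu) = N" using mu by (auto simp: shapes_of_def)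
  let ?c = "\<lambda>nu i. if card (cells nu) = N + i then (- 1) ^ i else 0 :: int"
  let ?V = "\<lambda>la. {nu. nu \<in> shapes \<and> vstrip mu nu \<and> hstrip nu la}"
  have fV: "finite (?V la)" if "la \<in> shapes" for la
    by (rule finite_subset[OF _ finite_functions_below[of la]])
       (use that in \<open>auto simp: hstripD(1), simp add: shapes_def\<close>)
  have "(\<Sum>i\<le>m. (- 1) ^ i * complete_sym (m - i) * (\<Sum>nu\<in>v_up i mu. schur nu)) =
      (\<Sum>i\<le>m. \<Sum>nu\<in>v_up i mu. \<Sum>la\<in>h_up (m - i) nu. (- 1) ^ i * schur la :: 'a mseries)"
    unfolding sum_distrib_left mult.assoc
    by (intro sum.cong refl) (auto simp: pieri v_up_def simp flip: sum_distrib_left)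
  also have "\<dots> = (\<Sum>i\<le>m. \<Sum>la\<in>shapes_of (N + m). \<Sum>nu\<in>{nu. nu \<in> v_up i mu \<and> hstrip nu la}. (- 1) ^ i * schur la)"
  proof (rule sum.cong[OF refl])
    fix i assume i: "i \<in> {..m}"
    have "(\<Sum>nu\<in>v_up i mu. \<Sum>la\<in>h_up (m - i) nu. (- 1) ^ i * schur la :: 'a mseries) =
       (\<Sum>nu\<in>v_up i mu. \<Sum>la\<in>{la. la \<in> shapes_of (N + m) \<and> hstrip nu la}. (- 1) ^ i * schur la)"
      using i by (intro sum.cong refl) (auto simp: v_up_def h_up_def shapes_of_def mu')
    also have "\<dots> = (\<Sum>la\<in>shapes_of (N + m). \<Sum>nu\<in>{nu. nu \<in> v_up i mu \<and> hstrip nu la}. (- 1) ^ i * schur la)"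
      by (rule sum.swap_restrict) auto
    finally show "(\<Sum>nu\<in>v_up i mu. \<Sum>la\<in>h_up (m - i) nu. (- 1) ^ i * schur la :: 'a mseries) = \<dots>" .
  qed
  also have "\<dots> = (\<Sum>la\<in>shapes_of (N + m). \<Sum>i\<le>m. \<Sum>nu\<in>{nu. nu \<in> v_up i mu \<and> hstrip nu la}. (- 1) ^ i * schur la)"
    by (rule sum.swap)
  also have "\<dots> = (\<Sum>la\<in>shapes_of (N + m). of_int ((- 1) ^ N * (if la = mu then (- 1) ^ N else 0)) * schur la)"
  proof (rule sum.cong[OF refl])
    fix la assume la: "la \<in> shapes_of (N + m)"
    then have la': "la \<in> shapes" "card (cells la) = N + m" by (auto simp: shapes_of_def)
    have "(\<Sum>i\<le>m. \<Sum>nu\<in>{nu. nu \<in> v_up i mu \<and> hstrip nu la}. (- 1) ^ i * schur la) =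
       (\<Sum>i\<le>m. \<Sum>nu\<in>?V la. of_int (?c nu i)) * (schur la :: 'a mseries)"
      unfolding sum_distrib_right
      by (intro sum.cong refl sum.mono_neutral_cong_left fV la') (auto simp: v_up_def mu')
    also have "(\<Sum>i\<le>m. \<Sum>nu\<in>?V la. of_int (?c nu i)) = (\<Sum>nu\<in>?V la. \<Sum>i\<le>m. of_int (?c nu i) :: 'a mseries)"
      by (rule sum.swap)
    also have "\<dots> = (\<Sum>nu\<in>?V la. of_int ((- 1) ^ N * (- 1) ^ card (cells nu)))"
    proof (rule sum.cong[OF refl])
      fix nu assume nu: "nu \<in> ?V la"
      have le: "N \<le> card (cells nu)" "card (cells nu) \<le> N + m"
        using nu card_cells_mono[of nu mu] card_cells_mono[of la nu] mu' la'
        by (auto simp: vstrip_def hstrip_def)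
      \<comment> \<open>Only the i that matches the number of added cells contributes; it is in
        range because the shape lies between \<open>mu\<close> and \<open>la\<close>.\<close>
      have "(\<Sum>i\<le>m. of_int (?c nu i) :: 'a mseries) = (\<Sum>i\<le>m. if i = card (cells nu) - N then of_int ((- 1) ^ i) else 0)"
        by (rule sum.cong) (use le in auto)
      also have "\<dots> = of_int ((- 1) ^ (card (cells nu) - N))" using le by simp
      also have "(- 1) ^ (card (cells nu) - N) = ((- 1) ^ N * (- 1) ^ card (cells nu) :: int)"
        using le by (simp add: minus_one_power_iff)
      finally show "(\<Sum>i\<le>m. of_int (?c nu i) :: 'a mseries) = of_int ((- 1) ^ N * (- 1) ^ card (cells nu))" .
    qed
    also have "\<dots> = of_int ((- 1) ^ N * (\<Sum>nu\<in>?V la. (- 1) ^ card (cells nu)))"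
      by (simp only: of_int_sum sum_distrib_left)
    also have "(\<Sum>nu\<in>?V la. (- 1) ^ card (cells nu)) = (if la = mu then (- 1) ^ N else 0 :: int)"
      using strip_sign_sum[OF mu'(1) la'(1)] mu' by simp
    finally show "(\<Sum>i\<le>m. \<Sum>nu\<in>{nu. nu \<in> v_up i mu \<and> hstrip nu la}. (- 1) ^ i * schur la) =
       of_int ((- 1) ^ N * (if la = mu then (- 1) ^ N else 0)) * (schur la :: 'a mseries)" .
  qed
  also have "\<dots> = (\<Sum>la\<in>shapes_of (N + m). if la = mu then schur la else 0)"
    by (rule sum.cong) (auto simp flip: power_add mult_2 simp: power_mult)
  also have "\<dots> = (if m = 0 then schur mu else 0)"
    unfolding sum.delta[OF finite_shapes_of] using mu mu' by (auto simp: shapes_of_def)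
  finally show ?thesis .
qed

lemma neg_one_power_sq [simp]: "(- 1) ^ r * ((- 1) ^ r * x) = (x :: 'a::comm_ring_1)"
  by (metis mult.assoc mult_1 power_add even_add minus_one_power_iff)

text \<open>Both sides solve the same triangular recursion, whose leading coefficient is h_0 = 1 up
  to sign.\<close>

lemma dual_pieri:
  assumes "mu \<in> shapes"
  shows "elem_sym r * schur mu = (\<Sum>nu\<in>v_up r mu. schur nu :: 'a::comm_ring_1 mseries)"
proof (induction r rule: less_induct)
  case (less r)
  let ?E = "\<lambda>i. \<Sum>nu\<in>v_up i mu. schur nu :: 'a mseries"
  have c0: "complete_sym 0 = (1 :: 'a mseries)"
    by (rule mseries_eqI) (simp add: complete_sym_def coeff_one)
  have "(\<Sum>i\<le>r. (- 1) ^ i * complete_sym (r - i) * ?E i) = (if r = 0 then schur mu else 0)"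
    using assms by (intro dual_pieri_signed) (auto simp: shapes_of_def)
  also have "\<dots> = (\<Sum>i\<le>r. (- 1) ^ i * elem_sym i * complete_sym (r - i)) * schur mu"
    by (simp add: elem_complete)
  also have "\<dots> = (\<Sum>i\<le>r. (- 1) ^ i * complete_sym (r - i) * (elem_sym i * schur mu))"
    by (simp add: sum_distrib_right mult.assoc mult.left_commute[of "elem_sym _"])
  finally have "(\<Sum>i<r. (- 1) ^ i * complete_sym (r - i) * ?E i) + (- 1) ^ r * ?E r =
     (\<Sum>i<r. (- 1) ^ i * complete_sym (r - i) * (elem_sym i * schur mu)) + (- 1) ^ r * (elem_sym r * schur mu)"
    by (simp add: c0 flip: lessThan_Suc_atMost)
  moreover have "(\<Sum>i<r. (- 1) ^ i * complete_sym (r - i) * ?E i) =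
     (\<Sum>i<r. (- 1) ^ i * complete_sym (r - i) * (elem_sym i * schur mu))"
    by (rule sum.cong) (auto simp: less)
  ultimately have "(- 1) ^ r * ?E r = (- 1) ^ r * (elem_sym r * schur mu)" by simp
  then have "(- 1) ^ r * ((- 1) ^ r * ?E r) = (- 1) ^ r * ((- 1) ^ r * (elem_sym r * schur mu))" by simp
  then show ?case by (simp only: neg_one_power_sq)
qed

section \<open>Products of complete or elementary functions in terms of Schur functions\<close>

lemma prod_complete_schur:
  "(\<Prod>i<k. complete_sym (al i)) =
    (\<Sum>mu\<in>shapes_of (\<Sum>i<k. al i). of_nat (kchain k al mu) * schur mu :: 'a::comm_ring_1 mseries)"
proof (induction k)
  case 0
  have "shapes_of 0 = {\<lambda>_. 0}" using card_cells_0_iff by (auto simp only: shapes_of_def cells_zero card.empty zero_shape)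
  moreover have "schur (\<lambda>_. 0) = (1 :: 'a mseries)"
  proof (rule mseries_eqI)
    fix al :: "nat \<Rightarrow>\<^sub>0 nat"
    have "tabs (\<lambda>_. 0) (Poly_Mapping.lookup al) = (if al = 0 then {\<lambda>_. undefined} else {})"
      by (auto simp: tabs_def extensional_def poly_mapping_eq_iff fun_eq_iff simp del: split_paired_All)
    then show "coeff_ms (schur (\<lambda>_. 0) :: 'a mseries) al = coeff_ms 1 al" by (simp add: schur_def coeff_one)
  qed
  ultimately show ?case by simp
next
  case (Suc k)
  let ?N = "\<Sum>i<k. al i"
  have "(\<Prod>i<Suc k. complete_sym (al i) :: 'a mseries) =
     (\<Sum>mu\<in>shapes_of ?N. of_nat (kchain k al mu) * (complete_sym (al k) * schur mu))"
    by (simp add: Suc sum_distrib_left mult_ac)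
  also have "\<dots> = (\<Sum>mu\<in>shapes_of ?N. \<Sum>nu\<in>{nu. nu \<in> shapes_of (?N + al k) \<and> hstrip mu nu}. of_nat (kchain k al mu) * schur nu)"
    by (rule sum.cong[OF refl], subst pieri) (auto simp: h_up_alt shapes_of_def sum_distrib_left)
  also have "\<dots> = (\<Sum>nu\<in>shapes_of (?N + al k). \<Sum>mu\<in>{mu. mu \<in> shapes_of ?N \<and> hstrip mu nu}. of_nat (kchain k al mu) * schur nu)"
    by (rule sum.swap_restrict) auto
  also have "\<dots> = (\<Sum>nu\<in>shapes_of (?N + al k). of_nat (kchain (Suc k) al nu) * schur nu)"
    by (rule sum.cong) (auto simp: h_down_alt sum_distrib_right)
  finally show ?case by simp
qed

text \<open>\<open>kchain\<close> runs along horizontal strips. Conjugation turns the vertical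
  strips of the dual Pieri rule into these, which is where the conjugate shape comes from.\<close>

lemma prod_elem_schur:
  "(\<Prod>i<k. elem_sym (al i)) =
    (\<Sum>mu\<in>shapes_of (\<Sum>i<k. al i). of_nat (kchain k al (conj_shape mu)) * schur mu :: 'a::comm_ring_1 mseries)"
proof (induction k)
  case 0
  have "shapes_of 0 = {\<lambda>_. 0}" using card_cells_0_iff by (auto simp only: shapes_of_def cells_zero card.empty zero_shape)
  then show ?case using prod_complete_schur[where k = 0 and 'a = 'a] by (simp add: conj_shape_def)
next
  case (Suc k)
  let ?N = "\<Sum>i<k. al i"
  have "(\<Prod>i<Suc k. elem_sym (al i) :: 'a mseries) =
     (\<Sum>mu\<in>shapes_of ?N. of_nat (kchain k al (conj_shape mu)) * (elem_sym (al k) * schur mu))"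
    by (simp add: Suc sum_distrib_left mult_ac)
  also have "\<dots> = (\<Sum>mu\<in>shapes_of ?N. \<Sum>nu\<in>{nu. nu \<in> shapes_of (?N + al k) \<and> vstrip mu nu}. of_nat (kchain k al (conj_shape mu)) * schur nu)"
    by (rule sum.cong[OF refl], subst dual_pieri) (auto simp: v_up_alt shapes_of_def sum_distrib_left)
  also have "\<dots> = (\<Sum>nu\<in>shapes_of (?N + al k). \<Sum>mu\<in>{mu. mu \<in> shapes_of ?N \<and> vstrip mu nu}. of_nat (kchain k al (conj_shape mu)) * schur nu)"
    by (rule sum.swap_restrict) auto
  also have "\<dots> = (\<Sum>nu\<in>shapes_of (?N + al k). of_nat (kchain (Suc k) al (conj_shape nu)) * schur nu)"
  proof (rule sum.cong[OF refl])
    fix nu assume nu: "nu \<in> shapes_of (?N + al k)"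
    then have c: "conj_shape nu \<in> shapes_of (?N + al k)" "nu \<in> shapes" by (auto simp: shapes_of_def)
    have v: "hstrip (conj_shape b) (conj_shape nu) \<longleftrightarrow> vstrip b nu"
      "vstrip (conj_shape b) nu \<longleftrightarrow> hstrip b (conj_shape nu)" if "b \<in> shapes" for b
      using hstrip_conj[of b nu] hstrip_conj[of "conj_shape b" nu] that c by simp_all
    have "(\<Sum>mu | mu \<in> shapes_of ?N \<and> vstrip mu nu. kchain k al (conj_shape mu)) =
       (\<Sum>mu | mu \<in> shapes_of ?N \<and> hstrip mu (conj_shape nu). kchain k al mu)"
      by (rule sum.reindex_bij_witness[where i = conj_shape and j = conj_shape])
         (use c v in \<open>auto simp: shapes_of_def\<close>)
    also have "\<dots> = kchain (Suc k) al (conj_shape nu)" using c by (simp add: h_down_alt)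
    finally have eq: "(\<Sum>mu | mu \<in> shapes_of ?N \<and> vstrip mu nu. kchain k al (conj_shape mu)) =
      kchain (Suc k) al (conj_shape nu)" .
    show "(\<Sum>mu | mu \<in> shapes_of ?N \<and> vstrip mu nu. of_nat (kchain k al (conj_shape mu)) * schur nu) =
       of_nat (kchain (Suc k) al (conj_shape nu)) * (schur nu :: 'a mseries)"
      by (simp only: eq flip: sum_distrib_right of_nat_sum)
  qed
  finally show ?case by simp
qed

text \<open>The partial sums express in terms of chains that the entries below j of a semistandard
  tableau lie in its first j rows.\<close>

lemma kchain_nonzero:
  assumes "kchain k al mu \<noteq> 0" "mu \<in> shapes"
  shows "(\<forall>i\<ge>k. mu i = 0) \<and> card (cells mu) = (\<Sum>i<k. al i) \<and> (\<forall>j\<le>k. (\<Sum>i<j. al i) \<le> (\<Sum>i<j. mu i))"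
  using assms
proof (induction k arbitrary: mu)
  case (Suc k)
  then obtain la where la: "la \<in> h_down (al k) mu" and nz: "kchain k al la \<noteq> 0"
    by (auto elim: sum.not_neutral_contains_not_neutral)
  then have d: "la \<in> shapes" "\<And>i. la i \<le> mu i" "\<And>i. mu (Suc i) \<le> la i" "card (cells mu) = card (cells la) + al k"
    by (auto simp: h_down_def hstrip_def)
  note IH = Suc.IH[OF nz d(1)]
  have z: "mu i = 0" if "i \<ge> Suc k" for i
    using d(3)[of "i - 1"] IH that by (cases i) auto
  have c: "card (cells mu) = (\<Sum>i<Suc k. al i)" using IH d(4) by simp
  have "(\<Sum>i<j. al i) \<le> (\<Sum>i<j. mu i)" if "j \<le> Suc k" for j
  proof (cases "j = Suc k")
    case True
    then show ?thesis using c card_cells[OF z] by simp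
  next
    case False
    then have "(\<Sum>i<j. al i) \<le> (\<Sum>i<j. la i)" using IH that by simp
    also have "\<dots> \<le> (\<Sum>i<j. mu i)" by (rule sum_mono) (rule d(2))
    finally show ?thesis .
  qed
  with z c show ?case by simp
qed (auto split: if_splits)

text \<open>The last strip has to be the whole last row: a shape that admits a chain of length k
  vanishes from row k on, lies inside \<open>mu\<close>, and has as many cells as \<open>mu\<close>
  without row k.\<close>

lemma kchain_diag:
  assumes "mu \<in> shapes" "\<And>i. i \<ge> k \<Longrightarrow> mu i = 0" "\<And>i. i < k \<Longrightarrow> al i = mu i"
  shows "kchain k al mu = 1"
  using assms
proof (induction k arbitrary: mu)
  case (Suc k)
  define nu where "nu = mu(k := 0)"
  have nu_le: "nu i \<le> mu i" for i by (simp add: nu_def)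
  have nu_z: "nu i = 0" if "i \<ge> k" for i using that Suc.prems(2)[of i] by (cases "i = k") (auto simp: nu_def)
  have mk: "mu (Suc k) = 0" using Suc.prems(2) by simp
  have hs: "mu (Suc i) \<le> nu i" for i
    using Suc.prems(2)[of "Suc i"] shapes_Suc[OF Suc.prems(1), of i] by (auto simp: nu_def)
  have nu: "nu \<in> shapes" by (rule between_shape[OF Suc.prems(1)]) (use nu_le hs in auto)
  have cmu: "card (cells mu) = (\<Sum>i<k. mu i) + mu k" using card_cells[of "Suc k" mu] Suc.prems(2) by simp
  have "card (cells nu) = (\<Sum>i<k. nu i)" by (rule card_cells[OF nu_z])
  also have "\<dots> = (\<Sum>i<k. mu i)" by (rule sum.cong) (auto simp: nu_def)
  finally have nd: "nu \<in> h_down (al k) mu"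
    using nu nu_le hs cmu Suc.prems(3)[of k] by (auto simp: h_down_def hstrip_def)
  have "kchain k al la = 0" if la: "la \<in> h_down (al k) mu" "la \<noteq> nu" for la
  proof (rule ccontr)
    assume nz: "kchain k al la \<noteq> 0"
    have d: "la \<in> shapes" "\<And>i. la i \<le> mu i" "card (cells mu) = card (cells la) + mu k"
      using la Suc.prems(3)[of k] by (auto simp: h_down_def hstrip_def)
    from kchain_nonzero[OF nz d(1)] have z: "\<And>i. i \<ge> k \<Longrightarrow> la i = 0" by simp
    have "card (cells la) = (\<Sum>i<k. la i)" by (rule card_cells[OF z])
    with cmu d(3) have "(\<Sum>i<k. la i) = (\<Sum>i<k. mu i)" by simp
    then have "\<forall>i<k. la i = mu i"
      using sum_mono_inv[of la "{..<k}" mu] d(2) by auto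
    then have "la i = nu i" for i using z[of i] nu_z[of i] by (cases "i < k") (auto simp: nu_def)
    then have "la = nu" by (rule ext)
    with la show False by simp
  qed
  then have "(\<Sum>la\<in>h_down (al k) mu. kchain k al la) = (\<Sum>la\<in>{nu}. kchain k al la)"
    by (intro sum.mono_neutral_right) (use nd Suc.prems(1) in auto)
  moreover have "kchain k al nu = 1" by (rule Suc.IH[OF nu nu_z]) (simp_all add: nu_def Suc.prems(3))
  ultimately show ?case by simp
qed (auto simp: fun_eq_iff)

section \<open>Partitions as lists, transposition and the dominance order\<close>

definition part_mon :: "nat list \<Rightarrow> nat \<Rightarrow>\<^sub>0 nat" where
  "part_mon la = Abs_poly_mapping (part_fun la)"

lemma lookup_part_mon [simp]: "Poly_Mapping.lookup (part_mon la) = part_fun la"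
  unfolding part_mon_def by (rule lookup_Abs_bounded[of "length la"]) (simp add: part_fun_def)

lemma part_fun_beyond: "i \<ge> length la \<Longrightarrow> part_fun la i = 0"
  by (simp add: part_fun_def)

lemma sum_part_fun: "(\<Sum>i<length la. part_fun la i) = sum_list la"
  by (simp add: part_fun_def sum_list_sum_nth atLeast0LessThan)

lemma card_cells_part_fun: "card (cells (part_fun la)) = sum_list la"
  by (subst card_cells[of "length la"]) (simp_all add: part_fun_beyond sum_part_fun)

lemma part_fun_shapes: "la \<in> partitions n \<Longrightarrow> part_fun la \<in> shapes_of n"
proof -
  assume la: "la \<in> partitions n"
  then have s: "sorted_wrt (\<ge>) la" "sum_list la = n" by (auto simp: partitions_def)
  have "part_fun la (Suc i) \<le> part_fun la i" for i
    using s(1) by (auto simp: part_fun_def sorted_wrt_iff_nth_less)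
  from shapesI[of "part_fun la", OF this part_fun_beyond] show ?thesis
    using s by (simp add: shapes_of_def card_cells_part_fun)
qed

lemma part_fun_shape [simp]: "la \<in> partitions n \<Longrightarrow> part_fun la \<in> shapes"
  using part_fun_shapes by (auto simp: shapes_of_def)

lemma part_fun_inj:
  assumes "la \<in> partitions n" "mu \<in> partitions m" "part_fun la = part_fun mu"
  shows "la = mu"
proof (rule nth_equalityI)
  have nz: "part_fun xs i \<noteq> 0 \<longleftrightarrow> i < length xs" if "xs \<in> partitions k" for xs k i
    using that nth_mem[of i xs] by (auto simp: part_fun_def partitions_def)
  have "i < length la \<longleftrightarrow> i < length mu" for i
    using nz[OF assms(1), of i] nz[OF assms(2), of i] assms(3) by simp
  then show l: "length la = length mu" by (metis nat_neq_iff)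
  fix i assume "i < length la"
  then show "la ! i = mu ! i" using fun_cong[OF assms(3), of i] l by (simp add: part_fun_def)
qed

lemma shape_is_part_fun:
  assumes "l \<in> shapes_of n"
  obtains la where "la \<in> partitions n" "part_fun la = l"
proof
  have l: "l \<in> shapes" "card (cells l) = n" using assms by (auto simp: shapes_of_def)
  let ?la = "map l [0..<conj_shape l 0]"
  have z: "i < conj_shape l 0 \<longleftrightarrow> l i > 0" for i by (rule less_conj_shape_iff[OF l(1)])
  show eq: "part_fun ?la = l"
    using z by (auto simp: part_fun_def fun_eq_iff)
  have "sum_list ?la = n" using card_cells_part_fun[of ?la] eq l by simp
  moreover have "sorted_wrt (\<ge>) ?la"
    unfolding sorted_wrt_iff_nth_less
  proof (intro allI impI)
    fix i j assume "i < j" "j < length ?la"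
    then show "?la ! j \<le> ?la ! i" using shapes_antimono[OF l(1), of i j] by simp
  qed
  moreover have "\<forall>x\<in>set ?la. 0 < x" using z by auto
  ultimately show "?la \<in> partitions n" by (simp only: partitions_def mem_Collect_eq simp_thms)
qed

lemma bij_part_fun: "bij_betw part_fun (partitions n) (shapes_of n)"
  unfolding bij_betw_def
proof
  show "inj_on part_fun (partitions n)" using part_fun_inj by (intro inj_onI)
  show "part_fun ` partitions n = shapes_of n"
  proof
    show "part_fun ` partitions n \<subseteq> shapes_of n" using part_fun_shapes by blast
    show "shapes_of n \<subseteq> part_fun ` partitions n"
    proof
      fix l assume "l \<in> shapes_of n"
      then obtain la where "la \<in> partitions n" "part_fun la = l" by (rule shape_is_part_fun)
      then show "l \<in> part_fun ` partitions n" by blast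
    qed
  qed
qed

lemma finite_partitions [simp]: "finite (partitions n)"
  using bij_betw_finite[OF bij_part_fun] by simp

lemma part_fun_transpose:
  assumes "la \<in> partitions n"
  shows "part_fun (transpose_partition la) = conj_shape (part_fun la)"
proof (cases la)
  case Nil
  then show ?thesis by (auto simp: transpose_partition_def part_fun_def conj_shape_def)
next
  case (Cons a xs)
  show ?thesis
  proof
    fix j
    have c: "conj_shape (part_fun la) j = length (filter (\<lambda>x. j < x) la)"
      unfolding conj_shape_def length_filter_conv_card
      by (rule arg_cong[of _ _ card]) (auto simp: part_fun_def)
    show "part_fun (transpose_partition la) j = conj_shape (part_fun la) j"
    proof (cases "j < a")
      case True
      then show ?thesis unfolding c using Cons by (simp add: part_fun_def transpose_partition_def del: filter.simps)
    next
      case False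
      then have "filter (\<lambda>x. j < x) la = []"
        using assms Cons by (auto simp: partitions_def filter_empty_conv)
      then show ?thesis unfolding c using False Cons by (simp add: part_fun_def transpose_partition_def)
    qed
  qed
qed

lemma transpose_partition [simp]:
  assumes "la \<in> partitions n"
  shows "transpose_partition la \<in> partitions n"
proof -
  have "conj_shape (part_fun la) \<in> shapes_of n"
    using part_fun_shapes[OF assms] by (simp add: shapes_of_def)
  then have s: "sum_list (transpose_partition la) = n"
    using card_cells_part_fun[of "transpose_partition la"] part_fun_transpose[OF assms]
    by (simp add: shapes_of_def)
  have sh: "part_fun (transpose_partition la) \<in> shapes"
    using part_fun_transpose[OF assms] assms by simp
  have "sorted_wrt (\<ge>) (transpose_partition la)"
    unfolding sorted_wrt_iff_nth_less
  proof (intro allI impI)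
    fix i j assume "i < j" "j < length (transpose_partition la)"
    then show "transpose_partition la ! j \<le> transpose_partition la ! i"
      using shapes_antimono[OF sh, of i j] by (simp add: part_fun_def)
  qed
  moreover have "\<forall>x\<in>set (transpose_partition la). 0 < x"
  proof (cases la)
    case (Cons a xs)
    then show ?thesis by (auto simp: transpose_partition_def)
  qed (simp add: transpose_partition_def)
  ultimately show ?thesis using s by (simp add: partitions_def)
qed

lemma transpose_transpose [simp]:
  assumes "la \<in> partitions n"
  shows "transpose_partition (transpose_partition la) = la"
  by (rule part_fun_inj[OF _ assms, of _ n])
     (use assms in \<open>simp_all add: part_fun_transpose[of _ n]\<close>)

lemma sum_partitions_transpose:
  "(\<Sum>la\<in>partitions n. f (transpose_partition la)) = (\<Sum>la\<in>partitions n. f la)"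
  by (rule sum.reindex_bij_witness[where i = transpose_partition and j = transpose_partition]) auto

definition dominated :: "nat list \<Rightarrow> nat list \<Rightarrow> bool" where
  "dominated la mu \<longleftrightarrow> (\<forall>j. (\<Sum>i<j. part_fun la i) \<le> (\<Sum>i<j. part_fun mu i))"

lemma dominated_refl [simp]: "dominated la la"
  by (simp add: dominated_def)

lemma dominated_trans: "dominated la mu \<Longrightarrow> dominated mu nu \<Longrightarrow> dominated la nu"
  unfolding dominated_def by (meson order_trans)

lemma dominated_antisym:
  assumes "la \<in> partitions n" "mu \<in> partitions m" "dominated la mu" "dominated mu la"
  shows "la = mu"
proof (rule part_fun_inj[OF assms(1,2)], rule ext)
  fix j
  have "(\<Sum>i<j. part_fun la i) = (\<Sum>i<j. part_fun mu i)" for j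
    using assms(3,4) by (auto simp: dominated_def intro: antisym)
  from this[of "Suc j"] this[of j] show "part_fun la j = part_fun mu j" by simp
qed

lemma sum_part_fun_ge:
  assumes "la \<in> partitions n" "length la \<le> k"
  shows "(\<Sum>i<k. part_fun la i) = n"
proof -
  have "card (cells (part_fun la)) = (\<Sum>i<k. part_fun la i)"
    by (rule card_cells) (use assms in \<open>auto simp: part_fun_def\<close>)
  then show ?thesis using card_cells_part_fun[of la] assms(1) by (simp add: partitions_def)
qed

lemma sum_part_fun_le:
  assumes "la \<in> partitions n"
  shows "(\<Sum>i<k. part_fun la i) \<le> n"
proof -
  have "(\<Sum>i<k. part_fun la i) \<le> (\<Sum>i<max k (length la). part_fun la i)"
    by (rule sum_mono2) auto
  also have "\<dots> = n" by (rule sum_part_fun_ge[OF assms]) simp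
  finally show ?thesis .
qed

text \<open>The sum of the first \<open>k\<close> parts of the transpose is \<open>\<Sum> min (la i) k\<close>, and \<open>\<Sum> (la i - k)\<close>
  is the maximum over \<open>j\<close> of \<open>la 0 + \<dots> + la (j - 1) - j k\<close>.\<close>

lemma sum_conj_shape:
  assumes "l \<in> shapes" "\<And>i. i \<ge> N \<Longrightarrow> l i = 0"
  shows "(\<Sum>j<k. conj_shape l j) = (\<Sum>i<N. min (l i) k)"
proof -
  have c: "conj_shape l j = (\<Sum>i<N. if j < l i then 1 else 0)" for j
  proof -
    have "i < N" if "j < l i" for i using that assms(2)[of i] by (cases "i < N") auto
    then have "{i. j < l i} = {i \<in> {..<N}. j < l i}" by auto
    then have "conj_shape l j = card {i \<in> {..<N}. j < l i}" by (simp add: conj_shape_def)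
    also have "\<dots> = (\<Sum>i\<in>{i \<in> {..<N}. j < l i}. 1)" by simp
    also have "\<dots> = (\<Sum>i<N. if j < l i then 1 else 0)" by (rule sum.inter_filter) simp
    finally show ?thesis .
  qed
  have "(\<Sum>j<k. if j < m then 1 else 0) = min m k" for m :: nat
  proof -
    have "(\<Sum>j<k. if j < m then 1 else 0) = card {j \<in> {..<k}. j < m}"
      by (subst sum.inter_filter[symmetric]) auto
    also have "{j \<in> {..<k}. j < m} = {..<min m k}" by auto
    finally show ?thesis by simp
  qed
  then show ?thesis unfolding c by (subst sum.swap) simp
qed

lemma dominated_transpose:
  assumes la: "la \<in> partitions n" and mu: "mu \<in> partitions n" and d: "dominated la mu"
  shows "dominated (transpose_partition mu) (transpose_partition la)"
  unfolding dominated_def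
proof
  fix k
  define N where "N = max (length la) (length mu)"
  let ?l = "part_fun la" and ?m = "part_fun mu"
  have z: "?l i = 0" "?m i = 0" if "i \<ge> N" for i using that by (auto simp: part_fun_def N_def)
  \<comment> \<open>The number of rows of \<open>la\<close> that are longer than k, where the
    maximum for \<open>la\<close> is attained. For \<open>mu\<close> the same j gives an upper
    bound, which is the direction that the claim asks for.\<close>
  define j where "j = conj_shape ?l k"
  have j: "i < j \<longleftrightarrow> k < ?l i" for i unfolding j_def by (rule less_conj_shape_iff) (use la in simp)
  have jN: "j \<le> N" using j[of N] z(1)[of N] by simp
  have split: "(\<Sum>i<N. f i) = (\<Sum>i<j. f i) + (\<Sum>i\<in>{j..<N}. f i)" for f :: "nat \<Rightarrow> nat"
    using sum.union_disjoint[of "{..<j}" "{j..<N}" f] jN by (simp add: ivl_disj_un_one(2) ivl_disj_int_one(2))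
  have "(\<Sum>i<N. min (?l i) k) = j * k + (\<Sum>i\<in>{j..<N}. ?l i)"
  proof -
    have "(\<Sum>i<j. min (?l i) k) = (\<Sum>i<j. k)" by (rule sum.cong) (use j in auto)
    moreover have "(\<Sum>i\<in>{j..<N}. min (?l i) k) = (\<Sum>i\<in>{j..<N}. ?l i)"
    proof (rule sum.cong)
      fix i assume "i \<in> {j..<N}"
      then have "\<not> k < ?l i" using j[of i] by simp
      then show "min (?l i) k = ?l i" by simp
    qed simp
    ultimately show ?thesis by (simp add: split)
  qed
  moreover have "(\<Sum>i<N. min (?m i) k) \<le> j * k + (\<Sum>i\<in>{j..<N}. ?m i)"
  proof -
    have "(\<Sum>i<j. min (?m i) k) \<le> (\<Sum>i<j. k)" by (rule sum_mono) auto
    moreover have "(\<Sum>i\<in>{j..<N}. min (?m i) k) \<le> (\<Sum>i\<in>{j..<N}. ?m i)" by (rule sum_mono) auto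
    ultimately show ?thesis by (simp add: split)
  qed
  moreover have "(\<Sum>i<j. ?l i) \<le> (\<Sum>i<j. ?m i)" using d by (simp add: dominated_def)
  moreover have "(\<Sum>i<N. ?l i) = n" "(\<Sum>i<N. ?m i) = n"
    by (rule sum_part_fun_ge[OF la] sum_part_fun_ge[OF mu], simp add: N_def)+
  ultimately have "(\<Sum>i<N. min (?m i) k) \<le> (\<Sum>i<N. min (?l i) k)"
    using split[of ?l] split[of ?m] by linarith
  then show "(\<Sum>i<k. part_fun (transpose_partition mu) i) \<le> (\<Sum>i<k. part_fun (transpose_partition la) i)"
    using sum_conj_shape[of ?l N k] sum_conj_shape[of ?m N k] z la mu
    by (simp add: part_fun_transpose[of _ n])
qed

section \<open>The Kostka matrix, shape first and content second, and its inverse\<close>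

definition kostka :: "nat list \<Rightarrow> nat list \<Rightarrow> int" where
  "kostka mu la = int (kchain (length la) (part_fun la) (part_fun mu))"

lemma coeff_schur_part:
  assumes "mu \<in> partitions n"
  shows "coeff_ms (sym_s mu) (part_mon la) = (of_int (kostka mu la) :: 'a::comm_ring_1)"
  unfolding sym_s_eq_schur using coeff_schur[of "part_fun mu" "length la" "part_mon la"] assms
  by (simp add: kostka_def part_fun_beyond)

lemma sum_shapes_of: "(\<Sum>l\<in>shapes_of n. f l) = (\<Sum>la\<in>partitions n. f (part_fun la))"
  by (rule sum.reindex_bij_betw[OF bij_part_fun, symmetric])

lemma smult_of_nat: "smult_ms (of_nat k) f = of_nat k * f"
  by (induction k) (auto simp: smult_add_left algebra_simps)

lemma sym_h_schur:
  assumes la: "la \<in> partitions n"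
  shows "sym_h la = (\<Sum>mu\<in>partitions n. smult_ms (of_int (kostka mu la)) (sym_s mu) :: 'a::comm_ring_1 mseries)"
proof -
  have "sym_h la = (\<Prod>i<length la. complete_sym (part_fun la i) :: 'a mseries)"
    unfolding sym_h_def prod.list_conv_set_nth by (simp add: part_fun_def atLeast0LessThan)
  also have "\<dots> = (\<Sum>mu\<in>partitions n. smult_ms (of_int (kostka mu la)) (sym_s mu))"
    using la unfolding prod_complete_schur sum_part_fun
    by (simp add: sum_shapes_of partitions_def smult_of_nat kostka_def sym_s_eq_schur)
  finally show ?thesis .
qed

lemma sym_e_schur:
  assumes la: "la \<in> partitions n"
  shows "sym_e la = (\<Sum>mu\<in>partitions n. smult_ms (of_int (kostka (transpose_partition mu) la)) (sym_s mu) :: 'a::comm_ring_1 mseries)"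
proof -
  have "sym_e la = (\<Prod>i<length la. elem_sym (part_fun la i) :: 'a mseries)"
    unfolding sym_e_def prod.list_conv_set_nth by (simp add: part_fun_def atLeast0LessThan)
  also have "\<dots> = (\<Sum>mu\<in>partitions n. of_nat (kchain (length la) (part_fun la) (conj_shape (part_fun mu))) * schur (part_fun mu))"
    using la unfolding prod_elem_schur sum_part_fun by (simp add: sum_shapes_of partitions_def)
  also have "\<dots> = (\<Sum>mu\<in>partitions n. smult_ms (of_int (kostka (transpose_partition mu) la)) (sym_s mu))"
    by (rule sum.cong) (auto simp: smult_of_nat kostka_def sym_s_eq_schur part_fun_transpose)
  finally show ?thesis .
qed

lemma kostka_nonzero:
  assumes "mu \<in> partitions n" "la \<in> partitions n" "kostka mu la \<noteq> 0"
  shows "dominated la mu"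
  unfolding dominated_def
proof
  fix j
  have k: "\<forall>i\<ge>length la. part_fun mu i = 0"
    "\<forall>j\<le>length la. (\<Sum>i<j. part_fun la i) \<le> (\<Sum>i<j. part_fun mu i)"
    using kchain_nonzero[of "length la" "part_fun la" "part_fun mu"] assms by (auto simp: kostka_def)
  show "(\<Sum>i<j. part_fun la i) \<le> (\<Sum>i<j. part_fun mu i)"
  proof (cases "j \<le> length la")
    case False
    have "card (cells (part_fun mu)) = (\<Sum>i<j. part_fun mu i)"
      by (rule card_cells) (use k False in auto)
    then have "(\<Sum>i<j. part_fun mu i) = n"
      using card_cells_part_fun[of mu] assms(1) by (simp add: partitions_def)
    then show ?thesis using sum_part_fun_le[OF assms(2)] by simp
  qed (use k in simp)
qed

lemma kostka_diag: "la \<in> partitions n \<Longrightarrow> kostka la la = 1"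
  unfolding kostka_def by (subst kchain_diag) (auto simp: part_fun_beyond)

text \<open>Triangularity is measured by a rank instead of a linear order of the indices, because
  dominance is only a partial order.\<close>

definition unitriangular :: "'i set \<Rightarrow> ('i \<Rightarrow> nat) \<Rightarrow> ('i \<Rightarrow> 'i \<Rightarrow> 'b::comm_ring_1) \<Rightarrow> bool" where
  "unitriangular I r K \<longleftrightarrow> (\<forall>i\<in>I. K i i = 1 \<and> (\<forall>j\<in>I. j \<noteq> i \<longrightarrow> K i j \<noteq> 0 \<longrightarrow> r j < r i))"

text \<open>Row i of the inverse is the unit row minus a combination of the rows of smaller rank,
  with the off-diagonal entries of row i of K as coefficients. The witness \<open>?l\<close> is this
  recursion.\<close>

lemma unitriangular_left_inverse:
  assumes I: "finite I" and K: "unitriangular I r K"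
  shows "\<exists>L. unitriangular I r L \<and> (\<forall>i\<in>I. \<forall>k\<in>I. (\<Sum>j\<in>I. L i j * K j k) = (if i = k then 1 else 0))"
proof -
  define P where "P i l \<longleftrightarrow> l i = 1 \<and> (\<forall>j. l j \<noteq> 0 \<longrightarrow> j = i \<or> r j < r i) \<and>
    (\<forall>k\<in>I. (\<Sum>j\<in>I. l j * K j k) = (if i = k then 1 else 0))" for i l
  have "\<exists>l. P i l" if "i \<in> I" for i
    using that
  proof (induction "r i" arbitrary: i rule: less_induct)
    case less
    let ?J = "{m \<in> I. r m < r i}"
    have "\<forall>m\<in>?J. \<exists>l. P m l" using less.hyps by blast
    from bchoice[OF this] obtain l where l: "\<And>m. m \<in> ?J \<Longrightarrow> P m (l m)" by blast
    let ?l = "\<lambda>j. (if j = i then 1 else 0) - (\<Sum>m\<in>?J. K i m * l m j)"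
    have ls: "j = m \<or> r j < r m" if "m \<in> ?J" "l m j \<noteq> 0" for m j using l[OF that(1)] that(2) by (simp add: P_def)
    have "(\<Sum>m\<in>?J. K i m * l m j) = 0" if "j = i \<or> \<not> r j < r i" for j
    proof (rule sum.neutral, rule ballI)
      fix m assume m: "m \<in> ?J"
      show "K i m * l m j = 0" by (cases "l m j = 0") (use ls[OF m, of j] m that in auto)
    qed
    then have "?l i = 1" "\<forall>j. ?l j \<noteq> 0 \<longrightarrow> j = i \<or> r j < r i" by auto
    moreover have "(\<Sum>j\<in>I. ?l j * K j k) = (if i = k then 1 else 0)" if k: "k \<in> I" for k
    proof -
      have "(\<Sum>j\<in>I. ?l j * K j k) = (\<Sum>j\<in>I. if j = i then K j k else 0) - (\<Sum>j\<in>I. (\<Sum>m\<in>?J. K i m * l m j) * K j k)"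
        unfolding sum_subtractf[symmetric] by (rule sum.cong) (auto simp: left_diff_distrib)
      also have "(\<Sum>j\<in>I. (\<Sum>m\<in>?J. K i m * l m j) * K j k) = (\<Sum>m\<in>?J. K i m * (\<Sum>j\<in>I. l m j * K j k))"
        unfolding sum_distrib_left sum_distrib_right mult.assoc by (rule sum.swap)
      also have "\<dots> = (\<Sum>m\<in>?J. if m = k then K i m else 0)"
        by (rule sum.cong) (use l k in \<open>auto simp: P_def\<close>)
      also have "\<dots> = (if k \<in> ?J then K i k else 0)" using I by simp
      finally show ?thesis using K less.prems k I unfolding unitriangular_def by auto
    qed
    ultimately have "P i ?l" unfolding P_def by blast
    then show ?case by (rule exI[of "P i"])
  qed
  then obtain L where "\<forall>i\<in>I. P i (L i)" using bchoice[of I P] by blast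
  then show ?thesis by (intro exI[of _ L]) (auto simp: P_def unitriangular_def)
qed

text \<open>The left inverse L is unitriangular again and so has a left inverse M of its own. From M
  = M (L K) = (M L) K = K it follows that L is also a right inverse of K.\<close>

lemma unitriangular_inverse:
  assumes I: "finite I" and K: "unitriangular I r K"
  shows "\<exists>L. (\<forall>i\<in>I. \<forall>k\<in>I. (\<Sum>j\<in>I. L i j * K j k) = (if i = k then 1 else 0)) \<and>
    (\<forall>i\<in>I. \<forall>k\<in>I. (\<Sum>j\<in>I. K i j * L j k) = (if i = k then 1 else 0))"
proof -
  obtain L where L: "unitriangular I r L" "\<forall>i\<in>I. \<forall>k\<in>I. (\<Sum>j\<in>I. L i j * K j k) = (if i = k then 1 else 0)"
    using unitriangular_left_inverse[OF I K] by blast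
  obtain M where M: "\<forall>i\<in>I. \<forall>k\<in>I. (\<Sum>j\<in>I. M i j * L j k) = (if i = k then 1 else 0)"
    using unitriangular_left_inverse[OF I L(1)] by blast
  have "M i k = K i k" if ik: "i \<in> I" "k \<in> I" for i k
  proof -
    have "M i k = (\<Sum>m\<in>I. M i m * (\<Sum>j\<in>I. L m j * K j k))"
      using I ik L(2) by (simp add: if_distrib[of "\<lambda>x. _ * x"] cong: if_cong)
    also have "\<dots> = (\<Sum>j\<in>I. (\<Sum>m\<in>I. M i m * L m j) * K j k)"
      unfolding sum_distrib_left sum_distrib_right mult.assoc by (rule sum.swap)
    also have "\<dots> = K i k" using I ik M by (simp add: if_distrib[of "\<lambda>x. x * _"] cong: if_cong)
    finally show ?thesis .
  qed
  then have "(\<Sum>j\<in>I. K i j * L j k) = (\<Sum>j\<in>I. M i j * L j k)" if "i \<in> I" for i k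
    using that by (intro sum.cong) simp_all
  then show ?thesis using L(2) M by (intro exI[of _ L] conjI ballI) simp_all
qed

text \<open>The number of dominating partitions drops strictly on the way up. It yields the rank for
  the Kostka matrix and is the measure for inductions along the dominance order.\<close>

lemma dominated_rank:
  assumes "la \<in> partitions n" "mu \<in> partitions n" "dominated la mu" "la \<noteq> mu"
  shows "card {ka \<in> partitions n. dominated mu ka} < card {ka \<in> partitions n. dominated la ka}"
proof (rule psubset_card_mono)
  have "la \<notin> {ka \<in> partitions n. dominated mu ka}" "la \<in> {ka \<in> partitions n. dominated la ka}"
    using dominated_antisym[OF assms(1,2,3)] assms(1,4) by auto
  moreover have "{ka \<in> partitions n. dominated mu ka} \<subseteq> {ka \<in> partitions n. dominated la ka}"
    using dominated_trans[OF assms(3)] by blast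
  ultimately show "{ka \<in> partitions n. dominated mu ka} \<subset> {ka \<in> partitions n. dominated la ka}" by blast
qed simp

lemma kostka_inverse:
  "\<exists>L. (\<forall>la\<in>partitions n. \<forall>nu\<in>partitions n. (\<Sum>mu\<in>partitions n. L la mu * kostka mu nu) = (if la = nu then 1 else 0)) \<and>
    (\<forall>la\<in>partitions n. \<forall>nu\<in>partitions n. (\<Sum>mu\<in>partitions n. kostka la mu * L mu nu) = (if la = nu then 1 else 0))"
proof (rule unitriangular_inverse[OF finite_partitions])
  let ?c = "\<lambda>la. card {ka \<in> partitions n. dominated la ka}"
  have "?c la \<le> card (partitions n)" for la by (rule card_mono) auto
  then have "card (partitions n) - ?c mu < card (partitions n) - ?c la"
    if "la \<in> partitions n" "mu \<in> partitions n" "mu \<noteq> la" "kostka la mu \<noteq> 0" for la mu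
    using dominated_rank[OF that(2,1) kostka_nonzero[OF that(1,2,4)] that(3)] by (meson diff_less_mono2 le_less_trans less_le_trans)
  then show "unitriangular (partitions n) (\<lambda>la. card (partitions n) - ?c la) kostka"
    by (simp add: unitriangular_def kostka_diag)
qed

section \<open>Symmetric functions and the involution \<open>\<omega>\<close>\<close>

text \<open>A complete invariant of monomials under permutations of the variables, by
  \<open>exps_eq_obtain_bij\<close> and \<open>exps_bij\<close>.\<close>

definition exps :: "(nat \<Rightarrow>\<^sub>0 nat) \<Rightarrow> nat multiset" where
  "exps al = image_mset (Poly_Mapping.lookup al) (mset_set (Poly_Mapping.keys al))"

lemma coeff_sym_m: "coeff_ms (sym_m la) al = (if exps al = mset la then 1 else 0)"
  by (simp add: sym_m_def exps_def)

lemma sum_mset_exps: "sum_mset (exps al) = monom_degree al"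
  by (simp add: exps_def monom_degree_def sum_unfold_sum_mset)

lemma exps_partition:
  obtains la where "la \<in> partitions (monom_degree al)" "exps al = mset la"
proof
  let ?la = "rev (sorted_list_of_multiset (exps al))"
  show m: "exps al = mset ?la" by simp
  have "sum_list ?la = monom_degree al"
    using sum_mset_exps[of al] by (metis m sum_mset_sum_list)
  moreover have "\<forall>x\<in>set ?la. 0 < x" by (auto simp: exps_def in_keys_iff)
  ultimately show "?la \<in> partitions (monom_degree al)"
    by (simp add: partitions_def sorted_wrt_rev)
qed

lemma partitions_mset_eq:
  assumes "la \<in> partitions n" "mu \<in> partitions m" "mset la = mset mu"
  shows "la = mu"
proof -
  have "sorted (rev la)" "sorted (rev mu)" using assms by (auto simp: partitions_def sorted_wrt_rev)
  then have "rev la = rev mu" using assms(3) by (metis mset_rev properties_for_sort)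
  then show ?thesis by simp
qed

lemma exps_part_mon [simp]:
  assumes "la \<in> partitions n"
  shows "exps (part_mon la) = mset la"
proof -
  have k: "Poly_Mapping.keys (part_mon la) = {..<length la}"
    using assms nth_mem[of _ la] by (auto simp: in_keys_iff part_fun_def partitions_def split: if_splits)
  have "exps (part_mon la) = image_mset (\<lambda>i. la ! i) (mset_set {..<length la})"
    unfolding exps_def k lookup_part_mon by (rule image_mset_cong) (simp add: part_fun_def)
  also have "\<dots> = mset (map (\<lambda>i. la ! i) [0..<length la])"
    by (simp only: mset_map mset_upt atLeast0LessThan)
  finally show ?thesis by (simp add: map_nth)
qed

lemma monom_degree_part_mon [simp]: "la \<in> partitions n \<Longrightarrow> monom_degree (part_mon la) = n"
  using sum_mset_exps[of "part_mon la"] by (simp add: partitions_def sum_mset_sum_list)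

text \<open>The parts of B outside A and of A outside B have equal size, so the bijection closes up
  to a permutation of the union.\<close>

lemma permutes_extending:
  assumes "finite A" "finite B" "bij_betw f A B"
  obtains p where "p permutes (A \<union> B)" "\<And>x. x \<in> A \<Longrightarrow> p x = f x"
proof -
  have "card (B - A) = card (A - B)"
    using assms card_Diff_subset_Int[of B A] card_Diff_subset_Int[of A B] bij_betw_same_card[OF assms(3)]
    by (simp add: Int_commute)
  then obtain g where g: "bij_betw g (B - A) (A - B)"
    using assms by (metis finite_same_card_bij finite_Diff)
  let ?p = "\<lambda>x. if x \<in> A then f x else if x \<in> B then g x else x"
  have "bij_betw ?p (A \<union> (B - A)) (B \<union> (A - B))"
  proof (rule bij_betw_combine)
    show "bij_betw ?p A B" using assms(3) by (simp cong: bij_betw_cong)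
    have "bij_betw ?p (B - A) (A - B) = bij_betw g (B - A) (A - B)" by (rule bij_betw_cong) simp
    then show "bij_betw ?p (B - A) (A - B)" using g by simp
  qed auto
  then have "bij_betw ?p (A \<union> B) (A \<union> B)" by (simp add: Un_commute)
  then have "?p permutes (A \<union> B)" by (rule bij_imp_permutes) auto
  then show thesis by (rule that) simp
qed

text \<open>For each value the sets of variables with that exponent have equal size in both
  monomials. Bijections between these sets are glued to one between the supports, which then extends
  to all variables.\<close>

lemma exps_eq_obtain_bij:
  assumes "exps al = exps be"
  obtains \<sigma> where "bij \<sigma>" "Poly_Mapping.lookup be = Poly_Mapping.lookup al \<circ> \<sigma>"
proof -
  let ?l = "Poly_Mapping.lookup"
  have "\<exists>f. bij_betw f (Poly_Mapping.keys be) (Poly_Mapping.keys al) \<and> (\<forall>x\<in>Poly_Mapping.keys be. ?l be x = ?l al (f x))"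
  proof -
    let ?A = "\<lambda>v. {x \<in> Poly_Mapping.keys be. ?l be x = v}" and ?B = "\<lambda>v. {x \<in> Poly_Mapping.keys al. ?l al x = v}"
    have cnt: "count (exps ga) v = card {x \<in> Poly_Mapping.keys ga. ?l ga x = v}" for ga v
      unfolding exps_def by (simp add: count_image_mset' eq_commute[of v])
    have "card (?A v) = card (?B v)" for v
      using assms cnt by metis
    then have "\<forall>v. \<exists>g. bij_betw g (?A v) (?B v)"
      by (auto intro!: finite_same_card_bij)
    then obtain g where g: "\<And>v. bij_betw (g v) (?A v) (?B v)" by metis
    have m: "g (?l be x) x \<in> Poly_Mapping.keys al" "?l al (g (?l be x) x) = ?l be x" if "x \<in> Poly_Mapping.keys be" for x
      using bij_betwE[OF g[of "?l be x"]] that by auto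
    have inj: "x = y" if "x \<in> Poly_Mapping.keys be" "y \<in> Poly_Mapping.keys be" "g (?l be x) x = g (?l be y) y" for x y
    proof -
      have v: "?l be x = ?l be y" using m that by metis
      then show ?thesis using bij_betw_imp_inj_on[OF g[of "?l be x"]] that by (auto simp: inj_on_def)
    qed
    have surj: "\<exists>x\<in>Poly_Mapping.keys be. g (?l be x) x = y" if "y \<in> Poly_Mapping.keys al" for y
    proof -
      have "y \<in> ?B (?l al y)" using that by simp
      then obtain x where x: "x \<in> ?A (?l al y)" "y = g (?l al y) x"
        unfolding bij_betw_imp_surj_on[OF g[of "?l al y"], symmetric] by (rule imageE)
      then show ?thesis by (intro bexI[of _ x]) simp_all
    qed
    have "bij_betw (\<lambda>x. g (?l be x) x) (Poly_Mapping.keys be) (Poly_Mapping.keys al)"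
      unfolding bij_betw_def
    proof
      show "inj_on (\<lambda>x. g (?l be x) x) (Poly_Mapping.keys be)"
      proof (rule inj_onI)
        fix x y assume "x \<in> Poly_Mapping.keys be" "y \<in> Poly_Mapping.keys be" "g (?l be x) x = g (?l be y) y"
        then show "x = y" by (rule inj)
      qed
      show "(\<lambda>x. g (?l be x) x) ` Poly_Mapping.keys be = Poly_Mapping.keys al"
      proof
        show "(\<lambda>x. g (?l be x) x) ` Poly_Mapping.keys be \<subseteq> Poly_Mapping.keys al" by (rule image_subsetI) (rule m(1))
        show "Poly_Mapping.keys al \<subseteq> (\<lambda>x. g (?l be x) x) ` Poly_Mapping.keys be"
        proof
          fix y assume "y \<in> Poly_Mapping.keys al"
          from surj[OF this] obtain x where "x \<in> Poly_Mapping.keys be" "g (?l be x) x = y" ..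
          then show "y \<in> (\<lambda>x. g (?l be x) x) ` Poly_Mapping.keys be"
            by (intro image_eqI[of _ _ x]) simp_all
        qed
      qed
    qed
    with m(2) show ?thesis by (intro exI[of _ "\<lambda>x. g (?l be x) x"]) simp
  qed
  then obtain f where f0: "bij_betw f (Poly_Mapping.keys be) (Poly_Mapping.keys al) \<and>
    (\<forall>x\<in>Poly_Mapping.keys be. ?l be x = ?l al (f x))" ..
  note f = conjunct1[OF f0] conjunct2[OF f0, rule_format]
  obtain p where p: "p permutes (Poly_Mapping.keys be \<union> Poly_Mapping.keys al)"
    "\<And>x. x \<in> Poly_Mapping.keys be \<Longrightarrow> p x = f x"
    using permutes_extending[OF _ _ f(1)] by auto
  show thesis
  proof (rule that[of p])
    show "bij p" using p(1) by (rule permutes_bij)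
    show "?l be = ?l al \<circ> p"
    proof
      fix x show "?l be x = (?l al \<circ> p) x"
      proof (cases "x \<in> Poly_Mapping.keys be")
        case False
        have "p x \<notin> Poly_Mapping.keys al"
        proof
          assume "p x \<in> Poly_Mapping.keys al"
          then obtain y where y: "y \<in> Poly_Mapping.keys be" "f y = p x"
            using bij_betw_imp_surj_on[OF f(1)] by (metis imageE)
          then have "p y = p x" using p(2) by simp
          then have "y = x" using permutes_inj[OF p(1)] by (simp add: inj_eq)
          with y False show False by simp
        qed
        with False show ?thesis by (simp add: in_keys_iff)
      qed (use f p in simp)
    qed
  qed
qed

lemma exps_bij:
  assumes "bij \<sigma>" "Poly_Mapping.lookup be = Poly_Mapping.lookup al \<circ> \<sigma>"
  shows "exps be = exps al"
proof -
  have k: "Poly_Mapping.keys al = \<sigma> ` Poly_Mapping.keys be"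
  proof
    show "Poly_Mapping.keys al \<subseteq> \<sigma> ` Poly_Mapping.keys be"
    proof
      fix x assume x: "x \<in> Poly_Mapping.keys al"
      obtain y where "x = \<sigma> y" using bij_is_surj[OF assms(1)] by (rule surjE)
      with x show "x \<in> \<sigma> ` Poly_Mapping.keys be" by (simp add: in_keys_iff assms(2))
    qed
  qed (auto simp: in_keys_iff assms(2))
  have inj: "inj_on \<sigma> X" for X using bij_is_inj[OF assms(1)] by (rule inj_on_subset) simp
  have "exps al = image_mset (Poly_Mapping.lookup al) (image_mset \<sigma> (mset_set (Poly_Mapping.keys be)))"
    unfolding exps_def k image_mset_mset_set[OF inj] ..
  also have "\<dots> = exps be" unfolding exps_def assms(2) by (simp add: image_mset.compositionality)
  finally show ?thesis ..
qed

lemma sym_functions_bounded: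
  "f \<in> sym_functions \<Longrightarrow> \<exists>d. \<forall>al. coeff_ms f al \<noteq> 0 \<longrightarrow> monom_degree al \<le> d"
  by (simp add: sym_functions_def)

lemma sym_functions_coeff:
  assumes "f \<in> sym_functions" "exps al = exps be"
  shows "coeff_ms f al = coeff_ms f be"
proof -
  obtain \<sigma> where "bij \<sigma>" "Poly_Mapping.lookup be = Poly_Mapping.lookup al \<circ> \<sigma>"
    using exps_eq_obtain_bij[OF assms(2)] .
  then show ?thesis using assms(1) unfolding sym_functions_def by simp
qed

lemma sym_functionsI:
  assumes "\<And>al be. exps al = exps be \<Longrightarrow> coeff_ms f al = coeff_ms f be"
    and "\<And>al. coeff_ms f al \<noteq> 0 \<Longrightarrow> monom_degree al \<le> d"
  shows "f \<in> sym_functions"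
  unfolding sym_functions_def
proof (intro CollectI conjI allI impI)
  fix \<sigma> :: "nat \<Rightarrow> nat" and al be :: "nat \<Rightarrow>\<^sub>0 nat"
  assume "bij \<sigma> \<and> Poly_Mapping.lookup be = Poly_Mapping.lookup al \<circ> \<sigma>"
  then have "exps be = exps al" by (intro exps_bij[of \<sigma>]) simp_all
  then show "coeff_ms f be = coeff_ms f al" by (rule assms(1))
next
  show "\<exists>d. \<forall>al. coeff_ms f al \<noteq> 0 \<longrightarrow> monom_degree al \<le> d"
    by (intro exI[of _ d] allI impI assms(2))
qed

lemma sym_functions_add: "f \<in> sym_functions \<Longrightarrow> g \<in> sym_functions \<Longrightarrow> f + g \<in> sym_functions"
proof -
  assume f: "f \<in> sym_functions" and g: "g \<in> sym_functions"
  obtain d where "\<forall>al. coeff_ms f al \<noteq> 0 \<longrightarrow> monom_degree al \<le> d" using sym_functions_bounded[OF f] ..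
  note d = this[rule_format]
  obtain e where "\<forall>al. coeff_ms g al \<noteq> 0 \<longrightarrow> monom_degree al \<le> e" using sym_functions_bounded[OF g] ..
  note e = this[rule_format]
  have "monom_degree al \<le> max d e" if "coeff_ms (f + g) al \<noteq> 0" for al
    using that d[of al] e[of al] by (cases "coeff_ms f al = 0") auto
  moreover have "coeff_ms (f + g) al = coeff_ms (f + g) be" if e: "exps al = exps be" for al be
    unfolding coeff_add sym_functions_coeff[OF f e] sym_functions_coeff[OF g e] ..
  ultimately show ?thesis by (rule sym_functionsI[rotated])
qed

lemma sym_functions_smult:
  assumes f: "f \<in> sym_functions"
  shows "smult_ms c f \<in> sym_functions"
proof -
  obtain d where "\<forall>al. coeff_ms f al \<noteq> 0 \<longrightarrow> monom_degree al \<le> d" using sym_functions_bounded[OF f] ..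
  note d = this[rule_format]
  show ?thesis
  proof (rule sym_functionsI)
    show "monom_degree al \<le> d" if "coeff_ms (smult_ms c f) al \<noteq> 0" for al
      using that d[of al] by (cases "coeff_ms f al = 0") simp_all
    show "coeff_ms (smult_ms c f) al = coeff_ms (smult_ms c f) be" if e: "exps al = exps be" for al be
      unfolding coeff_smult sym_functions_coeff[OF f e] ..
  qed
qed

lemma sym_functions_zero: "0 \<in> sym_functions"
  by (rule sym_functionsI[of _ 0]) simp_all

lemma sym_functions_sum: "(\<And>x. x \<in> A \<Longrightarrow> f x \<in> sym_functions) \<Longrightarrow> sum f A \<in> sym_functions"
  by (induction A rule: infinite_finite_induct) (auto simp: sym_functions_add sym_functions_zero)

lemma sym_functions_mult:
  assumes f: "f \<in> sym_functions" and g: "g \<in> sym_functions"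
  shows "f * g \<in> (sym_functions :: 'a::comm_ring_1 mseries set)"
proof -
  let ?l = "Poly_Mapping.lookup"
  obtain d where "\<forall>al. coeff_ms f al \<noteq> 0 \<longrightarrow> monom_degree al \<le> d" using sym_functions_bounded[OF f] ..
  note d = this[rule_format]
  obtain e where "\<forall>al. coeff_ms g al \<noteq> 0 \<longrightarrow> monom_degree al \<le> e" using sym_functions_bounded[OF g] ..
  note e = this[rule_format]
  have "monom_degree al \<le> d + e" if nz: "coeff_ms (f * g) al \<noteq> 0" for al
  proof -
    obtain x where x: "x \<in> splits al" "coeff_ms f (fst x) * coeff_ms g (snd x) \<noteq> 0"
      using nz unfolding coeff_mult case_prod_beta by (meson sum.not_neutral_contains_not_neutral)
    then have nz: "coeff_ms f (fst x) \<noteq> 0" "coeff_ms g (snd x) \<noteq> 0" by auto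
    have "monom_degree (fst x) \<le> d" by (rule d[OF nz(1)])
    moreover have "monom_degree (snd x) \<le> e" by (rule e[OF nz(2)])
    moreover note x
    ultimately
    show ?thesis by (auto simp: splits_def monom_degree_add)
  qed
  moreover have "coeff_ms (f * g) be = coeff_ms (f * g) al"
    if \<sigma>: "bij \<sigma>" "?l be = ?l al \<circ> \<sigma>" for \<sigma> al be
  proof -
    define \<tau> where "\<tau> = inv_into UNIV \<sigma>"
    have inj: "inj \<sigma>" "inj \<tau>" using \<sigma>(1) unfolding \<tau>_def by (auto simp: bij_is_inj bij_imp_bij_inv)
    have lk: "?l (Poly_Mapping.map_key \<sigma> ga) = ?l ga \<circ> \<sigma>" "?l (Poly_Mapping.map_key \<tau> ga) = ?l ga \<circ> \<tau>" for ga :: "nat \<Rightarrow>\<^sub>0 nat"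
      using map_key.rep_eq[OF inj(1)] map_key.rep_eq[OF inj(2)] by (auto simp: o_def)
    have iv: "\<sigma> (\<tau> x) = x" "\<tau> (\<sigma> x) = x" for x
      using \<sigma>(1) unfolding \<tau>_def by (auto simp: bij_is_surj surj_f_inv_f bij_is_inj)
    have cf: "coeff_ms f (Poly_Mapping.map_key \<sigma> ga) = coeff_ms f ga" "coeff_ms g (Poly_Mapping.map_key \<sigma> ga) = coeff_ms g ga" for ga
      by (rule sym_functions_coeff[OF f exps_bij[OF \<sigma>(1) lk(1)]] sym_functions_coeff[OF g exps_bij[OF \<sigma>(1) lk(1)]])+
    show ?thesis unfolding coeff_mult
    \<comment> \<open>Renaming the variables maps the factorizations of one monomial to those of the
      other, and both factors keep their coefficients.\<close>
    proof (rule sum.reindex_bij_witness[where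
          i = "\<lambda>(x, y). (Poly_Mapping.map_key \<sigma> x, Poly_Mapping.map_key \<sigma> y)" and
          j = "\<lambda>(x, y). (Poly_Mapping.map_key \<tau> x, Poly_Mapping.map_key \<tau> y)"], goal_cases)
      case (1 x)
      show ?case by (cases x) (auto intro!: poly_mapping_eqI simp: lk iv)
    next
      case (2 x)
      have "\<And>i. ?l al i = ?l be (\<tau> i)" using \<sigma>(2) by (simp add: iv)
      with 2 show ?case by (cases x) (auto intro!: poly_mapping_eqI simp: lk splits_def lookup_add)
    next
      case (3 x)
      show ?case by (cases x) (auto intro!: poly_mapping_eqI simp: lk iv)
    next
      case (4 x)
      then show ?case using \<sigma>(2) by (cases x) (auto intro!: poly_mapping_eqI simp: lk splits_def lookup_add)
    next
      case (5 x)
      have "Poly_Mapping.map_key \<sigma> (Poly_Mapping.map_key \<tau> ga) = ga" for ga :: "nat \<Rightarrow>\<^sub>0 nat"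
        by (rule poly_mapping_eqI) (simp add: lk iv)
      then show ?case using cf(1)[of "Poly_Mapping.map_key \<tau> (fst x)"] cf(2)[of "Poly_Mapping.map_key \<tau> (snd x)"]
        by (cases x) simp
    qed
  qed
  ultimately show ?thesis by (simp only: sym_functions_def mem_Collect_eq) blast
qed

lemma exps_monom_degree: "exps al = exps be \<Longrightarrow> monom_degree al = monom_degree be"
  using sum_mset_exps by metis

lemma complete_sym_functions: "complete_sym k \<in> sym_functions"
  by (rule sym_functionsI[of _ k]) (auto simp: complete_sym_def dest: exps_monom_degree split: if_splits)

lemma elem_le_1_iff: "(\<forall>i. Poly_Mapping.lookup al i \<le> 1) \<longleftrightarrow> (\<forall>x\<in>#exps al. x \<le> (1::nat))"
proof
  assume *: "\<forall>x\<in>#exps al. x \<le> 1"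
  show "\<forall>i. Poly_Mapping.lookup al i \<le> 1"
  proof
    fix i show "Poly_Mapping.lookup al i \<le> 1"
      using * by (cases "i \<in> Poly_Mapping.keys al") (auto simp: exps_def in_keys_iff)
  qed
qed (auto simp: exps_def)

lemma elem_sym_functions: "elem_sym k \<in> sym_functions"
  unfolding elem_sym_def elem_le_1_iff
  by (rule sym_functionsI[of _ k]) (auto dest: exps_monom_degree split: if_splits)

lemma sym_m_functions: "sym_m la \<in> sym_functions"
proof (rule sym_functionsI[of _ "sum_list la"])
  show "monom_degree al \<le> sum_list la" if "coeff_ms (sym_m la :: 'a mseries) al \<noteq> 0" for al
    using that sum_mset_exps[of al] by (auto simp: coeff_sym_m sum_mset_sum_list split: if_splits)
qed (simp add: coeff_sym_m)

lemma one_sym_functions: "1 \<in> sym_functions"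
proof -
  have "complete_sym 0 = (1 :: 'a mseries)" by (rule mseries_eqI) (simp add: complete_sym_def coeff_one)
  then show ?thesis using complete_sym_functions[of 0] by metis
qed

lemma sym_h_functions: "sym_h la \<in> sym_functions"
  unfolding sym_h_def by (induction la) (auto simp: one_sym_functions sym_functions_mult complete_sym_functions)

lemma sym_e_functions: "sym_e la \<in> sym_functions"
  unfolding sym_e_def by (induction la) (auto simp: one_sym_functions sym_functions_mult elem_sym_functions)

section \<open>Changes of basis by the inverse Kostka matrix\<close>

definition kinv :: "nat \<Rightarrow> nat list \<Rightarrow> nat list \<Rightarrow> int" where
  "kinv n = (SOME L.
    (\<forall>la\<in>partitions n. \<forall>nu\<in>partitions n. (\<Sum>mu\<in>partitions n. L la mu * kostka mu nu) = (if la = nu then 1 else 0)) \<and>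
    (\<forall>la\<in>partitions n. \<forall>nu\<in>partitions n. (\<Sum>mu\<in>partitions n. kostka la mu * L mu nu) = (if la = nu then 1 else 0)))"

lemma kinv:
  assumes "la \<in> partitions n" "nu \<in> partitions n"
  shows "(\<Sum>mu\<in>partitions n. kinv n la mu * kostka mu nu) = (if la = nu then 1 else 0)"
    "(\<Sum>mu\<in>partitions n. kostka la mu * kinv n mu nu) = (if la = nu then 1 else 0)"
proof -
  from someI_ex[OF kostka_inverse[of n], folded kinv_def]
  show "(\<Sum>mu\<in>partitions n. kinv n la mu * kostka mu nu) = (if la = nu then 1 else 0)"
    "(\<Sum>mu\<in>partitions n. kostka la mu * kinv n mu nu) = (if la = nu then 1 else 0)" using assms by (simp_all only:)
qed

lemma sum_smult_swap:
  "(\<Sum>i\<in>A. smult_ms (a i) (\<Sum>j\<in>B. smult_ms (b i j) (x j))) =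
    (\<Sum>j\<in>B. smult_ms (\<Sum>i\<in>A. a i * b i j) (x j))"
proof -
  have "(\<Sum>i\<in>A. smult_ms (a i) (\<Sum>j\<in>B. smult_ms (b i j) (x j))) =
     (\<Sum>i\<in>A. \<Sum>j\<in>B. smult_ms (a i * b i j) (x j))"
    by (simp add: smult_sum_right)
  also have "\<dots> = (\<Sum>j\<in>B. \<Sum>i\<in>A. smult_ms (a i * b i j) (x j))" by (rule sum.swap)
  finally show ?thesis by (simp only: smult_sum_left)
qed

lemma sum_smult_delta:
  "finite A \<Longrightarrow> la \<in> A \<Longrightarrow> (\<Sum>mu\<in>A. smult_ms (of_int (if la = mu then 1 else 0)) (x mu)) = x la"
proof -
  assume A: "finite A" "la \<in> A"
  have "(\<Sum>mu\<in>A. smult_ms (of_int (if la = mu then 1 else 0)) (x mu)) = (\<Sum>mu\<in>A. if la = mu then x mu else 0)"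
    by (rule sum.cong) auto
  with A show ?thesis by simp
qed

lemma sum_smult_delta':
  "finite A \<Longrightarrow> la \<in> A \<Longrightarrow> (\<Sum>mu\<in>A. smult_ms (of_int (if mu = la then 1 else 0)) (x mu)) = x la"
  using sum_smult_delta[of A la x] by (simp only: eq_commute[of la])

lemma sym_s_sym_h:
  assumes mu: "mu \<in> partitions n"
  shows "(sym_s mu :: 'a::comm_ring_1 mseries) = (\<Sum>la\<in>partitions n. smult_ms (of_int (kinv n la mu)) (sym_h la))"
proof -
  have "(\<Sum>la\<in>partitions n. smult_ms (of_int (kinv n la mu)) (sym_h la)) =
     (\<Sum>la\<in>partitions n. smult_ms (of_int (kinv n la mu)) (\<Sum>nu\<in>partitions n. smult_ms (of_int (kostka nu la)) (sym_s nu)) :: 'a mseries)"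
    by (rule sum.cong) (simp_all add: sym_h_schur)
  also have "\<dots> = (\<Sum>nu\<in>partitions n. smult_ms (of_int (\<Sum>la\<in>partitions n. kostka nu la * kinv n la mu)) (sym_s nu))"
    unfolding sum_smult_swap by (simp add: mult.commute)
  also have "\<dots> = (\<Sum>nu\<in>partitions n. smult_ms (of_int (if nu = mu then 1 else 0)) (sym_s nu))"
    by (rule sum.cong[OF refl]) (subst kinv(2)[OF _ mu], simp_all)
  also have "\<dots> = sym_s mu" by (rule sum_smult_delta'[OF finite_partitions mu])
  finally show ?thesis ..
qed

lemma sym_s_transpose_sym_e:
  assumes mu: "mu \<in> partitions n"
  shows "(sym_s (transpose_partition mu) :: 'a::comm_ring_1 mseries) =
    (\<Sum>la\<in>partitions n. smult_ms (of_int (kinv n la mu)) (sym_e la))"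
proof -
  have "(\<Sum>la\<in>partitions n. smult_ms (of_int (kinv n la mu)) (sym_e la)) =
     (\<Sum>la\<in>partitions n. smult_ms (of_int (kinv n la mu))
        (\<Sum>nu\<in>partitions n. smult_ms (of_int (kostka (transpose_partition nu) la)) (sym_s nu)) :: 'a mseries)"
    by (rule sum.cong) (simp_all add: sym_e_schur)
  also have "\<dots> = (\<Sum>nu\<in>partitions n. smult_ms (of_int (\<Sum>la\<in>partitions n. kostka (transpose_partition nu) la * kinv n la mu)) (sym_s nu))"
    unfolding sum_smult_swap by (simp add: mult.commute)
  also have "\<dots> = (\<Sum>nu\<in>partitions n. smult_ms (of_int (if transpose_partition nu = mu then 1 else 0)) (sym_s nu))"
    by (rule sum.cong[OF refl]) (subst kinv(2)[OF _ mu], simp_all)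
  also have "\<dots> = (\<Sum>nu\<in>partitions n. smult_ms (of_int (if transpose_partition (transpose_partition nu) = mu then 1 else 0)) (sym_s (transpose_partition nu)))"
    by (rule sum_partitions_transpose[symmetric])
  also have "\<dots> = (\<Sum>nu\<in>partitions n. smult_ms (of_int (if nu = mu then 1 else 0)) (sym_s (transpose_partition nu)))"
    by (rule sum.cong) auto
  also have "\<dots> = sym_s (transpose_partition mu)" by (rule sum_smult_delta'[OF finite_partitions mu])
  finally show ?thesis ..
qed

lemma sym_s_functions: "mu \<in> partitions n \<Longrightarrow> sym_s mu \<in> sym_functions"
  by (simp add: sym_s_sym_h[of mu n] sym_functions_sum sym_functions_smult sym_h_functions)

definition homogeneous :: "nat \<Rightarrow> 'a::comm_ring_1 mseries \<Rightarrow> bool" where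
  "homogeneous n f \<longleftrightarrow> (\<forall>al. coeff_ms f al \<noteq> 0 \<longrightarrow> monom_degree al = n)"

lemma homogeneous_sum: "(\<And>x. x \<in> A \<Longrightarrow> homogeneous n (f x)) \<Longrightarrow> homogeneous n (sum f A)"
  unfolding homogeneous_def coeff_sum by (meson sum.not_neutral_contains_not_neutral)

lemma homogeneous_smult: "homogeneous n f \<Longrightarrow> homogeneous n (smult_ms c f)"
  unfolding homogeneous_def coeff_smult by (metis mult_zero_right)

lemma homogeneous_sym_s: "mu \<in> partitions n \<Longrightarrow> homogeneous n (sym_s mu)"
  unfolding homogeneous_def
proof (intro allI impI)
  fix al assume mu: "mu \<in> partitions n" and nz: "coeff_ms (sym_s mu :: 'a mseries) al \<noteq> 0"
  obtain k where k: "\<And>i. i \<ge> k \<Longrightarrow> Poly_Mapping.lookup al i = 0" using lookup_bound by blast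
  have "kchain k (Poly_Mapping.lookup al) (part_fun mu) \<noteq> 0"
    using nz coeff_schur[OF part_fun_shape[OF mu] k, where 'a = 'a] by (metis of_nat_0 sym_s_eq_schur)
  then have "card (cells (part_fun mu)) = (\<Sum>i<k. Poly_Mapping.lookup al i)"
    using kchain_nonzero part_fun_shape[OF mu] by blast
  then show "monom_degree al = n"
    using monom_degree_bound[OF k] mu by (simp add: card_cells_part_fun partitions_def)
qed

lemma homogeneous_sym_m: "la \<in> partitions n \<Longrightarrow> homogeneous n (sym_m la)"
  unfolding homogeneous_def coeff_sym_m
  by (metis exps_monom_degree exps_part_mon monom_degree_part_mon)

text \<open>The monomials \<open>part_mon la\<close> represent all orbits of monomials of degree
  n.\<close>

lemma homogeneous_sym_eqI:
  fixes f g :: "'a::comm_ring_1 mseries"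
  assumes "f \<in> sym_functions" "g \<in> sym_functions" "homogeneous n f" "homogeneous n g"
    and "\<And>la. la \<in> partitions n \<Longrightarrow> coeff_ms f (part_mon la) = coeff_ms g (part_mon la)"
  shows "f = g"
proof (rule mseries_eqI)
  fix al
  obtain la where la: "la \<in> partitions (monom_degree al)" "exps al = mset la"
    by (rule exps_partition)
  have e: "exps al = exps (part_mon la)" using la by simp
  show "coeff_ms f al = coeff_ms g al"
  proof (cases "monom_degree al = n")
    case True
    then show ?thesis
      using sym_functions_coeff[OF assms(1) e] sym_functions_coeff[OF assms(2) e] assms(5)[of la] la by simp
  next
    case False
    then show ?thesis using assms(3,4) by (metis homogeneous_def)
  qed
qed

lemma coeff_sym_m_part_mon:
  assumes "la \<in> partitions n" "nu \<in> partitions m"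
  shows "coeff_ms (sym_m la) (part_mon nu) = (if la = nu then 1 else 0)"
  using assms partitions_mset_eq[OF assms] by (auto simp: coeff_sym_m)

lemma sym_expand_m:
  fixes f :: "'a::comm_ring_1 mseries"
  assumes "f \<in> sym_functions" "homogeneous n f"
  shows "f = (\<Sum>la\<in>partitions n. smult_ms (coeff_ms f (part_mon la)) (sym_m la))"
proof (rule homogeneous_sym_eqI[OF assms(1) _ assms(2)])
  fix nu assume nu: "nu \<in> partitions n"
  have "coeff_ms (\<Sum>la\<in>partitions n. smult_ms (coeff_ms f (part_mon la)) (sym_m la)) (part_mon nu) =
     (\<Sum>la\<in>partitions n. if nu = la then coeff_ms f (part_mon la) else 0)"
    unfolding coeff_sum by (rule sum.cong) (auto simp: coeff_sym_m_part_mon[OF _ nu])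
  with nu show "coeff_ms f (part_mon nu) =
     coeff_ms (\<Sum>la\<in>partitions n. smult_ms (coeff_ms f (part_mon la)) (sym_m la)) (part_mon nu)"
    by simp
qed (auto intro!: sym_functions_sum sym_functions_smult sym_m_functions homogeneous_sum homogeneous_smult homogeneous_sym_m)

lemma sym_s_sym_m:
  assumes mu: "mu \<in> partitions n"
  shows "sym_s mu = (\<Sum>la\<in>partitions n. smult_ms (of_int (kostka mu la)) (sym_m la))"
  using sym_expand_m[OF sym_s_functions[OF mu] homogeneous_sym_s[OF mu]] by (simp only: coeff_schur_part[OF mu])

lemma sym_m_sym_s:
  assumes la: "la \<in> partitions n"
  shows "(sym_m la :: 'a::comm_ring_1 mseries) = (\<Sum>mu\<in>partitions n. smult_ms (of_int (kinv n la mu)) (sym_s mu))"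
proof -
  have "(\<Sum>mu\<in>partitions n. smult_ms (of_int (kinv n la mu)) (sym_s mu)) =
     (\<Sum>mu\<in>partitions n. smult_ms (of_int (kinv n la mu)) (\<Sum>nu\<in>partitions n. smult_ms (of_int (kostka mu nu)) (sym_m nu)) :: 'a mseries)"
    by (rule sum.cong) (simp_all add: sym_s_sym_m)
  also have "\<dots> = (\<Sum>nu\<in>partitions n. smult_ms (of_int (\<Sum>mu\<in>partitions n. kinv n la mu * kostka mu nu)) (sym_m nu))"
    unfolding sum_smult_swap by simp
  also have "\<dots> = (\<Sum>nu\<in>partitions n. smult_ms (of_int (if la = nu then 1 else 0)) (sym_m nu))"
    by (rule sum.cong[OF refl]) (subst kinv(1)[OF la], simp_all)
  also have "\<dots> = sym_m la" by (rule sum_smult_delta[OF finite_partitions la])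
  finally show ?thesis ..
qed

text \<open>\<open>inv_kostka\<close> is a definite description, so uniqueness has to be shown as
  well: reading off coefficients at \<open>part_mon nu\<close> turns every admissible c into a
  solution of a linear system with the Kostka matrix, which its two-sided inverse solves.\<close>

lemma inv_kostka_eq:
  assumes la: "la \<in> partitions n" and mu: "mu \<in> partitions n"
  shows "inv_kostka la mu = kinv n la mu"
proof -
  have n: "sum_list la = n" using la by (simp add: partitions_def)
  let ?P = "\<lambda>c :: nat list \<Rightarrow> int. (\<forall>mu. mu \<notin> partitions n \<longrightarrow> c mu = 0) \<and>
     sym_m la = (\<Sum>mu\<in>partitions n. smult_ms (c mu) (sym_s mu))"
  let ?c = "\<lambda>mu. if mu \<in> partitions n then kinv n la mu else 0"
  have "?P ?c" using sym_m_sym_s[OF la, where 'a = int] by simp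
  moreover have "c = ?c" if c: "?P c" for c
  proof
    fix mu
    show "c mu = ?c mu"
    proof (cases "mu \<in> partitions n")
      case True
      have cK: "(\<Sum>ka\<in>partitions n. c ka * kostka ka nu) = (if la = nu then 1 else 0)" if nu: "nu \<in> partitions n" for nu
      proof -
        have "coeff_ms (sym_m la) (part_mon nu) = (\<Sum>ka\<in>partitions n. c ka * coeff_ms (sym_s ka) (part_mon nu))"
          using conjunct2[OF c] by simp
        also have "\<dots> = (\<Sum>ka\<in>partitions n. c ka * kostka ka nu)"
          by (rule sum.cong) (simp_all add: coeff_schur_part[where 'a = int])
        finally show ?thesis using coeff_sym_m_part_mon[OF la nu, where 'a = int] by simp
      qed
      have "c mu = (\<Sum>ka\<in>partitions n. c ka * (if ka = mu then 1 else 0))"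
        using True by (simp add: if_distrib[of "\<lambda>x. _ * x"] cong: if_cong)
      also have "\<dots> = (\<Sum>ka\<in>partitions n. c ka * (\<Sum>nu\<in>partitions n. kostka ka nu * kinv n nu mu))"
        by (rule sum.cong) (simp_all add: kinv(2) True)
      also have "\<dots> = (\<Sum>nu\<in>partitions n. (\<Sum>ka\<in>partitions n. c ka * kostka ka nu) * kinv n nu mu)"
        unfolding sum_distrib_left sum_distrib_right by (subst sum.swap) (simp add: mult.assoc)
      also have "\<dots> = (\<Sum>nu\<in>partitions n. if la = nu then kinv n nu mu else 0)"
        by (rule sum.cong) (simp_all add: cK)
      also have "\<dots> = kinv n la mu" using la by simp
      finally show ?thesis using True by simp
    qed (use c in auto)
  qed
  ultimately have "(THE c. ?P c) = ?c" by (rule the_equality)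
  then show ?thesis using mu by (simp add: inv_kostka_def n)
qed

section \<open>Existence of the involution, and its values on the bases\<close>

definition homogeneous_part :: "nat \<Rightarrow> 'a::comm_ring_1 mseries \<Rightarrow> 'a mseries" where
  "homogeneous_part n f = Abs_ms (\<lambda>al. if monom_degree al = n then coeff_ms f al else 0)"

lemma homogeneous_part: "homogeneous n (homogeneous_part n f)"
  by (simp add: homogeneous_def homogeneous_part_def)

lemma homogeneous_part_sym: "f \<in> sym_functions \<Longrightarrow> homogeneous_part n f \<in> sym_functions"
  by (rule sym_functionsI[of _ n])
     (auto simp: homogeneous_part_def dest: exps_monom_degree sym_functions_coeff split: if_splits)

lemma homogeneous_decomposition:
  assumes "\<forall>al. coeff_ms f al \<noteq> 0 \<longrightarrow> monom_degree al \<le> d"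
  shows "f = (\<Sum>n\<le>d. homogeneous_part n f)"
proof (rule mseries_eqI)
  fix al
  have "coeff_ms (\<Sum>n\<le>d. homogeneous_part n f) al = (\<Sum>n\<le>d. if monom_degree al = n then coeff_ms f al else 0)"
    by (simp add: homogeneous_part_def)
  also have "\<dots> = (if monom_degree al \<le> d then coeff_ms f al else 0)" by simp
  also have "\<dots> = coeff_ms f al" using assms by auto
  finally show "coeff_ms f al = coeff_ms (\<Sum>n\<le>d. homogeneous_part n f) al" ..
qed

text \<open>Finite expansions over any commutative ring whose terms may differ in degree; what is
  wanted from them is existence.\<close>

definition sym_span :: "(nat list \<Rightarrow> 'a::comm_ring_1 mseries) \<Rightarrow> 'a mseries set" where
  "sym_span b = {\<Sum>la\<in>A. smult_ms (c la) (b la) | A c. finite A \<and> A \<subseteq> (\<Union>n. partitions n)}"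

lemma sym_spanI: "\<lbrakk>finite A; A \<subseteq> (\<Union>n. partitions n); f = (\<Sum>la\<in>A. smult_ms (c la) (b la))\<rbrakk> \<Longrightarrow> f \<in> sym_span b"
  by (auto simp: sym_span_def)

lemma sym_span_base: "la \<in> partitions n \<Longrightarrow> b la \<in> sym_span b"
  by (rule sym_spanI[of "{la}" _ "\<lambda>_. 1"]) auto

lemma sym_span_zero: "0 \<in> sym_span b"
  by (rule sym_spanI[of "{}"]) auto

lemma sym_span_smult:
  assumes "f \<in> sym_span b"
  shows "smult_ms k f \<in> sym_span b"
proof -
  obtain A c where A: "finite A" "A \<subseteq> (\<Union>n. partitions n)" "f = (\<Sum>la\<in>A. smult_ms (c la) (b la))"
    using assms by (auto simp: sym_span_def)
  show ?thesis
    by (rule sym_spanI[OF A(1,2), of _ "\<lambda>la. k * c la"]) (simp add: A(3) smult_sum_right)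
qed

lemma sym_span_add:
  assumes "f \<in> sym_span b" "g \<in> sym_span b"
  shows "f + g \<in> sym_span b"
proof -
  obtain A c where A: "finite A" "A \<subseteq> (\<Union>n. partitions n)" "f = (\<Sum>la\<in>A. smult_ms (c la) (b la))"
    using assms(1) by (auto simp: sym_span_def)
  obtain B d where B: "finite B" "B \<subseteq> (\<Union>n. partitions n)" "g = (\<Sum>la\<in>B. smult_ms (d la) (b la))"
    using assms(2) by (auto simp: sym_span_def)
  let ?c = "\<lambda>la. (if la \<in> A then c la else 0) + (if la \<in> B then d la else 0)"
  have "f = (\<Sum>la\<in>A \<union> B. smult_ms (if la \<in> A then c la else 0) (b la))"
    unfolding A(3) by (rule sum.mono_neutral_cong_left) (use A(1) B(1) in auto)
  moreover have "g = (\<Sum>la\<in>A \<union> B. smult_ms (if la \<in> B then d la else 0) (b la))"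
    unfolding B(3) by (rule sum.mono_neutral_cong_left) (use A(1) B(1) in auto)
  ultimately have "f + g = (\<Sum>la\<in>A \<union> B. smult_ms (?c la) (b la))"
    by (simp add: smult_add_left sum.distrib)
  then show ?thesis using A B by (intro sym_spanI[of "A \<union> B"]) auto
qed

lemma sym_span_sum: "(\<And>x. x \<in> X \<Longrightarrow> f x \<in> sym_span b) \<Longrightarrow> sum f X \<in> sym_span b"
  by (induction X rule: infinite_finite_induct) (auto simp: sym_span_zero sym_span_add)

lemma sym_functions_span:
  assumes f: "f \<in> sym_functions" and b: "\<And>n la. la \<in> partitions n \<Longrightarrow> sym_m la \<in> sym_span b"
  shows "f \<in> sym_span b"
proof -
  obtain d where d: "\<forall>al. coeff_ms f al \<noteq> 0 \<longrightarrow> monom_degree al \<le> d" using sym_functions_bounded[OF f] ..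
  have "homogeneous_part n f \<in> sym_span b" for n
    by (subst sym_expand_m[OF homogeneous_part_sym[OF f] homogeneous_part])
       (auto intro!: sym_span_sum sym_span_smult b)
  then show ?thesis by (subst homogeneous_decomposition[OF d]) (auto intro!: sym_span_sum)
qed

lemma sym_m_span_s: "la \<in> partitions n \<Longrightarrow> sym_m la \<in> sym_span sym_s"
  by (subst sym_m_sym_s[of la n]) (auto intro!: sym_span_sum sym_span_smult sym_span_base)

lemma sym_m_span_e:
  assumes la: "la \<in> partitions n"
  shows "sym_m la \<in> sym_span sym_e"
proof -
  have "sym_s mu \<in> sym_span sym_e" if mu: "mu \<in> partitions n" for mu
  proof -
    have "sym_s mu = sym_s (transpose_partition (transpose_partition mu))" using mu by simp
    also have "\<dots> \<in> sym_span sym_e"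
      by (subst sym_s_transpose_sym_e[of _ n]) (auto simp: mu intro!: sym_span_sum sym_span_smult sym_span_base)
    finally show ?thesis .
  qed
  then show ?thesis using la by (subst sym_m_sym_s[of la n]) (auto intro!: sym_span_sum sym_span_smult)
qed

lemma sym_functions_span_e: "f \<in> sym_functions \<Longrightarrow> f \<in> sym_span sym_e"
  by (erule sym_functions_span) (rule sym_m_span_e)

lemma sym_functions_span_s: "f \<in> sym_functions \<Longrightarrow> f \<in> sym_span sym_s"
  by (erule sym_functions_span) (rule sym_m_span_s)

text \<open>\<open>\<omega>\<close> is first defined as the linear map with \<open>m\<^bsub>la\<^esub> \<mapsto> \<Sum> K\<^sup>-\<^sup>1 s\<^bsub>mu\<^sup>T\<^esub>\<close>, evaluated coefficientwise.\<close>

definition forgotten :: "nat \<Rightarrow> nat list \<Rightarrow> 'a::comm_ring_1 mseries" where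
  "forgotten n la = (\<Sum>mu\<in>partitions n. smult_ms (of_int (kinv n la mu)) (sym_s (transpose_partition mu)))"

definition omega_lin :: "'a::comm_ring_1 mseries \<Rightarrow> 'a mseries" where
  "omega_lin f = Abs_ms (\<lambda>al. \<Sum>la\<in>partitions (monom_degree al).
     coeff_ms f (part_mon la) * coeff_ms (forgotten (monom_degree al) la) al)"

lemma omega_lin_add: "omega_lin (f + g) = omega_lin f + omega_lin g"
  by (rule mseries_eqI) (simp add: omega_lin_def distrib_right sum.distrib)

lemma omega_lin_smult: "omega_lin (smult_ms c f) = smult_ms c (omega_lin f)"
  by (rule mseries_eqI) (simp add: omega_lin_def sum_distrib_left mult.assoc)

lemma omega_lin_zero: "omega_lin 0 = 0"
  by (rule mseries_eqI) (simp add: omega_lin_def)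

lemma omega_lin_sum: "omega_lin (\<Sum>i\<in>A. smult_ms (c i) (f i)) = (\<Sum>i\<in>A. smult_ms (c i) (omega_lin (f i)))"
  by (induction A rule: infinite_finite_induct) (auto simp: omega_lin_add omega_lin_smult omega_lin_zero)

lemma homogeneous_forgotten: "homogeneous n (forgotten n la)"
  unfolding forgotten_def by (intro homogeneous_sum homogeneous_smult homogeneous_sym_s) simp

lemma omega_lin_sym_m:
  assumes la: "la \<in> partitions n"
  shows "omega_lin (sym_m la :: 'a::comm_ring_1 mseries) = forgotten n la"
proof (rule mseries_eqI)
  fix al
  show "coeff_ms (omega_lin (sym_m la :: 'a mseries)) al = coeff_ms (forgotten n la) al"
  proof (cases "monom_degree al = n")
    case True
    have "coeff_ms (omega_lin (sym_m la :: 'a mseries)) al = (\<Sum>nu\<in>partitions n. if la = nu then coeff_ms (forgotten n nu) al else 0)"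
      unfolding omega_lin_def coeff_Abs_ms True by (rule sum.cong) (auto simp: coeff_sym_m_part_mon[OF la])
    then show ?thesis using la by simp
  next
    case False
    have z: "coeff_ms (sym_m la :: 'a mseries) (part_mon nu) = 0" if "nu \<in> partitions (monom_degree al)" for nu
      using homogeneous_sym_m[OF la] that False by (metis homogeneous_def monom_degree_part_mon)
    have "coeff_ms (omega_lin (sym_m la :: 'a mseries)) al = 0"
      unfolding omega_lin_def coeff_Abs_ms by (rule sum.neutral) (simp add: z)
    moreover have "coeff_ms (forgotten n la :: 'a mseries) al = 0" using homogeneous_forgotten False by (metis homogeneous_def)
    ultimately show ?thesis by simp
  qed
qed

lemma omega_lin_sym_s:
  assumes mu: "mu \<in> partitions n"
  shows "omega_lin (sym_s mu :: 'a::comm_ring_1 mseries) = sym_s (transpose_partition mu)"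
proof -
  have "omega_lin (sym_s mu :: 'a mseries) = (\<Sum>la\<in>partitions n. smult_ms (of_int (kostka mu la)) (forgotten n la))"
    by (subst sym_s_sym_m[OF mu]) (simp add: omega_lin_sum omega_lin_sym_m)
  also have "\<dots> = (\<Sum>nu\<in>partitions n. smult_ms (of_int (\<Sum>la\<in>partitions n. kostka mu la * kinv n la nu)) (sym_s (transpose_partition nu)))"
    unfolding forgotten_def sum_smult_swap by simp
  also have "\<dots> = (\<Sum>nu\<in>partitions n. smult_ms (of_int (if mu = nu then 1 else 0)) (sym_s (transpose_partition nu)))"
    by (rule sum.cong[OF refl]) (subst kinv(2)[OF mu], simp_all)
  also have "\<dots> = sym_s (transpose_partition mu)" by (rule sum_smult_delta[OF finite_partitions mu])
  finally show ?thesis .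
qed

lemma omega_lin_sym_e_partition:
  assumes la: "la \<in> partitions n"
  shows "omega_lin (sym_e la) = (sym_h la :: 'a::comm_ring_1 mseries)"
proof -
  have "omega_lin (sym_e la) = (\<Sum>mu\<in>partitions n. smult_ms (of_int (kostka (transpose_partition mu) la)) (sym_s (transpose_partition mu)) :: 'a mseries)"
    by (simp add: sym_e_schur[OF la] omega_lin_sum omega_lin_sym_s)
  also have "\<dots> = sym_h la" unfolding sum_partitions_transpose[where f = "\<lambda>mu. smult_ms (of_int (kostka mu la)) (sym_s mu)"]
    by (rule sym_h_schur[OF la, symmetric])
  finally show ?thesis .
qed

lemma sort_partition:
  assumes "\<forall>x\<in>set xs. 0 < (x::nat)"
  shows "rev (sort xs) \<in> partitions (sum_list xs)" "mset (rev (sort xs)) = mset xs"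
proof -
  show m: "mset (rev (sort xs)) = mset xs" by simp
  have "sum_list (rev (sort xs)) = sum_list xs" by (metis m sum_mset_sum_list)
  with assms show "rev (sort xs) \<in> partitions (sum_list xs)" by (simp add: partitions_def sorted_wrt_rev)
qed

lemma prod_list_mset_cong: "mset xs = mset ys \<Longrightarrow> prod_list (map f xs) = (prod_list (map f ys) :: 'b::comm_monoid_mult)"
  by (metis mset_map prod_mset_prod_list)

lemma omega_lin_sym_e:
  assumes "\<forall>x\<in>set xs. 0 < x"
  shows "omega_lin (sym_e xs) = (sym_h xs :: 'a::comm_ring_1 mseries)"
  using omega_lin_sym_e_partition[OF sort_partition(1)[OF assms], where 'a = 'a]
    prod_list_mset_cong[OF sort_partition(2)[OF assms], of "elem_sym :: nat \<Rightarrow> 'a mseries"]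
    prod_list_mset_cong[OF sort_partition(2)[OF assms], of "complete_sym :: nat \<Rightarrow> 'a mseries"]
  unfolding sym_e_def sym_h_def by simp

text \<open>Both factors are expanded in elementary products. These multiply by concatenation of
  their index lists, which is the reason for having \<open>omega_lin_sym_e\<close> for unsorted
  lists.\<close>

lemma omega_lin_mult:
  fixes f g :: "'a::comm_ring_1 mseries"
  assumes "f \<in> sym_functions" "g \<in> sym_functions"
  shows "omega_lin (f * g) = omega_lin f * omega_lin g"
proof -
  obtain A a where A: "finite A" "A \<subseteq> (\<Union>n. partitions n)" "f = (\<Sum>la\<in>A. smult_ms (a la) (sym_e la))"
    using sym_functions_span_e[OF assms(1)] by (auto simp: sym_span_def)
  obtain B b where B: "finite B" "B \<subseteq> (\<Union>n. partitions n)" "g = (\<Sum>la\<in>B. smult_ms (b la) (sym_e la))"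
    using sym_functions_span_e[OF assms(2)] by (auto simp: sym_span_def)
  have pos: "\<forall>x\<in>set la. 0 < x" if "la \<in> A \<union> B" for la using that A(2) B(2) by (auto simp: partitions_def)
  have fA: "omega_lin f = (\<Sum>la\<in>A. smult_ms (a la) (sym_h la))"
    unfolding A(3) omega_lin_sum by (rule sum.cong[OF refl], subst omega_lin_sym_e[OF pos]) simp_all
  have gB: "omega_lin g = (\<Sum>la\<in>B. smult_ms (b la) (sym_h la))"
    unfolding B(3) omega_lin_sum by (rule sum.cong[OF refl], subst omega_lin_sym_e[OF pos]) simp_all
  have prod: "(\<Sum>la\<in>A. smult_ms (a la) (x la)) * (\<Sum>mu\<in>B. smult_ms (b mu) (x mu)) =
      (\<Sum>p\<in>A \<times> B. smult_ms (a (fst p) * b (snd p)) (x (fst p) * x (snd p)))" for x :: "nat list \<Rightarrow> 'a mseries"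
    by (simp add: sum_product sum.cartesian_product smult_mult_left smult_mult_right case_prod_beta mult.commute)
  have "omega_lin (f * g) = omega_lin (\<Sum>p\<in>A \<times> B. smult_ms (a (fst p) * b (snd p)) (sym_e (fst p @ snd p)))"
    unfolding A(3) B(3) prod by (simp add: sym_e_def)
  also have "\<dots> = (\<Sum>p\<in>A \<times> B. smult_ms (a (fst p) * b (snd p)) (sym_h (fst p @ snd p)))"
    unfolding omega_lin_sum
  proof (rule sum.cong[OF refl])
    fix p assume "p \<in> A \<times> B"
    then have "\<forall>x\<in>set (fst p @ snd p). 0 < x" using pos[of "fst p"] pos[of "snd p"] by auto
    then show "smult_ms (a (fst p) * b (snd p)) (omega_lin (sym_e (fst p @ snd p))) =
       smult_ms (a (fst p) * b (snd p)) (sym_h (fst p @ snd p))" by (simp add: omega_lin_sym_e)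
  qed
  also have "\<dots> = omega_lin f * omega_lin g"
    unfolding fA gB prod by (simp add: sym_h_def)
  finally show ?thesis .
qed

text \<open>\<open>sym_omega\<close> is an arbitrary choice among the maps with
  \<open>is_omega\<close>, so one of them has to be exhibited before anything can be said about it.
  On Schur functions the exhibited map is transposition, which makes it an involution on symmetric
  functions.\<close>

lemma is_omega_omega_lin: "is_omega (omega_lin :: 'a::comm_ring_1 mseries \<Rightarrow> 'a mseries)"
  unfolding is_omega_def
proof (intro conjI ballI allI)
  fix f :: "'a mseries" assume f: "f \<in> sym_functions"
  obtain A a where A: "finite A" "A \<subseteq> (\<Union>n. partitions n)" "f = (\<Sum>la\<in>A. smult_ms (a la) (sym_s la))"
    using sym_functions_span_s[OF f] by (auto simp: sym_span_def)
  have s: "omega_lin (sym_s la :: 'a mseries) = sym_s (transpose_partition la)"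
    "omega_lin (sym_s (transpose_partition la) :: 'a mseries) = sym_s la"
    "(sym_s (transpose_partition la) :: 'a mseries) \<in> sym_functions" if la: "la \<in> A" for la
  proof -
    obtain n where n: "la \<in> partitions n" using A(2) la by blast
    show "omega_lin (sym_s la :: 'a mseries) = sym_s (transpose_partition la)" by (rule omega_lin_sym_s[OF n])
    show "omega_lin (sym_s (transpose_partition la) :: 'a mseries) = sym_s la"
      using omega_lin_sym_s[OF transpose_partition[OF n]] n by simp
    show "(sym_s (transpose_partition la) :: 'a mseries) \<in> sym_functions"
      by (rule sym_s_functions[OF transpose_partition[OF n]])
  qed
  have o: "omega_lin f = (\<Sum>la\<in>A. smult_ms (a la) (sym_s (transpose_partition la)))"
    unfolding A(3) omega_lin_sum by (rule sum.cong) (simp_all add: s)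
  show "omega_lin f \<in> sym_functions"
    unfolding o by (intro sym_functions_sum sym_functions_smult s)
  show "omega_lin (omega_lin f) = f"
    unfolding o omega_lin_sum unfolding A(3) by (simp add: s)
next
  have "omega_lin (sym_e []) = (sym_h [] :: 'a mseries)" by (rule omega_lin_sym_e) simp
  then show one: "omega_lin 1 = (1 :: 'a mseries)" by (simp add: sym_e_def sym_h_def)
  fix k
  have e0: "elem_sym 0 = (1 :: 'a mseries)" "complete_sym 0 = (1 :: 'a mseries)"
    by (rule mseries_eqI, auto simp: elem_sym_def complete_sym_def coeff_one)+
  show "omega_lin (elem_sym k) = (complete_sym k :: 'a mseries)"
  proof (cases "k = 0")
    case False
    then have "omega_lin (sym_e [k]) = (sym_h [k] :: 'a mseries)" by (intro omega_lin_sym_e) simp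
    then show ?thesis by (simp add: sym_e_def sym_h_def)
  qed (simp add: one e0)
qed (simp_all add: omega_lin_add omega_lin_smult omega_lin_mult)

lemma is_omega_sym_omega: "is_omega (sym_omega :: 'a::comm_ring_1 mseries \<Rightarrow> 'a mseries)"
  unfolding sym_omega_def by (rule someI[of is_omega, OF is_omega_omega_lin])

lemma sym_omega:
  fixes f g :: "'a::comm_ring_1 mseries"
  assumes "f \<in> sym_functions"
  shows "sym_omega f \<in> sym_functions" "sym_omega (sym_omega f) = f"
    "sym_omega (smult_ms c f) = smult_ms c (sym_omega f)"
    "g \<in> sym_functions \<Longrightarrow> sym_omega (f + g) = sym_omega f + sym_omega g"
    "g \<in> sym_functions \<Longrightarrow> sym_omega (f * g) = sym_omega f * sym_omega g"
  using is_omega_sym_omega[where 'a = 'a] assms unfolding is_omega_def by blast+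

lemma sym_omega_one: "sym_omega 1 = 1"
  and sym_omega_elem: "sym_omega (elem_sym k) = complete_sym k"
  using is_omega_sym_omega unfolding is_omega_def by blast+

lemma sym_omega_complete: "sym_omega (complete_sym k) = elem_sym k"
  using sym_omega(2)[OF elem_sym_functions, of k] by (simp only: sym_omega_elem)

lemma sym_omega_zero: "sym_omega 0 = 0"
  using sym_omega(3)[OF sym_functions_zero, of 0] by simp

lemma sym_omega_sum:
  assumes "\<And>i. i \<in> A \<Longrightarrow> f i \<in> sym_functions"
  shows "sym_omega (\<Sum>i\<in>A. smult_ms (c i) (f i)) = (\<Sum>i\<in>A. smult_ms (c i) (sym_omega (f i)))"
  using assms
  by (induction A rule: infinite_finite_induct)
     (simp_all add: sym_omega_zero sym_omega(3,4) sym_functions_smult sym_functions_sum)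

lemma sym_omega_sym_e: "sym_omega (sym_e la) = (sym_h la :: 'a::comm_ring_1 mseries)"
proof (induction la)
  case (Cons k la)
  have "sym_omega (elem_sym k * sym_e la :: 'a mseries) = sym_omega (elem_sym k) * sym_omega (sym_e la)"
    by (rule sym_omega(5)[OF elem_sym_functions sym_e_functions])
  also have "\<dots> = sym_h (k # la)" unfolding sym_omega_elem Cons by (simp add: sym_h_def)
  finally show ?case by (simp add: sym_e_def)
qed (simp add: sym_e_def sym_h_def sym_omega_one)

lemma sym_omega_sym_h: "sym_omega (sym_h la) = sym_e la"
  using sym_omega(2)[OF sym_e_functions, of la] by (simp only: sym_omega_sym_e)

text \<open>The column of the inverse Kostka matrix that expresses a Schur function through h
  expresses the transposed one through e.\<close>

lemma sym_omega_sym_s: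
  assumes mu: "mu \<in> partitions n"
  shows "sym_omega (sym_s mu) = sym_s (transpose_partition mu)"
  by (simp only: sym_s_sym_h[OF mu] sym_omega_sum sym_h_functions sym_omega_sym_h sym_s_transpose_sym_e[OF mu])

section \<open>Newton identities and power sums\<close>

lemma le_lookup_iff: "Poly_Mapping.single i k + (al - Poly_Mapping.single i k) = al \<longleftrightarrow> k \<le> Poly_Mapping.lookup al i"
  for al :: "nat \<Rightarrow>\<^sub>0 nat"
proof
  assume "Poly_Mapping.single i k + (al - Poly_Mapping.single i k) = al"
  then have "Poly_Mapping.lookup (Poly_Mapping.single i k + (al - Poly_Mapping.single i k)) i = Poly_Mapping.lookup al i" by simp
  then show "k \<le> Poly_Mapping.lookup al i" by (simp add: lookup_add lookup_minus)
next
  assume "k \<le> Poly_Mapping.lookup al i"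
  then show "Poly_Mapping.single i k + (al - Poly_Mapping.single i k) = al"
    by (intro poly_mapping_eqI) (auto simp: lookup_add lookup_minus lookup_single when_def)
qed

lemma monom_degree_single: "monom_degree (Poly_Mapping.single i k) = k"
  by (simp add: monom_degree_def)

lemma single_index_inj: "k > 0 \<Longrightarrow> Poly_Mapping.single i k = Poly_Mapping.single j k \<longleftrightarrow> i = j"
  for k :: nat
  by (metis lookup_single_eq lookup_single_not_eq less_irrefl)

lemma coeff_power_sum_mult:
  assumes k: "k > 0"
  shows "coeff_ms (power_sum k * f :: 'a::comm_ring_1 mseries) al =
    (\<Sum>i\<in>{i \<in> Poly_Mapping.keys al. k \<le> Poly_Mapping.lookup al i}. coeff_ms f (al - Poly_Mapping.single i k))"
proof -
  let ?s = "\<lambda>i. Poly_Mapping.single i k :: nat \<Rightarrow>\<^sub>0 nat"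
  have "coeff_ms (power_sum k * f) al = (\<Sum>x\<in>splits al. if \<exists>i. fst x = ?s i then coeff_ms f (snd x) else 0)"
    unfolding coeff_mult by (rule sum.cong) (auto simp: power_sum_def)
  also have "\<dots> = (\<Sum>x\<in>{x \<in> splits al. \<exists>i. fst x = ?s i}. coeff_ms f (snd x))"
    by (rule sum.inter_filter[symmetric]) (rule finite_splits)
  also have "\<dots> = (\<Sum>i\<in>{i \<in> Poly_Mapping.keys al. k \<le> Poly_Mapping.lookup al i}. coeff_ms f (al - ?s i))"
  proof (rule sum.reindex_cong[where l = "\<lambda>i. (?s i, al - ?s i)"])
    show "inj_on (\<lambda>i. (?s i, al - ?s i)) {i \<in> Poly_Mapping.keys al. k \<le> Poly_Mapping.lookup al i}"
      by (rule inj_onI) (simp add: single_index_inj k)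
    show "{x \<in> splits al. \<exists>i. fst x = ?s i} = (\<lambda>i. (?s i, al - ?s i)) ` {i \<in> Poly_Mapping.keys al. k \<le> Poly_Mapping.lookup al i}"
      (is "?X = ?Y")
    proof
      show "?X \<subseteq> ?Y"
      proof
        fix x assume "x \<in> ?X"
        then obtain i ga where x: "x = (?s i, ga)" "?s i + ga = al" by (cases x) (auto simp: splits_def)
        then have ga: "ga = al - ?s i" by auto
        have "k \<le> Poly_Mapping.lookup al i" using le_lookup_iff[of i k al] x ga by simp
        moreover from this have "i \<in> Poly_Mapping.keys al" using k by (auto simp: in_keys_iff)
        ultimately show "x \<in> ?Y" using x ga by auto
      qed
      show "?Y \<subseteq> ?X" using le_lookup_iff by (auto simp: splits_def)
    qed
  qed simp
  finally show ?thesis .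
qed

text \<open>For a monomial of degree n there are n pairs of a variable and a number k between 1 and
  its exponent, and each pair accounts for one term on the right.\<close>

lemma complete_newton:
  "of_nat n * complete_sym n = (\<Sum>k=1..n. power_sum k * complete_sym (n - k) :: 'a::comm_ring_1 mseries)"
proof (rule mseries_eqI)
  fix al :: "nat \<Rightarrow>\<^sub>0 nat"
  let ?l = "Poly_Mapping.lookup al" and ?K = "Poly_Mapping.keys al"
  have c: "coeff_ms (power_sum k * complete_sym (n - k) :: 'a mseries) al =
      (if monom_degree al = n then of_nat (card {i \<in> ?K. k \<le> ?l i}) else 0)"
    if k: "k \<in> {1..n}" for k
  proof -
    have "monom_degree al = k + monom_degree (al - Poly_Mapping.single i k)" if "k \<le> ?l i" for i
      using le_lookup_iff[of i k al] that by (metis monom_degree_add monom_degree_single)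
    then have "coeff_ms (complete_sym (n - k) :: 'a mseries) (al - Poly_Mapping.single i k) =
        (if monom_degree al = n then 1 else 0)" if "k \<le> ?l i" for i
      using that k by (force simp: complete_sym_def)
    then show ?thesis using k by (simp add: coeff_power_sum_mult)
  qed
  have "(\<Sum>k=1..n. card {i \<in> ?K. k \<le> ?l i}) = n" if "monom_degree al = n"
  proof -
    have "(\<Sum>k=1..n. card {i \<in> ?K. k \<le> ?l i}) = (\<Sum>i\<in>?K. card {k \<in> {1..n}. k \<le> ?l i})"
      using sum.swap_restrict[of "{1..n}" ?K "\<lambda>_ _. 1 :: nat" "\<lambda>k i. k \<le> ?l i"] by simp
    also have "\<dots> = (\<Sum>i\<in>?K. ?l i)"
    proof (rule sum.cong[OF refl])
      fix i assume "i \<in> ?K"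
      then have "?l i \<le> n" using that member_le_sum[of i ?K ?l] by (simp add: monom_degree_def)
      then have "{k \<in> {1..n}. k \<le> ?l i} = {1..?l i}" by auto
      then show "card {k \<in> {1..n}. k \<le> ?l i} = ?l i" by simp
    qed
    finally show ?thesis using that by (simp add: monom_degree_def)
  qed
  moreover have "coeff_ms (\<Sum>k=1..n. power_sum k * complete_sym (n - k) :: 'a mseries) al =
     (if monom_degree al = n then of_nat (\<Sum>k=1..n. card {i \<in> ?K. k \<le> ?l i}) else 0)"
    using c by simp
  ultimately show "coeff_ms (of_nat n * complete_sym n :: 'a mseries) al =
     coeff_ms (\<Sum>k=1..n. power_sum k * complete_sym (n - k) :: 'a mseries) al"
    by (simp only: flip: smult_of_nat) (simp add: complete_sym_def)
qed

text \<open>For the generating series H' = P H and E H = 1 give E' = - P E. The signs are part of E,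
  and P starts with the first power sum as its constant term.\<close>

lemma elem_newton:
  "of_nat n * ((- 1) ^ n * elem_sym n) + (\<Sum>k=1..n. power_sum k * ((- 1) ^ (n - k) * elem_sym (n - k))) =
    (0 :: 'a::comm_ring_1 mseries)"
proof -
  define H where "H = Abs_fps (complete_sym :: nat \<Rightarrow> 'a mseries)"
  define E where "E = Abs_fps (\<lambda>i. (- 1) ^ i * elem_sym i :: 'a mseries)"
  define P where "P = Abs_fps (\<lambda>k. power_sum (Suc k) :: 'a mseries)"
  have shift: "(\<Sum>k=1..Suc m. power_sum k * f (Suc m - k)) = (\<Sum>k=0..m. power_sum (Suc k) * f (m - k))"
    for m and f :: "nat \<Rightarrow> 'a mseries"
    by (rule sum.reindex_bij_witness[of _ Suc "\<lambda>k. k - 1"]) auto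
  have EH: "E * H = 1"
    by (rule fps_ext) (simp add: fps_mult_nth E_def H_def elem_complete atLeast0AtMost)
  have dH: "fps_deriv H = P * H"
    by (rule fps_ext) (simp only: fps_deriv_nth fps_mult_nth H_def P_def fps_nth_Abs_fps Suc_eq_plus1[symmetric] complete_newton shift)
  have "fps_deriv E * H + E * fps_deriv H = 0"
    using arg_cong[OF EH, of fps_deriv] by (simp add: add.commute)
  then have "(fps_deriv E + E * P) * H = 0" by (simp add: dH algebra_simps)
  then have "(fps_deriv E + E * P) * (H * E) = 0" by (metis mult.assoc mult_zero_left)
  then have dE: "fps_deriv E + P * E = 0" using EH by (simp add: mult.commute)
  show ?thesis
  proof (cases n)
    case (Suc m)
    show ?thesis
      using arg_cong[OF dE, of "\<lambda>F. fps_nth F m"] unfolding Suc shift[of "\<lambda>i. (- 1) ^ i * elem_sym i"]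
      by (simp add: fps_mult_nth E_def P_def del: of_nat_Suc power_Suc)
  qed simp
qed

lemma power_sum_functions: "k > 0 \<Longrightarrow> power_sum k \<in> sym_functions"
proof (rule sym_functionsI[of _ k])
  assume k: "k > 0"
  have iff: "(\<exists>i. al = Poly_Mapping.single i k) \<longleftrightarrow> exps al = {#k#}" for al
  proof
    assume "exps al = {#k#}"
    also have "{#k#} = exps (Poly_Mapping.single 0 k)" using k by (simp add: exps_def)
    finally have e: "exps al = exps (Poly_Mapping.single 0 k)" .
    obtain \<sigma> where \<sigma>: "bij \<sigma>" "Poly_Mapping.lookup (Poly_Mapping.single (0 :: nat) k) = Poly_Mapping.lookup al \<circ> \<sigma>"
      using exps_eq_obtain_bij[OF e] .
    have "al = Poly_Mapping.single (\<sigma> 0) k"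
    proof (rule poly_mapping_eqI)
      fix i
      obtain j where j: "i = \<sigma> j" using bij_is_surj[OF \<sigma>(1)] by (rule surjE)
      show "Poly_Mapping.lookup al i = Poly_Mapping.lookup (Poly_Mapping.single (\<sigma> 0) k) i"
        using fun_cong[OF \<sigma>(2), of j] bij_is_inj[OF \<sigma>(1)] unfolding j
        by (simp add: lookup_single inj_eq)
    qed
    then show "\<exists>i. al = Poly_Mapping.single i k" ..
  qed (use k in \<open>auto simp: exps_def\<close>)
  show "coeff_ms (power_sum k :: 'a mseries) al = coeff_ms (power_sum k) be" if "exps al = exps be" for al be
    unfolding power_sum_def coeff_Abs_ms iff that ..
  show "monom_degree al \<le> k" if "coeff_ms (power_sum k :: 'a mseries) al \<noteq> 0" for al
    using that k by (auto simp: power_sum_def monom_degree_def split: if_splits)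
qed

text \<open>The image of Newton's identity for h is compared with Newton's identity for e. The terms
  with k < n agree by induction, and the term with k = n has the factor e_0 = 1.\<close>

lemma sym_omega_power_sum:
  "k > 0 \<Longrightarrow> sym_omega (power_sum k) = (smult_ms ((- 1) ^ (k - 1)) (power_sum k) :: 'a::comm_ring_1 mseries)"
proof (induction k rule: less_induct)
  case (less n)
  have e0: "elem_sym 0 = (1 :: 'a mseries)" "complete_sym 0 = (1 :: 'a mseries)"
    by (rule mseries_eqI, auto simp: elem_sym_def complete_sym_def coeff_one)+
  have sgn: "smult_ms ((- 1) ^ i) g = (- 1) ^ i * g" for i and g :: "'a mseries"
    by (cases "even i") (simp_all add: smult_neg)
  have fn: "power_sum k * complete_sym (n - k) \<in> (sym_functions :: 'a mseries set)" if "k \<in> {1..n}" for k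
    using that by (intro sym_functions_mult complete_sym_functions power_sum_functions) simp
  have "of_nat n * elem_sym n = sym_omega (smult_ms (of_nat n) (complete_sym n) :: 'a mseries)"
    by (simp add: sym_omega(3)[OF complete_sym_functions] sym_omega_complete flip: smult_of_nat)
  also have "\<dots> = sym_omega (\<Sum>k=1..n. smult_ms 1 (power_sum k * complete_sym (n - k) :: 'a mseries))"
    by (simp add: smult_of_nat complete_newton)
  also have "\<dots> = (\<Sum>k=1..n. smult_ms 1 (sym_omega (power_sum k * complete_sym (n - k))))"
    by (rule sym_omega_sum) (rule fn)
  also have "\<dots> = (\<Sum>k=1..n. sym_omega (power_sum k) * elem_sym (n - k))"
    by (rule sum.cong) (auto simp: sym_omega(5)[OF power_sum_functions complete_sym_functions] sym_omega_complete)
  finally have eq: "of_nat n * elem_sym n = (\<Sum>k=1..n. sym_omega (power_sum k) * elem_sym (n - k) :: 'a mseries)" .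
  have "of_nat n * elem_sym n = (- 1) ^ n * (of_nat n * ((- 1) ^ n * elem_sym n) :: 'a mseries)"
    by (simp add: minus_one_power_iff)
  also have "\<dots> = (- 1) ^ n * - (\<Sum>k=1..n. power_sum k * ((- 1) ^ (n - k) * elem_sym (n - k)))"
    by (simp only: eq_neg_iff_add_eq_0[THEN iffD2, OF elem_newton])
  also have "\<dots> = (\<Sum>k=1..n. (- 1) ^ (k - 1) * power_sum k * elem_sym (n - k))"
    unfolding sum_negf[symmetric] sum_distrib_left by (rule sum.cong) (auto simp: minus_one_power_iff)
  finally have eq': "of_nat n * elem_sym n = (\<Sum>k=1..n. (- 1) ^ (k - 1) * power_sum k * elem_sym (n - k) :: 'a mseries)" .
  have split: "(\<Sum>k=1..n. f k) = (\<Sum>k=1..<n. f k) + f n" for f :: "nat \<Rightarrow> 'a mseries"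
    using less.prems by (cases n) (auto simp: atLeastLessThanSuc_atLeastAtMost)
  have "(\<Sum>k=1..<n. sym_omega (power_sum k) * elem_sym (n - k)) =
      (\<Sum>k=1..<n. (- 1) ^ (k - 1) * power_sum k * elem_sym (n - k) :: 'a mseries)"
    by (rule sum.cong) (simp_all add: less.IH sgn)
  with eq eq' show ?case unfolding split by (simp add: e0 sgn)
qed

lemma sym_p_functions: "\<forall>k\<in>set la. 0 < k \<Longrightarrow> sym_p la \<in> sym_functions"
  unfolding sym_p_def by (induction la) (auto simp: one_sym_functions sym_functions_mult power_sum_functions)

lemma sym_omega_sym_p:
  "\<forall>k\<in>set la. 0 < k \<Longrightarrow> sym_omega (sym_p la) = (smult_ms ((- 1) ^ (sum_list la - length la)) (sym_p la) :: 'a::comm_ring_1 mseries)"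
proof (induction la)
  case (Cons k la)
  have k: "k > 0" "\<forall>k\<in>set la. 0 < k" using Cons.prems by auto
  have len: "length la \<le> sum_list la" using k(2) by (induction la) auto
  have "sym_omega (power_sum k * sym_p la :: 'a mseries) = sym_omega (power_sum k) * sym_omega (sym_p la)"
    by (rule sym_omega(5)[OF power_sum_functions[OF k(1)] sym_p_functions[OF k(2)]])
  also have "\<dots> = smult_ms ((- 1) ^ (k - 1) * (- 1) ^ (sum_list la - length la)) (power_sum k * sym_p la)"
    unfolding sym_omega_power_sum[OF k(1)] Cons.IH[OF k(2)] by (simp add: smult_mult_left smult_mult_right mult.commute)
  also have "(- 1) ^ (k - 1) * (- 1) ^ (sum_list la - length la) = ((- 1) ^ (sum_list (k # la) - length (k # la)) :: 'a)"
    using k(1) len by (simp add: add.commute flip: power_add)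
  finally show ?case by (simp add: sym_p_def)
qed (simp add: sym_p_def sym_omega_one)

definition pos_msets :: "nat \<Rightarrow> nat multiset set" where
  "pos_msets n = {M. (\<forall>x\<in>#M. 0 < x) \<and> sum_mset M = n}"

lemma bij_mset_partitions: "bij_betw mset (partitions n) (pos_msets n)"
proof (rule bij_betw_imageI)
  show "inj_on mset (partitions n)"
    by (rule inj_onI) (rule partitions_mset_eq)
  show "mset ` partitions n = pos_msets n"
  proof
    show "mset ` partitions n \<subseteq> pos_msets n" by (auto simp: partitions_def pos_msets_def sum_mset_sum_list)
    show "pos_msets n \<subseteq> mset ` partitions n"
    proof
      fix M assume M: "M \<in> pos_msets n"
      obtain xs where xs: "M = mset xs" using ex_mset by metis
      have "rev (sort xs) \<in> partitions n"
        using sort_partition(1)[of xs] M unfolding xs by (auto simp: pos_msets_def sum_mset_sum_list)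
      then show "M \<in> mset ` partitions n" by (intro image_eqI[of _ _ "rev (sort xs)"]) (simp_all add: xs)
    qed
  qed
qed

lemma finite_pos_msets [simp]: "finite (pos_msets n)"
  using bij_betw_finite[OF bij_mset_partitions[of n]] by simp

definition z_mset :: "nat multiset \<Rightarrow> nat" where
  "z_mset M = prod_mset M * (\<Prod>x\<in>set_mset M. fact (count M x))"

lemma z_partition_mset:
  assumes "la \<in> partitions n"
  shows "z_partition la = z_mset (mset la)"
proof -
  have "x \<le> sum_list la" if "x \<in> set la" for x using that by (intro member_le_sum_list) auto
  then have sub: "set la \<subseteq> {1..sum_list la}" using assms by (auto simp: partitions_def Suc_le_eq)
  have "(\<Prod>i=1..sum_list la. fact (count_list la i)) = (\<Prod>i\<in>set la. fact (count (mset la) i) :: nat)"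
  proof (rule prod.mono_neutral_cong_right[OF _ sub])
    show "\<forall>i\<in>{1..sum_list la} - set la. fact (count_list la i) = (1 :: nat)"
      by (auto simp: count_list_0_iff)
    show "fact (count_list la i) = (fact (count (mset la) i) :: nat)" for i by (simp add: count_mset)
  qed simp
  then show ?thesis by (simp add: z_partition_def z_mset_def prod_mset_prod_list)
qed

text \<open>The new part contributes itself as a factor and raises the factorial of its multiplicity
  by one step. In this form z fits the recursion of Newton's identity.\<close>

lemma z_mset_add: "z_mset (add_mset k M) = k * Suc (count M k) * z_mset M"
proof -
  have "(\<Prod>x\<in>set_mset (add_mset k M). fact (count (add_mset k M) x)) =
     fact (Suc (count M k)) * (\<Prod>x\<in>set_mset M - {k}. fact (count M x) :: nat)"
    by (simp add: prod.insert_remove)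
  moreover have "(\<Prod>x\<in>set_mset M. fact (count M x)) = fact (count M k) * (\<Prod>x\<in>set_mset M - {k}. fact (count M x) :: nat)"
    by (cases "k \<in># M") (auto simp: prod.remove not_in_iff)
  ultimately show ?thesis by (simp add: z_mset_def algebra_simps)
qed

lemma z_mset_pos: "\<forall>x\<in>#M. 0 < x \<Longrightarrow> z_mset M > 0"
  by (induction M) (auto simp: z_mset_add, simp add: z_mset_def)

lemma sum_set_mset_count: "(\<Sum>k\<in>set_mset M. k * count M k) = (sum_mset M :: nat)"
proof (induction M)
  case (add k M)
  have "(\<Sum>x\<in>set_mset (add_mset k M). x * count (add_mset k M) x) =
     k * Suc (count M k) + (\<Sum>x\<in>set_mset M - {k}. x * count M x)"
    by (simp add: sum.insert_remove)
  moreover have "(\<Sum>x\<in>set_mset M. x * count M x) = k * count M k + (\<Sum>x\<in>set_mset M - {k}. x * count M x)"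
    by (cases "k \<in># M") (auto simp: sum.remove not_in_iff)
  ultimately show ?case using add by simp
qed simp

definition p_mset :: "nat multiset \<Rightarrow> 'a::comm_ring_1 mseries" where
  "p_mset M = prod_mset (image_mset power_sum M)"

lemma sym_p_mset: "sym_p la = p_mset (mset la)"
  by (simp add: sym_p_def p_mset_def prod_mset_prod_list flip: mset_map)

text \<open>Newton's identity inserts a part k into a partition of n - k. By
  \<open>z_mset_add\<close> the insertion has as weight k times the multiplicity of k in the result,
  divided by z of the result. Over the distinct parts of the result these numerators sum to n, which
  cancels the factor on the left.\<close>

lemma complete_sym_power_sums_mset:
  "(complete_sym n :: 'a::field_char_0 mseries) = (\<Sum>M\<in>pos_msets n. smult_ms (1 / of_nat (z_mset M)) (p_mset M))"
proof (induction n rule: less_induct)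
  case (less n)
  let ?Z = "\<lambda>n. \<Sum>M\<in>pos_msets n. smult_ms (1 / of_nat (z_mset M)) (p_mset M) :: 'a mseries"
  show ?case
  proof (cases "n = 0")
    case True
    have "M = {#}" if "\<forall>x\<in>#M. 0 < x" "sum_mset M = 0" for M :: "nat multiset"
      using that by (cases M) auto
    then have "pos_msets 0 = {{#}}" by (auto simp: pos_msets_def)
    moreover have "complete_sym 0 = (1 :: 'a mseries)" by (rule mseries_eqI) (simp add: complete_sym_def coeff_one)
    ultimately show ?thesis using True by (simp add: p_mset_def z_mset_def)
  next
    case False
    have "of_nat n * complete_sym n = (\<Sum>k=1..n. power_sum k * ?Z (n - k))"
      unfolding complete_newton by (rule sum.cong) (simp_all add: less)
    also have "\<dots> = (\<Sum>(k, M)\<in>Sigma {1..n} (\<lambda>k. pos_msets (n - k)). smult_ms (1 / of_nat (z_mset M)) (power_sum k * p_mset M))"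
      unfolding sum_distrib_left smult_mult_right by (rule sum.Sigma) auto
    also have "\<dots> = (\<Sum>(M, k)\<in>Sigma (pos_msets n) set_mset. smult_ms (of_nat (k * count M k) / of_nat (z_mset M)) (p_mset M))"
    proof (rule sum.reindex_bij_witness[where i = "\<lambda>(M, k). (k, M - {#k#})" and j = "\<lambda>(k, M). (add_mset k M, k)"], goal_cases)
      case (4 x)
      then obtain M k where x: "x = (M, k)" "\<forall>x\<in>#M. 0 < x" "sum_mset M = n" "k \<in># M" by (auto simp: pos_msets_def)
      then obtain N where N: "M = add_mset k N" by (metis insert_DiffM)
      with x show ?case by (auto simp: pos_msets_def)
    next
      case (5 x)
      then obtain k M where x: "x = (k, M)" "k > 0" "\<forall>x\<in>#M. 0 < x" by (auto simp: pos_msets_def)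
      then have "of_nat (k * Suc (count M k)) / of_nat (z_mset (add_mset k M)) = (1 / of_nat (z_mset M) :: 'a)"
      proof -
        have nz: "of_nat (k * Suc (count M k)) \<noteq> (0 :: 'a)" using x(2) unfolding of_nat_eq_0_iff by simp
        show ?thesis
          unfolding z_mset_add of_nat_mult[of "k * Suc (count M k)"] by (rule nonzero_divide_mult_cancel_left[OF nz])
      qed
      with x show ?case by (simp add: p_mset_def del: of_nat_Suc of_nat_mult)
    qed (auto simp: pos_msets_def)
    also have "\<dots> = (\<Sum>M\<in>pos_msets n. \<Sum>k\<in>set_mset M. smult_ms (of_nat (k * count M k) / of_nat (z_mset M)) (p_mset M))"
      by (rule sum.Sigma[symmetric]) auto
    also have "\<dots> = (\<Sum>M\<in>pos_msets n. smult_ms (of_nat n * (1 / of_nat (z_mset M))) (p_mset M))"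
    proof (rule sum.cong[OF refl])
      fix M assume "M \<in> pos_msets n"
      then have "(\<Sum>k\<in>set_mset M. k * count M k) = n"
        by (simp add: pos_msets_def sum_set_mset_count)
      then have "(\<Sum>k\<in>set_mset M. of_nat (k * count M k) / of_nat (z_mset M)) = (of_nat n * (1 / of_nat (z_mset M)) :: 'a)"
        by (simp only: times_divide_eq_right mult_1_right flip: sum_divide_distrib of_nat_sum)
      then show "(\<Sum>k\<in>set_mset M. smult_ms (of_nat (k * count M k) / of_nat (z_mset M)) (p_mset M)) =
         (smult_ms (of_nat n * (1 / of_nat (z_mset M))) (p_mset M) :: 'a mseries)"
        by (simp only: flip: smult_sum_left)
    qed
    also have "\<dots> = smult_ms (of_nat n) (?Z n)" by (simp add: smult_sum_right)
    finally have "smult_ms (of_nat n) (complete_sym n) = smult_ms (of_nat n) (?Z n)" by (simp add: smult_of_nat)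
    then have "smult_ms (1 / of_nat n) (smult_ms (of_nat n) (complete_sym n)) = smult_ms (1 / of_nat n) (smult_ms (of_nat n) (?Z n))" by simp
    with False show ?thesis by simp
  qed
qed

lemma complete_sym_power_sums:
  "(complete_sym n :: 'a::field_char_0 mseries) = (\<Sum>la\<in>partitions n. smult_ms (1 / of_nat (z_partition la)) (sym_p la))"
  unfolding complete_sym_power_sums_mset
  by (subst sum.reindex_bij_betw[OF bij_mset_partitions, symmetric])
     (simp add: z_partition_mset sym_p_mset cong: sum.cong)

section \<open>Permutation characters and Frobenius' formula\<close>

definition symgroup :: "nat \<Rightarrow> (nat \<Rightarrow> nat) set" where
  "symgroup n = {w. w permutes {1..n}}"

lemma finite_symgroup [simp]: "finite (symgroup n)"
  by (simp add: symgroup_def finite_permutations)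

lemma card_symgroup: "card (symgroup n) = fact n"
  by (simp add: symgroup_def card_permutations[OF refl])

lemma symgroup_comp: "u \<in> symgroup n \<Longrightarrow> v \<in> symgroup n \<Longrightarrow> u \<circ> v \<in> symgroup n"
  by (simp add: symgroup_def permutes_compose)

lemma symgroup_id [simp]: "id \<in> symgroup n"
  by (simp add: symgroup_def permutes_id)

abbreviation pinv :: "(nat \<Rightarrow> nat) \<Rightarrow> nat \<Rightarrow> nat" where
  "pinv w \<equiv> inv_into UNIV w"

lemma symgroup_inv: "u \<in> symgroup n \<Longrightarrow> pinv u \<in> symgroup n"
  by (simp add: symgroup_def permutes_inv)

lemma symgroup_inv_o [simp]: "u \<in> symgroup n \<Longrightarrow> pinv u \<circ> u = id" "u \<in> symgroup n \<Longrightarrow> u \<circ> pinv u = id"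
  by (simp_all add: symgroup_def permutes_inv_o)

lemma symgroup_inv_inv [simp]: "u \<in> symgroup n \<Longrightarrow> pinv (pinv u) = u"
  by (simp add: symgroup_def permutes_inv_inv)

lemma comp_eq_iff:
  assumes "g \<in> symgroup n"
  shows "f \<circ> g = h \<longleftrightarrow> f = h \<circ> pinv g"
proof -
  have "f \<circ> g \<circ> pinv g = f" "h \<circ> pinv g \<circ> g = h" by (simp_all only: comp_assoc symgroup_inv_o[OF assms] comp_id)
  then show ?thesis by auto
qed

text \<open>Words with content M, on which permutations act by precomposition. For the content of a
  partition they are the cosets of a Young subgroup, and \<open>fix_count\<close> is the permutation
  character on them.\<close>

definition colorings :: "nat \<Rightarrow> 'c multiset \<Rightarrow> (nat \<Rightarrow> 'c) set" where
  "colorings n M = {f \<in> extensional {1..n}. image_mset f (mset_set {1..n}) = M}"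

lemma coloring_comp:
  assumes "f \<in> colorings n M" "u \<in> symgroup n"
  shows "f \<circ> u \<in> colorings n M"
proof -
  have u: "u permutes {1..n}" using assms(2) by (simp add: symgroup_def)
  have "f \<circ> u \<in> extensional {1..n}"
    using assms(1) permutes_not_in[OF u] by (auto simp: colorings_def extensional_def)
  moreover have "image_mset (f \<circ> u) (mset_set {1..n}) = image_mset f (image_mset u (mset_set {1..n}))"
    by (simp add: image_mset.compositionality)
  moreover have "image_mset u (mset_set {1..n}) = mset_set {1..n}"
    using u by (simp add: image_mset_mset_set permutes_inj_on permutes_image)
  ultimately show ?thesis using assms(1) by (simp add: colorings_def)
qed

lemma colorings_transitive:
  assumes "f \<in> colorings n M" "g \<in> colorings n M"
  obtains u where "u \<in> symgroup n" "f \<circ> u = g"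
proof -
  have e: "image_mset g (mset_set {1..n}) = image_mset f (mset_set {1..n})"
    using assms by (simp add: colorings_def)
  obtain p where p: "p permutes {1..n}" "\<forall>x\<in>{1..n}. g x = f (p x)"
    by (rule image_mset_eq_implies_permutes[OF _ e]) auto
  have "f \<circ> p = g"
  proof
    fix x show "(f \<circ> p) x = g x"
      using p assms permutes_not_in[OF p(1), of x] by (cases "x \<in> {1..n}") (auto simp: colorings_def extensional_def)
  qed
  with p show thesis by (intro that[of p]) (simp_all add: symgroup_def)
qed

lemma colorings_nonempty:
  assumes "size M = n"
  obtains f where "f \<in> colorings n M"
proof -
  obtain xs where xs: "mset xs = M" using ex_mset by blast
  then have len: "length xs = n" using assms by auto
  let ?f = "restrict (\<lambda>x. xs ! (x - 1)) {1..n}"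
  have "image_mset ?f (mset_set {1..n}) = image_mset (\<lambda>x. xs ! (x - 1)) (mset_set {1..n})"
    by (rule image_mset_cong) simp
  also have "\<dots> = image_mset (\<lambda>x. xs ! (x - 1)) (mset [1..<Suc n])"
    by (simp only: mset_upt atLeastLessThanSuc_atLeastAtMost)
  also have "\<dots> = mset (map (\<lambda>x. xs ! (x - 1)) [1..<Suc n])"
    by (simp only: mset_map)
  also have "map (\<lambda>x. xs ! (x - 1)) [1..<Suc n] = map (\<lambda>x. xs ! x) [0..<n]"
    by (simp only: map_Suc_upt[of 0 n, symmetric] One_nat_def map_map comp_def diff_Suc_Suc diff_0_eq_0 minus_nat.diff_0)
  also have "\<dots> = xs" using len map_nth by blast
  finally have "image_mset ?f (mset_set {1..n}) = M" unfolding xs .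
  then show thesis by (intro that[of ?f]) (simp only: colorings_def mem_Collect_eq restrict_extensional simp_thms)
qed

lemma finite_colorings [simp]: "finite (colorings n M)"
proof (rule finite_subset)
  show "colorings n M \<subseteq> {1..n} \<rightarrow>\<^sub>E set_mset M"
  proof
    fix f assume "f \<in> colorings n M"
    then have f: "f \<in> extensional {1..n}" "image_mset f (mset_set {1..n}) = M" by (auto simp: colorings_def)
    have "set_mset M = f ` {1..n}" unfolding f(2)[symmetric] by simp
    with f(1) show "f \<in> {1..n} \<rightarrow>\<^sub>E set_mset M" by (auto simp: PiE_def)
  qed
qed (intro finite_PiE, auto)

text \<open>By transitivity the permutations that carry f to g form a coset of the stabilizer of
  g.\<close>

lemma card_coloring_transporter:
  assumes f: "f \<in> colorings n M" and g: "g \<in> colorings n M"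
  shows "card {u \<in> symgroup n. f \<circ> u = g} = card {u \<in> symgroup n. g \<circ> u = g}"
proof -
  obtain p where p: "p \<in> symgroup n" "f \<circ> p = g" by (rule colorings_transitive[OF f g])
  have f': "f = g \<circ> pinv p" using p by (simp only: comp_eq_iff)
  have gp: "g \<circ> (pinv p \<circ> u) = f \<circ> u" "f \<circ> (p \<circ> u) = g \<circ> u" "pinv p \<circ> (p \<circ> u) = u" "p \<circ> (pinv p \<circ> u) = u" for u :: "nat \<Rightarrow> nat"
    by (simp_all only: comp_assoc[symmetric] f'[symmetric] p(2) symgroup_inv_o[OF p(1)] id_comp)
  have "bij_betw (\<lambda>u. pinv p \<circ> u) {u \<in> symgroup n. f \<circ> u = g} {u \<in> symgroup n. g \<circ> u = g}"
    by (rule bij_betw_byWitness[where f' = "\<lambda>u. p \<circ> u"]) (simp_all add: gp symgroup_comp symgroup_inv p(1) image_subset_iff)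
  then show ?thesis by (rule bij_betw_same_card)
qed

lemma sum_card_stabilizers:
  assumes "size M = n"
  shows "(\<Sum>f\<in>colorings n M. card {u \<in> symgroup n. f \<circ> u = f}) = fact n"
proof -
  obtain f0 where f0: "f0 \<in> colorings n M" by (rule colorings_nonempty[OF assms])
  have "(\<Sum>f\<in>colorings n M. card {u \<in> symgroup n. f \<circ> u = f}) = (\<Sum>f\<in>colorings n M. card {u \<in> symgroup n. f0 \<circ> u = f})"
    by (rule sum.cong[OF refl], rule card_coloring_transporter[OF f0, symmetric])
  also have "\<dots> = (\<Sum>f\<in>colorings n M. \<Sum>u\<in>{u \<in> symgroup n. f0 \<circ> u = f}. 1)" by simp
  also have "\<dots> = (\<Sum>u\<in>symgroup n. 1)"
    by (rule sum.group) (use coloring_comp[OF f0] in auto)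
  finally show ?thesis by (simp add: card_symgroup)
qed

text \<open>The flag \<open>e\<close> selects the sign character, which corresponds to elementary instead of complete
  symmetric functions.\<close>

definition bounded_mset :: "bool \<Rightarrow> 'c multiset \<Rightarrow> bool" where
  "bounded_mset e M \<longleftrightarrow> (e \<longrightarrow> (\<forall>c. count M c \<le> 1))"

text \<open>A color that occurs twice puts a transposition into the stabilizer, which makes the
  signs cancel; if all colors are distinct the stabilizer is trivial.\<close>

lemma sum_sign_stabilizer:
  assumes f: "f \<in> colorings n M"
  shows "(\<Sum>u\<in>{u \<in> symgroup n. f \<circ> u = f}. if e then sign u else 1) =
    (if bounded_mset e M then int (card {u \<in> symgroup n. f \<circ> u = f}) else 0)"
proof (cases e)
  case e: True
  let ?S = "{u \<in> symgroup n. f \<circ> u = f}"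
  have cnt: "count M c = card {x \<in> {1..n}. f x = c}" for c
  proof -
    have "M = image_mset f (mset_set {1..n})" using f by (simp add: colorings_def)
    then show ?thesis by (simp add: count_image_mset' eq_commute[of c])
  qed
  show ?thesis
  proof (cases "\<forall>c. count M c \<le> 1")
    case True
    have inj: "x = y" if "x \<in> {1..n}" "y \<in> {1..n}" "f x = f y" for x y
    proof -
      have "card {z \<in> {1..n}. f z = f y} \<le> 1" using True unfolding cnt by blast
      then show ?thesis using that card_le_Suc0_iff_eq[of "{z \<in> {1..n}. f z = f y}"] by auto
    qed
    have "?S = {id}"
    proof
      show "?S \<subseteq> {id}"
      proof
        fix u assume "u \<in> ?S"
        then have u: "u permutes {1..n}" "f \<circ> u = f" by (auto simp: symgroup_def)
        have "u x = x" for x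
        proof (cases "x \<in> {1..n}")
          case True
          then show ?thesis using inj[of "u x" x] permutes_in_image[OF u(1), of x] fun_cong[OF u(2), of x] by simp
        qed (simp add: permutes_not_in[OF u(1)])
        then show "u \<in> {id}" by auto
      qed
    qed simp
    with True e show ?thesis by (simp add: bounded_mset_def)
  next
    case False
    then obtain c where "card {x \<in> {1..n}. f x = c} > 1" unfolding cnt by (auto simp: not_le)
    then obtain x y where xy: "x \<in> {1..n}" "y \<in> {1..n}" "x \<noteq> y" "f x = f y"
      using card_le_Suc0_iff_eq[of "{x \<in> {1..n}. f x = c}"] by (auto simp: not_le[symmetric])
    let ?t = "transpose x y"
    have t: "?t permutes {1..n}" using xy by (intro permutes_swap_id) auto
    have ft: "f \<circ> ?t = f" using xy by (auto simp: fun_eq_iff transpose_def)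
    have m: "u \<circ> ?t \<in> ?S" if "u \<in> ?S" for u
    proof -
      have "f \<circ> (u \<circ> ?t) = f" using that ft by (simp flip: comp_assoc)
      moreover have "u \<circ> ?t \<in> symgroup n" using that t by (intro symgroup_comp) (simp_all add: symgroup_def)
      ultimately show ?thesis by simp
    qed
    have "(\<Sum>u\<in>?S. sign u) = (\<Sum>u\<in>?S. - sign u)"
    proof (rule sum.reindex_bij_witness[where i = "\<lambda>u. u \<circ> ?t" and j = "\<lambda>u. u \<circ> ?t"])
      fix u assume u: "u \<in> ?S"
      show "u \<circ> ?t \<circ> ?t = u" by (simp add: comp_assoc)
      show "u \<circ> ?t \<in> ?S" by (rule m[OF u])
      have "permutation u" "permutation ?t"
        using u t by (auto simp: symgroup_def permutation_permutes intro: exI[of _ "{1..n}"])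
      then show "- sign (u \<circ> ?t) = sign u" using xy by (simp add: sign_compose sign_swap_id)
    qed (use m in auto)
    then have "(\<Sum>u\<in>?S. sign u) = 0" by (simp add: sum_negf)
    then show ?thesis using e False by (simp only: bounded_mset_def simp_thms if_True if_False)
  qed
qed (simp add: bounded_mset_def)

section \<open>Pairs of colorings, and coefficients of products of h or e\<close>

definition fix_count :: "nat \<Rightarrow> 'c multiset \<Rightarrow> (nat \<Rightarrow> nat) \<Rightarrow> nat" where
  "fix_count n M u = card {f \<in> colorings n M. f \<circ> u = f}"

text \<open>Matrices of natural numbers with prescribed row and column sums, encoded as multisets of
  positions. The joint content of two colorings is such a matrix.\<close>

definition matrices :: "'c multiset \<Rightarrow> 'd multiset \<Rightarrow> ('c \<times> 'd) multiset set" where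
  "matrices A B = {M. image_mset fst M = A \<and> image_mset snd M = B}"

lemma finite_matrices [simp]: "finite (matrices A B)"
proof -
  have "matrices A B \<subseteq> mset ` {xs. set xs \<subseteq> set_mset A \<times> set_mset B \<and> length xs = size A}"
  proof
    fix M assume "M \<in> matrices A B"
    then have M: "image_mset fst M = A" "image_mset snd M = B" by (auto simp: matrices_def)
    obtain xs where xs: "mset xs = M" using ex_mset by blast
    have "set xs \<subseteq> set_mset A \<times> set_mset B" unfolding M[symmetric] xs[symmetric] by force
    moreover have "length xs = size A" unfolding M(1)[symmetric] xs[symmetric] by simp
    ultimately show "M \<in> mset ` {xs. set xs \<subseteq> set_mset A \<times> set_mset B \<and> length xs = size A}"
      using xs by (intro image_eqI[of _ _ xs]) auto
  qed
  then show ?thesis by (rule finite_subset) (intro finite_imageI finite_lists_length_eq finite_cartesian_product finite_set_mset)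
qed

lemma image_mset_restrict: "finite A \<Longrightarrow> image_mset (restrict g A) (mset_set A) = image_mset g (mset_set A)"
  by (rule image_mset_cong) simp

lemma pair_colorings:
  fixes A :: "'c multiset" and B :: "'d multiset"
  shows
  "bij_betw (\<lambda>F. (restrict (fst \<circ> F) {1..n}, restrict (snd \<circ> F) {1..n}))
    (\<Union>M\<in>matrices A B. colorings n M) (colorings n A \<times> colorings n B)"
proof (rule bij_betw_byWitness[where f' = "\<lambda>(b, f). restrict (\<lambda>x. (b x, f x)) {1..n}"], goal_cases)
  case 1
  show ?case by (auto simp: colorings_def fun_eq_iff extensional_def)
next
  case 2
  show ?case by (auto simp: colorings_def fun_eq_iff extensional_def)
next
  case 3
  show ?case
    by (auto simp: colorings_def matrices_def image_mset_restrict image_mset.compositionality)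
next
  case 4
  have "image_mset (h \<circ> restrict (\<lambda>x. (b x, f x)) {1..n}) (mset_set {1..n}) = image_mset (\<lambda>x. h (b x, f x)) (mset_set {1..n})"
    for h :: "'c \<times> 'd \<Rightarrow> 'e" and b :: "nat \<Rightarrow> 'c" and f :: "nat \<Rightarrow> 'd"
    by (rule image_mset_cong) simp
  from this[of fst] this[of snd] show ?case
    by (auto simp: colorings_def matrices_def image_mset.compositionality)
qed

lemma sum_fix_count_product:
  fixes A :: "'c multiset" and B :: "'d multiset" and s :: "(nat \<Rightarrow> nat) \<Rightarrow> int"
  shows "(\<Sum>u\<in>symgroup n. s u * int (fix_count n A u * fix_count n B u)) =
    (\<Sum>M\<in>matrices A B. \<Sum>F\<in>colorings n M. \<Sum>u\<in>{u \<in> symgroup n. F \<circ> u = F}. s u)"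
proof -
  let ?F = "\<Union>M\<in>matrices A B. colorings n M"
  have stab: "F \<circ> u = F \<longleftrightarrow> restrict (fst \<circ> F) {1..n} \<circ> u = restrict (fst \<circ> F) {1..n} \<and> restrict (snd \<circ> F) {1..n} \<circ> u = restrict (snd \<circ> F) {1..n}"
    if "u \<in> symgroup n" "F \<in> ?F" for F u
  proof -
    have u: "u permutes {1..n}" using that by (simp add: symgroup_def)
    have ext: "F x = undefined" if "x \<notin> {1..n}" for x
      using \<open>F \<in> ?F\<close> that by (auto simp: colorings_def extensional_def)
    have "F (u x) = F x \<longleftrightarrow> restrict (fst \<circ> F) {1..n} (u x) = restrict (fst \<circ> F) {1..n} x \<and> restrict (snd \<circ> F) {1..n} (u x) = restrict (snd \<circ> F) {1..n} x" for x
      using permutes_in_image[OF u, of x] permutes_not_in[OF u, of x]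
      by (cases "x \<in> {1..n}") (simp_all add: prod_eq_iff restrict_def)
    then show ?thesis unfolding fun_eq_iff comp_def by blast
  qed
  have "int (fix_count n A u * fix_count n B u) = (\<Sum>F\<in>?F. if F \<circ> u = F then 1 else 0)" if u: "u \<in> symgroup n" for u
  proof -
    have "int (fix_count n A u * fix_count n B u) = int (card ({b \<in> colorings n A. b \<circ> u = b} \<times> {f \<in> colorings n B. f \<circ> u = f}))"
      by (simp add: fix_count_def card_cartesian_product)
    also have "\<dots> = int (card {p \<in> colorings n A \<times> colorings n B. fst p \<circ> u = fst p \<and> snd p \<circ> u = snd p})"
      by (rule arg_cong[of _ _ "\<lambda>X. int (card X)"]) auto
    also have "\<dots> = (\<Sum>p\<in>{p \<in> colorings n A \<times> colorings n B. fst p \<circ> u = fst p \<and> snd p \<circ> u = snd p}. 1)" by simp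
    also have "\<dots> = (\<Sum>p\<in>colorings n A \<times> colorings n B. if fst p \<circ> u = fst p \<and> snd p \<circ> u = snd p then 1 else 0)"
      by (rule sum.inter_filter) (intro finite_cartesian_product finite_colorings)
    also have "\<dots> = (\<Sum>F\<in>?F. if F \<circ> u = F then 1 else 0)"
      by (subst sum.reindex_bij_betw[OF pair_colorings, symmetric], rule sum.cong[OF refl]) (simp only: stab[OF u] fst_conv snd_conv)
    finally show ?thesis .
  qed
  then have "(\<Sum>u\<in>symgroup n. s u * int (fix_count n A u * fix_count n B u)) =
     (\<Sum>u\<in>symgroup n. \<Sum>F\<in>?F. if F \<circ> u = F then s u else 0)"
    by (intro sum.cong refl) (simp add: sum_distrib_left if_distrib[of "\<lambda>x. _ * x"] cong: if_cong)
  also have "\<dots> = (\<Sum>F\<in>?F. \<Sum>u\<in>symgroup n. if F \<circ> u = F then s u else 0)" by (rule sum.swap)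
  also have "\<dots> = (\<Sum>F\<in>?F. \<Sum>u\<in>{u \<in> symgroup n. F \<circ> u = F}. s u)"
    by (rule sum.cong[OF refl], rule sum.inter_filter[symmetric]) simp
  also have "\<dots> = (\<Sum>M\<in>matrices A B. \<Sum>F\<in>colorings n M. \<Sum>u\<in>{u \<in> symgroup n. F \<circ> u = F}. s u)"
  proof (rule sum.UNION_disjoint)
    show "\<forall>i\<in>matrices A B. \<forall>j\<in>matrices A B. i \<noteq> j \<longrightarrow> colorings n i \<inter> colorings n j = {}"
      by (auto simp: colorings_def)
  qed simp_all
  finally show ?thesis .
qed

text \<open>Burnside's count for pairs of colorings, whose orbits are the matrices with the given
  margins. With signs an orbit contributes only if its stabilizers are trivial, that is, if all
  entries are at most 1.\<close>

lemma sum_fix_count_matrices: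
  assumes A: "size A = n"
  shows "(\<Sum>u\<in>symgroup n. (if e then sign u else 1) * int (fix_count n A u * fix_count n B u)) =
    fact n * int (card {M \<in> matrices A B. bounded_mset e M})"
proof -
  have st: "(\<Sum>F\<in>colorings n M. int (card {u \<in> symgroup n. F \<circ> u = F})) = fact n" if "M \<in> matrices A B" for M
    using arg_cong[OF sum_card_stabilizers[of M n], of int] that A by (auto simp: matrices_def)
  have "(\<Sum>u\<in>symgroup n. (if e then sign u else 1) * int (fix_count n A u * fix_count n B u)) =
     (\<Sum>M\<in>matrices A B. \<Sum>F\<in>colorings n M. if bounded_mset e M then int (card {u \<in> symgroup n. F \<circ> u = F}) else 0)"
    unfolding sum_fix_count_product by (intro sum.cong refl sum_sign_stabilizer)
  also have "\<dots> = (\<Sum>M\<in>matrices A B. if bounded_mset e M then fact n else 0)"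
    by (rule sum.cong) (simp_all add: st)
  also have "\<dots> = (\<Sum>M\<in>{M \<in> matrices A B. bounded_mset e M}. fact n)"
    by (rule sum.inter_filter[symmetric]) simp
  finally show ?thesis by simp
qed

definition mon_mset :: "(nat \<Rightarrow>\<^sub>0 nat) \<Rightarrow> nat multiset" where
  "mon_mset al = Abs_multiset (Poly_Mapping.lookup al)"

lemma count_mon_mset [simp]: "count (mon_mset al) = Poly_Mapping.lookup al"
  unfolding mon_mset_def
  by (rule Abs_multiset_inverse) (auto intro: finite_subset[OF _ finite_keys[of al]] simp: in_keys_iff)

definition mset_mon :: "nat multiset \<Rightarrow> nat \<Rightarrow>\<^sub>0 nat" where
  "mset_mon M = Abs_poly_mapping (count M)"

lemma lookup_mset_mon [simp]: "Poly_Mapping.lookup (mset_mon M) = count M"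
  unfolding mset_mon_def
  by (rule lookup_Abs_poly_mapping) (rule finite_subset[OF _ finite_set_mset[of M]], auto)

lemma mset_mon_inverse [simp]: "mon_mset (mset_mon M) = M"
  by (rule multiset_eqI) simp

lemma mon_mset_inverse [simp]: "mset_mon (mon_mset al) = al"
  by (rule poly_mapping_eqI) simp

lemma mon_mset_add: "mon_mset (al + be) = mon_mset al + mon_mset be"
  by (rule multiset_eqI) (simp add: lookup_add)

lemma mon_mset_eq_iff: "mon_mset al = mon_mset be \<longleftrightarrow> al = be"
  by (metis mon_mset_inverse)

lemma size_mon_mset: "size (mon_mset al) = monom_degree al"
proof -
  have "set_mset (mon_mset al) = Poly_Mapping.keys al" by (auto simp: set_mset_def in_keys_iff)
  then show ?thesis by (simp add: size_multiset_overloaded_eq monom_degree_def)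
qed

lemma monom_degree_mset_mon: "monom_degree (mset_mon M) = size M"
  using size_mon_mset[of "mset_mon M"] by simp

definition elem_or_complete :: "bool \<Rightarrow> nat \<Rightarrow> 'a::comm_ring_1 mseries" where
  "elem_or_complete e k = (if e then elem_sym k else complete_sym k)"

lemma coeff_elem_or_complete:
  "coeff_ms (elem_or_complete e k) al = (if bounded_mset e (mon_mset al) \<and> monom_degree al = k then 1 else 0)"
  by (auto simp: elem_or_complete_def elem_sym_def complete_sym_def bounded_mset_def)

text \<open>Each factor is a sum of distinct monomials, so the coefficient of the product counts the
  families of exponents, one from each factor, with sum \<open>al\<close>.\<close>

lemma coeff_prod_indicator:
  fixes F :: "'i \<Rightarrow> 'a::comm_ring_1 mseries"
  assumes "finite I" "\<And>i be. i \<in> I \<Longrightarrow> coeff_ms (F i) be = (if Q i be then 1 else 0)"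
  shows "coeff_ms (\<Prod>i\<in>I. F i) al = of_nat (card {g \<in> extensional I. (\<forall>i\<in>I. Q i (g i)) \<and> (\<Sum>i\<in>I. g i) = al})"
  using assms
proof (induction I arbitrary: al rule: finite_induct)
  case empty
  have "{g :: 'i \<Rightarrow> _. g \<in> extensional {} \<and> 0 = al} = (if al = 0 then {\<lambda>_. undefined} else {})" by auto
  then show ?case by (simp add: coeff_one)
next
  case (insert c P)
  let ?X = "\<lambda>ga. {g \<in> extensional P. (\<forall>i\<in>P. Q i (g i)) \<and> sum g P = ga}"
  let ?S = "{x \<in> splits al. Q c (fst x)}"
  have fin: "finite (?X ga)" for ga
  proof (rule finite_subset[OF _ finite_PiE])
    show "?X ga \<subseteq> (\<Pi>\<^sub>E i\<in>P. fst ` splits ga)"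
    proof (intro subsetI PiE_I)
      fix g i assume "g \<in> ?X ga" "i \<in> P"
      then have "g i + sum g (P - {i}) = ga" using sum.remove[OF insert.hyps(1), of i g] by simp
      then show "g i \<in> fst ` splits ga"
        by (intro image_eqI[of _ _ "(g i, sum g (P - {i}))"]) (simp_all add: splits_def)
    qed (auto simp: extensional_def)
  qed (simp_all add: insert.hyps(1) finite_splits)
  have "coeff_ms (\<Prod>i\<in>insert c P. F i) al = (\<Sum>x\<in>splits al. if Q c (fst x) then of_nat (card (?X (snd x))) else 0)"
    using insert by (simp add: coeff_mult case_prod_beta if_distrib[of "\<lambda>x. x * _"] cong: if_cong)
  also have "\<dots> = (\<Sum>x\<in>?S. of_nat (card (?X (snd x))))"
    by (rule sum.inter_filter[symmetric]) (rule finite_splits)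
  also have "\<dots> = of_nat (card (Sigma ?S (\<lambda>x. ?X (snd x))))"
    using finite_splits[of al] fin by (subst card_SigmaI) simp_all
  also have "card (Sigma ?S (\<lambda>x. ?X (snd x))) =
      card {g \<in> extensional (insert c P). (\<forall>i\<in>insert c P. Q i (g i)) \<and> (\<Sum>i\<in>insert c P. g i) = al}"
  proof -
    have upd: "(\<Sum>i\<in>P. if i = c then v else g i) = sum g P" for g :: "'i \<Rightarrow> _" and v
      using insert.hyps(2) by (intro sum.cong) auto
    have idem: "g(c := undefined) = g" if "g \<in> extensional P" for g
      using extensional_arb[OF that insert.hyps(2)] by (rule fun_upd_idem)
    show ?thesis
    proof (rule bij_betw_same_card[of "\<lambda>(x, g). g(c := fst x)"],
        rule bij_betw_byWitness[where f' = "\<lambda>g. ((g c, sum g P), g(c := undefined))"], goal_cases)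
      case 1
      show ?case by (auto simp: upd idem splits_def)
    next
      case 3
      show ?case using insert.hyps by (auto simp: upd splits_def extensional_def)
    next
      case 4
      show ?case using insert.hyps by (auto simp: upd splits_def extensional_def)
    qed auto
  qed
  finally show ?case .
qed

lemma count_image_Pair: "count (image_mset (Pair i) N) (i', j) = (if i' = i then count N j else 0)"
  by (induction N) auto

text \<open>Row i of a matrix is the exponent of the monomial that is taken from factor i;
  \<open>glue\<close> stacks the rows.\<close>

lemma coeff_prod_elem_or_complete:
  fixes I :: "nat set"
  assumes I: "finite I"
  shows "coeff_ms (\<Prod>i\<in>I. elem_or_complete e (a i) :: 'a::comm_ring_1 mseries) al =
    of_nat (card {M \<in> matrices (\<Sum>i\<in>I. replicate_mset (a i) i) (mon_mset al). bounded_mset e M})"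
proof -
  let ?Q = "\<lambda>i be. bounded_mset e (mon_mset be) \<and> monom_degree be = a i"
  let ?G = "{g \<in> extensional I. (\<forall>i\<in>I. ?Q i (g i)) \<and> (\<Sum>i\<in>I. g i) = al}"
  let ?M = "{M \<in> matrices (\<Sum>i\<in>I. replicate_mset (a i) i) (mon_mset al). bounded_mset e M}"
  define glue where "glue g = (\<Sum>i\<in>I. image_mset (Pair i) (mon_mset (g i)))" for g :: "nat \<Rightarrow> nat \<Rightarrow>\<^sub>0 nat"
  have count: "count (glue g) (i, j) = (if i \<in> I then Poly_Mapping.lookup (g i) j else 0)" for g i j
    using I by (simp add: glue_def count_sum count_image_Pair)
  have snd: "image_mset snd (glue g) = mon_mset (\<Sum>i\<in>I. g i)" for g
    using I unfolding glue_def
    by (induction I rule: finite_induct)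
      (simp_all add: mon_mset_add image_mset.compositionality comp_def, simp add: multiset_eq_iff)
  have fst: "image_mset fst (glue g) = (\<Sum>i\<in>I. replicate_mset (monom_degree (g i)) i)" for g
    using I unfolding glue_def
    by (induction I rule: finite_induct)
      (simp_all add: image_mset.compositionality comp_def image_mset_const_eq size_mon_mset)
  have bdd: "bounded_mset e (glue g) \<longleftrightarrow> (\<forall>i\<in>I. bounded_mset e (mon_mset (g i)))" for g
    by (auto simp: bounded_mset_def count)
  have "bij_betw glue ?G ?M"
  proof (rule bij_betw_imageI)
    show "inj_on glue ?G"
    proof (rule inj_onI)
      fix g h assume gh: "g \<in> ?G" "h \<in> ?G" "glue g = glue h"
      then have "g i = h i" if "i \<in> I" for i
        using count[of g i] count[of h i] that by (intro poly_mapping_eqI) simp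
      then show "g = h" using gh(1,2) by (auto intro: extensionalityI)
    qed
    show "glue ` ?G = ?M"
    proof
      show "glue ` ?G \<subseteq> ?M" by (auto simp: matrices_def snd fst bdd)
      show "?M \<subseteq> glue ` ?G"
      proof
        fix M assume M: "M \<in> ?M"
        let ?f = "\<lambda>i. image_mset snd {#p \<in># M. fst p = i#}"
        define g where "g = restrict (\<lambda>i. mset_mon (?f i)) I"
        have f: "count (?f i) j = count M (i, j)" "size (?f i) = count (image_mset fst M) i" for i j
          by (induction M) auto
        have fM: "image_mset fst M = (\<Sum>i\<in>I. replicate_mset (a i) i)" using M by (simp add: matrices_def)
        then have size: "size (?f i) = (if i \<in> I then a i else 0)" for i
          unfolding f(2) using I by (simp add: count_sum count_replicate_mset if_distrib cong: if_cong)
        have glue: "glue g = M"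
        proof (rule multiset_eqI)
          fix p show "count (glue g) p = count M p"
          proof (cases "fst p \<in> I")
            case True
            then show ?thesis using f(1)[of "fst p" "snd p"] count[of g "fst p" "snd p"] by (simp add: g_def)
          next
            case False
            then have "?f (fst p) = {#}" using size[of "fst p"] by (simp only: if_False size_eq_0_iff_empty)
            then have "count M p = 0" using f(1)[of "fst p" "snd p"] by (simp only: count_empty prod.collapse)
            then show ?thesis using False count[of g "fst p" "snd p"] by simp
          qed
        qed
        have "monom_degree (g i) = a i" if "i \<in> I" for i
          using size[of i] that by (simp add: g_def monom_degree_mset_mon)
        then have "g \<in> ?G"
          using M bdd[of g] snd[of g] unfolding glue by (simp add: matrices_def g_def mon_mset_eq_iff)
        with glue show "M \<in> glue ` ?G" by blast
      qed
    qed
  qed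
  from bij_betw_same_card[OF this] show ?thesis
    by (subst coeff_prod_indicator[OF I, of _ ?Q]) (simp_all add: coeff_elem_or_complete)
qed

definition part_content :: "nat list \<Rightarrow> nat multiset" where
  "part_content la = mon_mset (part_mon la)"

lemma part_content_sum: "(\<Sum>i\<in>{..<length la}. replicate_mset (la ! i) i) = part_content la"
proof (rule multiset_eqI)
  fix j
  have "count (\<Sum>i\<in>{..<length la}. replicate_mset (la ! i) i) j = (\<Sum>i<length la. if i = j then la ! i else 0)"
    by (simp add: count_sum count_replicate_mset if_distrib cong: if_cong)
  also have "\<dots> = count (part_content la) j" by (simp add: part_content_def part_fun_def)
  finally show "count (\<Sum>i\<in>{..<length la}. replicate_mset (la ! i) i) j = count (part_content la) j" .
qed

lemma size_part_content: "size (part_content la) = sum_list la"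
proof -
  have "size (\<Sum>i\<in>A. replicate_mset (la ! i) i) = (\<Sum>i\<in>A. la ! i)" if "finite A" for A
    using that by (induction A rule: finite_induct) auto
  from this[of "{..<length la}"]
  have "size (\<Sum>i\<in>{..<length la}. replicate_mset (la ! i) i) = (\<Sum>i<length la. la ! i)" by simp
  then show ?thesis by (simp add: part_content_sum sum_list_sum_nth atLeast0LessThan)
qed

text \<open>Both sides count the same matrices. Thus scalar products of permutation characters
  become coefficients of h, and those twisted by the sign become coefficients of e.\<close>

lemma coeff_sym_fix:
  assumes "sum_list la = n"
  shows "(\<Sum>u\<in>symgroup n. of_int (if e then sign u else 1) * of_nat (fix_count n (part_content la) u * fix_count n (mon_mset al) u)) =
      (fact n * coeff_ms (if e then sym_e la else sym_h la) al :: 'a::field_char_0)"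
proof -
  have "coeff_ms (if e then sym_e la else sym_h la :: 'a mseries) al =
      of_nat (card {M \<in> matrices (part_content la) (mon_mset al). bounded_mset e M})"
    using coeff_prod_elem_or_complete[of "{..<length la}" e "\<lambda>i. la ! i" al, where 'a = 'a]
    unfolding part_content_sum
    by (cases e) (simp_all add: elem_or_complete_def sym_e_def sym_h_def prod.list_conv_set_nth atLeast0LessThan)
  moreover have "(\<Sum>u\<in>symgroup n. (if e then sign u else 1) * int (fix_count n (part_content la) u * fix_count n (mon_mset al) u)) =
     fact n * int (card {M \<in> matrices (part_content la) (mon_mset al). bounded_mset e M})"
    by (rule sum_fix_count_matrices) (simp add: size_part_content assms)
  from arg_cong[OF this, of "of_int :: int \<Rightarrow> 'a"]
  have "(\<Sum>u\<in>symgroup n. of_int (if e then sign u else 1) * of_nat (fix_count n (part_content la) u * fix_count n (mon_mset al) u)) =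
     fact n * (of_nat (card {M \<in> matrices (part_content la) (mon_mset al). bounded_mset e M}) :: 'a)" by simp
  ultimately show ?thesis by simp
qed

lemmas coeff_sym_h_fix = coeff_sym_fix[where e = False, unfolded if_False of_int_1 mult_1_left]
  and coeff_sym_e_fix = coeff_sym_fix[where e = True, unfolded if_True]

section \<open>Power sums, cycle types and class sizes\<close>

lemma coeff_prod_power_sum:
  assumes P: "finite P" "\<And>c. c \<in> P \<Longrightarrow> 0 < k c"
  shows "coeff_ms (\<Prod>c\<in>P. power_sum (k c) :: 'a::comm_ring_1 mseries) al =
    of_nat (card {g \<in> extensional P. (\<Sum>c\<in>P. Poly_Mapping.single (g c) (k c)) = al})"
proof -
  let ?Q = "\<lambda>c be. \<exists>i. be = Poly_Mapping.single i (k c)"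
  let ?h = "\<lambda>g. restrict (\<lambda>c. Poly_Mapping.single (g c) (k c)) P"
  have some: "Poly_Mapping.single (SOME i. be = Poly_Mapping.single i (k c)) (k c) = be" if "?Q c be" for c be
    using someI_ex[OF that] by simp
  have "bij_betw ?h {g \<in> extensional P. (\<Sum>c\<in>P. Poly_Mapping.single (g c) (k c)) = al}
    {g \<in> extensional P. (\<forall>c\<in>P. ?Q c (g c)) \<and> sum g P = al}"
  proof (rule bij_betw_byWitness[where f' = "\<lambda>h. restrict (\<lambda>c. SOME i. h c = Poly_Mapping.single i (k c)) P"], goal_cases)
    case 1
    show ?case by (auto simp: extensional_def fun_eq_iff single_index_inj[OF P(2)])
  next
    case 2
    show ?case by (auto simp: extensional_def fun_eq_iff some)
  next
    case 4
    show ?case by (auto intro!: sum.cong simp: some)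
  qed auto
  from bij_betw_same_card[OF this] show ?thesis
    by (subst coeff_prod_indicator[OF P(1), of _ ?Q]) (simp_all add: power_sum_def)
qed

definition cycle_mset :: "nat \<Rightarrow> (nat \<Rightarrow> nat) \<Rightarrow> nat multiset" where
  "cycle_mset n u = image_mset card (mset_set (orbit u ` {1..n}))"

lemma orbit_symgroup:
  assumes u: "u \<in> symgroup n"
  shows "x \<in> orbit u x" "y \<in> orbit u x \<longleftrightarrow> orbit u y = orbit u x" "x \<in> {1..n} \<Longrightarrow> orbit u x \<subseteq> {1..n}"
    "finite (orbit u x)"
proof -
  have p: "u permutes {1..n}" using u by (simp add: symgroup_def)
  have perm: "permutation u" using p by (auto simp: permutation_permutes)
  show self: "x \<in> orbit u x" for x by (rule permutation_self_in_orbit[OF perm])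
  have "orbit u y = orbit u x" if "y \<in> orbit u x" by (rule orbit_cyclic_eq3[OF cyclic_on_orbit'[OF perm] that])
  then show "y \<in> orbit u x \<longleftrightarrow> orbit u y = orbit u x" using self[of y] by blast
  show "x \<in> {1..n} \<Longrightarrow> orbit u x \<subseteq> {1..n}" by (rule permutes_orbit_subset[OF p])
  show "finite (orbit u x)" by (rule finite_orbit[OF self])
qed

lemma sum_over_orbits:
  assumes u: "u \<in> symgroup n"
  shows "(\<Sum>x\<in>{1..n}. h (orbit u x)) = (\<Sum>c\<in>orbit u ` {1..n}. card c * h c :: nat)"
proof -
  have "(\<Sum>x\<in>{1..n}. h (orbit u x)) = (\<Sum>c\<in>orbit u ` {1..n}. \<Sum>x\<in>{x. x \<in> {1..n} \<and> orbit u x = c}. h (orbit u x))"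
    by (rule sum.image_gen) simp
  also have "\<dots> = (\<Sum>c\<in>orbit u ` {1..n}. card c * h c)"
  proof (rule sum.cong[OF refl])
    fix c assume "c \<in> orbit u ` {1..n}"
    then have "{x. x \<in> {1..n} \<and> orbit u x = c} = c" using orbit_symgroup(2,3)[OF u] by blast
    then have "(\<Sum>x\<in>{x. x \<in> {1..n} \<and> orbit u x = c}. h (orbit u x)) = (\<Sum>x\<in>c. h c)"
      by (intro sum.cong) auto
    then show "(\<Sum>x\<in>{x. x \<in> {1..n} \<and> orbit u x = c}. h (orbit u x)) = card c * h c" by simp
  qed
  finally show ?thesis .
qed

text \<open>A coloring fixed by u is constant on the cycles of u, and the choice of one variable for
  each cycle picks a term in the product of the power sums of the cycle lengths.\<close>

lemma coeff_p_mset_cycle: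
  assumes u: "u \<in> symgroup n"
  shows "coeff_ms (p_mset (cycle_mset n u) :: 'a::comm_ring_1 mseries) al = of_nat (fix_count n (mon_mset al) u)"
proof -
  let ?P = "orbit u ` {1..n}" and ?S = "\<lambda>g. \<Sum>c\<in>orbit u ` {1..n}. Poly_Mapping.single (g c) (card c)"
  \<comment> \<open>The inverse map reads the color of a cycle off at an arbitrary point of
    it.\<close>
  let ?f = "\<lambda>g. restrict (\<lambda>x. g (orbit u x)) {1..n}" and ?g = "\<lambda>f. restrict (\<lambda>c. f (SOME x. x \<in> c)) (orbit u ` {1..n})"
  note os = orbit_symgroup[OF u]
  have p: "u permutes {1..n}" using u by (simp add: symgroup_def)
  have "0 < card c" if "c \<in> ?P" for c using that os(1,4) by (auto simp: card_gt_0_iff)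
  moreover have "p_mset (cycle_mset n u) = (\<Prod>c\<in>?P. power_sum (card c) :: 'a mseries)"
    by (simp add: p_mset_def cycle_mset_def image_mset.compositionality comp_def prod_unfold_prod_mset)
  ultimately have "coeff_ms (p_mset (cycle_mset n u) :: 'a mseries) al = of_nat (card {g \<in> extensional ?P. ?S g = al})"
    using coeff_prod_power_sum[of ?P card al, where 'a = 'a] by simp
  also have "card {g \<in> extensional ?P. ?S g = al} = card {f \<in> colorings n (mon_mset al). f \<circ> u = f}"
  proof -
    have content: "image_mset (?f g) (mset_set {1..n}) = mon_mset (?S g)" for g
    proof (rule multiset_eqI)
      fix i
      have "count (image_mset (?f g) (mset_set {1..n})) i = (\<Sum>x\<in>{1..n}. if g (orbit u x) = i then 1 else 0)"
        by (simp add: image_mset_restrict count_image_mset' eq_commute[of i] flip: sum.inter_filter)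
      also have "\<dots> = count (mon_mset (?S g)) i"
        unfolding sum_over_orbits[OF u, of "\<lambda>c. if g c = i then 1 else 0"] by (simp add: lookup_sum lookup_single when_def if_distrib cong: if_cong)
      finally show "count (image_mset (?f g) (mset_set {1..n})) i = count (mon_mset (?S g)) i" .
    qed
    have some: "(SOME y. y \<in> orbit u x) \<in> orbit u x" for x using os(1) by (rule someI)
    have gf: "?g (?f g) = g" if "g \<in> extensional ?P" for g
    proof
      fix c show "?g (?f g) c = g c"
      proof (cases "c \<in> ?P")
        case True
        then obtain x where x: "x \<in> {1..n}" "c = orbit u x" by blast
        then show ?thesis using some[of x] os(2)[of "SOME y. y \<in> c" x] os(3)[OF x(1)] by auto
      qed (use that in \<open>auto simp: extensional_def\<close>)
    qed
    have const: "f y = f x" if f: "f \<circ> u = f" and y: "y \<in> orbit u x" for f :: "nat \<Rightarrow> nat" and x y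
    proof -
      have "f (u z) = f z" for z using fun_cong[OF f, of z] by simp
      with y show ?thesis by (induction rule: orbit.induct) simp_all
    qed
    have fg: "?f (?g f) = f" if f: "f \<in> extensional {1..n}" "f \<circ> u = f" for f :: "nat \<Rightarrow> nat"
    proof
      fix x show "?f (?g f) x = f x"
        using const[OF f(2) some[of x]] f(1) by (cases "x \<in> {1..n}") (auto simp: extensional_def)
    qed
    have "bij_betw ?f {g \<in> extensional ?P. ?S g = al} {f \<in> colorings n (mon_mset al). f \<circ> u = f}"
    proof (rule bij_betw_byWitness[where f' = ?g], goal_cases)
      case 3
      have "?f g \<circ> u = ?f g" for g
      proof
        fix x
        have "orbit u (u x) = orbit u x" using os(2)[of "u x" x] orbit.base[of u x] by blast
        then show "(?f g \<circ> u) x = ?f g x" using permutes_in_image[OF p, of x] by simp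
      qed
      then show ?case using content by (auto simp: colorings_def)
    next
      case 4
      have "?S (?g f) = al" if "f \<in> colorings n (mon_mset al)" "f \<circ> u = f" for f
        using content[of "?g f"] fg[of f] that by (simp add: colorings_def mon_mset_eq_iff del: restrict_apply)
      then show ?case by auto
    qed (use gf fg in \<open>auto simp: colorings_def simp del: restrict_apply\<close>)
    then show ?thesis by (rule bij_betw_same_card)
  qed
  finally show ?thesis by (simp add: fix_count_def)
qed

lemma cycle_mset_pos: "u \<in> symgroup n \<Longrightarrow> cycle_mset n u \<in> pos_msets n"
  using sum_over_orbits[of u n "\<lambda>_. 1"] orbit_symgroup[of u n]
  by (auto simp: pos_msets_def cycle_mset_def sum_unfold_sum_mset card_gt_0_iff)

text \<open>By counting dimensions: the \<open>sym_p la\<close> span all \<open>sym_h la\<close>, hence all \<open>sym_m la\<close>.\<close>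

lemma sym_p_independent:
  fixes c :: "nat list \<Rightarrow> 'a::field_char_0"
  assumes z: "(\<Sum>la\<in>partitions n. smult_ms (c la) (sym_p la)) = 0" and mu: "mu \<in> partitions n"
  shows "c mu = 0"
proof -
  interpret vector_space "smult_ms :: 'a \<Rightarrow> 'a mseries \<Rightarrow> 'a mseries"
    by unfold_locales (simp_all add: smult_add_left smult_add_right)
  let ?P = "sym_p ` partitions n :: 'a mseries set" and ?M = "sym_m ` partitions n :: 'a mseries set"
  have h: "(sym_h la :: 'a mseries) \<in> span ?P" if "la \<in> partitions n" for la
  proof -
    have eq: "sym_h la = smult_ms (1 / fact n)
        (\<Sum>u\<in>symgroup n. smult_ms (of_nat (fix_count n (part_content la) u)) (p_mset (cycle_mset n u)) :: 'a mseries)"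
      using that by (intro mseries_eqI) (simp add: coeff_p_mset_cycle coeff_sym_h_fix partitions_def flip: of_nat_mult)
    have "p_mset (cycle_mset n u) \<in> ?P" if "u \<in> symgroup n" for u
      using cycle_mset_pos[OF that] unfolding bij_betw_imp_surj_on[OF bij_mset_partitions[of n], symmetric]
      by (auto simp: sym_p_mset)
    then show ?thesis unfolding eq by (intro span_scale span_sum span_base)
  qed
  have "sym_s la \<in> span ?P" if "la \<in> partitions n" for la
    unfolding sym_s_sym_h[OF that] by (intro span_sum span_scale h)
  then have M: "?M \<subseteq> span ?P"
    by (auto simp: sym_m_sym_s[of _ n] intro!: span_sum span_scale)
  have inj_M: "inj_on (sym_m :: _ \<Rightarrow> 'a mseries) (partitions n)"
    by (rule inj_onI) (metis coeff_sym_m_part_mon zero_neq_one)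
  have "independent ?M"
  proof
    assume "dependent ?M"
    then obtain a where a: "\<exists>v\<in>?M. a v \<noteq> 0" "(\<Sum>v\<in>?M. smult_ms (a v) v) = 0" by (auto simp: dependent_finite)
    then have s: "(\<Sum>la\<in>partitions n. smult_ms (a (sym_m la)) (sym_m la)) = 0" by (simp add: sum.reindex[OF inj_M])
    have "a (sym_m nu) = 0" if "nu \<in> partitions n" for nu
      using arg_cong[OF s, of "\<lambda>f. coeff_ms f (part_mon nu)"] that
      by (simp add: coeff_sym_m_part_mon[OF _ that] if_distrib cong: if_cong)
    with a(1) show False by blast
  qed
  obtain B where B: "B \<subseteq> ?P" "independent B" "?P \<subseteq> span B" by (rule maximal_independent_subset)
  have fin: "finite B" using B(1) by (rule finite_subset) simp
  have "?M \<subseteq> span B" using M span_minimal[OF B(3) subspace_span] by blast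
  from independent_span_bound[OF fin \<open>independent ?M\<close> this]
  have le: "card (partitions n) \<le> card B" by (simp add: card_image[OF inj_M])
  then have BP: "B = ?P" using card_image_le[of "partitions n" "sym_p :: _ \<Rightarrow> 'a mseries"] by (intro card_seteq[OF _ B(1)]) simp_all
  then have inj: "inj_on (sym_p :: _ \<Rightarrow> 'a mseries) (partitions n)"
    using le card_image_le[of "partitions n" "sym_p :: _ \<Rightarrow> 'a mseries"] by (intro eq_card_imp_inj_on) simp_all
  have "(\<Sum>v\<in>?P. smult_ms (c (the_inv_into (partitions n) sym_p v)) v) = 0"
    using z by (simp add: sum.reindex[OF inj] the_inv_into_f_f[OF inj])
  from independentD[OF B(2)[unfolded BP] _ subset_refl this, of "sym_p mu"] show ?thesis
    using mu by (simp add: the_inv_into_f_f[OF inj])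
qed

lemma has_cycle_type_iff: "has_cycle_type n u la \<longleftrightarrow> u \<in> symgroup n \<and> cycle_mset n u = mset la"
  by (simp add: has_cycle_type_def symgroup_def cycle_mset_def)

lemma sum_over_cycle_types:
  fixes f :: "(nat \<Rightarrow> nat) \<Rightarrow> 'b::comm_monoid_add"
  shows "(\<Sum>u\<in>symgroup n. f u) = (\<Sum>la\<in>partitions n. \<Sum>u | has_cycle_type n u la. f u)"
proof -
  have "(\<Sum>u\<in>symgroup n. f u) = (\<Sum>M\<in>pos_msets n. \<Sum>u\<in>{u \<in> symgroup n. cycle_mset n u = M}. f u)"
    by (rule sum.group[symmetric]) (use cycle_mset_pos in auto)
  also have "\<dots> = (\<Sum>la\<in>partitions n. \<Sum>u\<in>{u \<in> symgroup n. cycle_mset n u = mset la}. f u)"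
    by (rule sum.reindex_bij_betw[OF bij_mset_partitions, symmetric])
  finally show ?thesis by (simp only: has_cycle_type_iff)
qed

lemma sum_fix_count: "(\<Sum>u\<in>symgroup n. fix_count n M u) = (if size M = n then fact n else 0)"
proof -
  have "(\<Sum>u\<in>symgroup n. fix_count n M u) = (\<Sum>u\<in>symgroup n. \<Sum>f\<in>{f \<in> colorings n M. f \<circ> u = f}. 1)"
    by (simp add: fix_count_def)
  also have "\<dots> = (\<Sum>f\<in>colorings n M. \<Sum>u\<in>{u \<in> symgroup n. f \<circ> u = f}. 1)"
    by (rule sum.swap_restrict) simp_all
  also have "\<dots> = (if size M = n then fact n else 0)"
  proof (cases "size M = n")
    case True
    then show ?thesis using sum_card_stabilizers[OF True] by simp
  next
    case False
    then have "colorings n M = {}" by (auto simp: colorings_def)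
    then show ?thesis using False by simp
  qed
  finally show ?thesis .
qed

text \<open>The average over S_n of the power sums of the cycle types is h_n, since every word of
  length n has orbit average 1. Comparison with the power sum expansion of h_n gives the class
  sizes, because power sums are linearly independent.\<close>

lemma class_size:
  assumes la: "la \<in> partitions n"
  shows "of_nat (card {u. has_cycle_type n u la}) = (fact n / of_nat (z_partition la) :: 'a::field_char_0)"
proof -
  let ?c = "\<lambda>la. of_nat (card {u. has_cycle_type n u la}) - fact n / of_nat (z_partition la) :: 'a"
  have "(\<Sum>la\<in>partitions n. smult_ms (?c la) (sym_p la)) = 0"
  proof (rule mseries_eqI)
    fix al
    have "of_nat (card {u. has_cycle_type n u la}) * coeff_ms (sym_p la :: 'a mseries) al =
        (\<Sum>u | has_cycle_type n u la. of_nat (fix_count n (mon_mset al) u))" for la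
    proof -
      have "coeff_ms (sym_p la :: 'a mseries) al = of_nat (fix_count n (mon_mset al) u)" if "has_cycle_type n u la" for u
        using coeff_p_mset_cycle[of u n al, where 'a = 'a] that by (simp add: sym_p_mset has_cycle_type_iff)
      then have "(\<Sum>u | has_cycle_type n u la. of_nat (fix_count n (mon_mset al) u)) =
          (\<Sum>u | has_cycle_type n u la. coeff_ms (sym_p la :: 'a mseries) al)"
        by (intro sum.cong) simp_all
      then show ?thesis by simp
    qed
    then have "(\<Sum>la\<in>partitions n. of_nat (card {u. has_cycle_type n u la}) * coeff_ms (sym_p la :: 'a mseries) al) =
       of_nat (\<Sum>u\<in>symgroup n. fix_count n (mon_mset al) u)"
      by (simp add: sum_over_cycle_types)
    also have "\<dots> = fact n * coeff_ms (complete_sym n :: 'a mseries) al"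
      unfolding sum_fix_count by (simp add: complete_sym_def size_mon_mset)
    also have "\<dots> = (\<Sum>la\<in>partitions n. fact n / of_nat (z_partition la) * coeff_ms (sym_p la :: 'a mseries) al)"
      by (subst complete_sym_power_sums) (simp add: sum_distrib_left)
    finally show "coeff_ms (\<Sum>la\<in>partitions n. smult_ms (?c la) (sym_p la)) al = coeff_ms 0 al"
      by (simp add: left_diff_distrib sum_subtractf)
  qed
  from sym_p_independent[OF this la] show ?thesis by simp
qed

lemma exists_cycle_type:
  assumes "la \<in> partitions n"
  shows "\<exists>u. has_cycle_type n u la"
proof (rule ccontr)
  assume "\<not> ?thesis"
  then have "{u. has_cycle_type n u la} = {}" by blast
  moreover have "z_partition la > 0" using assms z_mset_pos[of "mset la"] by (simp add: z_partition_mset partitions_def)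
  ultimately show False using class_size[OF assms, where 'a = rat] by simp
qed

lemma class_function_expansion:
  fixes F :: "(nat \<Rightarrow> nat) \<Rightarrow> 'a::field_char_0"
  assumes G: "\<And>la u. \<lbrakk>la \<in> partitions n; has_cycle_type n u la\<rbrakk> \<Longrightarrow> F u = G la"
  shows "fact n * coeff_ms (\<Sum>la\<in>partitions n. smult_ms (G la / of_nat (z_partition la)) (sym_p la)) al =
    (\<Sum>u\<in>symgroup n. F u * of_nat (fix_count n (mon_mset al) u))"
proof -
  have "(\<Sum>u\<in>symgroup n. F u * of_nat (fix_count n (mon_mset al) u)) =
     (\<Sum>la\<in>partitions n. \<Sum>u | has_cycle_type n u la. F u * of_nat (fix_count n (mon_mset al) u))"
    by (rule sum_over_cycle_types)
  also have "\<dots> = (\<Sum>la\<in>partitions n. \<Sum>u | has_cycle_type n u la. G la * coeff_ms (sym_p la) al)"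
  proof (intro sum.cong refl)
    fix la u assume la: "la \<in> partitions n" and u: "u \<in> {u. has_cycle_type n u la}"
    then have "u \<in> symgroup n" "cycle_mset n u = mset la" by (simp_all add: has_cycle_type_iff)
    then show "F u * of_nat (fix_count n (mon_mset al) u) = G la * coeff_ms (sym_p la) al"
      using coeff_p_mset_cycle[of u n al, where 'a = 'a] G[OF la] u by (simp add: sym_p_mset)
  qed
  also have "\<dots> = (\<Sum>la\<in>partitions n. fact n * (G la / of_nat (z_partition la) * coeff_ms (sym_p la) al))"
    by (rule sum.cong[OF refl]) (simp add: class_size)
  finally show ?thesis by (simp add: sum_distrib_left)
qed

text \<open>The irreducible characters of the symmetric group in terms of the permutation characters; the
  matrix is the inverse of the one expressing \<open>h\<close> through \<open>s\<close>.\<close>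

definition perm_char :: "nat \<Rightarrow> nat list \<Rightarrow> (nat \<Rightarrow> nat) \<Rightarrow> 'a::field_char_0" where
  "perm_char n mu u = (\<Sum>la\<in>partitions n. of_int (kinv n la mu) * of_nat (fix_count n (part_content la) u))"

lemma fix_count_cycle_mset:
  "u \<in> symgroup n \<Longrightarrow> v \<in> symgroup n \<Longrightarrow> cycle_mset n u = cycle_mset n v \<Longrightarrow>
    fix_count n (part_content la) u = fix_count n (part_content la) v"
  using coeff_p_mset_cycle[of u n "part_mon la", where 'a = int] coeff_p_mset_cycle[of v n "part_mon la", where 'a = int]
  by (simp add: part_content_def)

lemma perm_char_cycle_type:
  "has_cycle_type n u la \<Longrightarrow> has_cycle_type n v la \<Longrightarrow> perm_char n mu u = perm_char n mu v"
  unfolding perm_char_def has_cycle_type_iff by (simp add: fix_count_cycle_mset[of u n v])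

text \<open>Averages of products of permutation characters are coefficients of h, and
  \<open>kinv\<close> passes from h to s. The values G are left abstract because the formula is
  applied over the rationals and over \<open>ratfun\<close>, there with constants coming from Specht
  modules.\<close>

lemma frobenius:
  assumes mu: "mu \<in> partitions n"
    and G: "\<And>la u. \<lbrakk>la \<in> partitions n; has_cycle_type n u la\<rbrakk> \<Longrightarrow> G la = perm_char n mu u"
  shows "(\<Sum>la\<in>partitions n. smult_ms (G la / of_nat (z_partition la)) (sym_p la)) = (sym_s mu :: 'a::field_char_0 mseries)"
proof (rule mseries_eqI)
  fix al
  have "fact n * coeff_ms (\<Sum>la\<in>partitions n. smult_ms (G la / of_nat (z_partition la)) (sym_p la)) al =
    (\<Sum>u\<in>symgroup n. perm_char n mu u * of_nat (fix_count n (mon_mset al) u))"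
    by (rule class_function_expansion) (simp add: G)
  also have "\<dots> = (\<Sum>la\<in>partitions n. of_int (kinv n la mu) *
      (\<Sum>u\<in>symgroup n. of_nat (fix_count n (part_content la) u * fix_count n (mon_mset al) u)))"
    unfolding perm_char_def sum_distrib_right sum_distrib_left by (subst sum.swap) (simp add: mult.assoc)
  also have "\<dots> = (\<Sum>la\<in>partitions n. of_int (kinv n la mu) * (fact n * coeff_ms (sym_h la :: 'a mseries) al))"
    by (rule sum.cong[OF refl], subst coeff_sym_h_fix) (simp_all add: partitions_def)
  also have "\<dots> = fact n * coeff_ms (sym_s mu :: 'a mseries) al"
    unfolding sym_s_sym_h[OF mu] by (simp add: sum_distrib_left mult.left_commute)
  finally show "coeff_ms (\<Sum>la\<in>partitions n. smult_ms (G la / of_nat (z_partition la)) (sym_p la)) al =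
    coeff_ms (sym_s mu :: 'a mseries) al" by simp
qed

section \<open>Projections with Kostka trace numbers\<close>

text \<open>A copy of \<^locale>\<open>vector_space\<close>, so that new definitions do not clash with its interpretations.\<close>

locale trace_space = vector_space scale
  for scale :: "'a::field \<Rightarrow> 'b::ab_group_add \<Rightarrow> 'b" (infixr \<open>*s\<close> 75)
begin

definition lin :: "('b \<Rightarrow> 'b) \<Rightarrow> bool" where
  "lin f \<longleftrightarrow> (\<forall>x y. f (x + y) = f x + f y) \<and> (\<forall>c x. f (c *s x) = c *s f x)"

lemma linD: "lin f \<Longrightarrow> f (x + y) = f x + f y" "lin f \<Longrightarrow> f (c *s x) = c *s f x"
  by (simp_all add: lin_def)

lemma lin_zero: "lin f \<Longrightarrow> f 0 = 0"
  using linD(2)[of f 0 0] by simp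

lemma lin_diff: "lin f \<Longrightarrow> f (x - y) = f x - f y"
  using linD(1)[of f "x - y" y] by simp

lemma lin_sum: "lin f \<Longrightarrow> f (\<Sum>i\<in>I. a i *s v i) = (\<Sum>i\<in>I. a i *s f (v i))"
  by (induction I rule: infinite_finite_induct) (simp_all add: lin_zero linD)

lemma lin_comp: "lin f \<Longrightarrow> lin g \<Longrightarrow> lin (\<lambda>x. f (g x))"
  by (simp add: lin_def)

lemma lin_span:
  assumes "lin f" "\<And>c. c \<in> C \<Longrightarrow> f c \<in> span D" "x \<in> span C"
  shows "f x \<in> span D"
  using assms(3)
proof (induction rule: span_induct_alt)
  case base
  then show ?case by (simp add: lin_zero[OF assms(1)] span_zero)
next
  case (step c x y)
  then show ?case by (simp add: linD[OF assms(1)] span_add span_scale assms(2))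
qed

definition btrace :: "'b set \<Rightarrow> ('b \<Rightarrow> 'b) \<Rightarrow> 'a" where
  "btrace C f = (\<Sum>c\<in>C. representation C (f c) c)"

lemma representation_combination:
  assumes "independent B" "\<And>i. i \<in> I \<Longrightarrow> v i \<in> span B"
  shows "representation B (\<Sum>i\<in>I. a i *s v i) b = (\<Sum>i\<in>I. a i * representation B (v i) b)"
  using assms by (simp add: representation_sum representation_scale span_scale)

lemma expand:
  assumes "finite B" "independent B" "x \<in> span B"
  shows "x = (\<Sum>b\<in>B. representation B x b *s b)"
  using sum_representation_eq[OF assms(2,3,1)] by simp

lemma btrace_cong: "(\<And>c. c \<in> C \<Longrightarrow> f c = g c) \<Longrightarrow> btrace C f = btrace C g"
  by (simp add: btrace_def)

lemma representation_comp:
  assumes C: "finite C" "independent C" and D: "finite D" "independent D" "span C = span D"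
    and f: "lin f" "\<And>x. x \<in> span C \<Longrightarrow> f x \<in> span C" and x: "x \<in> span C"
  shows "representation C (f x) c = (\<Sum>d\<in>D. representation D x d * representation C (f d) c)"
proof -
  have fd: "f d \<in> span C" if "d \<in> D" for d using that D(3) by (intro f(2)) (simp add: span_base)
  have "x \<in> span D" using x unfolding D(3) .
  then have "f x = f (\<Sum>d\<in>D. representation D x d *s d)" by (rule arg_cong[OF expand[OF D(1,2)]])
  also have "\<dots> = (\<Sum>d\<in>D. representation D x d *s f d)" by (rule lin_sum[OF f(1)])
  finally have "representation C (f x) c = representation C (\<Sum>d\<in>D. representation D x d *s f d) c" by (rule arg_cong)
  also have "\<dots> = (\<Sum>d\<in>D. representation D x d * representation C (f d) c)"
    by (rule representation_combination[OF C(2) fd])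
  finally show ?thesis .
qed

text \<open>Admitting two bases of the same space gives tr(f g) = tr(g f) and, with g the identity,
  independence of the basis in one computation.\<close>

lemma btrace_comp_commute:
  assumes C: "finite C" "independent C" and D: "finite D" "independent D" "span C = span D"
    and f: "lin f" "\<And>x. x \<in> span C \<Longrightarrow> f x \<in> span C" and g: "lin g" "\<And>x. x \<in> span C \<Longrightarrow> g x \<in> span C"
  shows "btrace C (\<lambda>x. f (g x)) = btrace D (\<lambda>x. g (f x))"
proof -
  have sC: "c \<in> C \<Longrightarrow> c \<in> span C" for c by (rule span_base)
  have sD: "d \<in> D \<Longrightarrow> d \<in> span C" for d unfolding D(3) by (rule span_base)
  have "btrace C (\<lambda>x. f (g x)) = (\<Sum>c\<in>C. \<Sum>d\<in>D. representation D (g c) d * representation C (f d) c)"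
    unfolding btrace_def by (rule sum.cong[OF refl]) (rule representation_comp[OF C D f g(2)[OF sC]])
  also have "\<dots> = (\<Sum>d\<in>D. \<Sum>c\<in>C. representation C (f d) c * representation D (g c) d)"
    by (subst sum.swap) (simp add: mult.commute)
  also have "\<dots> = btrace D (\<lambda>x. g (f x))"
    unfolding btrace_def
  proof (rule sum.cong[OF refl])
    fix d assume "d \<in> D"
    then have "f d \<in> span D" unfolding D(3)[symmetric] by (intro f(2) sD)
    then show "(\<Sum>c\<in>C. representation C (f d) c * representation D (g c) d) = representation D (g (f d)) d"
      by (intro representation_comp[OF D(1,2) C D(3)[symmetric] g(1), symmetric]) (simp_all add: g(2) flip: D(3))
  qed
  finally show ?thesis .
qed

lemma btrace_change_basis:
  assumes C: "finite C" "independent C" and D: "finite D" "independent D" "span C = span D"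
    and f: "lin f" "\<And>x. x \<in> span C \<Longrightarrow> f x \<in> span C"
  shows "btrace C f = btrace D f"
  using btrace_comp_commute[OF C D f, of "\<lambda>x. x"] by (simp add: lin_def)

lemma btrace_add:
  assumes "independent C" "\<And>c. c \<in> C \<Longrightarrow> f c \<in> span C" "\<And>c. c \<in> C \<Longrightarrow> g c \<in> span C"
  shows "btrace C (\<lambda>x. f x + g x) = btrace C f + btrace C g"
  using assms by (simp add: btrace_def representation_add sum.distrib)

lemma btrace_scale:
  assumes "independent C" "\<And>c. c \<in> C \<Longrightarrow> f c \<in> span C"
  shows "btrace C (\<lambda>x. a *s f x) = a * btrace C f"
  using assms by (simp add: btrace_def representation_scale sum_distrib_left)

lemma extend_to_basis:
  assumes C: "finite C" and B: "independent B" "B \<subseteq> span C"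
  obtains D where "B \<subseteq> D" "finite D" "independent D" "span D = span C"
proof -
  obtain D where D: "B \<subseteq> D" "D \<subseteq> span C" "independent D" "span C \<subseteq> span D"
    using maximal_independent_subset_extend[OF B(2,1)] by blast
  have "finite D" using independent_span_bound[OF C D(3,2)] by simp
  moreover have "span D = span C" using D(2,4) span_minimal[OF D(2) subspace_span] by blast
  ultimately show thesis using D by (intro that)
qed

lemma finite_independent_in_span: "finite C \<Longrightarrow> independent B \<Longrightarrow> B \<subseteq> span C \<Longrightarrow> finite B"
  using independent_span_bound[of C B] by simp

lemma subspace_basis:
  assumes "finite C" "subspace U" "U \<subseteq> span C"
  obtains B where "finite B" "independent B" "span B = U"
proof -
  obtain B where B: "B \<subseteq> U" "independent B" "U \<subseteq> span B" by (rule maximal_independent_subset)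
  have "finite B" using finite_independent_in_span[OF assms(1) B(2)] B(1) assms(3) by blast
  moreover have "span B = U" using B span_minimal[OF B(1) assms(2)] by blast
  ultimately show thesis using B(2) by (intro that)
qed

text \<open>In a basis that extends one of the subspace, the additional vectors have zero as their
  diagonal entries.\<close>

lemma btrace_into_subspace:
  assumes D: "finite D" "independent D" and C: "finite C" "independent C" "C \<subseteq> span D"
    and F: "lin F" "\<And>x. x \<in> span D \<Longrightarrow> F x \<in> span C"
  shows "btrace D F = btrace C F"
proof -
  obtain E where E: "C \<subseteq> E" "finite E" "independent E" "span E = span D"
    by (rule extend_to_basis[OF D(1) C(2,3)])
  have sub: "span C \<subseteq> span D" by (rule span_minimal[OF C(3) subspace_span])
  have "btrace D F = btrace E F"
    by (rule btrace_change_basis[OF D E(2,3) E(4)[symmetric] F(1)]) (rule subsetD[OF sub F(2)])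
  also have "\<dots> = (\<Sum>e\<in>E. representation C (F e) e)"
    unfolding btrace_def
  proof (rule sum.cong[OF refl])
    fix e assume "e \<in> E"
    then have "e \<in> span D" unfolding E(4)[symmetric] by (rule span_base)
    then show "representation E (F e) e = representation C (F e) e"
      using representation_extend[OF E(3) F(2) E(1)] by simp
  qed
  also have "\<dots> = (\<Sum>e\<in>C. representation C (F e) e)"
    by (rule sum.mono_neutral_right[OF E(2,1)]) (auto dest: representation_ne_zero)
  finally show ?thesis by (simp add: btrace_def)
qed

text \<open>P projects along U and stands in for the passage to cosets. In the basis chosen by
  \<open>trace_on_quotient\<close> the vectors in U contribute nothing to the trace of f P, and on
  the others f and f P differ by elements of U.\<close>

lemma btrace_on_quotient:
  assumes D: "finite D" "independent D" and U: "subspace U" "U \<subseteq> span D"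
    and f: "lin f" "\<And>x. x \<in> span D \<Longrightarrow> f x \<in> span D" "\<And>x. x \<in> U \<Longrightarrow> f x \<in> U"
    and P: "lin P" "\<And>x. x \<in> span D \<Longrightarrow> P x \<in> span D" "\<And>x. x \<in> U \<Longrightarrow> P x = 0"
      "\<And>x. x \<in> span D \<Longrightarrow> x - P x \<in> U"
  shows "trace_on_quotient (span D) U f = btrace D (\<lambda>x. f (P x))"
proof -
  let ?Q = "\<lambda>(B, C). B \<subseteq> C \<and> independent C \<and> span B = U \<and> span C = span D"
  obtain B0 where B0: "finite B0" "independent B0" "span B0 = U" by (rule subspace_basis[OF D(1) U])
  have "B0 \<subseteq> span D" using B0(3) U(2) span_superset[of B0] by blast
  then obtain C0 where "B0 \<subseteq> C0" "finite C0" "independent C0" "span C0 = span D"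
    by (rule extend_to_basis[OF D(1) B0(2)])
  then have "?Q (B0, C0)" using B0(3) by simp
  then have Q: "?Q (SOME x. ?Q x)" by (rule someI[of ?Q])
  obtain B C where BC: "(SOME x. ?Q x) = (B, C)" by fastforce
  have B: "B \<subseteq> C" "span B = U" and C: "independent C" "span C = span D" using Q unfolding BC by simp_all
  have "C \<subseteq> span D" unfolding C(2)[symmetric] by (rule span_superset)
  then have finC: "finite C" by (rule finite_independent_in_span[OF D(1) C(1)])
  have indB: "independent B" using C(1) B(1) by (rule independent_mono)
  have "btrace D (\<lambda>x. f (P x)) = btrace C (\<lambda>x. f (P x))"
    by (rule btrace_change_basis[OF D finC C(1) C(2)[symmetric] lin_comp[OF f(1) P(1)]]) (intro f(2) P(2))
  also have "\<dots> = (\<Sum>c\<in>C - B. representation C (f (P c)) c)"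
    unfolding btrace_def
  proof (rule sum.mono_neutral_right[OF finC])
    show "\<forall>c\<in>C - (C - B). representation C (f (P c)) c = 0"
    proof
      fix c assume "c \<in> C - (C - B)"
      then have "c \<in> U" using B by (auto intro: span_base)
      then show "representation C (f (P c)) c = 0" by (simp add: P(3) lin_zero[OF f(1)] representation_zero)
    qed
  qed auto
  also have "\<dots> = (\<Sum>c\<in>C - B. representation C (f c) c)"
  proof (rule sum.cong[OF refl])
    fix c assume c: "c \<in> C - B"
    then have cD: "c \<in> span D" unfolding C(2)[symmetric] by (intro span_base) simp
    have U': "f (c - P c) \<in> span B" unfolding B(2) by (intro f(3) P(4) cD)
    have "representation C (f (c - P c)) c = representation B (f (c - P c)) c"
      using representation_extend[OF C(1) U' B(1)] by simp
    also have "\<dots> = 0" using c representation_ne_zero[of B "f (c - P c)" c] by auto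
    finally have "representation C (f (c - P c)) c = 0" .
    moreover have "f c \<in> span C" "f (P c) \<in> span C" unfolding C(2) by (intro f(2) P(2) cD)+
    ultimately show "representation C (f (P c)) c = representation C (f c) c"
      by (simp add: lin_diff[OF f(1)] representation_diff C(1))
  qed
  also have "\<dots> = trace_on_quotient (span D) U f"
    unfolding trace_on_quotient_def BC by simp
  finally show ?thesis ..
qed

lemma btrace_idempotent:
  assumes D: "finite D" "independent D" and P: "lin P" "\<And>x. x \<in> span D \<Longrightarrow> P x \<in> span D"
    "\<And>x. x \<in> span D \<Longrightarrow> P (P x) = P x"
  obtains B where "finite B" "independent B" "span B = P ` span D" "btrace D P = of_nat (card B)"
proof -
  have sub: "subspace (P ` span D)"
    unfolding subspace_def
  proof (intro conjI ballI allI)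
    show "0 \<in> P ` span D" by (rule image_eqI[of _ _ 0]) (simp_all add: lin_zero[OF P(1)] span_zero)
    fix x assume "x \<in> P ` span D"
    then obtain u where u: "x = P u" "u \<in> span D" by blast
    show "c *s x \<in> P ` span D" for c
      by (rule image_eqI[of _ _ "c *s u"]) (simp_all add: u linD[OF P(1)] span_scale)
    fix y assume "y \<in> P ` span D"
    then obtain v where v: "y = P v" "v \<in> span D" by blast
    show "x + y \<in> P ` span D"
      by (rule image_eqI[of _ _ "u + v"]) (simp_all add: u v linD[OF P(1)] span_add)
  qed
  have "P ` span D \<subseteq> span D" using P(2) by (rule image_subsetI)
  then obtain B where B: "finite B" "independent B" "span B = P ` span D" by (rule subspace_basis[OF D(1) sub])
  have BD: "B \<subseteq> span D" using span_superset[of B] \<open>P ` span D \<subseteq> span D\<close> unfolding B(3) by (rule subset_trans)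
  have Pb: "P b = b" if b: "b \<in> B" for b
  proof -
    have "b \<in> P ` span D" unfolding B(3)[symmetric] using b by (rule span_base)
    then obtain x where x: "b = P x" "x \<in> span D" by blast
    show ?thesis unfolding x(1) by (rule P(3)[OF x(2)])
  qed
  have "btrace D P = btrace B P"
    by (rule btrace_into_subspace[OF D B(1,2) BD P(1)]) (simp add: B(3))
  also have "\<dots> = (\<Sum>b\<in>B. 1)"
    unfolding btrace_def by (rule sum.cong[OF refl]) (simp add: Pb representation_basis[OF B(2)])
  finally have "btrace D P = of_nat (card B)" by simp
  with B show thesis by (rule that)
qed

text \<open>The trace of a projection is its rank, and in characteristic 0 the rank is recovered
  from the trace. Ranks 0 and 1 are the cases that matter for the pairings below.\<close>

lemma btrace_idempotent_cases:
  assumes D: "finite D" "independent D" and P: "lin P" "\<And>x. x \<in> span D \<Longrightarrow> P x \<in> span D"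
    "\<And>x. x \<in> span D \<Longrightarrow> P (P x) = P x" and char: "\<And>k. of_nat k = (0::'a) \<Longrightarrow> k = 0"
  shows "\<exists>k. btrace D P = of_nat k"
    and "btrace D P = 0 \<Longrightarrow> x \<in> span D \<Longrightarrow> P x = 0"
    and "btrace D P = 1 \<Longrightarrow> \<exists>v. v \<noteq> 0 \<and> v \<in> P ` span D \<and> (\<forall>x\<in>span D. \<exists>a. P x = a *s v)"
    and "v \<noteq> 0 \<Longrightarrow> v \<in> P ` span D \<Longrightarrow> (\<And>x. x \<in> span D \<Longrightarrow> \<exists>a. P x = a *s v) \<Longrightarrow> btrace D P = 1"
proof -
  obtain B where B: "finite B" "independent B" "span B = P ` span D" "btrace D P = of_nat (card B)"
    by (rule btrace_idempotent[OF D P])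
  show "\<exists>k. btrace D P = of_nat k" using B(4) ..
  show "P x = 0" if "btrace D P = 0" "x \<in> span D"
  proof -
    have "card B = 0" using that(1) B(4) by (intro char) simp
    then have "B = {}" using B(1) by simp
    then have "P ` span D = {0}" using B(3) by simp
    then show ?thesis using that(2) by blast
  qed
  show "\<exists>v. v \<noteq> 0 \<and> v \<in> P ` span D \<and> (\<forall>x\<in>span D. \<exists>a. P x = a *s v)" if "btrace D P = 1"
  proof -
    have "card B \<noteq> 0" using that B(4) by (metis of_nat_0 zero_neq_one)
    moreover have "card B - 1 = 0"
    proof (rule char)
      have "of_nat (card B) = (of_nat (card B - 1) + 1 :: 'a)"
        using \<open>card B \<noteq> 0\<close> by (metis Suc_pred' neq0_conv of_nat_Suc add.commute)
      then show "of_nat (card B - 1) = (0 :: 'a)" using that B(4) by simp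
    qed
    ultimately have "card B = 1" by simp
    then obtain v where v: "B = {v}" by (rule card_1_singletonE)
    have "v \<noteq> 0" using B(2) dependent_zero[of B] v by auto
    moreover have "v \<in> P ` span D" unfolding B(3)[symmetric] v by (rule span_base) simp
    moreover have "\<exists>a. P x = a *s v" if "x \<in> span D" for x
    proof -
      have "P x \<in> span {v}" using that B(3) v by blast
      then show ?thesis by (auto simp: span_singleton)
    qed
    ultimately show ?thesis by blast
  qed
  show "btrace D P = 1" if "v \<noteq> 0" and vP: "v \<in> P ` span D" and ex: "\<And>x. x \<in> span D \<Longrightarrow> \<exists>a. P x = a *s v"
  proof -
    have iv: "independent {v}" using that(1) by simp
    have "btrace D P = btrace {v} P"
    proof (rule btrace_into_subspace[OF D _ iv _ P(1)])
      show "{v} \<subseteq> span D" using that(2) image_subsetI[of "span D" P "span D", OF P(2)] by blast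
      show "P x \<in> span {v}" if "x \<in> span D" for x
        using ex[OF that] by (auto simp: span_singleton)
    qed simp
    also have "\<dots> = 1"
    proof -
      obtain x where x: "v = P x" "x \<in> span D" using vP by blast
      have "P v = v" unfolding x(1) by (rule P(3)[OF x(2)])
      then show ?thesis by (simp add: btrace_def representation_basis[OF iv])
    qed
    finally show ?thesis .
  qed
qed

end

text \<open>The algebra is the span of B inside a possibly larger ring: the group algebra of S_n
  will be found inside the monoid algebra of all maps on the natural numbers.\<close>

locale star_algebra = trace_space scale
  for scale :: "'k::linordered_field \<Rightarrow> 'h::ring_1 \<Rightarrow> 'h" (infixr \<open>*s\<close> 75) +
  fixes B :: "'h set" and star :: "'h \<Rightarrow> 'h"
  assumes finite_basis: "finite B" and independent_basis: "independent B"
    and mult_scale_left: "(c *s x) * y = c *s (x * y)"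
    and mult_scale_right: "x * (c *s y) = c *s (x * y)"
    and one_closed: "1 \<in> span B"
    and mult_closed: "\<lbrakk>x \<in> span B; y \<in> span B\<rbrakk> \<Longrightarrow> x * y \<in> span B"
    and star_closed: "x \<in> span B \<Longrightarrow> star x \<in> span B"
    and star_star: "x \<in> span B \<Longrightarrow> star (star x) = x"
    and star_mult: "\<lbrakk>x \<in> span B; y \<in> span B\<rbrakk> \<Longrightarrow> star (x * y) = star y * star x"
    and star_add: "\<lbrakk>x \<in> span B; y \<in> span B\<rbrakk> \<Longrightarrow> star (x + y) = star x + star y"
    and star_scale: "x \<in> span B \<Longrightarrow> star (c *s x) = c *s star x"
    and star_definite: "\<lbrakk>x \<in> span B; star x * x = 0\<rbrakk> \<Longrightarrow> x = 0"
begin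

abbreviation A :: "'h set" where "A \<equiv> span B"

text \<open>If b is a projection this is the character of the left ideal A b at g
  (\<open>Tr_ideal\<close>); with projections on both sides it is the dimension of g A b.\<close>

definition Tr :: "'h \<Rightarrow> 'h \<Rightarrow> 'k" where
  "Tr g b = btrace B (\<lambda>x. g * x * b)"

lemma lin_mult: "lin (\<lambda>x. g * x * b)"
  by (simp add: lin_def distrib_left distrib_right mult_scale_left mult_scale_right)

lemma lin_mult_left: "lin (\<lambda>x. g * x)"
  by (simp add: lin_def distrib_left mult_scale_right)

lemma lin_mult_right: "lin (\<lambda>x. x * b)"
  by (simp add: lin_def distrib_right mult_scale_left)

lemma basis_in [simp]: "b \<in> B \<Longrightarrow> b \<in> A"
  by (rule span_base)

lemma Tr_add_right: "g \<in> A \<Longrightarrow> b \<in> A \<Longrightarrow> b' \<in> A \<Longrightarrow> Tr g (b + b') = Tr g b + Tr g b'"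
  unfolding Tr_def by (simp add: distrib_left btrace_add[OF independent_basis] mult_closed)

lemma Tr_scale_right: "g \<in> A \<Longrightarrow> b \<in> A \<Longrightarrow> Tr g (c *s b) = c * Tr g b"
  unfolding Tr_def by (simp add: mult_scale_right btrace_scale[OF independent_basis] mult_closed)

lemma Tr_add_left: "g \<in> A \<Longrightarrow> g' \<in> A \<Longrightarrow> b \<in> A \<Longrightarrow> Tr (g + g') b = Tr g b + Tr g' b"
  unfolding Tr_def by (simp add: distrib_right btrace_add[OF independent_basis] mult_closed)

lemma Tr_scale_left: "g \<in> A \<Longrightarrow> b \<in> A \<Longrightarrow> Tr (c *s g) b = c * Tr g b"
  unfolding Tr_def by (simp add: mult_scale_left btrace_scale[OF independent_basis] mult_closed)

lemma Tr_commute_right: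
  assumes "g \<in> A" "b \<in> A" "c \<in> A"
  shows "Tr g (b * c) = Tr g (c * b)"
  using btrace_comp_commute[OF finite_basis independent_basis finite_basis independent_basis refl
      lin_mult_right[of c] _ lin_mult[of g b]] assms
  by (simp add: Tr_def mult_closed mult.assoc)

lemma Tr_commute_left:
  assumes "g \<in> A" "b \<in> A" "c \<in> A"
  shows "Tr (b * c) g = Tr (c * b) g"
  using btrace_comp_commute[OF finite_basis independent_basis finite_basis independent_basis refl
      lin_mult_left[of b] _ lin_mult[of c g]] assms
  by (simp add: Tr_def mult_closed mult.assoc)

section \<open>Projections, primitive projections and multiplicities\<close>

definition proj :: "'h \<Rightarrow> bool" where
  "proj e \<longleftrightarrow> e \<in> A \<and> star e = e \<and> e * e = e"

lemma projD: "proj e \<Longrightarrow> e \<in> A" "proj e \<Longrightarrow> star e = e" "proj e \<Longrightarrow> e * e = e" "proj e \<Longrightarrow> e * (e * x) = e * x"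
  by (simp_all add: proj_def flip: mult.assoc)

lemma star_zero: "star 0 = 0"
  using star_scale[of 0 0] by (simp add: span_zero)

lemma star_diff: "x \<in> A \<Longrightarrow> y \<in> A \<Longrightarrow> star (x - y) = star x - star y"
  using star_add[of "x - y" y] by (simp add: span_diff)

lemma char0: "of_nat k = (0 :: 'k) \<Longrightarrow> k = 0"
  by simp

lemma Tr_proj:
  assumes e: "proj e" and f: "proj f"
  shows "\<exists>k. Tr e f = of_nat k"
    and "Tr e f = 0 \<Longrightarrow> x \<in> A \<Longrightarrow> e * x * f = 0"
    and "Tr e f = 1 \<Longrightarrow> \<exists>c\<in>A. c \<noteq> 0 \<and> e * c = c \<and> c * f = c \<and> (\<forall>x\<in>A. \<exists>a. e * x * f = a *s c)"
    and "\<lbrakk>c \<noteq> 0; c \<in> A; e * c = c; c * f = c; \<And>x. x \<in> A \<Longrightarrow> \<exists>a. e * x * f = a *s c\<rbrakk> \<Longrightarrow> Tr e f = 1"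
proof -
  note eA = projD(1)[OF e] and fA = projD(1)[OF f]
  have P: "e * x * f \<in> A" if "x \<in> A" for x using that by (intro mult_closed eA fA)
  have PP: "e * (e * x * f) * f = e * x * f" if "x \<in> A" for x
    by (simp add: mult.assoc projD(4)[OF e] projD(3)[OF f])
  note T = btrace_idempotent_cases[OF finite_basis independent_basis lin_mult, folded Tr_def]
  show "\<exists>k. Tr e f = of_nat k" by (rule T(1)) (fact P PP char0)+
  show "e * x * f = 0" if "Tr e f = 0" "x \<in> A"
    by (rule T(2)) (fact P PP char0 that)+
  show "\<exists>c\<in>A. c \<noteq> 0 \<and> e * c = c \<and> c * f = c \<and> (\<forall>x\<in>A. \<exists>a. e * x * f = a *s c)" if one: "Tr e f = 1"
  proof -
    have "\<exists>v. v \<noteq> 0 \<and> v \<in> (\<lambda>x. e * x * f) ` A \<and> (\<forall>x\<in>A. \<exists>a. e * x * f = a *s v)"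
      by (rule T(3)) (fact P PP char0 one)+
    then obtain v where v: "v \<noteq> 0" "v \<in> (\<lambda>x. e * x * f) ` A" "\<forall>x\<in>A. \<exists>a. e * x * f = a *s v"
      by blast
    then obtain y where y: "v = e * y * f" "y \<in> A" by blast
    have "e * v = v" unfolding y(1) using projD(3)[OF e] by (simp flip: mult.assoc)
    moreover have "v * f = v" unfolding y(1) using projD(3)[OF f] by (simp add: mult.assoc)
    moreover have "v \<in> A" unfolding y(1) by (rule P[OF y(2)])
    ultimately show ?thesis using v by blast
  qed
  show "Tr e f = 1" if h: "c \<noteq> 0" "c \<in> A" "e * c = c" "c * f = c" and one: "\<And>x. x \<in> A \<Longrightarrow> \<exists>a. e * x * f = a *s c"
  proof -
    have "c \<in> (\<lambda>x. e * x * f) ` A" by (rule image_eqI[of _ _ c]) (simp_all add: h)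
    then show ?thesis by (intro T(4)[of e f c] P PP char0 h(1) one)
  qed
qed

lemma star_one: "star 1 = 1"
proof -
  have "star (1 * star 1) = star (star 1) * star 1" by (rule star_mult[OF one_closed star_closed[OF one_closed]])
  then show ?thesis by (simp add: star_star[OF one_closed])
qed

lemma proj_one: "proj 1"
  by (simp add: proj_def one_closed star_one)

text \<open>The corner of d consists of scalars over the given field, so d stays primitive under
  every field extension.\<close>

definition prim :: "'h \<Rightarrow> bool" where
  "prim d \<longleftrightarrow> proj d \<and> d \<noteq> 0 \<and> (\<forall>h\<in>A. \<exists>a. d * h * d = a *s d)"

lemma prim_proj: "prim d \<Longrightarrow> proj d"
  by (simp add: prim_def)

lemma star_mult_self_nonzero: "c \<in> A \<Longrightarrow> c \<noteq> 0 \<Longrightarrow> star c * c \<noteq> 0"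
  using star_definite by blast

lemma mult_star_self_nonzero: "c \<in> A \<Longrightarrow> c \<noteq> 0 \<Longrightarrow> c * star c \<noteq> 0"
proof
  assume c: "c \<in> A" "c \<noteq> 0" and "c * star c = 0"
  then have "star (star c) * star c = 0" by (simp add: star_star)
  then have "star c = 0" by (intro star_definite[OF star_closed[OF c(1)]])
  then have "star (star c) = 0" by (simp add: star_zero)
  with c show False by (simp add: star_star)
qed

text \<open>The scalar k may fail to be a square, so c itself is not normalized; dividing
  \<open>star c * c\<close> and \<open>c * star c\<close> by k takes no root.\<close>

lemma partial_isometry:
  assumes c: "c \<in> A" "c \<noteq> 0" and k: "c * star c * c = k *s c"
  shows "k \<noteq> 0" "proj (inverse k *s (star c * c))" "proj (inverse k *s (c * star c))"
    "c * (inverse k *s (star c * c)) = c" "inverse k *s (c * star c) * c = c"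
proof -
  have sc: "star c \<in> A" by (rule star_closed[OF c(1)])
  have y: "c * star c \<in> A" by (intro mult_closed c sc)
  have ys: "star (c * star c) = c * star c" by (simp add: star_mult c sc star_star)
  \<comment> \<open>Definiteness is applied to the selfadjoint element \<open>c * star c\<close>,
    whose square would be 0.\<close>
  show k0: "k \<noteq> 0"
  proof
    assume "k = 0"
    then have "c * star c * c = 0" using k by simp
    moreover have "c * star c * (c * star c) = c * star c * c * star c" by (simp only: mult.assoc)
    ultimately have "star (c * star c) * (c * star c) = 0" unfolding ys by simp
    then have "c * star c = 0" by (rule star_definite[OF y])
    with mult_star_self_nonzero[OF c] show False ..
  qed
  have k': "star c * (c * star c) = k *s star c"
    using arg_cong[OF k, of star] by (simp add: star_mult mult_closed c sc star_star star_scale mult.assoc)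
  show "c * (inverse k *s (star c * c)) = c" "inverse k *s (c * star c) * c = c"
    using k k0 by (simp_all add: mult_scale_right mult_scale_left flip: mult.assoc)
  have 1: "star c * c * (star c * c) = k *s (star c * c)"
    using k by (simp add: mult.assoc mult_scale_right)
  have 2: "c * star c * (c * star c) = k *s (c * star c)"
    using k' by (simp add: mult.assoc mult_scale_right)
  show "proj (inverse k *s (star c * c))"
    unfolding proj_def using k0 1
    by (simp add: span_scale mult_closed c sc star_scale star_mult star_star mult_scale_left mult_scale_right)
  show "proj (inverse k *s (c * star c))"
    unfolding proj_def using k0 2
    by (simp add: span_scale mult_closed c sc star_scale star_mult star_star mult_scale_left mult_scale_right)
qed

text \<open>Every product c x c lies in the one-dimensional corner of e and f. So
  \<open>c * star c * c\<close> is a multiple of c, and the corner of d reduces to products of the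
  form \<open>c * (h * star c) * c\<close>.\<close>

lemma prim_from_corner:
  assumes e: "proj e" and f: "proj f" and c: "c \<in> A" "c \<noteq> 0" "e * c = c" "c * f = c"
    and one: "\<And>x. x \<in> A \<Longrightarrow> \<exists>a. e * x * f = a *s c"
  shows "\<exists>k. k \<noteq> 0 \<and> prim (inverse k *s (star c * c)) \<and> c * (inverse k *s (star c * c)) = c"
proof -
  have sc: "star c \<in> A" by (rule star_closed[OF c(1)])
  have one': "\<exists>a. c * x * c = a *s c" if x: "x \<in> A" for x
  proof -
    have "e * (c * x * c) * f = (e * c) * x * (c * f)" by (simp only: mult.assoc)
    moreover have "\<exists>a. e * (c * x * c) * f = a *s c" by (intro one mult_closed c x)
    ultimately show ?thesis by (simp only: c(3,4))
  qed
  obtain k where k: "c * star c * c = k *s c" using one'[OF sc] by blast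
  note pi = partial_isometry[OF c(1,2) k]
  let ?d = "inverse k *s (star c * c)"
  have "\<exists>a. ?d * h * ?d = a *s ?d" if h: "h \<in> A" for h
  proof -
    obtain a where a: "c * (h * star c) * c = a *s c" using one'[of "h * star c"] h sc mult_closed by blast
    have "star c * c * h * (star c * c) = star c * (c * (h * star c) * c)" by (simp only: mult.assoc)
    also have "\<dots> = a *s (star c * c)" unfolding a by (rule mult_scale_right)
    finally have "?d * h * ?d = (inverse k * (inverse k * a)) *s (star c * c)"
      by (simp add: mult_scale_left mult_scale_right)
    also have "\<dots> = (inverse k * a) *s ?d" by (simp add: mult_ac)
    finally show ?thesis ..
  qed
  moreover have "?d \<noteq> 0" using star_mult_self_nonzero[OF c(1,2)] pi(1) by simp
  ultimately have "prim ?d" using pi(2) by (simp add: prim_def)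
  with pi(1,4) show ?thesis by blast
qed

text \<open>For c = e x d the element \<open>star c * c\<close> lies in the corner of d and so is a
  multiple of d; \<open>c * star c\<close>, divided by the same scalar, is a copy of d below e.
  Cyclicity of \<open>Tr\<close> in each argument gives both the same traces. The form y d z will
  show membership in two-sided ideals.\<close>

lemma split_off:
  assumes e: "proj e" and d: "prim d" and x: "x \<in> A" "e * x * d \<noteq> 0"
  shows "\<exists>d'. proj d' \<and> d' \<noteq> 0 \<and> e * d' = d' \<and> d' * e = d' \<and> (\<forall>g\<in>A. Tr g d' = Tr g d \<and> Tr d' g = Tr d g) \<and>
    (\<exists>y\<in>A. \<exists>z\<in>A. d' = y * d * z)"
proof -
  define c where "c = e * x * d"
  have eA: "e \<in> A" and dA: "d \<in> A" using e d by (auto simp: proj_def prim_def)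
  have c: "c \<in> A" "c \<noteq> 0" unfolding c_def using x by (auto intro!: mult_closed eA dA)
  have sc: "star c \<in> A" by (rule star_closed[OF c(1)])
  have ec: "e * c = c" unfolding c_def using projD(3)[OF e] by (simp flip: mult.assoc)
  have cd: "c * d = c" unfolding c_def using projD(3)[OF prim_proj[OF d]] by (simp add: mult.assoc)
  have dsc: "d * star c = star c"
    using arg_cong[OF cd, of star] projD(2)[OF prim_proj[OF d]] by (simp add: star_mult c dA)
  have sce: "star c * e = star c"
    using arg_cong[OF ec, of star] projD(2)[OF e] by (simp add: star_mult c eA)
  obtain k where k: "d * (star c * c) * d = k *s d" using d mult_closed[OF sc c(1)] unfolding prim_def by blast
  have scc: "star c * c = k *s d"
  proof -
    have "d * (star c * c) * d = (d * star c) * (c * d)" by (simp only: mult.assoc)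
    then show ?thesis using k unfolding dsc cd by simp
  qed
  have k2: "c * star c * c = k *s c" by (simp add: mult.assoc scc mult_scale_right cd)
  note pi = partial_isometry[OF c k2]
  let ?d = "inverse k *s (c * star c)"
  have d_eq: "d = inverse k *s (star c * c)" unfolding scc using pi(1) by simp
  have "proj ?d" by (rule pi(3))
  moreover have "?d \<noteq> 0" using mult_star_self_nonzero[OF c] pi(1) by simp
  moreover have "e * ?d = ?d" by (simp add: mult_scale_right ec flip: mult.assoc)
  moreover have "?d * e = ?d" by (simp add: mult_scale_left mult.assoc sce)
  moreover have "Tr g ?d = Tr g d \<and> Tr ?d g = Tr d g" if g: "g \<in> A" for g
  proof
    show "Tr g ?d = Tr g d"
      unfolding d_eq using Tr_commute_right[OF g c(1) sc] by (simp add: Tr_scale_right g c sc mult_closed)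
    show "Tr ?d g = Tr d g"
      unfolding d_eq using Tr_commute_left[OF g c(1) sc] by (simp add: Tr_scale_left g c sc mult_closed)
  qed
  moreover have "?d = c * d * (inverse k *s star c)" by (simp add: cd mult_scale_right)
  moreover have "inverse k *s star c \<in> A" by (intro span_scale sc)
  ultimately show ?thesis using c(1) by blast
qed

text \<open>The copy of d' below d lies in the corner of d, so it is a nonzero idempotent multiple
  of d and hence d itself.\<close>

lemma Tr_eq_if_corner:
  assumes d: "prim d" and d': "prim d'" and x: "x \<in> A" "d * x * d' \<noteq> 0" and g: "g \<in> A"
  shows "Tr g d = Tr g d'"
proof -
  obtain p where p: "proj p" "p \<noteq> 0" "d * p = p" "p * d = p" "\<forall>g\<in>A. Tr g p = Tr g d' \<and> Tr p g = Tr d' g"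
    using split_off[OF prim_proj[OF d] d' x] by blast
  obtain a where a: "d * p * d = a *s d" using d projD(1)[OF p(1)] unfolding prim_def by blast
  then have pa: "p = a *s d" using p(3,4) by simp
  have dA: "d \<in> A" and dd: "d * d = d" and d0: "d \<noteq> 0" using d by (auto simp: prim_def proj_def)
  have "p * p = p" using p(1) by (simp add: proj_def)
  then have "(a * a) *s d = a *s d" unfolding pa by (simp add: mult_scale_left mult_scale_right dd)
  then have "a * a = a" using d0 by (simp add: scale_cancel_right)
  moreover have "a \<noteq> 0" using p(2) pa by auto
  ultimately have "a = 1" by simp
  then have "p = d" using pa by simp
  then show ?thesis using p(5) g by simp
qed

lemma Tr_prim_self: "prim d \<Longrightarrow> Tr d d = 1"
  by (rule Tr_proj(4)[of d d d]) (auto simp: prim_def proj_def)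

lemma proj_diff:
  assumes e: "proj e" and d: "proj d" and ed: "e * d = d" "d * e = d"
  shows "proj (e - d)"
  using projD[OF e] projD[OF d] ed
  by (simp add: proj_def span_diff star_diff left_diff_distrib right_diff_distrib)

text \<open>Copies of the D i are split off from e as long as some corner of e and D i is nonzero.
  Orthogonality makes \<open>Tr e (D i)\<close> the number of copies of D i, and the rest r has zero
  corners with all of them.\<close>

lemma decompose:
  fixes D :: "'i \<Rightarrow> 'h"
  assumes I: "finite I" and D: "\<And>i. i \<in> I \<Longrightarrow> prim (D i)"
    and orth: "\<And>i j x. \<lbrakk>i \<in> I; j \<in> I; i \<noteq> j; x \<in> A\<rbrakk> \<Longrightarrow> D i * x * D j = 0"
    and e: "proj e"
  shows "\<exists>r. proj r \<and> e * r = r \<and> (\<forall>i\<in>I. \<forall>x\<in>A. r * x * D i = 0) \<and>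
    e - r \<in> span {y * D i * z | y i z. y \<in> A \<and> i \<in> I \<and> z \<in> A} \<and>
    (\<forall>g\<in>A. Tr g e = (\<Sum>i\<in>I. Tr e (D i) * Tr g (D i)) + Tr g r)"
proof -
  let ?J = "span {y * D i * z | y i z. y \<in> A \<and> i \<in> I \<and> z \<in> A}"
  have DA: "D i \<in> A" if "i \<in> I" for i using prim_proj[OF D[OF that]] by (rule projD(1))
  note one = proj_one
  have delta: "Tr (D i) (D j) = (if i = j then 1 else 0)" if "i \<in> I" "j \<in> I" for i j
  proof (cases "i = j")
    case False
    have "btrace B (\<lambda>x. D i * x * D j) = 0"
      unfolding btrace_def using orth[OF that False] by (simp add: representation_zero)
    with False show ?thesis by (simp add: Tr_def)
  qed (use Tr_prim_self[OF D] that in simp)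
  \<comment> \<open>The dimension of e A serves as induction measure; it drops with every copy that
    is split off.\<close>
  obtain n where "Tr e 1 = of_nat n" using Tr_proj(1)[OF e one] by blast
  then show ?thesis using e
  proof (induction n arbitrary: e rule: less_induct)
    case (less n)
    note e = less.prems(2)
    note eA = projD(1)[OF e]
    show ?case
    proof (cases "\<forall>i\<in>I. \<forall>x\<in>A. e * x * D i = 0")
      case True
      have "Tr e (D i) = 0" if "i \<in> I" for i
      proof -
        have "btrace B (\<lambda>x. e * x * D i) = 0"
          unfolding btrace_def using True that by (simp add: representation_zero)
        then show ?thesis by (simp add: Tr_def)
      qed
      then show ?thesis using e True projD(3)[OF e] by (intro exI[of _ e]) (simp add: span_zero)
    next
      case False
      then obtain i x where i: "i \<in> I" "x \<in> A" "e * x * D i \<noteq> 0" by blast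
      obtain d y z where d: "proj d" "d \<noteq> 0" "e * d = d" "d * e = d"
        "\<forall>g\<in>A. Tr g d = Tr g (D i) \<and> Tr d g = Tr (D i) g" "y \<in> A" "z \<in> A" "d = y * D i * z"
        using split_off[OF e D[OF i(1)] i(2,3)] by blast
      note dA = projD(1)[OF d(1)]
      define e' where "e' = e - d"
      have e': "proj e'" unfolding e'_def by (rule proj_diff[OF e d(1,3,4)])
      note e'A = projD(1)[OF e']
      obtain m where m: "Tr d 1 = of_nat m" using Tr_proj(1)[OF d(1) one] by blast
      have "m \<noteq> 0"
      proof
        assume "m = 0"
        then have "d * 1 * 1 = 0" using m by (intro Tr_proj(2)[OF d(1) one _ one_closed]) simp
        with d(2) show False by simp
      qed
      obtain n' where n': "Tr e' 1 = of_nat n'" using Tr_proj(1)[OF e' one] by blast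
      have ee: "e = d + e'" by (simp add: e'_def)
      have "Tr e 1 = Tr d 1 + Tr e' 1" unfolding ee by (rule Tr_add_left[OF dA e'A one_closed])
      then have "of_nat n = (of_nat (m + n') :: 'k)" using less.prems(1) m n' by simp
      then have "n = m + n'" by (simp only: of_nat_eq_iff)
      with \<open>m \<noteq> 0\<close> have "n' < n" by simp
      from less.IH[OF this n' e'] obtain r where r: "proj r" "e' * r = r" "\<forall>i\<in>I. \<forall>x\<in>A. r * x * D i = 0"
        "e' - r \<in> ?J" "\<forall>g\<in>A. Tr g e' = (\<Sum>i\<in>I. Tr e' (D i) * Tr g (D i)) + Tr g r" by blast
      have "e * e' = e'" unfolding e'_def using projD(3)[OF e] d(3) by (simp add: right_diff_distrib)
      then have "e * (e' * r) = e' * r" by (simp only: mult.assoc[symmetric])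
      then have "e * r = r" by (simp only: r(2))
      moreover have "e - r \<in> ?J"
      proof -
        have "d \<in> ?J" using d(6-8) i(1) by (intro span_base) blast
        then have "d + (e' - r) \<in> ?J" using r(4) by (rule span_add)
        then show ?thesis by (simp add: e'_def)
      qed
      moreover have "Tr g e = (\<Sum>j\<in>I. Tr e (D j) * Tr g (D j)) + Tr g r" if g: "g \<in> A" for g
      proof -
        have "Tr e (D j) = (if j = i then 1 else 0) + Tr e' (D j)" if j: "j \<in> I" for j
        proof -
          have "Tr e (D j) = Tr d (D j) + Tr e' (D j)" unfolding ee by (rule Tr_add_left[OF dA e'A DA[OF j]])
          then show ?thesis using d(5) DA[OF j] delta[OF i(1) j] by auto
        qed
        then have "(\<Sum>j\<in>I. Tr e (D j) * Tr g (D j)) = (\<Sum>j\<in>I. (if j = i then Tr g (D j) else 0) + Tr e' (D j) * Tr g (D j))"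
          by (intro sum.cong) (auto simp: distrib_right)
        also have "\<dots> = Tr g (D i) + (\<Sum>j\<in>I. Tr e' (D j) * Tr g (D j))"
          using I i(1) by (simp add: sum.distrib)
        finally have "(\<Sum>j\<in>I. Tr e (D j) * Tr g (D j)) + Tr g r = Tr g (D i) + Tr g e'" using r(5) g by simp
        also have "\<dots> = Tr g e" unfolding ee using d(5) g by (simp add: Tr_add_right dA e'A)
        finally show ?thesis ..
      qed
      ultimately show ?thesis using r(1,3) by blast
    qed
  qed
qed

lemma Tr_sum:
  assumes b: "b \<in> A" and v: "\<And>i. i \<in> I \<Longrightarrow> v i \<in> A"
  shows "Tr (\<Sum>i\<in>I. a i *s v i) b = (\<Sum>i\<in>I. a i * Tr (v i) b)"
    and "Tr b (\<Sum>i\<in>I. a i *s v i) = (\<Sum>i\<in>I. a i * Tr b (v i))"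
proof -
  have 0: "Tr 0 b = 0" "Tr b 0 = 0" by (simp_all add: Tr_def btrace_def representation_zero)
  have "Tr (\<Sum>i\<in>I. a i *s v i) b = (\<Sum>i\<in>I. a i * Tr (v i) b) \<and> Tr b (\<Sum>i\<in>I. a i *s v i) = (\<Sum>i\<in>I. a i * Tr b (v i))"
    using v
  proof (induction I rule: infinite_finite_induct)
    case (insert i I)
    have "(\<Sum>i\<in>I. a i *s v i) \<in> A" using insert.prems by (intro span_sum span_scale) simp
    with insert b show ?case by (simp add: Tr_add_left Tr_add_right Tr_scale_left Tr_scale_right span_scale)
  qed (simp_all add: 0)
  then show "Tr (\<Sum>i\<in>I. a i *s v i) b = (\<Sum>i\<in>I. a i * Tr (v i) b)"
    "Tr b (\<Sum>i\<in>I. a i *s v i) = (\<Sum>i\<in>I. a i * Tr b (v i))" by simp_all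
qed

text \<open>The map x \<mapsto> g x e has its image in A e, where right multiplication by e is the
  identity.\<close>

lemma Tr_ideal:
  assumes e: "proj e" and g: "g \<in> A" and C: "finite C" "independent C" "span C = (\<lambda>x. x * e) ` A"
  shows "Tr g e = btrace C (\<lambda>x. g * x)"
proof -
  note eA = projD(1)[OF e]
  have Ce: "x * e = x" if "x \<in> span C" for x
    using that projD(3)[OF e] unfolding C(3) by (auto simp: mult.assoc)
  have "C \<subseteq> A" using span_superset[of C] mult_closed[OF _ eA] unfolding C(3) by auto
  then have "Tr g e = btrace C (\<lambda>x. g * x * e)"
    unfolding Tr_def by (intro btrace_into_subspace finite_basis independent_basis C(1,2) lin_mult)
      (simp_all add: C(3) mult_closed g)
  also have "\<dots> = btrace C (\<lambda>x. g * x)"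
    by (rule btrace_cong) (simp add: mult.assoc Ce span_base)
  finally show ?thesis .
qed

text \<open>For x in A d the product \<open>star x * x\<close> is a multiple of d, and a nonzero one
  by definiteness. So each nonzero element of A d generates it, which makes A d a simple
  module.\<close>

lemma prim_generated:
  assumes d: "prim d" and x: "x \<in> A" "x * d = x" "x \<noteq> 0"
  shows "\<exists>z\<in>A. z * x = d"
proof -
  note p = projD[OF prim_proj[OF d]]
  have sx: "star x \<in> A" by (rule star_closed[OF x(1)])
  have "d * star x = star x" using arg_cong[OF x(2), of star] by (simp add: star_mult x(1) p)
  then have "star x * x = d * (star x * x) * d" by (metis mult.assoc x(2))
  also have "\<exists>a. \<dots> = a *s d" using d mult_closed[OF sx x(1)] unfolding prim_def by blast
  finally obtain a where a: "star x * x = a *s d" ..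
  have "a \<noteq> 0" using a star_mult_self_nonzero[OF x(1,3)] by auto
  then have "(inverse a *s star x) * x = d" by (simp add: mult_scale_left a)
  then show ?thesis using sx by (intro bexI[of _ "inverse a *s star x"]) (simp_all add: span_scale)
qed

end

text \<open>E and F stand for the normalized symmetrizers and antisymmetrizers of the Young
  subgroups. The decomposition is derived from the ranks of their pairings and from the partition
  into ones, whose E is the unit.\<close>

locale kostka_family = star_algebra scale B star
  for scale :: "'k::linordered_field \<Rightarrow> 'h::ring_1 \<Rightarrow> 'h" (infixr \<open>*s\<close> 75) and B star +
  fixes n :: nat and E F :: "nat list \<Rightarrow> 'h"
  assumes proj_E: "la \<in> partitions n \<Longrightarrow> proj (E la)"
    and proj_F: "la \<in> partitions n \<Longrightarrow> proj (F la)"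
    and E_one: "E (replicate n 1) = 1"
    and Tr_E_E: "\<lbrakk>la \<in> partitions n; mu \<in> partitions n\<rbrakk> \<Longrightarrow>
      Tr (E la) (E mu) = of_int (\<Sum>nu\<in>partitions n. kostka nu la * kostka nu mu)"
    and Tr_E_F: "\<lbrakk>la \<in> partitions n; mu \<in> partitions n\<rbrakk> \<Longrightarrow>
      Tr (E la) (F mu) = of_int (\<Sum>nu\<in>partitions n. kostka nu la * kostka (transpose_partition nu) mu)"
    and Tr_F_E: "\<lbrakk>la \<in> partitions n; mu \<in> partitions n\<rbrakk> \<Longrightarrow>
      Tr (F mu) (E la) = of_int (\<Sum>nu\<in>partitions n. kostka nu la * kostka (transpose_partition nu) mu)"
begin

lemma E_A: "la \<in> partitions n \<Longrightarrow> E la \<in> A" and F_A: "la \<in> partitions n \<Longrightarrow> F la \<in> A"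
  using proj_E proj_F projD(1) by blast+

text \<open>The two Kostka numbers squeeze \<open>ka\<close> between \<open>mu\<close> and
  \<open>nu\<close>, as transposition reverses the dominance order. So the pairing of E nu with F of
  its transpose has a single term, and the pairing with E mu has none unless nu dominates
  mu.\<close>

lemma kostka_pair:
  assumes "nu \<in> partitions n" "mu \<in> partitions n" "ka \<in> partitions n"
    and "kostka ka mu * kostka (transpose_partition ka) (transpose_partition nu) \<noteq> 0"
  shows "dominated mu ka" "dominated ka nu"
proof -
  have nz: "kostka ka mu \<noteq> 0" "kostka (transpose_partition ka) (transpose_partition nu) \<noteq> 0"
    using assms(4) by auto
  show "dominated mu ka" by (rule kostka_nonzero[OF assms(3,2) nz(1)])
  have "dominated (transpose_partition nu) (transpose_partition ka)"
    by (rule kostka_nonzero[of _ n]) (use assms nz in simp_all)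
  from dominated_transpose[OF _ _ this, of n] assms show "dominated ka nu" by simp
qed

lemma Tr_E_F_transpose:
  assumes nu: "nu \<in> partitions n"
  shows "Tr (E nu) (F (transpose_partition nu)) = 1"
proof -
  have "(\<Sum>ka\<in>partitions n. kostka ka nu * kostka (transpose_partition ka) (transpose_partition nu)) =
     (\<Sum>ka\<in>{nu}. kostka ka nu * kostka (transpose_partition ka) (transpose_partition nu))"
  proof (rule sum.mono_neutral_right)
    show "\<forall>ka\<in>partitions n - {nu}. kostka ka nu * kostka (transpose_partition ka) (transpose_partition nu) = 0"
    proof (intro ballI, rule ccontr)
      fix ka assume ka: "ka \<in> partitions n - {nu}"
        and nz: "kostka ka nu * kostka (transpose_partition ka) (transpose_partition nu) \<noteq> 0"
      then have "ka = nu" using kostka_pair[OF nu nu _ nz] dominated_antisym[OF _ nu] by blast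
      with ka show False by simp
    qed
  qed (use nu in auto)
  also have "\<dots> = 1" using nu by (simp add: kostka_diag[of _ n])
  finally show ?thesis using nu by (simp only: Tr_E_F transpose_partition of_int_1)
qed

lemma E_F_zero:
  assumes "nu \<in> partitions n" "mu \<in> partitions n" "\<not> dominated mu nu" "x \<in> A"
  shows "E mu * x * F (transpose_partition nu) = 0"
proof -
  have "(\<Sum>ka\<in>partitions n. kostka ka mu * kostka (transpose_partition ka) (transpose_partition nu)) = 0"
  proof (rule sum.neutral, intro ballI, rule ccontr)
    fix ka assume ka: "ka \<in> partitions n"
      and nz: "kostka ka mu * kostka (transpose_partition ka) (transpose_partition nu) \<noteq> 0"
    from kostka_pair[OF assms(1,2) ka nz] have "dominated mu nu" by (rule dominated_trans)
    with assms(3) show False ..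
  qed
  then have "Tr (E mu) (F (transpose_partition nu)) = 0" using assms by (simp only: Tr_E_F transpose_partition of_int_0)
  from Tr_proj(2)[OF proj_E proj_F this assms(4)] assms show ?thesis by simp
qed

text \<open>The generators of a one-dimensional corner, unique up to a scalar by
  \<open>corner_span\<close>. Young symmetrizers are of this kind up to translation by a
  permutation.\<close>

definition corner :: "nat list \<Rightarrow> 'h \<Rightarrow> bool" where
  "corner nu c \<longleftrightarrow> c \<in> A \<and> c \<noteq> 0 \<and> E nu * c = c \<and> c * F (transpose_partition nu) = c"

lemma corner_span:
  assumes nu: "nu \<in> partitions n" and c: "corner nu c" and x: "x \<in> A"
  shows "\<exists>a. E nu * x * F (transpose_partition nu) = a *s c"
proof -
  obtain c0 where c0: "c0 \<noteq> 0" "\<forall>x\<in>A. \<exists>a. E nu * x * F (transpose_partition nu) = a *s c0"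
    using Tr_proj(3)[OF proj_E[OF nu] proj_F[OF transpose_partition[OF nu]] Tr_E_F_transpose[OF nu]] by blast
  have cc: "c \<in> A" "c \<noteq> 0" "E nu * c * F (transpose_partition nu) = c" using c by (simp_all add: corner_def)
  obtain b where "E nu * c * F (transpose_partition nu) = b *s c0" using c0(2) cc(1) by blast
  then have b: "c = b *s c0" using cc(3) by simp
  then have "b \<noteq> 0" using cc(2) by auto
  then have c0_eq: "c0 = inverse b *s c" using b by simp
  obtain a where "E nu * x * F (transpose_partition nu) = a *s c0" using c0(2) x by blast
  then have "E nu * x * F (transpose_partition nu) = (a * inverse b) *s c" unfolding c0_eq by simp
  then show ?thesis ..
qed

lemma corner_exists:
  assumes "nu \<in> partitions n"
  shows "\<exists>c. corner nu c"
  using Tr_proj(3)[OF proj_E[OF assms] proj_F[OF transpose_partition[OF assms]] Tr_E_F_transpose[OF assms]]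
  unfolding corner_def by blast

definition corner_elem :: "nat list \<Rightarrow> 'h" where
  "corner_elem nu = (SOME c. corner nu c)"

lemma corner_elem: "nu \<in> partitions n \<Longrightarrow> corner nu (corner_elem nu)"
  unfolding corner_elem_def by (rule someI_ex[OF corner_exists])

text \<open>The last clause records the factor \<open>corner_elem nu\<close> on the right, from
  which it follows that F of the transpose fixes D nu (\<open>D_F\<close>).\<close>

definition D :: "nat list \<Rightarrow> 'h" where
  "D nu = (SOME d. prim d \<and> corner_elem nu * d = corner_elem nu \<and>
    (\<exists>k. d = k *s (star (corner_elem nu) * corner_elem nu)))"

lemma D:
  assumes nu: "nu \<in> partitions n"
  shows "prim (D nu)" "corner_elem nu * D nu = corner_elem nu"
    "\<exists>k. D nu = k *s (star (corner_elem nu) * corner_elem nu)"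
proof -
  note c = corner_elem[OF nu, unfolded corner_def]
  have "\<exists>k. k \<noteq> 0 \<and> prim (inverse k *s (star (corner_elem nu) * corner_elem nu)) \<and>
      corner_elem nu * (inverse k *s (star (corner_elem nu) * corner_elem nu)) = corner_elem nu"
    by (rule prim_from_corner[OF proj_E[OF nu] proj_F[OF transpose_partition[OF nu]] _ _ _ _ corner_span[OF nu corner_elem[OF nu]]])
      (use c in simp_all)
  then have "\<exists>d. prim d \<and> corner_elem nu * d = corner_elem nu \<and>
    (\<exists>k. d = k *s (star (corner_elem nu) * corner_elem nu))" by blast
  from someI_ex[OF this, folded D_def]
  show "prim (D nu)" "corner_elem nu * D nu = corner_elem nu"
    "\<exists>k. D nu = k *s (star (corner_elem nu) * corner_elem nu)" by simp_all
qed

lemma D_A: "nu \<in> partitions n \<Longrightarrow> D nu \<in> A"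
  using D(1) prim_proj projD(1) by blast

lemma D_F: "nu \<in> partitions n \<Longrightarrow> D nu * F (transpose_partition nu) = D nu"
proof -
  assume nu: "nu \<in> partitions n"
  obtain k where "D nu = k *s (star (corner_elem nu) * corner_elem nu)" using D(3)[OF nu] ..
  with corner_elem[OF nu] show ?thesis by (simp add: corner_def mult_scale_left mult.assoc)
qed

text \<open>Any corner element generates the left ideal of D nu. This will recognize the Specht
  module as that ideal.\<close>

lemma corner_ideal:
  assumes nu: "nu \<in> partitions n" and c: "corner nu c"
  shows "c * D nu = c" "\<exists>y\<in>A. y * c = D nu"
proof -
  let ?c = "corner_elem nu"
  have c0: "?c \<in> A" "?c \<noteq> 0" "E nu * ?c * F (transpose_partition nu) = ?c"
    using corner_elem[OF nu] by (simp_all add: corner_def)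
  have "E nu * c * F (transpose_partition nu) = c" using c by (simp add: corner_def)
  then obtain a where a: "c = a *s ?c" using corner_span[OF nu corner_elem[OF nu], of c] c by (auto simp: corner_def)
  then have a0: "a \<noteq> 0" using c by (auto simp: corner_def)
  show "c * D nu = c" unfolding a by (simp add: mult_scale_left D(2)[OF nu])
  obtain k where k: "D nu = k *s (star ?c * ?c)" using D(3)[OF nu] ..
  have "((k * inverse a) *s star ?c) * c = D nu"
    unfolding a k using a0 by (simp add: mult_scale_left mult_scale_right)
  moreover have "(k * inverse a) *s star ?c \<in> A" by (intro span_scale star_closed c0)
  ultimately show "\<exists>y\<in>A. y * c = D nu" by blast
qed

lemma E_D_zero:
  assumes "nu \<in> partitions n" "mu \<in> partitions n" "\<not> dominated mu nu" "x \<in> A"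
  shows "E mu * x * D nu = 0"
proof -
  have "E mu * x * D nu = E mu * (x * D nu) * F (transpose_partition nu)"
    by (simp add: mult.assoc D_F assms)
  also have "\<dots> = 0" by (rule E_F_zero[OF assms(1-3)]) (intro mult_closed assms D_A)
  finally show ?thesis .
qed

lemma Tr_zero: "(\<And>x. x \<in> A \<Longrightarrow> e * x * f = 0) \<Longrightarrow> Tr e f = 0"
  by (simp add: Tr_def btrace_def representation_zero)

lemma Tr_E_D_zero:
  assumes "nu \<in> partitions n" "mu \<in> partitions n" "\<not> dominated mu nu"
  shows "Tr (E mu) (D nu) = 0"
  by (rule Tr_zero) (rule E_D_zero[OF assms])

lemma Tr_E_D_diag:
  assumes nu: "nu \<in> partitions n"
  shows "Tr (E nu) (D nu) = 1"
proof (rule Tr_proj(4)[OF proj_E[OF nu] prim_proj[OF D(1)[OF nu]]])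
  note c = corner_elem[OF nu]
  show "corner_elem nu \<noteq> 0" "corner_elem nu \<in> A" "E nu * corner_elem nu = corner_elem nu"
    using c by (simp_all add: corner_def)
  show "corner_elem nu * D nu = corner_elem nu" by (rule D(2)[OF nu])
  fix x assume x: "x \<in> A"
  have "E nu * x * D nu = E nu * (x * D nu) * F (transpose_partition nu)"
    by (simp add: mult.assoc D_F nu)
  also have "\<exists>a. \<dots> = a *s corner_elem nu" by (rule corner_span[OF nu c]) (intro mult_closed x D_A nu)
  finally show "\<exists>a. E nu * x * D nu = a *s corner_elem nu" .
qed

text \<open>Otherwise D nu and D mu would have the same trace against every E, and since
  \<open>Tr (E nu) (D nu)\<close> is 1 while E nu pairs to 0 with all D that do not dominate it, nu
  and mu would dominate each other.\<close>

lemma D_orthogonal: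
  assumes "nu \<in> partitions n" "mu \<in> partitions n" "nu \<noteq> mu" "x \<in> A"
  shows "D nu * x * D mu = 0"
proof (rule ccontr)
  assume nz: "D nu * x * D mu \<noteq> 0"
  have eq: "Tr g (D nu) = Tr g (D mu)" if "g \<in> A" for g
    by (rule Tr_eq_if_corner[OF D(1)[OF assms(1)] D(1)[OF assms(2)] assms(4) nz that])
  have "Tr (E mu) (D nu) = 1" using eq[OF E_A[OF assms(2)]] Tr_E_D_diag[OF assms(2)] by simp
  then have "dominated mu nu" using Tr_E_D_zero[OF assms(1,2)] by auto
  moreover have "Tr (E nu) (D mu) = 1" using eq[OF E_A[OF assms(1)]] Tr_E_D_diag[OF assms(1)] by simp
  then have "dominated nu mu" using Tr_E_D_zero[OF assms(2,1)] by auto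
  ultimately show False using dominated_antisym[OF assms(1,2)] assms(3) by simp
qed

definition D_ideal :: "'h set" where
  "D_ideal = span {y * D i * z | y i z. y \<in> A \<and> i \<in> partitions n \<and> z \<in> A}"

lemma decompose_D:
  assumes e: "proj e"
  obtains r where "proj r" "e * r = r" "\<forall>i\<in>partitions n. \<forall>x\<in>A. r * x * D i = 0" "e - r \<in> D_ideal"
    "\<forall>g\<in>A. Tr g e = (\<Sum>i\<in>partitions n. Tr e (D i) * Tr g (D i)) + Tr g r"
proof -
  have "\<exists>r. proj r \<and> e * r = r \<and> (\<forall>i\<in>partitions n. \<forall>x\<in>A. r * x * D i = 0) \<and>
    e - r \<in> span {y * D i * z | y i z. y \<in> A \<and> i \<in> partitions n \<and> z \<in> A} \<and>
    (\<forall>g\<in>A. Tr g e = (\<Sum>i\<in>partitions n. Tr e (D i) * Tr g (D i)) + Tr g r)"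
    by (rule decompose[OF finite_partitions D(1) D_orthogonal e])
  then show thesis using that unfolding D_ideal_def by blast
qed

text \<open>The multiplicities of the D nu in E mu are extracted from \<open>Tr_E_E\<close>. For nu
  strictly above mu the expansion of E nu is known by the outer induction, and the pairing of E mu
  with E nu contains the multiplicity of D nu with coefficient 1 and otherwise only those of
  partitions above nu; hence the inner induction from the top downwards. No remainder is left,
  because the squares of the multiplicities already add up to
  \<open>Tr (E mu) (E mu)\<close>.\<close>

lemma Tr_E_main:
  assumes mu: "mu \<in> partitions n"
  shows "(\<forall>g\<in>A. Tr g (E mu) = (\<Sum>nu\<in>partitions n. of_int (kostka nu mu) * Tr g (D nu))) \<and> E mu \<in> D_ideal"
  using mu
proof (induct "card {ka \<in> partitions n. dominated mu ka}" arbitrary: mu rule: less_induct)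
  case less
  note mu = less.prems and IH = less.hyps
  have strict: "Tr (E mu) (D nu) = of_int (kostka nu mu)"
    if "nu \<in> partitions n" "dominated mu nu" "nu \<noteq> mu" for nu
    using that
  proof (induct "card {ka \<in> partitions n. dominated nu ka}" arbitrary: nu rule: less_induct)
    case (less nu)
    note nu = less.prems
    have C: "\<forall>g\<in>A. Tr g (E nu) = (\<Sum>ka\<in>partitions n. of_int (kostka ka nu) * Tr g (D ka))"
      using IH[OF dominated_rank[OF mu nu(1,2) nu(3)[symmetric]] nu(1)] by (rule conjunct1)
    have split: "(\<Sum>ka\<in>partitions n. f ka) = f nu + (\<Sum>ka\<in>partitions n - {nu}. f ka)" for f :: "nat list \<Rightarrow> 'k"
      by (rule sum.remove) (use nu in simp_all)
    have "of_int (kostka nu nu) * Tr (E mu) (D nu) + (\<Sum>ka\<in>partitions n - {nu}. of_int (kostka ka nu) * Tr (E mu) (D ka)) = Tr (E mu) (E nu)"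
      using C E_A[OF mu] split by simp
    also have "\<dots> = (\<Sum>ka\<in>partitions n. of_int (kostka ka mu) * of_int (kostka ka nu))"
      using mu nu by (simp add: Tr_E_E)
    also have "\<dots> = of_int (kostka nu mu) * of_int (kostka nu nu) + (\<Sum>ka\<in>partitions n - {nu}. of_int (kostka ka mu) * of_int (kostka ka nu))"
      by (rule split)
    also have "(\<Sum>ka\<in>partitions n - {nu}. of_int (kostka ka mu) * of_int (kostka ka nu)) =
       (\<Sum>ka\<in>partitions n - {nu}. of_int (kostka ka nu) * Tr (E mu) (D ka))"
    proof (rule sum.cong[OF refl])
      fix ka assume ka: "ka \<in> partitions n - {nu}"
      show "of_int (kostka ka mu) * of_int (kostka ka nu) = of_int (kostka ka nu) * Tr (E mu) (D ka)"
      proof (cases "kostka ka nu = 0")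
        case False
        then have d: "dominated nu ka" using kostka_nonzero[of ka n nu] ka nu by simp
        have "ka \<noteq> mu" using dominated_antisym[OF nu(1) mu] d nu(2,3) by auto
        moreover have "dominated mu ka" by (rule dominated_trans[OF nu(2) d])
        ultimately have "Tr (E mu) (D ka) = of_int (kostka ka mu)"
          using less.hyps[OF dominated_rank[OF nu(1) _ d]] ka by auto
        then show ?thesis by simp
      qed simp
    qed
    finally show ?case using nu by (simp add: kostka_diag[of _ n])
  qed
  have all: "Tr (E mu) (D nu) = of_int (kostka nu mu)" if nu: "nu \<in> partitions n" for nu
  proof (cases "dominated mu nu")
    case False
    then have "kostka nu mu = 0" using kostka_nonzero[OF nu mu] by blast
    then show ?thesis using Tr_E_D_zero[OF nu mu False] by simp
  next
    case True
    then show ?thesis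
      using strict[OF nu True] Tr_E_D_diag[OF mu] kostka_diag[OF mu] by (cases "nu = mu") simp_all
  qed
  obtain r where r: "proj r" "E mu * r = r" "\<forall>i\<in>partitions n. \<forall>x\<in>A. r * x * D i = 0" "E mu - r \<in> D_ideal"
    "\<forall>g\<in>A. Tr g (E mu) = (\<Sum>i\<in>partitions n. Tr (E mu) (D i) * Tr g (D i)) + Tr g r"
    by (rule decompose_D[OF proj_E[OF mu]])
  have "Tr (E mu) (E mu) = (\<Sum>i\<in>partitions n. Tr (E mu) (D i) * Tr (E mu) (D i)) + Tr (E mu) r"
    using r(5) E_A[OF mu] by blast
  moreover have "Tr (E mu) (E mu) = (\<Sum>i\<in>partitions n. Tr (E mu) (D i) * Tr (E mu) (D i))"
    using mu by (simp add: Tr_E_E all)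
  ultimately have "Tr (E mu) r = 0" by simp
  \<comment> \<open>Rank 0 of the pairing makes the product of E mu and r vanish, while this product
    is r.\<close>
  from Tr_proj(2)[OF proj_E[OF mu] r(1) this one_closed] have r0: "r = 0" using r(2) by simp
  have "Tr g (E mu) = (\<Sum>nu\<in>partitions n. of_int (kostka nu mu) * Tr g (D nu))" if g: "g \<in> A" for g
    using r(5) g all by (simp add: r0 Tr_zero)
  moreover have "E mu \<in> D_ideal" using r(4) r0 by simp
  ultimately show ?case by blast
qed

lemma Tr_E: "\<lbrakk>mu \<in> partitions n; g \<in> A\<rbrakk> \<Longrightarrow> Tr g (E mu) = (\<Sum>nu\<in>partitions n. of_int (kostka nu mu) * Tr g (D nu))"
  using Tr_E_main by blast

text \<open>The unit is the E of the partition into ones. This completeness of the D nu excludes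
  further irreducible characters and remainders.\<close>

lemma one_D_ideal: "1 \<in> D_ideal"
proof -
  have "replicate n 1 \<in> partitions n" by (simp add: partitions_def sorted_wrt_iff_nth_less sum_list_replicate)
  from Tr_E_main[OF this] show ?thesis unfolding E_one by simp
qed

lemma Tr_D:
  assumes nu: "nu \<in> partitions n" and g: "g \<in> A"
  shows "Tr g (D nu) = (\<Sum>la\<in>partitions n. of_int (kinv n la nu) * Tr g (E la))"
proof -
  have "(\<Sum>la\<in>partitions n. of_int (kinv n la nu) * Tr g (E la)) =
     (\<Sum>la\<in>partitions n. \<Sum>ka\<in>partitions n. of_int (kostka ka la * kinv n la nu) * Tr g (D ka))"
    by (rule sum.cong) (simp_all add: Tr_E[OF _ g] sum_distrib_left mult_ac)
  also have "\<dots> = (\<Sum>ka\<in>partitions n. of_int (\<Sum>la\<in>partitions n. kostka ka la * kinv n la nu) * Tr g (D ka))"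
    by (subst sum.swap) (simp add: sum_distrib_right)
  also have "\<dots> = (\<Sum>ka\<in>partitions n. if ka = nu then Tr g (D ka) else 0)"
    by (rule sum.cong[OF refl]) (subst kinv(2)[OF _ nu], simp_all)
  also have "\<dots> = Tr g (D nu)" using nu by simp
  finally show ?thesis ..
qed

text \<open>The remainder annihilates the ideal of the D nu, which contains 1, and so is 0. The
  multiplicities result from writing D nu through the E by \<open>Tr_D\<close> and inserting the
  pairings of F with E.\<close>

lemma Tr_F:
  assumes mu: "mu \<in> partitions n" and g: "g \<in> A"
  shows "Tr g (F mu) = (\<Sum>nu\<in>partitions n. of_int (kostka (transpose_partition nu) mu) * Tr g (D nu))"
proof -
  obtain r where r: "proj r" "F mu * r = r" "\<forall>i\<in>partitions n. \<forall>x\<in>A. r * x * D i = 0" "F mu - r \<in> D_ideal"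
    "\<forall>g\<in>A. Tr g (F mu) = (\<Sum>i\<in>partitions n. Tr (F mu) (D i) * Tr g (D i)) + Tr g r"
    by (rule decompose_D[OF proj_F[OF mu]])
  have "r * y = 0" if "y \<in> D_ideal" for y
    using that unfolding D_ideal_def
  proof (induction rule: span_induct_alt)
    case (step c x y)
    then obtain u i z where x: "x = u * D i * z" "u \<in> A" "i \<in> partitions n" by blast
    have "r * x = (r * u * D i) * z" unfolding x(1) by (simp only: mult.assoc)
    also have "\<dots> = 0" using r(3) x by simp
    finally show ?case using step by (simp add: distrib_left mult_scale_right)
  qed simp
  from this[OF one_D_ideal] have r0: "r = 0" by simp
  have FD: "Tr (F mu) (D nu) = of_int (kostka (transpose_partition nu) mu)" if nu: "nu \<in> partitions n" for nu
  proof -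
    have "Tr (F mu) (D nu) = (\<Sum>la\<in>partitions n. of_int (kinv n la nu) *
        of_int (\<Sum>ka\<in>partitions n. kostka ka la * kostka (transpose_partition ka) mu))"
      unfolding Tr_D[OF nu F_A[OF mu]] by (rule sum.cong) (simp_all only: Tr_F_E mu)
    also have "\<dots> = of_int (\<Sum>la\<in>partitions n. \<Sum>ka\<in>partitions n. kostka (transpose_partition ka) mu * (kostka ka la * kinv n la nu))"
      by (simp add: sum_distrib_left mult_ac)
    also have "(\<Sum>la\<in>partitions n. \<Sum>ka\<in>partitions n. kostka (transpose_partition ka) mu * (kostka ka la * kinv n la nu)) =
       (\<Sum>ka\<in>partitions n. kostka (transpose_partition ka) mu * (\<Sum>la\<in>partitions n. kostka ka la * kinv n la nu))"
      by (subst sum.swap) (simp add: sum_distrib_left)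
    also have "\<dots> = (\<Sum>ka\<in>partitions n. if ka = nu then kostka (transpose_partition ka) mu else 0)"
      by (rule sum.cong[OF refl]) (subst kinv(2)[OF _ nu], simp_all)
    also have "\<dots> = kostka (transpose_partition nu) mu" using nu by simp
    finally show ?thesis .
  qed
  show ?thesis using r(5) g by (simp add: r0 Tr_zero FD)
qed

end

section \<open>Inversions and Young subgroups\<close>

definition inv_pairs :: "(nat \<Rightarrow> nat) \<Rightarrow> (nat \<times> nat) set" where
  "inv_pairs w = {(a, b). a < b \<and> w b < w a}"

definition inv_count :: "(nat \<Rightarrow> nat) \<Rightarrow> nat" where
  "inv_count w = card (inv_pairs w)"

lemma finite_inv_pairs:
  assumes "w \<in> symgroup n"
  shows "finite (inv_pairs w)"
proof (rule finite_subset)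
  have w: "w permutes {1..n}" using assms by (simp add: symgroup_def)
  show "inv_pairs w \<subseteq> {1..n} \<times> {1..n}"
  proof
    fix p assume "p \<in> inv_pairs w"
    then obtain a b where p: "p = (a, b)" and ab: "a < b" "w b < w a" by (auto simp: inv_pairs_def)
    have in_iff: "w x \<in> {1..n} \<longleftrightarrow> x \<in> {1..n}" and out: "x \<notin> {1..n} \<Longrightarrow> w x = x" for x
      using permutes_in_image[OF w] permutes_not_in[OF w] by auto
    from in_iff[of a] in_iff[of b] out[of a] out[of b] ab
    show "p \<in> {1..n} \<times> {1..n}" unfolding p by (cases "a \<in> {1..n}"; cases "b \<in> {1..n}") auto
  qed
qed simp

lemma adj_transp_apply: "adj_transp i x = (if x = i then Suc i else if x = Suc i then i else x)"
  by (simp add: adj_transp_def transpose_def)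

lemma adj_transp_symgroup: "i \<in> {1..<n} \<Longrightarrow> adj_transp i \<in> symgroup n"
  by (auto simp: symgroup_def adj_transp_def intro!: permutes_swap_id)

lemma adj_transp_twice [simp]: "adj_transp i \<circ> adj_transp i = id" "adj_transp i \<circ> (adj_transp i \<circ> w) = w"
    "w \<circ> adj_transp i \<circ> adj_transp i = w"
  by (simp_all add: adj_transp_def comp_assoc fun_eq_iff)

lemma pinv_adj_transp [simp]: "pinv (adj_transp i) = adj_transp i"
  by (simp add: adj_transp_def)

lemma pinv_comp: "u \<in> symgroup n \<Longrightarrow> v \<in> symgroup n \<Longrightarrow> pinv (u \<circ> v) = pinv v \<circ> pinv u"
  unfolding symgroup_def by (intro o_inv_distrib) (auto intro: permutes_bij)

text \<open>Exchanging the positions i and i + 1 preserves the order of every other pair of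
  positions, so exactly one inversion is new.\<close>

lemma inv_pairs_comp:
  assumes "w i < w (Suc i)"
  shows "inv_pairs (w \<circ> adj_transp i) =
    insert (i, Suc i) ((\<lambda>(a, b). (adj_transp i a, adj_transp i b)) ` inv_pairs w)" (is "?L = insert _ (?f ` _)")
proof -
  have ord: "adj_transp i a < adj_transp i b" if "a < b" "(a, b) \<noteq> (i, Suc i)" for a b
    using that by (auto simp: adj_transp_apply)
  have tw: "adj_transp i (adj_transp i x) = x" for x by (simp add: adj_transp_def)
  show ?thesis
  proof (intro equalityI subsetI)
    fix p assume p: "p \<in> ?L"
    show "p \<in> insert (i, Suc i) (?f ` inv_pairs w)"
    proof (cases "p = (i, Suc i)")
      case False
      obtain a b where ab: "p = (a, b)" by (cases p)
      have "(adj_transp i a, adj_transp i b) \<in> inv_pairs w"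
        using p False ord[of a b] unfolding ab inv_pairs_def by simp
      then show ?thesis unfolding ab by (intro insertI2 image_eqI[of _ _ "(adj_transp i a, adj_transp i b)"]) (simp_all add: tw)
    qed simp
  next
    fix p assume "p \<in> insert (i, Suc i) (?f ` inv_pairs w)"
    then consider "p = (i, Suc i)" | a b where "p = ?f (a, b)" "(a, b) \<in> inv_pairs w" by auto
    then show "p \<in> ?L"
    proof cases
      case 1
      then show ?thesis using assms by (simp add: inv_pairs_def adj_transp_apply)
    next
      case (2 a b)
      then have "(a, b) \<noteq> (i, Suc i)" using assms by (auto simp: inv_pairs_def)
      with 2 ord[of a b] show ?thesis by (simp add: inv_pairs_def tw)
    qed
  qed
qed

lemma inv_count_up:
  assumes w: "w \<in> symgroup n" and "w i < w (Suc i)"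
  shows "inv_count (w \<circ> adj_transp i) = Suc (inv_count w)"
proof -
  let ?f = "\<lambda>(a, b). (adj_transp i a, adj_transp i b)"
  have "(i, Suc i) \<notin> ?f ` inv_pairs w"
  proof
    assume "(i, Suc i) \<in> ?f ` inv_pairs w"
    then obtain a b where "a < b" "adj_transp i a = i" "adj_transp i b = Suc i" by (auto simp: inv_pairs_def)
    then show False by (auto simp: adj_transp_apply split: if_splits)
  qed
  moreover have "inj_on ?f (inv_pairs w)"
    by (rule inj_onI) (auto simp: adj_transp_apply split: if_splits)
  ultimately show ?thesis
    unfolding inv_count_def inv_pairs_comp[OF assms(2)] using finite_inv_pairs[OF w] by (simp add: card_image)
qed

lemma inv_count_right:
  assumes w: "w \<in> symgroup n" and i: "i \<in> {1..<n}"
  shows "w i < w (Suc i) \<Longrightarrow> inv_count (w \<circ> adj_transp i) = Suc (inv_count w)"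
    and "w (Suc i) < w i \<Longrightarrow> inv_count w = Suc (inv_count (w \<circ> adj_transp i))"
    and "inv_count (w \<circ> adj_transp i) = Suc (inv_count w) \<or> inv_count w = Suc (inv_count (w \<circ> adj_transp i))"
proof -
  show 1: "w i < w (Suc i) \<Longrightarrow> inv_count (w \<circ> adj_transp i) = Suc (inv_count w)"
    by (rule inv_count_up[OF w])
  show 2: "w (Suc i) < w i \<Longrightarrow> inv_count w = Suc (inv_count (w \<circ> adj_transp i))"
    using inv_count_up[OF symgroup_comp[OF w adj_transp_symgroup[OF i]], of i] by (simp add: adj_transp_apply)
  have "w i \<noteq> w (Suc i)" using w by (simp add: symgroup_def permutes_inj inj_eq)
  with 1 2 show "inv_count (w \<circ> adj_transp i) = Suc (inv_count w) \<or> inv_count w = Suc (inv_count (w \<circ> adj_transp i))"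
    by (meson linorder_neqE_nat)
qed

lemma inv_count_inv:
  assumes "w \<in> symgroup n"
  shows "inv_count (pinv w) = inv_count w"
proof -
  have w: "w permutes {1..n}" using assms by (simp add: symgroup_def)
  have inv: "pinv w (w x) = x" "w (pinv w x) = x" for x
    using permutes_inverses[OF w] by simp_all
  have "bij_betw (\<lambda>(a, b). (w b, w a)) (inv_pairs w) (inv_pairs (pinv w))"
    by (rule bij_betw_byWitness[where f' = "\<lambda>(a, b). (pinv w b, pinv w a)"]) (auto simp: inv_pairs_def inv)
  then show ?thesis unfolding inv_count_def by (rule bij_betw_same_card[symmetric])
qed

lemma inv_count_left:
  assumes w: "w \<in> symgroup n" and i: "i \<in> {1..<n}"
  shows "inv_count (adj_transp i \<circ> w) = Suc (inv_count w) \<or> inv_count w = Suc (inv_count (adj_transp i \<circ> w))"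
proof -
  have "inv_count (adj_transp i \<circ> w) = inv_count (pinv w \<circ> adj_transp i)"
    using inv_count_inv[OF symgroup_comp[OF adj_transp_symgroup[OF i] w]] pinv_comp[OF adj_transp_symgroup[OF i] w] by simp
  then show ?thesis using inv_count_right(3)[OF symgroup_inv[OF w] i] by (simp add: inv_count_inv[OF w])
qed

text \<open>Without a descent w is increasing on 1..n, hence w x is at least x, and the equality of
  the sums over 1..n forces w = id.\<close>

lemma exists_descent:
  assumes "w \<in> symgroup n" "w \<noteq> id"
  shows "\<exists>i\<in>{1..<n}. w (Suc i) < w i"
proof (rule ccontr)
  assume nd: "\<not> ?thesis"
  have w: "w permutes {1..n}" using assms by (simp add: symgroup_def)
  have step: "w i < w (Suc i)" if "i \<in> {1..<n}" for i
    using nd that permutes_inj[OF w] by (metis inj_eq n_not_Suc_n linorder_neqE_nat)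
  have ge: "x \<le> w x" if "x \<in> {1..n}" for x
    using that
  proof (induction x)
    case (Suc x)
    then show ?case using step[of x] permutes_in_image[OF w, of "Suc x"] by (cases "x = 0") auto
  qed simp
  have "(\<Sum>x\<in>{1..n}. w x) = (\<Sum>x\<in>{1..n}. x)" by (rule sum.permute[OF w, symmetric, of "\<lambda>x. x", unfolded comp_def])
  then have "w x = x" if "x \<in> {1..n}" for x
    using sum_mono_inv[of "\<lambda>x. x" "{1..n}" w x] ge that by simp
  then have "w = id" using permutes_not_in[OF w] by (intro ext) (metis id_apply)
  with assms(2) show False ..
qed

lemma inv_count_id [simp]: "inv_count id = 0"
proof -
  have "inv_pairs id = {}" by (auto simp: inv_pairs_def)
  then show ?thesis by (simp add: inv_count_def)
qed

text \<open>Induction along right multiplications that raise the length, which stands in for the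
  choice of a reduced word.\<close>

lemma symgroup_induct [consumes 1, case_names id step]:
  assumes "w \<in> symgroup n" "P id"
    and step: "\<And>w i. \<lbrakk>w \<in> symgroup n; i \<in> {1..<n}; inv_count (w \<circ> adj_transp i) = Suc (inv_count w); P w\<rbrakk> \<Longrightarrow> P (w \<circ> adj_transp i)"
  shows "P w"
  using assms(1)
proof (induction "inv_count w" arbitrary: w rule: less_induct)
  case less
  show ?case
  proof (cases "w = id")
    case False
    then obtain i where i: "i \<in> {1..<n}" "w (Suc i) < w i" using exists_descent[OF less.prems] by blast
    let ?v = "w \<circ> adj_transp i"
    have v: "?v \<in> symgroup n" by (intro symgroup_comp less.prems adj_transp_symgroup i(1))
    have c: "inv_count w = Suc (inv_count ?v)" by (rule inv_count_right(2)[OF less.prems i])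
    have "P (?v \<circ> adj_transp i)" by (rule step[OF v i(1)]) (use c less.hyps[OF _ v] in simp_all)
    then show ?thesis by simp
  qed (simp add: assms(2))
qed

lemma word_perm_append: "word_perm (xs @ ys) = word_perm xs \<circ> word_perm ys"
  by (induction xs) (simp_all add: word_perm_def comp_assoc)

lemma word_perm_single: "word_perm [i] = adj_transp i"
  by (simp add: word_perm_def)

lemma word_perm_symgroup: "set ws \<subseteq> {1..<n} \<Longrightarrow> word_perm ws \<in> symgroup n"
  by (induction ws) (auto simp: word_perm_def intro!: symgroup_comp adj_transp_symgroup)

lemma perm_length_eq:
  assumes "w \<in> symgroup n"
  shows "perm_length n w = inv_count w"
  unfolding perm_length_def
proof (rule Least_equality)
  show "\<exists>ws. set ws \<subseteq> {1..<n} \<and> word_perm ws = w \<and> length ws = inv_count w"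
    using assms
  proof (induction rule: symgroup_induct)
    case id
    then show ?case by (intro exI[of _ "[]"]) (simp add: word_perm_def flip: id_def)
  next
    case (step w i)
    then obtain ws where "set ws \<subseteq> {1..<n}" "word_perm ws = w" "length ws = inv_count w" by blast
    then have "set (ws @ [i]) \<subseteq> {1..<n} \<and> word_perm (ws @ [i]) = w \<circ> adj_transp i \<and> length (ws @ [i]) = inv_count (w \<circ> adj_transp i)"
      using step(2,3) by (simp add: word_perm_append word_perm_single)
    then show ?case ..
  qed
  fix k assume "\<exists>ws. set ws \<subseteq> {1..<n} \<and> word_perm ws = w \<and> length ws = k"
  then obtain ws where ws: "set ws \<subseteq> {1..<n}" "word_perm ws = w" "length ws = k" by blast
  have "inv_count (word_perm ws) \<le> length ws"
    using ws(1)
  proof (induction ws)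
    case (Cons i ws)
    have "inv_count (word_perm (i # ws)) \<le> Suc (inv_count (word_perm ws))"
      using inv_count_left[OF word_perm_symgroup, of ws n i] Cons.prems by (auto simp: word_perm_def)
    with Cons show ?case by simp
  qed (simp add: word_perm_def)
  with ws show "inv_count w \<le> k" by simp
qed

lemma sign_inv_count:
  assumes "w \<in> symgroup n"
  shows "(- 1) ^ inv_count w = sign w"
  using assms
proof (induction rule: symgroup_induct)
  case (step w i)
  have "permutation w" using step(1) by (auto simp: symgroup_def permutation_permutes)
  moreover have "permutation (adj_transp i)" by (simp add: adj_transp_def permutation_swap_id)
  ultimately have "sign (w \<circ> adj_transp i) = - sign w" by (simp add: sign_compose) (simp add: adj_transp_def sign_swap_id)
  then show ?case by (simp only: step(3,4) power_Suc mult_minus1)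
qed (simp only: inv_count_id power_0 sign_id)

text \<open>A root t of 1 covers the trivial and the sign character together; over an integral
  domain t can only be 1 or -1.\<close>

lemma power_inv_count_comp:
  fixes t :: "'a::idom"
  assumes "t * t = 1" "u \<in> symgroup n" "v \<in> symgroup n"
  shows "t ^ inv_count (u \<circ> v) = t ^ inv_count u * t ^ inv_count v"
proof -
  have "t = 1 \<or> t = - 1" using assms(1) by (simp add: square_eq_1_iff)
  moreover have "(- 1) ^ inv_count (u \<circ> v) = ((- 1) ^ inv_count u * (- 1) ^ inv_count v :: int)"
    using assms(2,3) sign_compose[of u v]
    by (simp add: sign_inv_count[of _ n] symgroup_comp) (auto simp: symgroup_def permutation_permutes)
  then have "of_int ((- 1) ^ inv_count (u \<circ> v)) = (of_int ((- 1) ^ inv_count u * (- 1) ^ inv_count v) :: 'a)" by (rule arg_cong)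
  ultimately show ?thesis by auto
qed

lemma power_inv_count_conj:
  fixes t :: "'a::idom"
  assumes t: "t * t = 1" and u: "u \<in> symgroup n" and g: "g \<in> symgroup n"
  shows "t ^ inv_count (pinv g \<circ> u \<circ> g) = t ^ inv_count u"
proof -
  have "t ^ inv_count (pinv g \<circ> u \<circ> g) = t ^ inv_count u * (t * t) ^ inv_count g"
    by (simp add: power_inv_count_comp[OF t, of _ n] symgroup_comp symgroup_inv u g inv_count_inv[OF g] power_mult_distrib)
  then show ?thesis by (simp add: t)
qed

lemma sign_conj:
  assumes "u \<in> symgroup n" "g \<in> symgroup n"
  shows "sign (pinv g \<circ> u \<circ> g) = sign u"
  using power_inv_count_conj[of "- 1 :: int", OF _ assms] assms
  by (simp add: sign_inv_count[of _ n] symgroup_comp symgroup_inv)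

section \<open>Young subgroups as stabilizers of colorings\<close>

lemma stabilizer_blocks:
  assumes w: "w \<in> symgroup n" and f: "f \<in> extensional {1..n}"
    and B: "\<And>j. j \<in> J \<Longrightarrow> B j = {x \<in> {1..n}. f x = j}" and J: "\<And>x. x \<in> {1..n} \<Longrightarrow> f x \<in> J"
  shows "(\<forall>j\<in>J. w ` B j = B j) \<longleftrightarrow> f \<circ> w = f"
proof
  have wp: "w permutes {1..n}" using w by (simp add: symgroup_def)
  note in_iff = permutes_in_image[OF wp]
  show "f \<circ> w = f" if H: "\<forall>j\<in>J. w ` B j = B j"
  proof
    fix x
    show "(f \<circ> w) x = f x"
    proof (cases "x \<in> {1..n}")
      case True
      have "x \<in> B (f x)" unfolding B[OF J[OF True]] using True by simp
      then have "w x \<in> B (f x)" using H J[OF True] by blast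
      then show ?thesis unfolding B[OF J[OF True]] by simp
    qed (simp add: permutes_not_in[OF wp])
  qed
  show "\<forall>j\<in>J. w ` B j = B j" if H: "f \<circ> w = f"
  proof
    fix j assume j: "j \<in> J"
    have fw: "f (w x) = f x" for x using fun_cong[OF H, of x] by simp
    have "w ` B j \<subseteq> B j" "finite (B j)" unfolding B[OF j] using in_iff fw by auto
    then show "w ` B j = B j" using permutes_inj_on[OF wp, of "B j"] by (intro endo_inj_surj)
  qed
qed

lemma coloringsI:
  assumes "f \<in> extensional {1..n}" "\<And>j. card {x \<in> {1..n}. f x = j} = count M j"
  shows "f \<in> colorings n M"
proof -
  have "count (image_mset f (mset_set {1..n})) j = count M j" for j
    using assms(2)[of j] by (simp add: count_image_mset' eq_commute[of j])
  then show ?thesis using assms(1) by (auto simp: colorings_def intro: multiset_eqI)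
qed

text \<open>The row of the entry x in the tableau that is filled row by row, made extensional so
  that it belongs to \<open>colorings\<close>. Its stabilizer is the Young subgroup.\<close>

definition block_coloring :: "nat list \<Rightarrow> nat \<Rightarrow> nat" where
  "block_coloring la = restrict (\<lambda>x. LEAST i. x \<le> sum_list (take (Suc i) la)) {1..sum_list la}"

lemma block_coloring_extensional: "block_coloring la \<in> extensional {1..sum_list la}"
  by (simp add: block_coloring_def)

lemma sum_take_mono: "i \<le> j \<Longrightarrow> sum_list (take i la) \<le> (sum_list (take j la) :: nat)"
  by (auto simp: le_iff_add take_add)

lemma block_coloring:
  assumes x: "x \<in> {1..sum_list la}"
  shows "block_coloring la x < length la" "i < length la \<Longrightarrow> x \<in> row_block la i \<longleftrightarrow> block_coloring la x = i"
    "y \<in> {1..sum_list la} \<Longrightarrow> x \<le> y \<Longrightarrow> block_coloring la x \<le> block_coloring la y"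
proof -
  let ?P = "\<lambda>x i. x \<le> sum_list (take (Suc i) la)"
  have l: "la \<noteq> []" using x by auto
  have P: "?P x (length la - 1)" if "x \<in> {1..sum_list la}" for x using that l by simp
  have e: "block_coloring la x = (LEAST i. ?P x i)" if "x \<in> {1..sum_list la}" for x
    using that by (simp add: block_coloring_def)
  show "block_coloring la x < length la"
    unfolding e[OF x] using Least_le[of "?P x", OF P[OF x]] l by (simp add: le_less_trans)
  show "block_coloring la x \<le> block_coloring la y" if "y \<in> {1..sum_list la}" "x \<le> y"
    unfolding e[OF x] e[OF that(1)] by (rule Least_le) (rule order_trans[OF that(2) LeastI[of "?P y", OF P[OF that(1)]]])
  show "x \<in> row_block la i \<longleftrightarrow> block_coloring la x = i" if "i < length la"
  proof
    assume r: "x \<in> row_block la i"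
    show "block_coloring la x = i"
      unfolding e[OF x]
    proof (rule Least_equality)
      show "?P x i" using r by (simp add: row_block_def)
      show "i \<le> y" if "?P x y" for y
        using that r sum_take_mono[of "Suc y" i la] by (cases "i \<le> y") (auto simp: row_block_def)
    qed
  next
    assume i: "block_coloring la x = i"
    have "?P x i" using LeastI[of "?P x", OF P[OF x]] unfolding e[OF x, symmetric] i .
    moreover have "sum_list (take i la) < x"
      using not_less_Least[of "i - 1" "?P x"] x unfolding e[OF x, symmetric] i by (cases i) simp_all
    ultimately show "x \<in> row_block la i" by (simp add: row_block_def)
  qed
qed

lemma row_block_eq:
  assumes i: "i < length la"
  shows "row_block la i = {x \<in> {1..sum_list la}. block_coloring la x = i}"
proof -
  have "x \<in> {1..sum_list la}" if "x \<in> row_block la i" for x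
    using that sum_take_mono[of "Suc i" "length la" la] i by (auto simp: row_block_def)
  then show ?thesis using block_coloring(2)[OF _ i] by blast
qed

lemma young_subgroup_stabilizer:
  assumes n: "sum_list la = n"
  shows "young_subgroup la = {w \<in> symgroup n. block_coloring la \<circ> w = block_coloring la}"
proof -
  have "(\<forall>i\<in>{..<length la}. w ` row_block la i = row_block la i) \<longleftrightarrow> block_coloring la \<circ> w = block_coloring la"
    if "w \<in> symgroup n" for w
    by (rule stabilizer_blocks[OF that block_coloring_extensional[of la, unfolded n]])
      (use row_block_eq[of _ la] block_coloring(1)[of _ la] n in auto)
  then show ?thesis unfolding young_subgroup_def n symgroup_def Ball_def lessThan_iff by blast
qed

lemma block_coloring_content:
  assumes n: "sum_list la = n"
  shows "block_coloring la \<in> colorings n (part_content la)"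
proof (rule coloringsI)
  fix i
  have "card {x \<in> {1..n}. block_coloring la x = i} = (if i < length la then la ! i else 0)"
  proof (cases "i < length la")
    case True
    then show ?thesis unfolding n[symmetric] row_block_eq[OF True, symmetric]
      by (simp add: row_block_def take_Suc_conv_app_nth)
  next
    case False
    then have "{x \<in> {1..n}. block_coloring la x = i} = {}" using block_coloring(1) n by blast
    then show ?thesis using False by (simp only: card.empty if_False)
  qed
  then show "card {x \<in> {1..n}. block_coloring la x = i} = count (part_content la) i"
    by (simp add: part_content_def part_fun_def)
qed (use block_coloring_extensional n in blast)

lemma young_subgroup_group:
  assumes n: "sum_list la = n"
  shows "young_subgroup la \<subseteq> symgroup n" "id \<in> young_subgroup la"
    "u \<in> young_subgroup la \<Longrightarrow> v \<in> young_subgroup la \<Longrightarrow> u \<circ> v \<in> young_subgroup la"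
    "u \<in> young_subgroup la \<Longrightarrow> pinv u \<in> young_subgroup la"
  unfolding young_subgroup_stabilizer[OF n]
  using comp_eq_iff[of u n "block_coloring la" "block_coloring la"]
  by (auto simp: symgroup_comp symgroup_inv simp flip: comp_assoc)

text \<open>A descent i of an element of the Young subgroup lies within one block, because the block
  coloring is weakly increasing and invariant under w. So the induction does not leave the
  subgroup.\<close>

lemma young_subgroup_induct [consumes 2, case_names id step]:
  assumes w: "w \<in> young_subgroup la" and n: "sum_list la = n" and "P id"
    and step: "\<And>w i. \<lbrakk>w \<in> young_subgroup la; adj_transp i \<in> young_subgroup la; i \<in> {1..<n};
      inv_count (w \<circ> adj_transp i) = Suc (inv_count w); P w\<rbrakk> \<Longrightarrow> P (w \<circ> adj_transp i)"
  shows "P w"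
  using w
proof (induction "inv_count w" arbitrary: w rule: less_induct)
  case less
  let ?f = "block_coloring la"
  have ws: "w \<in> symgroup n" and "?f \<circ> w = ?f" using less.prems unfolding young_subgroup_stabilizer[OF n] by auto
  then have f: "?f (w x) = ?f x" for x by (metis comp_apply)
  show ?case
  proof (cases "w = id")
    case False
    then obtain i where i: "i \<in> {1..<n}" "w (Suc i) < w i" using exists_descent[OF ws] by blast
    have "w i \<in> {1..n}" "w (Suc i) \<in> {1..n}"
      using ws i(1) permutes_in_image[of w "{1..n}"] by (simp_all add: symgroup_def)
    then have "?f i = ?f (Suc i)"
      using block_coloring(3)[of "w (Suc i)" la "w i"] block_coloring(3)[of i la "Suc i"] i f n by force
    then have s: "adj_transp i \<in> young_subgroup la"
      using adj_transp_symgroup[OF i(1)] by (auto simp: young_subgroup_stabilizer[OF n] adj_transp_apply)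
    let ?v = "w \<circ> adj_transp i"
    have v: "?v \<in> young_subgroup la" by (rule young_subgroup_group(3)[OF n less.prems s])
    have c: "inv_count w = Suc (inv_count ?v)" by (rule inv_count_right(2)[OF ws i])
    have "P (?v \<circ> adj_transp i)" by (rule step[OF v s i(1)]) (use c less.hyps[OF _ v] in simp_all)
    then show ?thesis by simp
  qed (simp add: assms(3))
qed

text \<open>The conjugate of u by g lies in the Young subgroup iff u fixes the block coloring
  translated by g, and every fixed coloring arises from as many g as the subgroup has elements. This
  is the formula for an induced character.\<close>

lemma card_conjugate_in_young_subgroup:
  assumes n: "sum_list la = n" and u: "u \<in> symgroup n"
  shows "card {g \<in> symgroup n. pinv g \<circ> u \<circ> g \<in> young_subgroup la} =
    card (young_subgroup la) * fix_count n (part_content la) u"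
proof -
  let ?f = "block_coloring la" and ?C = "colorings n (part_content la)"
  note f = block_coloring_content[OF n]
  have eq: "pinv g \<circ> u \<circ> g \<in> young_subgroup la \<longleftrightarrow> ?f \<circ> pinv g \<circ> u = ?f \<circ> pinv g" if g: "g \<in> symgroup n" for g
    using symgroup_comp[OF symgroup_comp[OF symgroup_inv[OF g] u] g]
    by (simp add: young_subgroup_stabilizer[OF n] comp_eq_iff[OF g, symmetric] comp_assoc)
  have tr: "?f \<circ> pinv g = h \<longleftrightarrow> h \<circ> g = ?f" if "g \<in> symgroup n" for g h
    unfolding comp_eq_iff[OF that] by (rule eq_commute)
  have "{g \<in> symgroup n. pinv g \<circ> u \<circ> g \<in> young_subgroup la} =
      (\<Union>h\<in>{h \<in> ?C. h \<circ> u = h}. {g \<in> symgroup n. h \<circ> g = ?f})"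
    using coloring_comp[OF f symgroup_inv] by (auto simp: eq tr[symmetric])
  then have "card {g \<in> symgroup n. pinv g \<circ> u \<circ> g \<in> young_subgroup la} =
      card (\<Union>h\<in>{h \<in> ?C. h \<circ> u = h}. {g \<in> symgroup n. h \<circ> g = ?f})" by (rule arg_cong)
  also have "\<dots> = (\<Sum>h\<in>{h \<in> ?C. h \<circ> u = h}. card {g \<in> symgroup n. h \<circ> g = ?f})"
  proof (rule card_UN_disjoint)
    show "finite {h \<in> ?C. h \<circ> u = h}" by (rule finite_subset[OF Collect_restrict finite_colorings])
    show "\<forall>h\<in>{h \<in> ?C. h \<circ> u = h}. finite {g \<in> symgroup n. h \<circ> g = ?f}"
      by (intro ballI finite_subset[OF Collect_restrict finite_symgroup])
  qed (auto simp: tr[symmetric])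
  also have "\<dots> = (\<Sum>h\<in>{h \<in> ?C. h \<circ> u = h}. card (young_subgroup la))"
    unfolding young_subgroup_stabilizer[OF n]
    by (rule sum.cong[OF refl], rule card_coloring_transporter[OF _ f]) simp
  also have "\<dots> = card (young_subgroup la) * fix_count n (part_content la) u" by (simp add: fix_count_def)
  finally show ?thesis .
qed

lemma fix_count_inv:
  assumes "u \<in> symgroup n"
  shows "fix_count n M (pinv u) = fix_count n M u"
  unfolding fix_count_def comp_eq_iff[OF assms] by (simp only: eq_commute)

lemma fix_count_conj:
  assumes u: "u \<in> symgroup n" and g: "g \<in> symgroup n"
  shows "fix_count n M (pinv g \<circ> u \<circ> g) = fix_count n M u"
proof -
  have gg: "f \<circ> g \<circ> pinv g = f" "f \<circ> pinv g \<circ> g = f" for f :: "nat \<Rightarrow> 'a"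
    by (simp_all only: comp_assoc symgroup_inv_o[OF g] comp_id)
  have eq: "f \<circ> (pinv g \<circ> u \<circ> g) = f \<longleftrightarrow> f \<circ> pinv g \<circ> u = f \<circ> pinv g" for f :: "nat \<Rightarrow> 'a"
    unfolding comp_eq_iff[OF g, symmetric] comp_assoc ..
  have "bij_betw (\<lambda>f. f \<circ> g) {f \<in> colorings n M. f \<circ> u = f} {f \<in> colorings n M. f \<circ> (pinv g \<circ> u \<circ> g) = f}"
    by (rule bij_betw_byWitness[where f' = "\<lambda>f. f \<circ> pinv g"])
      (use coloring_comp[OF _ g] coloring_comp[OF _ symgroup_inv[OF g]] in \<open>auto simp: eq gg\<close>)
  then show ?thesis unfolding fix_count_def by (rule bij_betw_same_card[symmetric])
qed

text \<open>Frobenius reciprocity for a class function F, as a double count of the pairs of u and g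
  for which the conjugate of u by g lies in the subgroup.\<close>

lemma sum_young_subgroup:
  fixes F :: "(nat \<Rightarrow> nat) \<Rightarrow> 'a::field_char_0"
  assumes n: "sum_list la = n"
    and F: "\<And>u g. u \<in> symgroup n \<Longrightarrow> g \<in> symgroup n \<Longrightarrow> F (pinv g \<circ> u \<circ> g) = F u"
  shows "of_nat (card (young_subgroup la)) * (\<Sum>u\<in>symgroup n. of_nat (fix_count n (part_content la) u) * F u) =
    fact n * (\<Sum>w\<in>young_subgroup la. F w)"
proof -
  let ?Y = "young_subgroup la"
  have sub: "?Y \<subseteq> symgroup n" by (rule young_subgroup_group(1)[OF n])
  have "of_nat (card ?Y) * (\<Sum>u\<in>symgroup n. of_nat (fix_count n (part_content la) u) * F u) =
      (\<Sum>u\<in>symgroup n. of_nat (card {g \<in> symgroup n. pinv g \<circ> u \<circ> g \<in> ?Y}) * F u)"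
    by (simp add: card_conjugate_in_young_subgroup[OF n] sum_distrib_left mult_ac)
  also have "\<dots> = (\<Sum>u\<in>symgroup n. \<Sum>g\<in>{g \<in> symgroup n. pinv g \<circ> u \<circ> g \<in> ?Y}. F u)" by simp
  also have "\<dots> = (\<Sum>g\<in>symgroup n. \<Sum>u\<in>{u \<in> symgroup n. pinv g \<circ> u \<circ> g \<in> ?Y}. F u)"
    by (rule sum.swap_restrict) simp_all
  also have "\<dots> = (\<Sum>g\<in>symgroup n. \<Sum>w\<in>?Y. F w)"
  proof (rule sum.cong[OF refl])
    fix g assume g: "g \<in> symgroup n"
    have gg: "g \<circ> (pinv g \<circ> u) = u" "pinv g \<circ> (g \<circ> u) = u" for u :: "nat \<Rightarrow> nat"
      by (simp_all only: comp_assoc[symmetric] symgroup_inv_o[OF g] id_comp)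
    note c = comp_assoc gg symgroup_inv_o[OF g] comp_id
    show "(\<Sum>u\<in>{u \<in> symgroup n. pinv g \<circ> u \<circ> g \<in> ?Y}. F u) = (\<Sum>w\<in>?Y. F w)"
    proof (rule sum.reindex_bij_witness[where i = "\<lambda>w. g \<circ> w \<circ> pinv g" and j = "\<lambda>u. pinv g \<circ> u \<circ> g"])
      fix w assume w: "w \<in> ?Y"
      show *: "pinv g \<circ> (g \<circ> w \<circ> pinv g) \<circ> g = w" by (simp only: c)
      have "g \<circ> w \<circ> pinv g \<in> symgroup n" using sub w g by (intro symgroup_comp symgroup_inv) auto
      with * w show "g \<circ> w \<circ> pinv g \<in> {u \<in> symgroup n. pinv g \<circ> u \<circ> g \<in> ?Y}" by simp
    next
      fix u assume u: "u \<in> {u \<in> symgroup n. pinv g \<circ> u \<circ> g \<in> ?Y}"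
      then show "pinv g \<circ> u \<circ> g \<in> ?Y" by simp
      show "g \<circ> (pinv g \<circ> u \<circ> g) \<circ> pinv g = u" by (simp only: c)
      show "F (pinv g \<circ> u \<circ> g) = F u" by (rule F[OF _ g]) (use u in simp)
    qed
  qed
  also have "\<dots> = fact n * (\<Sum>w\<in>?Y. F w)" by (simp add: card_symgroup of_nat_fact)
  finally show ?thesis .
qed

section \<open>Young idempotents in deformed group algebras\<close>

text \<open>\<open>sp x c\<close> reads: x is regular at q = 1 with value c. Multiplication rules
  are assumed only where the length grows; the other products follow from the quadratic
  relation.\<close>

locale deformed_group_algebra = trace_space scale
  for scale :: "'k::linordered_field \<Rightarrow> 'h::ring_1 \<Rightarrow> 'h" (infixr \<open>*s\<close> 75) +
  fixes n :: nat and T :: "(nat \<Rightarrow> nat) \<Rightarrow> 'h" and q :: 'k and sp :: "'k \<Rightarrow> rat \<Rightarrow> bool"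
  assumes scale_mult_left: "(c *s x) * y = c *s (x * y)"
    and scale_mult_right: "x * (c *s y) = c *s (x * y)"
    and T_id: "T id = 1"
    and T_quadratic: "i \<in> {1..<n} \<Longrightarrow> T (adj_transp i) * T (adj_transp i) = (q - 1) *s T (adj_transp i) + q *s 1"
    and T_left: "\<lbrakk>w \<in> symgroup n; i \<in> {1..<n}; inv_count (adj_transp i \<circ> w) = Suc (inv_count w)\<rbrakk> \<Longrightarrow>
      T (adj_transp i) * T w = T (adj_transp i \<circ> w)"
    and T_right: "\<lbrakk>w \<in> symgroup n; i \<in> {1..<n}; inv_count (w \<circ> adj_transp i) = Suc (inv_count w)\<rbrakk> \<Longrightarrow>
      T w * T (adj_transp i) = T (w \<circ> adj_transp i)"
    and T_inj: "inj_on T (symgroup n)"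
    and T_indep: "independent (T ` symgroup n)"
    and q_pos: "0 < q"
    and sp_1: "sp 1 1" and sp_q: "sp q 1"
    and sp_add: "sp c a \<Longrightarrow> sp d b \<Longrightarrow> sp (c + d) (a + b)"
    and sp_mult: "sp c a \<Longrightarrow> sp d b \<Longrightarrow> sp (c * d) (a * b)"
    and sp_uminus: "sp c a \<Longrightarrow> sp (- c) (- a)"
    and sp_inverse: "sp c a \<Longrightarrow> a \<noteq> 0 \<Longrightarrow> sp (inverse c) (inverse a)"
    and sp_unique: "sp c a \<Longrightarrow> sp c b \<Longrightarrow> a = b"
begin

abbreviation "H \<equiv> span (T ` symgroup n)"

lemma sp_0: "sp 0 0"
  using sp_add[OF sp_1 sp_uminus[OF sp_1]] by simp

lemma sp_diff: "sp x a \<Longrightarrow> sp y b \<Longrightarrow> sp (x - y) (a - b)"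
  using sp_add[OF _ sp_uminus, of x a y b] by simp

lemma sp_divide: "sp x a \<Longrightarrow> sp y b \<Longrightarrow> b \<noteq> 0 \<Longrightarrow> sp (x / y) (a / b)"
  unfolding divide_inverse by (intro sp_mult sp_inverse)

lemma sp_sum: "(\<And>i. i \<in> I \<Longrightarrow> sp (f i) (g i)) \<Longrightarrow> sp (sum f I) (sum g I)"
  by (induction I rule: infinite_finite_induct) (simp_all add: sp_0 sp_add)

lemma sp_of_nat: "sp (of_nat k) (of_nat k)"
  by (induction k) (simp_all add: sp_0 sp_1 sp_add)

lemma sp_of_int: "sp (of_int k) (of_int k)"
  by (cases k rule: int_cases2) (simp_all add: sp_of_nat sp_uminus)

lemma sp_power: "sp x a \<Longrightarrow> sp (x ^ k) (a ^ k)"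
  by (induction k) (simp_all add: sp_1 sp_mult)

definition cf :: "'h \<Rightarrow> (nat \<Rightarrow> nat) \<Rightarrow> 'k" where
  "cf x w = representation (T ` symgroup n) x (T w)"

lemma T_H [simp]: "w \<in> symgroup n \<Longrightarrow> T w \<in> H"
  by (rule span_base) simp

lemma cf_T: "u \<in> symgroup n \<Longrightarrow> w \<in> symgroup n \<Longrightarrow> cf (T u) w = (if u = w then 1 else 0)"
  using T_inj by (auto simp: cf_def representation_basis[OF T_indep] dest: inj_onD)

lemma cf_0 [simp]: "cf 0 w = 0"
  by (simp add: cf_def representation_zero)

lemma cf_scale: "x \<in> H \<Longrightarrow> cf (c *s x) w = c * cf x w"
  by (simp add: cf_def representation_scale[OF T_indep])

lemma cf_add: "x \<in> H \<Longrightarrow> y \<in> H \<Longrightarrow> cf (x + y) w = cf x w + cf y w"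
  by (simp add: cf_def representation_add[OF T_indep])

lemma cf_combination: "(\<And>i. i \<in> I \<Longrightarrow> v i \<in> H) \<Longrightarrow> cf (\<Sum>i\<in>I. a i *s v i) w = (\<Sum>i\<in>I. a i * cf (v i) w)"
  unfolding cf_def by (rule representation_combination[OF T_indep])

lemma cf_expand: "x \<in> H \<Longrightarrow> x = (\<Sum>w\<in>symgroup n. cf x w *s T w)"
  using expand[OF _ T_indep, of x] by (simp add: sum.reindex[OF T_inj] cf_def)

lemma H_eqI: "x \<in> H \<Longrightarrow> y \<in> H \<Longrightarrow> (\<And>w. w \<in> symgroup n \<Longrightarrow> cf x w = cf y w) \<Longrightarrow> x = y"
  using cf_expand[of x] cf_expand[of y] by simp

lemma H_induct [consumes 1, case_names zero step]:
  assumes "x \<in> H" "P 0"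
    and step: "\<And>c w y. \<lbrakk>w \<in> symgroup n; y \<in> H; P y\<rbrakk> \<Longrightarrow> P (c *s T w + y)"
  shows "P x"
proof -
  have "x \<in> H \<and> P x"
    using assms(1)
  proof (induction rule: span_induct_alt)
    case (step c x y)
    then obtain w where w: "w \<in> symgroup n" "x = T w" by blast
    then have "P (c *s T w + y)" using step by (intro assms(3)) simp_all
    with step w show ?case by (simp add: span_add span_scale)
  qed (simp add: span_zero assms(2))
  then show ?thesis ..
qed

text \<open>If the generator shortens w then \<open>T w\<close> is the generator times a shorter
  basis element, and the quadratic relation applies.\<close>

lemma T_adj_mult:
  assumes w: "w \<in> symgroup n" and i: "i \<in> {1..<n}"
  shows "T (adj_transp i) * T w = (if inv_count (adj_transp i \<circ> w) = Suc (inv_count w) then T (adj_transp i \<circ> w)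
    else (q - 1) *s T w + q *s T (adj_transp i \<circ> w))"
proof (cases "inv_count (adj_transp i \<circ> w) = Suc (inv_count w)")
  case False
  let ?v = "adj_transp i \<circ> w"
  have v: "?v \<in> symgroup n" by (intro symgroup_comp adj_transp_symgroup w i)
  have "inv_count (adj_transp i \<circ> ?v) = Suc (inv_count ?v)" using False inv_count_left[OF w i] by simp
  then have Tw: "T w = T (adj_transp i) * T ?v" using T_left[OF v i] by simp
  have "T (adj_transp i) * T w = (T (adj_transp i) * T (adj_transp i)) * T ?v" unfolding Tw by (rule mult.assoc[symmetric])
  also have "\<dots> = (q - 1) *s T w + q *s T ?v"
    by (simp only: T_quadratic[OF i] distrib_right scale_mult_left mult_1_left Tw)
  finally show ?thesis using False by simp
qed (simp add: T_left[OF w i])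

lemma T_mult_adj:
  assumes w: "w \<in> symgroup n" and i: "i \<in> {1..<n}"
  shows "T w * T (adj_transp i) = (if inv_count (w \<circ> adj_transp i) = Suc (inv_count w) then T (w \<circ> adj_transp i)
    else (q - 1) *s T w + q *s T (w \<circ> adj_transp i))"
proof (cases "inv_count (w \<circ> adj_transp i) = Suc (inv_count w)")
  case False
  let ?v = "w \<circ> adj_transp i"
  have v: "?v \<in> symgroup n" by (intro symgroup_comp adj_transp_symgroup w i)
  have "inv_count (?v \<circ> adj_transp i) = Suc (inv_count ?v)" using False inv_count_right(3)[OF w i] by simp
  then have Tw: "T w = T ?v * T (adj_transp i)" using T_right[OF v i] by simp
  have "T w * T (adj_transp i) = T ?v * (T (adj_transp i) * T (adj_transp i))" unfolding Tw by (rule mult.assoc)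
  also have "\<dots> = (q - 1) *s T w + q *s T ?v"
    by (simp only: T_quadratic[OF i] distrib_left scale_mult_right mult_1_right Tw)
  finally show ?thesis using False by simp
qed (simp add: T_right[OF w i])

lemma T_adj_mult_H:
  assumes i: "i \<in> {1..<n}" and x: "x \<in> H"
  shows "T (adj_transp i) * x \<in> H"
  using x
proof (induction rule: H_induct)
  case (step c w y)
  have "T (adj_transp i) * T w \<in> H"
    unfolding T_adj_mult[OF step(1) i]
    by (auto intro!: span_add span_scale T_H symgroup_comp adj_transp_symgroup[OF i] step(1))
  with step show ?case by (simp add: distrib_left scale_mult_right span_add span_scale)
qed (simp add: span_zero)

lemma cf_adj_mult:
  assumes i: "i \<in> {1..<n}" and x: "x \<in> H" and z: "z \<in> symgroup n"
  shows "cf (T (adj_transp i) * x) z = (if inv_count (adj_transp i \<circ> z) = Suc (inv_count z)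
    then q * cf x (adj_transp i \<circ> z) else cf x (adj_transp i \<circ> z) + (q - 1) * cf x z)"
  using x
proof (induction rule: H_induct)
  case (step c w y)
  let ?s = "adj_transp i"
  have sw: "?s \<circ> w \<in> symgroup n" and sz: "?s \<circ> z \<in> symgroup n"
    by (intro symgroup_comp adj_transp_symgroup step(1) i z)+
  have eq: "?s \<circ> w = z \<longleftrightarrow> w = ?s \<circ> z" by (auto simp flip: comp_assoc)
  have neq: "?s \<circ> z \<noteq> z" using inv_count_left[OF z i] by auto
  have Tw: "cf (T ?s * T w) z = (if inv_count (?s \<circ> z) = Suc (inv_count z) then q * cf (T w) (?s \<circ> z)
      else cf (T w) (?s \<circ> z) + (q - 1) * cf (T w) z)"
  proof (cases "w = ?s \<circ> z")
    case True
    show ?thesis unfolding T_adj_mult[OF step(1) i] unfolding True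
      using inv_count_left[OF z i] neq by (auto simp: cf_T sz z cf_add cf_scale span_scale)
  next
    case False
    then show ?thesis unfolding T_adj_mult[OF step(1) i]
      using inv_count_left[OF z i] eq by (cases "w = z") (auto simp: cf_T sz sw z cf_add cf_scale span_scale step(1))
  qed
  have "T ?s * T w \<in> H" "T ?s * y \<in> H" by (intro T_adj_mult_H i T_H step)+
  then have "cf (T ?s * (c *s T w + y)) z = c * cf (T ?s * T w) z + cf (T ?s * y) z"
    by (simp add: distrib_left scale_mult_right cf_add cf_scale span_scale)
  also have "\<dots> = (if inv_count (?s \<circ> z) = Suc (inv_count z) then q * cf (c *s T w + y) (?s \<circ> z)
      else cf (c *s T w + y) (?s \<circ> z) + (q - 1) * cf (c *s T w + y) z)"
    using step by (simp add: Tw cf_add cf_scale span_scale algebra_simps del: comp_apply)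
  finally show ?case .
qed simp

lemma T_mult_H: "u \<in> symgroup n \<Longrightarrow> x \<in> H \<Longrightarrow> T u * x \<in> H"
proof (induction arbitrary: x rule: symgroup_induct)
  case (step u i)
  have "T (u \<circ> adj_transp i) * x = T u * (T (adj_transp i) * x)"
    unfolding T_right[OF step(1-3), symmetric] by (rule mult.assoc)
  with step T_adj_mult_H[OF step(2)] show ?case by (simp del: comp_apply)
qed (simp only: T_id mult_1_left)

lemma mult_H: "x \<in> H \<Longrightarrow> y \<in> H \<Longrightarrow> x * y \<in> H"
proof (induction rule: H_induct)
  case (step c w x)
  then show ?case by (simp add: distrib_right scale_mult_left span_add span_scale T_mult_H)
qed (simp add: span_zero)

text \<open>The coefficient at the identity is the symmetrizing trace of the algebra: basis elements
  of inverse permutations are dual to each other up to the factor q^l(u).\<close>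

lemma cf_T_mult_id: "u \<in> symgroup n \<Longrightarrow> x \<in> H \<Longrightarrow> cf (T u * x) id = q ^ inv_count u * cf x (pinv u)"
proof (induction arbitrary: x rule: symgroup_induct)
  case id
  then show ?case by (simp only: T_id mult_1_left inv_count_id power_0 inv_id)
next
  case (step u i)
  note s = adj_transp_symgroup[OF step(2)]
  have pi: "pinv (u \<circ> adj_transp i) = adj_transp i \<circ> pinv u" using pinv_comp[OF step(1) s] by simp
  have up: "inv_count (adj_transp i \<circ> pinv u) = Suc (inv_count (pinv u))"
    unfolding pi[symmetric] inv_count_inv[OF symgroup_comp[OF step(1) s]] inv_count_inv[OF step(1)] by (rule step(3))
  have "cf (T (u \<circ> adj_transp i) * x) id = cf (T u * (T (adj_transp i) * x)) id"
    unfolding T_right[OF step(1-3), symmetric] by (simp only: mult.assoc)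
  also have "\<dots> = q ^ inv_count u * cf (T (adj_transp i) * x) (pinv u)"
    by (rule step.IH[OF T_adj_mult_H[OF step(2) step.prems]])
  also have "\<dots> = q ^ inv_count u * (q * cf x (adj_transp i \<circ> pinv u))"
    using up by (simp add: cf_adj_mult[OF step(2) step.prems symgroup_inv[OF step(1)]])
  finally show ?case by (simp only: pi step(3) power_Suc2 mult.assoc)
qed

definition star :: "'h \<Rightarrow> 'h" where
  "star x = (\<Sum>w\<in>symgroup n. cf x w *s T (pinv w))"

lemma star_H: "star x \<in> H"
  unfolding star_def by (intro span_sum span_scale T_H symgroup_inv)

lemma cf_star:
  assumes z: "z \<in> symgroup n"
  shows "cf (star x) z = cf x (pinv z)"
proof -
  have eq: "pinv w = z \<longleftrightarrow> w = pinv z" if "w \<in> symgroup n" for w using z that by auto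
  have "cf (star x) z = (\<Sum>w\<in>symgroup n. cf x w * (if w = pinv z then 1 else 0))"
    unfolding star_def by (subst cf_combination) (simp_all add: symgroup_inv cf_T z eq)
  also have "\<dots> = (\<Sum>w\<in>symgroup n. if w = pinv z then cf x w else 0)" by (rule sum.cong) simp_all
  also have "\<dots> = cf x (pinv z)" by (simp add: symgroup_inv[OF z])
  finally show ?thesis .
qed

lemma star_linear: "x \<in> H \<Longrightarrow> y \<in> H \<Longrightarrow> star (x + y) = star x + star y" "x \<in> H \<Longrightarrow> star (c *s x) = c *s star x"
  unfolding star_def by (simp_all add: cf_add cf_scale scale_left_distrib sum.distrib scale_sum_right)

lemma star_T: "w \<in> symgroup n \<Longrightarrow> star (T w) = T (pinv w)"
  by (rule H_eqI) (auto simp: star_H cf_star cf_T symgroup_inv)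

lemma star_involution: "x \<in> H \<Longrightarrow> star (star x) = x"
  by (rule H_eqI) (simp_all add: star_H cf_star symgroup_inv)

lemma star_adj_mult:
  assumes i: "i \<in> {1..<n}" and x: "x \<in> H"
  shows "star (T (adj_transp i) * x) = star x * T (adj_transp i)"
  using x
proof (induction rule: H_induct)
  case zero
  have "star 0 = 0" by (simp add: star_def)
  then show ?case by simp
next
  case (step c w y)
  note s = adj_transp_symgroup[OF i] and w = step(1)
  have pi: "pinv (adj_transp i \<circ> w) = pinv w \<circ> adj_transp i" using pinv_comp[OF s w] by simp
  have "inv_count (pinv w \<circ> adj_transp i) = inv_count (adj_transp i \<circ> w)"
    unfolding pi[symmetric] by (rule inv_count_inv[OF symgroup_comp[OF s w]])
  then have "star (T (adj_transp i) * T w) = T (pinv w) * T (adj_transp i)"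
    unfolding T_adj_mult[OF w i] T_mult_adj[OF symgroup_inv[OF w] i] inv_count_inv[OF w]
    by (auto simp: star_linear star_T w s symgroup_comp pi span_scale)
  then have "star (T (adj_transp i) * T w) = star (T w) * T (adj_transp i)" by (simp only: star_T[OF w])
  with step show ?case
    by (simp add: distrib_left distrib_right scale_mult_right scale_mult_left star_linear span_scale T_adj_mult_H[OF i])
qed

lemma star_T_mult: "u \<in> symgroup n \<Longrightarrow> x \<in> H \<Longrightarrow> star (T u * x) = star x * T (pinv u)"
proof (induction arbitrary: x rule: symgroup_induct)
  case id
  then show ?case by (simp only: T_id mult_1_left mult_1_right inv_id)
next
  case (step u i)
  note s = adj_transp_symgroup[OF step(2)] and u = step(1)
  have pi: "pinv (u \<circ> adj_transp i) = adj_transp i \<circ> pinv u" using pinv_comp[OF u s] by simp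
  have up: "inv_count (adj_transp i \<circ> pinv u) = Suc (inv_count (pinv u))"
    unfolding pi[symmetric] inv_count_inv[OF symgroup_comp[OF u s]] inv_count_inv[OF u] by (rule step(3))
  have "star (T (u \<circ> adj_transp i) * x) = star (T u * (T (adj_transp i) * x))"
    unfolding T_right[OF step(1-3), symmetric] by (simp only: mult.assoc)
  also have "\<dots> = star (T (adj_transp i) * x) * T (pinv u)" by (rule step.IH[OF T_adj_mult_H[OF step(2) step.prems]])
  also have "\<dots> = star x * (T (adj_transp i) * T (pinv u))"
    unfolding star_adj_mult[OF step(2) step.prems] by (rule mult.assoc)
  finally show ?case unfolding T_left[OF symgroup_inv[OF u] step(2) up] pi .
qed

lemma star_antimult: "x \<in> H \<Longrightarrow> y \<in> H \<Longrightarrow> star (x * y) = star y * star x"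
proof (induction rule: H_induct)
  case zero
  have "star 0 = 0" by (simp add: star_def)
  then show ?case by simp
next
  case (step c w x)
  then show ?case
    by (simp add: distrib_left distrib_right scale_mult_right scale_mult_left star_linear span_scale
        T_mult_H mult_H star_T_mult star_T)
qed

lemma star_definiteness:
  assumes x: "x \<in> H" and "star x * x = 0"
  shows "x = 0"
proof -
  have "star x * x = (\<Sum>w\<in>symgroup n. cf x w *s (T (pinv w) * x))"
    by (simp add: star_def sum_distrib_right scale_mult_left)
  then have "0 = cf (\<Sum>w\<in>symgroup n. cf x w *s (T (pinv w) * x)) id" using assms(2) by simp
  also have "\<dots> = (\<Sum>w\<in>symgroup n. cf x w * cf (T (pinv w) * x) id)"
    by (rule cf_combination) (intro T_mult_H symgroup_inv x)
  also have "\<dots> = (\<Sum>w\<in>symgroup n. q ^ inv_count w * (cf x w)\<^sup>2)"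
    by (rule sum.cong) (simp_all add: cf_T_mult_id symgroup_inv x inv_count_inv power2_eq_square)
  finally have "\<forall>w\<in>symgroup n. q ^ inv_count w * (cf x w)\<^sup>2 = 0"
    using q_pos by (subst (asm) eq_commute, subst (asm) sum_nonneg_eq_0_iff) simp_all
  then have "cf x w = 0" if "w \<in> symgroup n" for w using q_pos that by auto
  then show ?thesis by (intro H_eqI x) (simp_all add: span_zero)
qed

sublocale star_algebra scale "T ` symgroup n" star
  by unfold_locales (fact finite_imageI[OF finite_symgroup] T_indep scale_mult_left scale_mult_right
      T_H[OF symgroup_id, unfolded T_id] mult_H star_involution star_antimult star_linear star_definiteness
      | rule star_H)+

section \<open>Specialization at q = 1 and the Young idempotents\<close>

definition specializes :: "'h \<Rightarrow> ((nat \<Rightarrow> nat) \<Rightarrow> rat) \<Rightarrow> bool" where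
  "specializes x f \<longleftrightarrow> x \<in> H \<and> (\<forall>z\<in>symgroup n. sp (cf x z) (f z))"

lemma specializes_T: "w \<in> symgroup n \<Longrightarrow> specializes (T w) (\<lambda>z. if w = z then 1 else 0)"
  by (simp add: specializes_def cf_T sp_0 sp_1)

lemma specializes_adj_mult:
  assumes i: "i \<in> {1..<n}" and x: "specializes x f"
  shows "specializes (T (adj_transp i) * x) (\<lambda>z. f (adj_transp i \<circ> z))"
  unfolding specializes_def
proof (intro conjI ballI)
  have xH: "x \<in> H" and f: "\<And>z. z \<in> symgroup n \<Longrightarrow> sp (cf x z) (f z)" using x by (auto simp: specializes_def)
  show "T (adj_transp i) * x \<in> H" by (rule T_adj_mult_H[OF i xH])
  fix z assume z: "z \<in> symgroup n"
  have f': "sp (cf x (adj_transp i \<circ> z)) (f (adj_transp i \<circ> z))" by (intro f symgroup_comp adj_transp_symgroup i z)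
  show "sp (cf (T (adj_transp i) * x) z) (f (adj_transp i \<circ> z))"
    unfolding cf_adj_mult[OF i xH z]
    using sp_mult[OF sp_q f'] sp_add[OF f' sp_mult[OF sp_diff[OF sp_q sp_1] f[OF z]]] by simp
qed

lemma specializes_T_mult:
  "u \<in> symgroup n \<Longrightarrow> specializes x f \<Longrightarrow> specializes (T u * x) (\<lambda>z. f (pinv u \<circ> z))"
proof (induction arbitrary: x f rule: symgroup_induct)
  case id
  then show ?case by (simp only: T_id mult_1_left inv_id id_comp)
next
  case (step u i)
  note s = adj_transp_symgroup[OF step(2)]
  have pi: "pinv (u \<circ> adj_transp i) = adj_transp i \<circ> pinv u" using pinv_comp[OF step(1) s] by simp
  have eq: "T (u \<circ> adj_transp i) * x = T u * (T (adj_transp i) * x)"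
    unfolding T_right[OF step(1-3), symmetric] by (rule mult.assoc)
  show ?case unfolding pi eq comp_assoc by (rule step.IH[OF specializes_adj_mult[OF step(2) step.prems]])
qed

text \<open>At q = 1 the product of u, g and w is the permutation u g w, which equals g iff w is the
  conjugate of the inverse of u by g.\<close>

lemma Tr_T_T:
  assumes u: "u \<in> symgroup n" and w: "w \<in> symgroup n"
  shows "sp (Tr (T u) (T w)) (of_nat (card {g \<in> symgroup n. pinv g \<circ> pinv u \<circ> g = w}))"
proof -
  have "Tr (T u) (T w) = (\<Sum>g\<in>symgroup n. cf (T u * (T g * T w)) g)"
    unfolding Tr_def btrace_def by (simp add: sum.reindex[OF T_inj] cf_def mult.assoc)
  also have "sp \<dots> (\<Sum>g\<in>symgroup n. if w = pinv g \<circ> (pinv u \<circ> g) then 1 else 0)"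
  proof (rule sp_sum)
    fix g assume g: "g \<in> symgroup n"
    from specializes_T_mult[OF u specializes_T_mult[OF g specializes_T[OF w]]] g
    show "sp (cf (T u * (T g * T w)) g) (if w = pinv g \<circ> (pinv u \<circ> g) then 1 else 0)"
      by (simp add: specializes_def)
  qed
  also have "(\<Sum>g\<in>symgroup n. if w = pinv g \<circ> (pinv u \<circ> g) then 1 else 0) =
      (of_nat (card {g \<in> symgroup n. pinv g \<circ> pinv u \<circ> g = w}) :: rat)"
    by (simp add: sum.If_cases Int_def eq_commute[of w] comp_assoc)
  finally show ?thesis .
qed

text \<open>For t = q or t = -1 each \<open>T w\<close> of the Young subgroup acts on this element
  by t^l(w). The base t / q of the weights is 1 in the first case and -1/q in the second.\<close>

definition young_elem :: "'k \<Rightarrow> nat list \<Rightarrow> 'h" where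
  "young_elem t la = (\<Sum>w\<in>young_subgroup la. (t / q) ^ inv_count w *s T w)"

text \<open>The Poincare polynomial of the Young subgroup, at q for t = q and at 1/q for t =
  -1.\<close>

definition young_norm :: "'k \<Rightarrow> nat list \<Rightarrow> 'k" where
  "young_norm t la = (\<Sum>w\<in>young_subgroup la. (t * t / q) ^ inv_count w)"

definition young_idem :: "'k \<Rightarrow> nat list \<Rightarrow> 'h" where
  "young_idem t la = inverse (young_norm t la) *s young_elem t la"

end

text \<open>The equation says that t is q or -1, the value of a generator in the trivial or the sign
  representation, so that both kinds of idempotents are treated at once. The value s of t at q = 1
  is a square root of 1.\<close>

locale young_idempotents = deformed_group_algebra +
  fixes t :: 'a and s :: rat
  assumes t_root: "t * t = (q - 1) * t + q" and sp_t: "sp t s"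
begin

lemma s_square: "s * s = 1"
proof (rule sp_unique)
  show "sp (t * t) (s * s)" by (intro sp_mult sp_t)
  show "sp (t * t) 1" unfolding t_root using sp_add[OF sp_mult[OF sp_diff[OF sp_q sp_1] sp_t] sp_q] by simp
qed

lemma t_nonzero: "t \<noteq> 0"
  using t_root q_pos by auto

context
  fixes la :: "nat list"
  assumes la: "sum_list la = n"
begin

lemma finite_young: "finite (young_subgroup la)"
  using finite_subset[OF young_subgroup_group(1)[OF la] finite_symgroup] .

lemma young_sub: "w \<in> young_subgroup la \<Longrightarrow> w \<in> symgroup n"
  using young_subgroup_group(1)[OF la] by blast

lemma young_elem_H: "young_elem t la \<in> H"
  unfolding young_elem_def by (intro span_sum span_scale T_H young_sub)

lemma cf_young_elem:
  assumes z: "z \<in> symgroup n"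
  shows "cf (young_elem t la) z = (if z \<in> young_subgroup la then (t / q) ^ inv_count z else 0)"
proof -
  have "cf (young_elem t la) z = (\<Sum>w\<in>young_subgroup la. (t / q) ^ inv_count w * cf (T w) z)"
    unfolding young_elem_def by (rule cf_combination) (intro T_H young_sub)
  also have "\<dots> = (\<Sum>w\<in>young_subgroup la. if w = z then (t / q) ^ inv_count z else 0)"
    by (rule sum.cong) (simp_all add: cf_T young_sub z)
  also have "\<dots> = (if z \<in> young_subgroup la then (t / q) ^ inv_count z else 0)"
    using finite_young by simp
  finally show ?thesis .
qed

lemma T_adj_young_elem:
  assumes i: "i \<in> {1..<n}" and s: "adj_transp i \<in> young_subgroup la"
  shows "T (adj_transp i) * young_elem t la = t *s young_elem t la"
proof (rule H_eqI)
  show "T (adj_transp i) * young_elem t la \<in> H" "t *s young_elem t la \<in> H"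
    by (intro T_adj_mult_H i young_elem_H span_scale)+
  fix z assume z: "z \<in> symgroup n"
  have sz: "adj_transp i \<circ> z \<in> symgroup n" by (intro symgroup_comp adj_transp_symgroup i z)
  have iff: "adj_transp i \<circ> z \<in> young_subgroup la \<longleftrightarrow> z \<in> young_subgroup la"
    using young_subgroup_group(3)[OF la s, of z] young_subgroup_group(3)[OF la s, of "adj_transp i \<circ> z"] by auto
  let ?r = "t / q"
  have q0: "q \<noteq> 0" using q_pos by simp
  have up: "q * (?r * x) = t * x" for x using q0 by simp
  \<comment> \<open>The equation of t divided by q; it settles the case in which the generator
    shortens z.\<close>
  have down: "x + (q - 1) * (?r * x) = t * (?r * x)" for x
  proof -
    have "1 + (q - 1) * ?r = t * ?r" using t_root q0 by (simp add: field_simps)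
    then have "(1 + (q - 1) * ?r) * x = t * ?r * x" by simp
    then show ?thesis by (simp only: distrib_right mult_1_left mult.assoc)
  qed
  show "cf (T (adj_transp i) * young_elem t la) z = cf (t *s young_elem t la) z"
    unfolding cf_adj_mult[OF i young_elem_H z] cf_scale[OF young_elem_H] cf_young_elem[OF z] cf_young_elem[OF sz] iff
    using inv_count_left[OF z i] down[of "?r ^ inv_count (adj_transp i \<circ> z)"] up by auto
qed

lemma T_young_elem:
  assumes w: "w \<in> young_subgroup la"
  shows "T w * young_elem t la = t ^ inv_count w *s young_elem t la"
  using w la
proof (induction rule: young_subgroup_induct)
  case id
  show ?case by (simp only: T_id mult_1_left inv_count_id power_0 scale_one)
next
  case (step w i)
  have "T (w \<circ> adj_transp i) * young_elem t la = T w * (T (adj_transp i) * young_elem t la)"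
    unfolding T_right[OF young_sub[OF step(1)] step(3,4), symmetric] by (rule mult.assoc)
  also have "\<dots> = t ^ inv_count (w \<circ> adj_transp i) *s young_elem t la"
    by (simp only: T_adj_young_elem[OF step(3,2)] scale_mult_right step scale_scale power_Suc)
  finally show ?case .
qed

lemma young_norm_pos: "young_norm t la > 0"
  unfolding young_norm_def
proof (rule sum_pos[OF finite_young])
  show "young_subgroup la \<noteq> {}" using young_subgroup_group(2)[OF la] by auto
  show "(t * t / q) ^ inv_count w > 0" for w
    using q_pos t_nonzero by (intro zero_less_power divide_pos_pos) (simp_all add: zero_less_mult_iff linorder_neq_iff disj_commute)
qed

lemma young_elem_square: "young_elem t la * young_elem t la = young_norm t la *s young_elem t la"
proof -
  have "young_elem t la * young_elem t la = (\<Sum>w\<in>young_subgroup la. (t / q) ^ inv_count w *s (T w * young_elem t la))"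
    by (subst (1) young_elem_def) (simp add: sum_distrib_right scale_mult_left)
  also have "\<dots> = (\<Sum>w\<in>young_subgroup la. (t * t / q) ^ inv_count w *s young_elem t la)"
    by (rule sum.cong) (simp_all add: T_young_elem power_divide power_mult_distrib mult_ac)
  finally show ?thesis by (simp add: young_norm_def scale_sum_left)
qed

lemma star_young_elem: "star (young_elem t la) = young_elem t la"
proof (rule H_eqI)
  fix z assume z: "z \<in> symgroup n"
  have "pinv z \<in> young_subgroup la \<longleftrightarrow> z \<in> young_subgroup la"
    using young_subgroup_group(4)[OF la, of z] young_subgroup_group(4)[OF la, of "pinv z"] z by auto
  then show "cf (star (young_elem t la)) z = cf (young_elem t la) z"
    unfolding cf_star[OF z] cf_young_elem[OF symgroup_inv[OF z]] cf_young_elem[OF z] inv_count_inv[OF z] by simp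
qed (simp_all only: star_H young_elem_H)

lemma proj_young_idem: "proj (young_idem t la)"
  unfolding proj_def young_idem_def using young_norm_pos
  by (simp add: young_elem_H span_scale star_linear star_young_elem scale_mult_left scale_mult_right young_elem_square)

lemma T_young_idem: "w \<in> young_subgroup la \<Longrightarrow> T w * young_idem t la = t ^ inv_count w *s young_idem t la"
  unfolding young_idem_def by (simp add: scale_mult_right T_young_elem mult.commute)

lemma young_idem_expand: "young_idem t la = (\<Sum>w\<in>young_subgroup la. (inverse (young_norm t la) * (t / q) ^ inv_count w) *s T w)"
  by (simp add: young_idem_def young_elem_def scale_sum_right)

lemma card_young_pos: "card (young_subgroup la) > 0"
  using finite_young young_subgroup_group(2)[OF la] by (auto simp: card_gt_0_iff)

lemma sp_young_coeff: "sp (inverse (young_norm t la) * (t / q) ^ k) (inverse (of_nat (card (young_subgroup la))) * s ^ k)"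
proof -
  have "sp (young_norm t la) (\<Sum>w\<in>young_subgroup la. (s * s / 1) ^ inv_count w)"
    unfolding young_norm_def by (intro sp_sum sp_power sp_divide sp_mult sp_t sp_q) simp
  then have "sp (young_norm t la) (of_nat (card (young_subgroup la)))" by (simp add: s_square)
  moreover have "sp ((t / q) ^ k) ((s / 1) ^ k)" by (intro sp_power sp_divide sp_t sp_q) simp
  ultimately show ?thesis using card_young_pos by (intro sp_mult sp_inverse) simp_all
qed

text \<open>Summing \<open>Tr_T_T\<close> over the Young subgroup counts the g that conjugate the
  inverse of u into it; powers of s are class functions and leave the sum.\<close>

lemma Tr_T_young_idem:
  assumes u: "u \<in> symgroup n"
  shows "sp (Tr (T u) (young_idem t la)) (s ^ inv_count u * of_nat (fix_count n (part_content la) u))"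
proof -
  let ?Y = "young_subgroup la" and ?c = "\<lambda>w. card {g \<in> symgroup n. pinv g \<circ> pinv u \<circ> g = w}"
  let ?i = "inverse (of_nat (card ?Y))"
  have "sp (Tr (T u) (young_idem t la)) (\<Sum>w\<in>?Y. ?i * s ^ inv_count w * of_nat (?c w))"
    unfolding young_idem_expand using Tr_sum(2)[OF T_H[OF u] T_H[OF young_sub], of ?Y "\<lambda>w. w"]
    by (simp add: sp_sum sp_mult[OF sp_young_coeff] Tr_T_T u young_sub)
  also have "(\<Sum>w\<in>?Y. ?i * s ^ inv_count w * of_nat (?c w)) = (\<Sum>w\<in>?Y. ?i * s ^ inv_count u * of_nat (?c w))"
  proof (rule sum.cong[OF refl])
    fix w
    show "?i * s ^ inv_count w * of_nat (?c w) = ?i * s ^ inv_count u * of_nat (?c w)"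
    proof (cases "{g \<in> symgroup n. pinv g \<circ> pinv u \<circ> g = w} = {}")
      case False
      then obtain g where g: "g \<in> symgroup n" "w = pinv g \<circ> pinv u \<circ> g" by blast
      show ?thesis unfolding g(2) power_inv_count_conj[OF s_square symgroup_inv[OF u] g(1)] inv_count_inv[OF u] ..
    qed (simp only: card.empty of_nat_0 mult_zero_right)
  qed
  also have "\<dots> = ?i * s ^ inv_count u * of_nat (\<Sum>w\<in>?Y. ?c w)"
    by (simp add: sum_distrib_left)
  also have "(\<Sum>w\<in>?Y. ?c w) = card (\<Union>w\<in>?Y. {g \<in> symgroup n. pinv g \<circ> pinv u \<circ> g = w})"
  proof (rule card_UN_disjoint[symmetric])
    show "\<forall>w\<in>?Y. finite {g \<in> symgroup n. pinv g \<circ> pinv u \<circ> g = w}"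
      by (intro ballI finite_subset[OF Collect_restrict finite_symgroup])
  qed (auto intro: finite_young)
  also have "(\<Union>w\<in>?Y. {g \<in> symgroup n. pinv g \<circ> pinv u \<circ> g = w}) = {g \<in> symgroup n. pinv g \<circ> pinv u \<circ> g \<in> ?Y}"
    by auto
  also have "card \<dots> = card ?Y * fix_count n (part_content la) u"
    using card_conjugate_in_young_subgroup[OF la symgroup_inv[OF u]] by (simp only: fix_count_inv[OF u])
  finally have sp: "sp (Tr (T u) (young_idem t la)) (?i * s ^ inv_count u * of_nat (card ?Y * fix_count n (part_content la) u))" .
  have "inverse c * x * (c * y) = x * y" if "c \<noteq> 0" for c x y :: rat using that by simp
  from this[of "of_nat (card ?Y)"] show ?thesis using sp card_young_pos by (simp only: of_nat_mult)
qed

end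

end

context deformed_group_algebra
begin

text \<open>At q = 1 the pairing is a scalar product of permutation characters, twisted by signs;
  Frobenius reciprocity moves the sum from the Young subgroup to the whole group.\<close>

lemma Tr_young_idem:
  assumes la: "sum_list la = n" and mu: "sum_list mu = n"
    and t: "young_idempotents scale n T q sp t s" and t': "young_idempotents scale n T q sp t' s'"
  shows "sp (Tr (young_idem t la) (young_idem t' mu))
    ((\<Sum>u\<in>symgroup n. (s * s') ^ inv_count u * (of_nat (fix_count n (part_content la) u) * of_nat (fix_count n (part_content mu) u))) / fact n)"
proof -
  interpret t: young_idempotents scale n T q sp t s by (rule t)
  interpret t': young_idempotents scale n T q sp t' s' by (rule t')
  let ?Y = "young_subgroup la" and ?F = "\<lambda>u. (s * s') ^ inv_count u * of_nat (fix_count n (part_content mu) u)"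
  let ?i = "inverse (of_nat (card ?Y))"
  have "sp (Tr (young_idem t la) (young_idem t' mu))
      (\<Sum>w\<in>?Y. ?i * s ^ inv_count w * (s' ^ inv_count w * of_nat (fix_count n (part_content mu) w)))"
    unfolding t.young_idem_expand[OF la]
    using Tr_sum(1)[OF projD(1)[OF t'.proj_young_idem[OF mu]] T_H[OF t.young_sub[OF la]], of ?Y "\<lambda>w. w"]
    by (simp add: sp_sum sp_mult[OF t.sp_young_coeff[OF la]] t'.Tr_T_young_idem[OF mu] t.young_sub[OF la])
  also have "(\<Sum>w\<in>?Y. ?i * s ^ inv_count w * (s' ^ inv_count w * of_nat (fix_count n (part_content mu) w))) = ?i * (\<Sum>w\<in>?Y. ?F w)"
    by (simp add: sum_distrib_left power_mult_distrib mult_ac)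
  also have "\<dots> = (\<Sum>u\<in>symgroup n. of_nat (fix_count n (part_content la) u) * ?F u) / fact n"
  proof -
    have "s * s' * (s * s') = (s * s) * (s' * s')" by (simp only: mult_ac)
    then have "?F (pinv g \<circ> u \<circ> g) = ?F u" if "u \<in> symgroup n" "g \<in> symgroup n" for u g
      using power_inv_count_conj[of "s * s'", OF _ that] by (simp add: t.s_square t'.s_square fix_count_conj[OF that])
    from sum_young_subgroup[OF la, of ?F, OF this]
    have eq: "of_nat (card ?Y) * (\<Sum>u\<in>symgroup n. of_nat (fix_count n (part_content la) u) * ?F u) = fact n * (\<Sum>w\<in>?Y. ?F w)" .
    have "inverse c * Z = X / f" if "c * X = f * Z" "c \<noteq> 0" "f \<noteq> 0" for c X f Z :: rat
      using that by (simp add: field_simps)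
    from this[OF eq] show ?thesis using t.card_young_pos[OF la] by simp
  qed
  finally show ?thesis by (simp only: mult.left_commute)
qed

end

text \<open>The sums are coefficients of h_la at the monomial of mu and of e_mu at the monomial of
  la, and the Schur expansions of h and e bring in the Kostka numbers.\<close>

lemma sum_fix_kostka:
  assumes la: "la \<in> partitions n" and mu: "mu \<in> partitions n"
  shows "(\<Sum>u\<in>symgroup n. of_nat (fix_count n (part_content la) u) * of_nat (fix_count n (part_content mu) u)) =
      (fact n * of_int (\<Sum>nu\<in>partitions n. kostka nu la * kostka nu mu) :: rat)"
    and "(\<Sum>u\<in>symgroup n. (- 1) ^ inv_count u * (of_nat (fix_count n (part_content la) u) * of_nat (fix_count n (part_content mu) u))) =
      (fact n * of_int (\<Sum>nu\<in>partitions n. kostka nu la * kostka (transpose_partition nu) mu) :: rat)"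
proof -
  have n: "sum_list la = n" "sum_list mu = n" using la mu by (simp_all add: partitions_def)
  show "(\<Sum>u\<in>symgroup n. of_nat (fix_count n (part_content la) u) * of_nat (fix_count n (part_content mu) u)) =
      (fact n * of_int (\<Sum>nu\<in>partitions n. kostka nu la * kostka nu mu) :: rat)"
    using coeff_sym_h_fix[OF n(1), of "part_mon mu", where 'a = rat, folded part_content_def]
    by (simp add: sym_h_schur[OF la] coeff_schur_part)
  have "of_int (sign u) = ((- 1) ^ inv_count u :: rat)" if "u \<in> symgroup n" for u
    by (simp flip: sign_inv_count[OF that])
  then show "(\<Sum>u\<in>symgroup n. (- 1) ^ inv_count u * (of_nat (fix_count n (part_content la) u) * of_nat (fix_count n (part_content mu) u))) =
      (fact n * of_int (\<Sum>nu\<in>partitions n. kostka nu la * kostka (transpose_partition nu) mu) :: rat)"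
    using coeff_sym_e_fix[OF n(2), of "part_mon la", where 'a = rat, folded part_content_def]
    by (simp add: sym_e_schur[OF mu] coeff_schur_part mult_ac)
qed

lemma young_subgroup_replicate: "young_subgroup (replicate n 1) = {id}"
proof
  show "young_subgroup (replicate n 1) \<subseteq> {id}"
  proof
    fix w assume w: "w \<in> young_subgroup (replicate n 1)"
    have "w x = x" for x
    proof (cases "x \<in> {1..n}")
      case True
      then obtain i where i: "x = Suc i" "i < n" by (cases x) auto
      then have "w ` row_block (replicate n 1) i = row_block (replicate n 1) i" using w by (simp add: young_subgroup_def)
      moreover have "row_block (replicate n 1) i = {Suc i}" using i(2) by (auto simp: row_block_def sum_list_replicate)
      ultimately show ?thesis using i(1) by simp
    next
      case False
      moreover have "w permutes {1..n}" using w by (simp add: young_subgroup_def sum_list_replicate)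
      ultimately show ?thesis by (intro permutes_not_in)
    qed
    then have "w = id" unfolding fun_eq_iff id_apply ..
    then show "w \<in> {id}" by (simp only: singleton_iff)
  qed
  show "{id} \<subseteq> young_subgroup (replicate n 1)"
    using young_subgroup_group(2)[of "replicate n 1" n] by (simp add: sum_list_replicate)
qed

context deformed_group_algebra
begin

lemma minus_one_root: "young_idempotents scale n T q sp (- 1) (- 1)" and q_root: "young_idempotents scale n T q sp q 1"
  by (unfold_locales, simp_all add: sp_uminus[OF sp_1] sp_q algebra_simps)+

text \<open>A rank is a natural number and therefore agrees with its own specialization.\<close>

lemma Tr_determined:
  assumes "proj e" "proj f" "sp (Tr e f) (of_int k)"
  shows "Tr e f = of_int k"
proof -
  obtain m where m: "Tr e f = of_nat m" using Tr_proj(1)[OF assms(1,2)] by blast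
  then have "of_nat m = (of_int k :: rat)" using assms(3) sp_of_nat sp_unique by metis
  then have "int m = k" by (metis of_int_eq_iff of_int_of_nat_eq)
  with m show ?thesis by auto
qed

lemma young_idem_one: "young_idem q (replicate n 1) = 1"
  using q_pos T_id by (simp add: young_idem_def young_elem_def young_norm_def young_subgroup_replicate[simplified])

sublocale kostka_family scale "T ` symgroup n" star n "young_idem q" "young_idem (- 1)"
proof unfold_locales
  fix la assume la: "la \<in> partitions n"
  have n: "sum_list ka = n" if "ka \<in> partitions n" for ka using that by (simp add: partitions_def)
  note E = young_idempotents.proj_young_idem[OF q_root n] and F = young_idempotents.proj_young_idem[OF minus_one_root n]
  show "proj (young_idem q la)" "proj (young_idem (- 1) la)" by (rule E[OF la] F[OF la])+
  fix mu assume mu: "mu \<in> partitions n"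
  note Tr = Tr_young_idem[OF n n] and k = sum_fix_kostka[OF la mu]
  show "Tr (young_idem q la) (young_idem q mu) = of_int (\<Sum>nu\<in>partitions n. kostka nu la * kostka nu mu)"
    using Tr[OF la mu q_root q_root] k(1) by (intro Tr_determined E la mu) simp
  show "Tr (young_idem q la) (young_idem (- 1) mu) = of_int (\<Sum>nu\<in>partitions n. kostka nu la * kostka (transpose_partition nu) mu)"
    using Tr[OF la mu q_root minus_one_root] k(2) by (intro Tr_determined E F la mu) simp
  show "Tr (young_idem (- 1) mu) (young_idem q la) = of_int (\<Sum>nu\<in>partitions n. kostka nu la * kostka (transpose_partition nu) mu)"
    using Tr[OF mu la minus_one_root q_root] k(2) by (intro Tr_determined E F la mu) (simp add: mult.commute)
qed (rule young_idem_one)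

lemma Tr_T_D:
  assumes nu: "nu \<in> partitions n" and u: "u \<in> symgroup n"
  shows "sp (Tr (T u) (D nu)) (perm_char n nu u)"
  unfolding Tr_D[OF nu T_H[OF u]] perm_char_def
proof (intro sp_sum sp_mult sp_of_int)
  fix la assume "la \<in> partitions n"
  then have n: "sum_list la = n" by (simp add: partitions_def)
  show "sp (Tr (T u) (young_idem q la)) (of_nat (fix_count n (part_content la) u))"
    using young_idempotents.Tr_T_young_idem[OF q_root n u] by simp
qed

end

section \<open>Values of rational functions at q = 1\<close>

lemma specializes_at_1_I: "poly b 1 \<noteq> 0 \<Longrightarrow> specializes_at_1 (Fract a b) (poly a 1 / poly b 1)"
  unfolding specializes_at_1_def by blast

lemma specializes_at_1_arith:
  assumes "specializes_at_1 x c" "specializes_at_1 y d"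
  shows "specializes_at_1 (x + y) (c + d)" "specializes_at_1 (x * y) (c * d)" "specializes_at_1 (- x) (- c)"
    "c \<noteq> 0 \<Longrightarrow> specializes_at_1 (inverse x) (inverse c)" "x = y \<Longrightarrow> c = d"
proof -
  obtain a b where ab: "poly b 1 \<noteq> 0" "x = Fract a b" "c = poly a 1 / poly b 1"
    using assms(1) unfolding specializes_at_1_def by blast
  obtain a' b' where ab': "poly b' 1 \<noteq> 0" "y = Fract a' b'" "d = poly a' 1 / poly b' 1"
    using assms(2) unfolding specializes_at_1_def by blast
  have nz: "b \<noteq> 0" "b' \<noteq> 0" using ab(1) ab'(1) by auto
  show "specializes_at_1 (x + y) (c + d)"
    using specializes_at_1_I[of "b * b'" "a * b' + a' * b"] ab ab' nz by (simp add: add_frac_eq)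
  show "specializes_at_1 (x * y) (c * d)"
    using specializes_at_1_I[of "b * b'" "a * a'"] ab ab' nz by simp
  show "specializes_at_1 (- x) (- c)"
    using specializes_at_1_I[of b "- a"] ab nz by simp
  show "specializes_at_1 (inverse x) (inverse c)" if "c \<noteq> 0"
    using specializes_at_1_I[of a b] ab that by auto
  show "c = d" if "x = y"
  proof -
    have "a * b' = a' * b" using that unfolding ab(2) ab'(2) by (simp add: eq_fract nz)
    then have "poly a 1 * poly b' 1 = poly a' 1 * poly b 1" by (metis poly_mult)
    then show ?thesis unfolding ab(3) ab'(3) using ab(1) ab'(1) by (simp add: frac_eq_eq)
  qed
qed

section \<open>Characters of the Hecke algebra\<close>

lemma specializes_at_1_q: "specializes_at_1 1 1" "specializes_at_1 q_rf 1"
  using specializes_at_1_I[of 1 1] specializes_at_1_I[of 1 "[:0, 1:]"] by (simp_all add: q_rf_def One_fract_def)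

text \<open>Polynomials are ordered by the sign of the leading coefficient, so q exceeds every
  constant.\<close>

lemma q_rf_pos: "0 < q_rf"
  by (simp add: q_rf_def zero_less_Fract_iff less_poly_def pos_poly_def)

context hecke_algebra
begin

lemma reduced_word_exists:
  assumes "w \<in> symgroup n"
  obtains ws where "set ws \<subseteq> {1..<n}" "word_perm ws = w" "length ws = inv_count w" "reduced_word n ws"
proof -
  let ?P = "\<lambda>k. \<exists>ws. set ws \<subseteq> {1..<n} \<and> word_perm ws = w \<and> length ws = k"
  have "\<exists>k. ?P k"
    using assms
  proof (induction rule: symgroup_induct)
    case id
    show ?case by (intro exI[of _ 0] exI[of _ "[]"]) (simp add: word_perm_def id_def)
  next
    case (step w i)
    then obtain ws where "set ws \<subseteq> {1..<n}" "word_perm ws = w" by blast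
    with step(2) have "set (ws @ [i]) \<subseteq> {1..<n} \<and> word_perm (ws @ [i]) = w \<circ> adj_transp i \<and> length (ws @ [i]) = length (ws @ [i])"
      by (simp add: word_perm_append word_perm_single)
    then show ?case by blast
  qed
  from LeastI_ex[OF this, folded perm_length_def] perm_length_eq[OF assms] that
  show thesis unfolding reduced_word_def by metis
qed

lemma T_word_perm:
  assumes "set ws \<subseteq> {1..<n}" "length ws = inv_count (word_perm ws)"
  shows "T (word_perm ws) = prod_list (map (\<lambda>i. T (adj_transp i)) ws)"
  using assms by (intro T_reduced) (simp add: reduced_word_def perm_length_eq[OF word_perm_symgroup])

text \<open>A reduced word of w remains reduced after adding a generator at either end if the length
  grows, so \<open>T_reduced\<close> yields both multiplication rules.\<close>

sublocale deformed_group_algebra scale n T q_rf specializes_at_1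
proof unfold_locales
  show "T id = 1" using T_word_perm[of "[]"] by (simp add: word_perm_def flip: id_def)
  show "inj_on T (symgroup n)" "independent (T ` symgroup n)"
    unfolding symgroup_def by (rule T_inj T_independent)+
  fix w i assume w: "w \<in> symgroup n" and i: "i \<in> {1..<n}"
  obtain ws where ws: "set ws \<subseteq> {1..<n}" "word_perm ws = w" "length ws = inv_count w"
    using reduced_word_exists[OF w] by metis
  have Tw: "T w = prod_list (map (\<lambda>i. T (adj_transp i)) ws)" using T_word_perm[of ws] ws by simp
  have cons: "word_perm (i # ws) = adj_transp i \<circ> w" and snoc: "word_perm (ws @ [i]) = w \<circ> adj_transp i"
    by (simp_all add: word_perm_append word_perm_single ws(2)) (simp add: word_perm_def ws(2)[symmetric])
  show "T (adj_transp i) * T w = T (adj_transp i \<circ> w)" if "inv_count (adj_transp i \<circ> w) = Suc (inv_count w)"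
    using T_word_perm[of "i # ws"] ws(1,3) i that unfolding cons Tw by simp
  show "T w * T (adj_transp i) = T (w \<circ> adj_transp i)" if "inv_count (w \<circ> adj_transp i) = Suc (inv_count w)"
    using T_word_perm[of "ws @ [i]"] ws(1,3) i that unfolding snoc Tw by simp
qed (fact scale_mult_left scale_mult_right quadratic q_rf_pos specializes_at_1_q specializes_at_1_arith(1,2)
  | rule specializes_at_1_arith(3,4), assumption+ | erule (1) specializes_at_1_arith(5), rule refl)+

lemma H_UNIV: "H = UNIV"
  using T_span by (simp add: symgroup_def)

lemma in_H [simp]: "x \<in> H"
  by (simp add: H_UNIV)

lemma T_functional_eq: "T_functional c x = (\<Sum>w\<in>symgroup n. cf x w * c w)"
  unfolding T_functional_def symgroup_def cf_def ..

text \<open>The induced module is realized on H e. Right multiplication by e kills the relations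
  because b e = \<theta>(b) e for b in the parabolic subalgebra, and modulo the relations it is the
  identity because \<theta>(e) = 1. So it can serve as the projection in
  \<open>btrace_on_quotient\<close>.\<close>

lemma induced_char_young:
  assumes t: "young_idempotents scale n T q_rf specializes_at_1 t s" and la: "sum_list la = n"
    and c: "\<And>w. w \<in> symgroup n \<Longrightarrow> c w = t ^ inv_count w"
  shows "induced_char (parabolic la) (T_functional c) g = Tr g (young_idem t la)"
proof -
  interpret young_idempotents scale n T q_rf specializes_at_1 t s by (rule t)
  let ?e = "young_idem t la" and ?P = "parabolic la" and ?\<theta> = "T_functional c"
  let ?S = "{x * b - ?\<theta> b *s x | x b. b \<in> ?P}"
  have \<theta>_linear: "?\<theta> (a *s x + y) = a * ?\<theta> x + ?\<theta> y" for a x y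
    unfolding T_functional_eq by (simp add: cf_add cf_scale distrib_right sum.distrib sum_distrib_left mult.assoc)
  have \<theta>_T: "?\<theta> (T w) = t ^ inv_count w" if w: "w \<in> symgroup n" for w
  proof -
    have "?\<theta> (T w) = (\<Sum>u\<in>symgroup n. if w = u then c u else 0)"
      unfolding T_functional_eq by (rule sum.cong) (simp_all add: cf_T w)
    then show ?thesis using w by (simp add: c)
  qed
  have be: "b * ?e = ?\<theta> b *s ?e" if "b \<in> ?P" for b
    using that unfolding parabolic_def
  proof (induction rule: span_induct_alt)
    case base
    show ?case by (simp add: T_functional_eq)
  next
    case (step a x y)
    then obtain w where w: "w \<in> young_subgroup la" "x = T w" by blast
    then show ?case using step(2)
      by (simp add: distrib_right scale_mult_left T_young_idem[OF la] \<theta>_linear \<theta>_T young_sub[OF la] scale_left_distrib)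
  qed
  have eP: "?e \<in> ?P" unfolding parabolic_def young_idem_expand[OF la] by (intro span_sum span_scale span_base) simp
  have e0: "?e \<noteq> 0"
  proof
    assume "?e = 0"
    then have "cf ?e id = 0" by simp
    moreover have "cf ?e id = inverse (young_norm t la)"
      using young_subgroup_group(2)[OF la] by (simp add: young_idem_def cf_scale cf_young_elem[OF la])
    ultimately show False using young_norm_pos[OF la] by simp
  qed
  \<comment> \<open>The relation for b = e, compared with e e = e.\<close>
  have "?\<theta> ?e *s ?e = 1 *s ?e" using be[OF eP] projD(3)[OF proj_young_idem[OF la]] by simp
  then have \<theta>_e: "?\<theta> ?e = 1" using e0 by (simp only: scale_cancel_right simp_thms)
  have "trace_on_quotient (span (T ` symgroup n)) (span ?S) (\<lambda>x. g * x) = btrace (T ` symgroup n) (\<lambda>x. g * (x * ?e))"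
  proof (rule btrace_on_quotient)
    show "lin (\<lambda>x. g * x)" by (rule lin_mult_left)
    show "lin (\<lambda>x. x * ?e)" by (rule lin_mult_right)
    show "g * x \<in> span ?S" if "x \<in> span ?S" for x
    proof (rule lin_span[OF lin_mult_left _ that])
      fix y assume "y \<in> ?S"
      then obtain x b where y: "y = x * b - ?\<theta> b *s x" "b \<in> ?P" by blast
      have "g * y = (g * x) * b - ?\<theta> b *s (g * x)"
        unfolding y(1) by (simp add: right_diff_distrib scale_mult_right mult.assoc)
      then show "g * y \<in> span ?S" using y(2) by (intro span_base) blast
    qed
    show "x * ?e = 0" if "x \<in> span ?S" for x
    proof -
      have "x * ?e \<in> span {}"
      proof (rule lin_span[OF lin_mult_right _ that])
        fix y assume "y \<in> ?S"
        then obtain x b where y: "y = x * b - ?\<theta> b *s x" "b \<in> ?P" by blast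
        have "y * ?e = x * (b * ?e) - ?\<theta> b *s (x * ?e)"
          unfolding y(1) by (simp add: left_diff_distrib scale_mult_left mult.assoc)
        then show "y * ?e \<in> span {}" by (simp add: be[OF y(2)] scale_mult_right span_zero)
      qed
      then show ?thesis by simp
    qed
    show "x - x * ?e \<in> span ?S" for x
    proof -
      have "x * ?e - ?\<theta> ?e *s x \<in> span ?S" using eP by (intro span_base) blast
      from span_neg[OF this] show ?thesis by (simp add: \<theta>_e)
    qed
  qed (simp_all add: T_indep H_UNIV)
  then show ?thesis by (simp add: induced_char_def H_UNIV Tr_def mult.assoc)
qed

lemma eta_q_eq:
  assumes "la \<in> partitions n"
  shows "eta_q la g = Tr g (young_idem q_rf la)"
  unfolding eta_q_def trivial_functional_def using assms
  by (intro induced_char_young[OF q_root]) (simp_all add: partitions_def perm_length_eq)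

lemma epsilon_q_eq:
  assumes "la \<in> partitions n"
  shows "epsilon_q la g = Tr g (young_idem (- 1) la)"
  unfolding epsilon_q_def sign_functional_def using assms
  by (intro induced_char_young[OF minus_one_root]) (simp_all add: partitions_def perm_length_eq)

text \<open>The representation is the left ideal of D nu in coordinates. It is irreducible since D
  nu is a left multiple of every nonzero element of the ideal
  (\<open>prim_generated\<close>).\<close>

lemma irreducible_char_D:
  assumes nu: "nu \<in> partitions n"
  shows "irreducible_char (\<lambda>g. Tr g (D nu))"
proof -
  let ?D = "D nu"
  note p = prim_proj[OF D(1)[OF nu]]
  define V where "V = (\<lambda>x. x * ?D) ` H"
  have V_iff: "x \<in> V \<longleftrightarrow> x * ?D = x" for x
    using projD(3)[OF p] by (auto simp: V_def mult.assoc intro: image_eqI[of _ _ x])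
  have V: "subspace V" by (simp add: subspace_def V_iff distrib_right scale_mult_left)
  have gV: "g * x \<in> V" if "x \<in> V" for g x using that by (simp add: V_iff mult.assoc)
  obtain C where C: "finite C" "independent C" "span C = V"
    using subspace_basis[OF _ V, of "T ` symgroup n"] by (metis finite_imageI finite_symgroup H_UNIV subset_UNIV)
  obtain bs where bs: "set bs = C" "distinct bs" using finite_distinct_list[OF C(1)] by blast
  define d where "d = length bs"
  have bV: "bs ! i \<in> V" if "i < d" for i using that C(3) bs(1) by (metis d_def nth_mem span_base)
  have sumC: "(\<Sum>c\<in>C. f c) = (\<Sum>i<d. f (bs ! i))" for f :: "'h \<Rightarrow> ratfun"
    using sum.reindex_bij_betw[OF bij_betw_nth[OF bs(2) refl bs(1)[symmetric]], of f] by (simp add: d_def)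
  let ?r = "\<lambda>x i. representation C x (bs ! i)"
  have r_basis: "?r (bs ! j) i = (if i = j then 1 else 0)" if "i < d" "j < d" for i j
    using that bs nth_eq_iff_index_eq[OF bs(2), of i j]
    by (subst representation_basis[OF C(2)]) (auto simp: d_def)
  define R where "R g = mat d d (\<lambda>(i, j). ?r (g * bs ! j) i)" for g
  have R_carrier: "R g \<in> carrier_mat d d" for g by (simp add: R_def)
  have R_mult: "R (g * h) = R g * R h" for g h
  proof (rule eq_matI)
    fix i j assume "i < dim_row (R g * R h)" "j < dim_col (R g * R h)"
    then have ij: "i < d" "j < d" by (simp_all add: R_def)
    have "?r (g * (h * bs ! j)) i = (\<Sum>c\<in>C. representation C (h * bs ! j) c * representation C (g * c) (bs ! i))"
      by (rule representation_comp[OF C(1,2) C(1,2) refl lin_mult_left]) (simp_all add: C(3) gV bV ij)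
    also have "\<dots> = (\<Sum>k<d. ?r (h * bs ! j) k * ?r (g * bs ! k) i)" by (rule sumC)
    also have "\<dots> = (R g * R h) $$ (i, j)"
      using ij by (simp add: R_def scalar_prod_def atLeast0LessThan mult.commute)
    finally show "R (g * h) $$ (i, j) = (R g * R h) $$ (i, j)" using ij by (simp add: R_def mult.assoc)
  qed (simp_all add: R_def)
  have rep: "is_rep d R"
    unfolding is_rep_def
  proof (intro conjI allI R_carrier R_mult)
    show "R 1 = 1\<^sub>m d" by (rule eq_matI) (simp_all add: R_def r_basis)
    show "R (g + h) = R g + R h" for g h
      by (rule eq_matI) (simp_all add: R_def distrib_right representation_add[OF C(2)] C(3) gV bV)
    show "R (c *s g) = c \<cdot>\<^sub>m R g" for c g
      by (rule eq_matI) (simp_all add: R_def scale_mult_left representation_scale[OF C(2)] C(3) gV bV)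
  qed
  \<comment> \<open>The element of the ideal with coordinate vector v, inverse to taking
    coordinates.\<close>
  define el where "el v = (\<Sum>j<d. v $ j *s bs ! j)" for v
  have el_V: "el v \<in> V" for v unfolding el_def by (rule subspace_sum[OF V], rule subspace_scale[OF V]) (simp add: bV)
  have r_el: "?r (el v) i = v $ i" if "i < d" for v i
  proof -
    have "?r (el v) i = (\<Sum>j<d. v $ j * ?r (bs ! j) i)"
      unfolding el_def by (rule representation_combination[OF C(2)]) (simp add: C(3) bV)
    also have "\<dots> = (\<Sum>j<d. if i = j then v $ j else 0)" by (rule sum.cong) (simp_all add: r_basis that)
    finally show ?thesis using that by simp
  qed
  have el_inj: "v = w" if "el v = el w" "v \<in> carrier_vec d" "w \<in> carrier_vec d" for v w
    by (rule eq_vecI) (use that r_el[of _ v] r_el[of _ w] in auto)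
  have el_vec: "el (vec d (?r x)) = x" if "x \<in> V" for x
  proof -
    have "x = (\<Sum>c\<in>C. representation C x c *s c)" using expand[OF C(1,2)] that C(3) by simp
    also have "\<dots> = (\<Sum>i<d. ?r x i *s bs ! i)"
      using sum.reindex_bij_betw[OF bij_betw_nth[OF bs(2) refl bs(1)[symmetric]], of "\<lambda>c. representation C x c *s c"]
      by (simp add: d_def)
    finally show ?thesis by (simp add: el_def)
  qed
  have el_R: "el (R g *\<^sub>v v) = g * el v" if v: "v \<in> carrier_vec d" for g v
  proof -
    have "R g *\<^sub>v v = vec d (?r (g * el v))"
    proof (rule eq_vecI)
      fix i assume "i < dim_vec (vec d (?r (g * el v)))"
      then have i: "i < d" by simp
      have eq: "g * el v = (\<Sum>j<d. v $ j *s (g * bs ! j))" by (simp add: el_def sum_distrib_left scale_mult_right)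
      have "?r (g * el v) i = (\<Sum>j<d. v $ j * ?r (g * bs ! j) i)"
        unfolding eq by (rule representation_combination[OF C(2)]) (simp add: C(3) gV bV)
      then show "(R g *\<^sub>v v) $ i = vec d (?r (g * el v)) $ i"
        using i v by (simp add: R_def scalar_prod_def atLeast0LessThan mult.commute)
    qed (simp add: R_def)
    then show ?thesis by (simp add: el_vec gV el_V)
  qed
  have irr: "W = {0\<^sub>v d} \<or> W = carrier_vec d" if W: "invariant_subspace d R W" for W
  proof (cases "W \<subseteq> {0\<^sub>v d}")
    case False
    then obtain v where v: "v \<in> W" "v \<noteq> 0\<^sub>v d" by blast
    have vc: "v \<in> carrier_vec d" using W v(1) by (auto simp: invariant_subspace_def)
    have "el v \<noteq> el (0\<^sub>v d)" using el_inj[OF _ vc] v(2) by auto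
    moreover have "el (0\<^sub>v d) = 0" by (simp add: el_def)
    ultimately obtain z where z: "z * el v = ?D"
      using prim_generated[OF D(1)[OF nu], of "el v"] el_V[of v] by (auto simp: V_iff)
    \<comment> \<open>Multiplication by \<open>el u * z\<close> carries v to an arbitrary vector u:
      z sends \<open>el v\<close> to D nu, and D nu fixes \<open>el u\<close> from the
      right.\<close>
    have "u \<in> W" if u: "u \<in> carrier_vec d" for u
    proof -
      have Rv: "R (el u * z) *\<^sub>v v \<in> carrier_vec d" using vc R_carrier by (rule mult_mat_vec_carrier[rotated])
      have "el (R (el u * z) *\<^sub>v v) = el u"
        unfolding el_R[OF vc] using el_V[of u] by (simp add: mult.assoc z V_iff)
      then have "R (el u * z) *\<^sub>v v = u" by (rule el_inj[OF _ Rv u])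
      then show ?thesis using W v(1) unfolding invariant_subspace_def by metis
    qed
    then show ?thesis using W by (auto simp: invariant_subspace_def)
  qed (use W in \<open>auto simp: invariant_subspace_def\<close>)
  have "d \<noteq> 0"
  proof
    assume "d = 0"
    then have "el v = 0" for v by (simp add: el_def)
    then have "?D = 0" using el_vec[of ?D] projD(3)[OF p] by (simp add: V_iff)
    then show False using D(1)[OF nu] by (simp add: prim_def)
  qed
  have "mat_trace (R g) = Tr g ?D" for g
    using Tr_ideal[OF p, of g C] C by (simp add: V_def btrace_def sumC mat_trace_def R_def)
  then have "(\<lambda>g. Tr g ?D) = (\<lambda>g. mat_trace (R g))" by simp
  moreover have "irreducible_rep d R" using rep irr \<open>d \<noteq> 0\<close> by (simp add: irreducible_rep_def)
  ultimately show ?thesis unfolding irreducible_char_def by blast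
qed

text \<open>As 1 lies in the ideal generated by the D nu, some D nu acts as a nonzero matrix. For a
  vector u that it does not kill, evaluation at u is an isomorphism from the left ideal of D nu to
  the representation: onto by irreducibility, injective because each nonzero element of the ideal
  has D nu as a left multiple.\<close>

lemma irreducible_char_is_D:
  assumes "irreducible_char \<theta>"
  shows "\<exists>nu\<in>partitions n. \<theta> = (\<lambda>g. Tr g (D nu))"
proof -
  obtain d R where irr: "irreducible_rep d R" and \<theta>: "\<theta> = (\<lambda>g. mat_trace (R g))"
    using assms unfolding irreducible_char_def by blast
  have carrier: "R g \<in> carrier_mat d d" and one: "R 1 = 1\<^sub>m d" and add: "R (g + h) = R g + R h"
    and mult: "R (g * h) = R g * R h" and scale: "R (c *s g) = c \<cdot>\<^sub>m R g" and d: "0 < d" for g h c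
    using irr by (auto simp: irreducible_rep_def is_rep_def)
  have "R 0 = 0 \<cdot>\<^sub>m R 0" using scale[of 0 0] by simp
  also have "\<dots> = 0\<^sub>m d d" using carrier[of 0] by (intro eq_matI) auto
  finally have R0: "R 0 = 0\<^sub>m d d" .
  have "\<exists>nu\<in>partitions n. R (D nu) \<noteq> 0\<^sub>m d d"
  proof (rule ccontr)
    assume H: "\<not> ?thesis"
    have "R x = 0\<^sub>m d d" if "x \<in> D_ideal" for x
      using that unfolding D_ideal_def
    proof (induction rule: span_induct_alt)
      case (step c x y)
      then obtain a i b where x: "x = a * D i * b" "i \<in> partitions n" by blast
      have "R x = 0\<^sub>m d d" unfolding x(1) mult using H x(2) carrier[of a] carrier[of b] by simp
      then show ?case unfolding add scale step by (intro eq_matI) simp_all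
    qed (rule R0)
    from this[OF one_D_ideal] have "1\<^sub>m d $$ (0, 0) = (0\<^sub>m d d $$ (0, 0) :: ratfun)" unfolding one by simp
    with d show False by simp
  qed
  then obtain nu where nu: "nu \<in> partitions n" "R (D nu) \<noteq> 0\<^sub>m d d" by blast
  let ?D = "D nu"
  note p = prim_proj[OF D(1)[OF nu(1)]]
  have "\<exists>r j. r < d \<and> j < d \<and> R ?D $$ (r, j) \<noteq> 0"
  proof (rule ccontr)
    assume "\<not> ?thesis"
    then have "R ?D = 0\<^sub>m d d" using carrier[of ?D] by (intro eq_matI) auto
    with nu(2) show False ..
  qed
  then obtain r j where ij: "r < d" "j < d" "R ?D $$ (r, j) \<noteq> 0" by blast
  define u :: "ratfun vec" where "u = unit_vec d j"
  have u: "u \<in> carrier_vec d" by (simp add: u_def)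
  define ev where "ev x = R x *\<^sub>v u" for x
  have ev_carrier: "ev x \<in> carrier_vec d" for x unfolding ev_def using carrier u by (rule mult_mat_vec_carrier)
  have ev_add: "ev (x + y) = ev x + ev y" for x y
    unfolding ev_def add by (rule add_mult_distrib_mat_vec[OF carrier carrier u])
  have ev_scale: "ev (c *s x) = c \<cdot>\<^sub>v ev x" for c x
    unfolding ev_def scale using carrier[of x] u by (intro eq_vecI) (auto simp: scalar_prod_def sum_distrib_left mult.assoc)
  have ev_mult: "ev (g * x) = R g *\<^sub>v ev x" for g x
    unfolding ev_def mult by (rule assoc_mult_mat_vec[OF carrier carrier u])
  have ev_0: "ev 0 = 0\<^sub>v d" unfolding ev_def R0 using u by (intro eq_vecI) auto
  have ev_sum: "ev (\<Sum>k\<in>K. a k *s v k) $ i = (\<Sum>k\<in>K. a k * ev (v k) $ i)" if "i < d" for K i and a :: "nat \<Rightarrow> ratfun" and v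
    using that
  proof (induction K rule: infinite_finite_induct)
    case (insert k K)
    then show ?case using ev_carrier[of "v k"] ev_carrier[of "\<Sum>k\<in>K. a k *s v k"] by (simp add: ev_add ev_scale)
  qed (simp_all add: ev_0)
  have ev_D: "ev ?D \<noteq> 0\<^sub>v d"
  proof
    assume "ev ?D = 0\<^sub>v d"
    then have "ev ?D $ r = 0" using ij(1) by simp
    moreover have "ev ?D $ r = R ?D $$ (r, j)" using ij carrier[of ?D] by (simp add: ev_def u_def)
    ultimately show False using ij(3) by simp
  qed
  define W where "W = range (\<lambda>x. ev (x * ?D))"
  have "invariant_subspace d R W"
    unfolding invariant_subspace_def
  proof (intro conjI ballI allI)
    show "W \<subseteq> carrier_vec d" using ev_carrier by (auto simp: W_def)
    have "ev (0 * ?D) = 0\<^sub>v d" by (simp add: ev_0)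
    then show "0\<^sub>v d \<in> W" unfolding W_def by (metis rangeI)
    fix v assume "v \<in> W"
    then obtain x where v: "v = ev (x * ?D)" by (auto simp: W_def)
    show "c \<cdot>\<^sub>v v \<in> W" for c
      unfolding W_def by (rule range_eqI[of _ _ "c *s x"]) (simp add: v scale_mult_left ev_scale)
    show "R g *\<^sub>v v \<in> W" for g
      unfolding W_def by (rule range_eqI[of _ _ "g * x"]) (simp add: v ev_mult mult.assoc)
    fix w assume "w \<in> W"
    then obtain y where w: "w = ev (y * ?D)" by (auto simp: W_def)
    show "v + w \<in> W"
      unfolding W_def by (rule range_eqI[of _ _ "x + y"]) (simp add: v w distrib_right ev_add)
  qed
  moreover have "ev ?D \<in> W" unfolding W_def by (rule range_eqI[of _ _ 1]) simp
  then have "W \<noteq> {0\<^sub>v d}" using ev_D by auto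
  ultimately have W: "W = carrier_vec d" using irr unfolding irreducible_rep_def by blast
  \<comment> \<open>Preimages of the unit vectors; they will form a basis of the left ideal in which
    left multiplication by g has the matrix \<open>R g\<close>.\<close>
  have "\<forall>k. \<exists>x. unit_vec d k = ev (x * ?D)"
    using W unit_vec_carrier[of d] unfolding W_def by blast
  then obtain f where f: "\<And>k. unit_vec d k = ev (f k * ?D)" by metis
  define b where "b k = f k * ?D" for k
  have b_ev: "ev (b k) $ i = (if i = k then 1 else 0)" if "i < d" "k < d" for i k
    using f[of k] that by (metis b_def index_unit_vec(1))
  have ev_b: "ev (\<Sum>k<d. a k *s b k) $ i = a i" if "i < d" for a :: "nat \<Rightarrow> ratfun" and i
  proof -
    have "ev (\<Sum>k<d. a k *s b k) $ i = (\<Sum>k<d. if i = k then a k else 0)"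
      unfolding ev_sum[OF that] by (rule sum.cong) (simp_all add: b_ev that)
    with that show ?thesis by simp
  qed
  have b_inj: "inj_on b {..<d}"
    by (rule inj_onI) (metis b_ev lessThan_iff zero_neq_one)
  let ?C = "b ` {..<d}"
  have indep: "independent ?C"
  proof
    assume "dependent ?C"
    then obtain a where a: "\<exists>v\<in>?C. a v \<noteq> 0" "(\<Sum>v\<in>?C. a v *s v) = 0" by (auto simp: dependent_finite)
    then have s0: "(\<Sum>k<d. a (b k) *s b k) = 0" by (simp add: sum.reindex[OF b_inj])
    have "a (b i) = 0" if "i < d" for i
    proof -
      have "a (b i) = ev 0 $ i" using ev_b[OF that, of "\<lambda>k. a (b k)"] unfolding s0 by simp
      then show ?thesis using that by (simp add: ev_0)
    qed
    with a(1) show False by auto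
  qed
  have V_iff: "x \<in> (\<lambda>x. x * ?D) ` H \<longleftrightarrow> x * ?D = x" for x
    using projD(3)[OF p] by (auto simp: mult.assoc intro: image_eqI[of _ _ x])
  have b_V: "b k * ?D = b k" for k using projD(3)[OF p] by (simp add: b_def mult.assoc)
  \<comment> \<open>A nonzero difference would be killed by \<open>ev\<close> and have D nu as a
    left multiple, although \<open>ev\<close> does not kill D nu.\<close>
  have expand_b: "y = (\<Sum>k<d. ev y $ k *s b k)" if y: "y * ?D = y" for y
  proof (rule ccontr)
    let ?y = "y - (\<Sum>k<d. ev y $ k *s b k)"
    assume "y \<noteq> (\<Sum>k<d. ev y $ k *s b k)"
    then have "?y \<noteq> 0" by simp
    moreover have "?y * ?D = ?y"
      by (simp add: left_diff_distrib y sum_distrib_right scale_mult_left b_V)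
    ultimately obtain z where z: "z * ?y = ?D" using prim_generated[OF D(1)[OF nu(1)], of ?y] by auto
    have "ev ?y + ev (\<Sum>k<d. ev y $ k *s b k) = ev y" by (simp flip: ev_add)
    then have "ev ?y $ i = 0" if "i < d" for i
      using that ev_b[OF that, of "\<lambda>k. ev y $ k"] ev_carrier[of ?y] ev_carrier[of "\<Sum>k<d. ev y $ k *s b k"]
      using index_add_vec(1)[of i "ev (\<Sum>k<d. ev y $ k *s b k)" "ev ?y"] by auto
    then have "ev ?y = 0\<^sub>v d" using ev_carrier[of ?y] by (intro eq_vecI) auto
    then have "ev ?D = R z *\<^sub>v 0\<^sub>v d" using ev_mult[of z ?y] by (simp add: z)
    also have "\<dots> = 0\<^sub>v d" using carrier[of z] by (intro eq_vecI) auto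
    finally show False using ev_D by simp
  qed
  have span_C: "span ?C = (\<lambda>x. x * ?D) ` H"
  proof
    have "subspace ((\<lambda>x. x * ?D) ` H)" by (simp add: subspace_def V_iff distrib_right scale_mult_left)
    then show "span ?C \<subseteq> (\<lambda>x. x * ?D) ` H" by (rule span_minimal[rotated]) (auto simp: V_iff b_V simp del: image_iff)
    show "(\<lambda>x. x * ?D) ` H \<subseteq> span ?C"
    proof
      fix y assume "y \<in> (\<lambda>x. x * ?D) ` H"
      then have "y = (\<Sum>k<d. ev y $ k *s b k)" unfolding V_iff by (rule expand_b)
      also have "\<dots> \<in> span ?C" by (intro span_sum span_scale span_base) simp
      finally show "y \<in> span ?C" .
    qed
  qed
  have "Tr g ?D = mat_trace (R g)" for g
  proof -
    have "Tr g ?D = (\<Sum>i<d. representation ?C (g * b i) (b i))"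
      using Tr_ideal[OF p _ _ indep span_C, of g] by (simp add: btrace_def sum.reindex[OF b_inj])
    also have "\<dots> = (\<Sum>i<d. R g $$ (i, i))"
    proof (rule sum.cong[OF refl])
      fix i assume i: "i \<in> {..<d}"
      have "(g * b i) * ?D = g * b i" by (simp add: mult.assoc b_V)
      from expand_b[OF this] have "representation ?C (g * b i) (b i) =
          representation ?C (\<Sum>k<d. ev (g * b i) $ k *s b k) (b i)" by simp
      also have "\<dots> = (\<Sum>k<d. ev (g * b i) $ k * representation ?C (b k) (b i))"
        by (rule representation_combination[OF indep]) (simp add: span_base)
      also have "\<dots> = (\<Sum>k<d. if k = i then ev (g * b i) $ k else 0)"
        by (rule sum.cong) (use i b_inj in \<open>auto simp: representation_basis[OF indep] inj_on_eq_iff\<close>)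
      also have "\<dots> = ev (g * b i) $ i" using i by simp
      also have "\<dots> = R g $$ (i, i)"
        using i carrier[of g] unfolding ev_mult[of g "b i"] f[of i, folded b_def, symmetric] by simp
      finally show "representation ?C (g * b i) (b i) = R g $$ (i, i)" .
    qed
    finally show ?thesis using carrier[of g] by (simp add: mat_trace_def)
  qed
  then have "\<theta> = (\<lambda>g. Tr g ?D)" by (simp add: \<theta>)
  with nu(1) show ?thesis by blast
qed

end

section \<open>Columns of the tableau that is filled row by row\<close>

definition column_coloring :: "nat list \<Rightarrow> nat \<Rightarrow> nat" where
  "column_coloring la = restrict (\<lambda>x. x - Suc (sum_list (take (block_coloring la x) la))) {1..sum_list la}"

lemma row_column:
  assumes x: "x \<in> {1..sum_list la}"
  shows "block_coloring la x < length la" "column_coloring la x < la ! block_coloring la x"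
    "x = sum_list (take (block_coloring la x) la) + Suc (column_coloring la x)"
proof -
  show l: "block_coloring la x < length la" by (rule block_coloring(1)[OF x])
  have "x \<in> row_block la (block_coloring la x)" using block_coloring(2)[OF x l] by simp
  then have b: "sum_list (take (block_coloring la x) la) < x"
    "x \<le> sum_list (take (block_coloring la x) la) + la ! block_coloring la x"
    using l by (simp_all add: row_block_def take_Suc_conv_app_nth)
  have c: "column_coloring la x = x - Suc (sum_list (take (block_coloring la x) la))"
    unfolding column_coloring_def using x by (rule restrict_apply')
  show "column_coloring la x < la ! block_coloring la x"
    "x = sum_list (take (block_coloring la x) la) + Suc (column_coloring la x)"
    unfolding c using b by linarith+
qed

lemma cell_row_column:
  assumes "i < length la" "j < la ! i"
  shows "sum_list (take i la) + Suc j \<in> {1..sum_list la}"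
    "block_coloring la (sum_list (take i la) + Suc j) = i" "column_coloring la (sum_list (take i la) + Suc j) = j"
proof -
  let ?x = "sum_list (take i la) + Suc j"
  have "?x \<in> row_block la i" using assms by (simp add: row_block_def take_Suc_conv_app_nth)
  then show x: "?x \<in> {1..sum_list la}" and b: "block_coloring la ?x = i" unfolding row_block_eq[OF assms(1)] by simp_all
  show "column_coloring la ?x = j" using row_column(3)[OF x] unfolding b by linarith
qed

lemma column_block_eq: "column_block la j = {x \<in> {1..sum_list la}. column_coloring la x = j}"
proof
  show "column_block la j \<subseteq> {x \<in> {1..sum_list la}. column_coloring la x = j}"
  proof
    fix x assume "x \<in> column_block la j"
    then obtain i where "x = sum_list (take i la) + Suc j" "i < length la" "j < la ! i" by (auto simp: column_block_def)
    then show "x \<in> {x \<in> {1..sum_list la}. column_coloring la x = j}" using cell_row_column[of i la j] by simp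
  qed
  show "{x \<in> {1..sum_list la}. column_coloring la x = j} \<subseteq> column_block la j"
  proof
    fix x assume "x \<in> {x \<in> {1..sum_list la}. column_coloring la x = j}"
    then have x: "x \<in> {1..sum_list la}" and j: "column_coloring la x = j" by auto
    show "x \<in> column_block la j"
      unfolding column_block_def mem_Collect_eq using row_column[OF x, unfolded j] by blast
  qed
qed

lemma column_group_stabilizer:
  assumes n: "sum_list la = n"
  shows "column_group la = {w \<in> symgroup n. column_coloring la \<circ> w = column_coloring la}"
proof -
  have "(\<forall>j. w ` column_block la j = column_block la j) \<longleftrightarrow> column_coloring la \<circ> w = column_coloring la"
    if "w \<in> symgroup n" for w
    using stabilizer_blocks[OF that, of "column_coloring la" UNIV "column_block la"]
    by (simp add: column_block_eq n) (simp add: column_coloring_def n)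
  then show ?thesis unfolding column_group_def n symgroup_def by blast
qed

lemma column_coloring_content:
  assumes la: "la \<in> partitions n"
  shows "column_coloring la \<in> colorings n (part_content (transpose_partition la))"
proof (rule coloringsI)
  have n: "sum_list la = n" using la by (simp add: partitions_def)
  show "column_coloring la \<in> extensional {1..n}" by (simp add: column_coloring_def n)
  fix j
  have "card {x \<in> {1..n}. column_coloring la x = j} = card {i. i < length la \<and> j < la ! i}"
    unfolding n[symmetric] column_block_eq[symmetric]
  proof (rule bij_betw_same_card[of "block_coloring la"], rule bij_betw_byWitness[where f' = "\<lambda>i. sum_list (take i la) + Suc j"])
    show "\<forall>x\<in>column_block la j. sum_list (take (block_coloring la x) la) + Suc j = x"
      unfolding column_block_eq using row_column(3) by fastforce
    show "block_coloring la ` column_block la j \<subseteq> {i. i < length la \<and> j < la ! i}"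
      unfolding column_block_eq using row_column(1,2) by blast
    show "\<forall>i\<in>{i. i < length la \<and> j < la ! i}. block_coloring la (sum_list (take i la) + Suc j) = i"
      using cell_row_column(2) by blast
    show "(\<lambda>i. sum_list (take i la) + Suc j) ` {i. i < length la \<and> j < la ! i} \<subseteq> column_block la j"
      by (auto simp: column_block_def)
  qed
  also have "{i. i < length la \<and> j < la ! i} = {i. j < part_fun la i}" by (auto simp: part_fun_def)
  also have "card \<dots> = count (part_content (transpose_partition la)) j"
    using part_fun_transpose[OF la] by (simp add: part_content_def conj_shape_def)
  finally show "card {x \<in> {1..n}. column_coloring la x = j} = count (part_content (transpose_partition la)) j" .
qed

text \<open>The column coloring and the block coloring of the transpose have the same content, so a
  permutation carries one to the other and conjugates their stabilizers.\<close>

lemma column_group_conjugate: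
  assumes la: "la \<in> partitions n"
  obtains g where "g \<in> symgroup n"
    "bij_betw (\<lambda>v. g \<circ> v \<circ> pinv g) (young_subgroup (transpose_partition la)) (column_group la)"
proof -
  have n: "sum_list la = n" "sum_list (transpose_partition la) = n"
    using la transpose_partition[OF la] by (auto simp: partitions_def)
  let ?f = "block_coloring (transpose_partition la)" and ?c = "column_coloring la"
  obtain u where u: "u \<in> symgroup n" "?f \<circ> u = ?c"
    by (rule colorings_transitive[OF block_coloring_content[OF n(2)] column_coloring_content[OF la]])
  have "u \<circ> (pinv u \<circ> w) = w" "pinv u \<circ> (u \<circ> w) = w" for w
    by (simp_all only: comp_assoc[symmetric] symgroup_inv_o[OF u(1)] id_comp)
  note e = comp_assoc this symgroup_inv_o[OF u(1)] comp_id
  have "bij_betw (\<lambda>v. pinv u \<circ> v \<circ> u) (young_subgroup (transpose_partition la)) (column_group la)"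
    unfolding young_subgroup_stabilizer[OF n(2)] column_group_stabilizer[OF n(1)] u(2)[symmetric]
  proof (rule bij_betw_byWitness[where f' = "\<lambda>w. u \<circ> w \<circ> pinv u"], goal_cases)
    case 3
    have "?f \<circ> u \<circ> (pinv u \<circ> v \<circ> u) = ?f \<circ> v \<circ> u" for v by (simp only: e)
    then show ?case by (auto intro!: symgroup_comp symgroup_inv u(1))
  next
    case 4
    have "?f \<circ> (u \<circ> w \<circ> pinv u) = ?f" if "?f \<circ> u \<circ> w = ?f \<circ> u" for w
      using arg_cong[OF that, of "\<lambda>h. h \<circ> pinv u"] by (simp only: e)
    then show ?case by (auto intro!: symgroup_comp symgroup_inv u(1))
  qed (simp_all only: e, simp_all)
  then show thesis by (intro that[of "pinv u"]) (simp_all add: symgroup_inv[OF u(1)] symgroup_inv_inv[OF u(1)])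
qed

lemma row_column_trivial:
  assumes "p \<in> young_subgroup la" "p \<in> column_group la"
  shows "p = id"
proof
  fix x
  let ?n = "sum_list la"
  have rc: "block_coloring la (p x) = block_coloring la x" "column_coloring la (p x) = column_coloring la x"
    using assms unfolding young_subgroup_stabilizer[OF refl] column_group_stabilizer[OF refl] by (auto simp: fun_eq_iff)
  have p: "p permutes {1..?n}" using assms(1) by (simp add: young_subgroup_def)
  show "p x = id x"
  proof (cases "x \<in> {1..?n}")
    case True
    then have "p x \<in> {1..?n}" using permutes_in_image[OF p] by blast
    from row_column(3)[OF this] row_column(3)[OF True] show ?thesis unfolding rc by simp
  qed (simp add: permutes_not_in[OF p])
qed

section \<open>The group algebra and Specht modules\<close>

text \<open>A copy of \<^typ>\<open>nat \<Rightarrow> nat\<close> with composition as addition, so that finitely supported functions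
  on it form the monoid algebra.\<close>

typedef endo = "UNIV :: (nat \<Rightarrow> nat) set"
  morphisms app Endo ..

instantiation endo :: monoid_add
begin

definition "0 = Endo id"

definition "a + b = Endo (app a \<circ> app b)"

instance
  by standard (simp_all add: zero_endo_def plus_endo_def Endo_inverse app_inverse comp_assoc)

end

text \<open>The index 0 is the identity map, since composition is written additively; scaling is
  multiplication by a constant at this index.\<close>

definition scale_endo :: "rat \<Rightarrow> (endo \<Rightarrow>\<^sub>0 rat) \<Rightarrow> (endo \<Rightarrow>\<^sub>0 rat)" where
  "scale_endo c x = Poly_Mapping.single 0 c * x"

definition gr :: "(nat \<Rightarrow> nat) \<Rightarrow> (endo \<Rightarrow>\<^sub>0 rat)" where
  "gr w = Poly_Mapping.single (Endo w) 1"

lemma gr_mult: "gr u * gr v = gr (u \<circ> v)"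
  by (simp add: gr_def mult_single plus_endo_def Endo_inverse)

lemma single_gr: "Poly_Mapping.single (Endo u) c = scale_endo c (gr u)"
  by (simp add: gr_def scale_endo_def mult_single)

lemma lookup_scale_endo: "Poly_Mapping.lookup (scale_endo c x) u = c * Poly_Mapping.lookup x u"
  unfolding scale_endo_def mult_map_scale_conv_mult[symmetric] by (simp add: map.rep_eq when_def)

lemma poly_mapping_expand:
  fixes x :: "'a \<Rightarrow>\<^sub>0 'b::comm_monoid_add"
  shows "x = (\<Sum>u\<in>Poly_Mapping.keys x. Poly_Mapping.single u (Poly_Mapping.lookup x u))"
  by (rule poly_mapping_eqI) (simp add: lookup_sum lookup_single when_def sum.delta in_keys_iff)

interpretation group_algebra: trace_space scale_endo
  by unfold_locales (simp_all add: scale_endo_def distrib_left distrib_right single_add mult_single flip: mult.assoc)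

lemma scale_endo_mult: "scale_endo c x * y = scale_endo c (x * y)" "x * scale_endo c y = scale_endo c (x * y)"
proof -
  show "scale_endo c x * y = scale_endo c (x * y)" by (simp add: scale_endo_def mult.assoc)
  have "Poly_Mapping.single u d * (Poly_Mapping.single 0 c * y) = Poly_Mapping.single 0 c * (Poly_Mapping.single u d * y)" for u d
    by (simp add: mult_single mult.commute[of c] flip: mult.assoc)
  then show "x * scale_endo c y = scale_endo c (x * y)"
    unfolding scale_endo_def by (subst (1 2) poly_mapping_expand[of x]) (simp add: sum_distrib_right sum_distrib_left)
qed

text \<open>At q = 1 the quadratic relation says that generators square to 1, and \<open>gr\<close>
  is multiplicative whatever the lengths are.\<close>

lemma group_algebra: "deformed_group_algebra scale_endo n gr 1 (\<lambda>x c. x = c)"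
proof unfold_locales
  show inj: "inj_on gr (symgroup n)"
  proof (rule inj_onI)
    fix u v assume "gr u = gr v"
    then have "Poly_Mapping.lookup (gr u) (Endo u) = Poly_Mapping.lookup (gr v) (Endo u)" by simp
    then show "u = v" by (simp add: gr_def lookup_single when_def Endo_inject split: if_splits)
  qed
  show "group_algebra.independent (gr ` symgroup n)"
  proof (rule group_algebra.independent_if_scalars_zero)
    fix f x assume s: "(\<Sum>x\<in>gr ` symgroup n. scale_endo (f x) x) = 0" and "x \<in> gr ` symgroup n"
    then obtain w where w: "w \<in> symgroup n" "x = gr w" by blast
    have "0 = Poly_Mapping.lookup (\<Sum>u\<in>symgroup n. scale_endo (f (gr u)) (gr u)) (Endo w)"
      using s by (simp add: sum.reindex[OF inj])
    also have "\<dots> = (\<Sum>u\<in>symgroup n. if u = w then f (gr u) else 0)"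
      by (simp add: lookup_sum lookup_scale_endo gr_def lookup_single when_def Endo_inject if_distrib cong: if_cong)
    finally show "f x = 0" using w by simp
  qed simp
  show "gr id = 1" by (simp add: gr_def flip: zero_endo_def)
  show "gr (adj_transp i) * gr (adj_transp i) = scale_endo (1 - 1) (gr (adj_transp i)) + scale_endo 1 1" for i
    using \<open>gr id = 1\<close> by (simp add: gr_mult)
qed (simp_all add: scale_endo_mult gr_mult)

text \<open>Transport of the group algebra of the definitions into the ring, where left translation
  becomes left multiplication (\<open>to_endo_left_translate\<close>).\<close>

definition to_endo :: "((nat \<Rightarrow> nat) \<Rightarrow>\<^sub>0 rat) \<Rightarrow> (endo \<Rightarrow>\<^sub>0 rat)" where
  "to_endo = Poly_Mapping.map_key app"

lemma inj_app: "inj app"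
  by (simp add: inj_def app_inject)

lemma to_endo_single: "to_endo (Poly_Mapping.single u c) = scale_endo c (gr u)"
  unfolding to_endo_def single_gr[symmetric]
  using map_key_single[OF inj_app, of "Endo u" c] by (simp add: Endo_inverse)

lemma lookup_to_endo: "Poly_Mapping.lookup (to_endo x) e = Poly_Mapping.lookup x (app e)"
  by (simp add: to_endo_def map_key.rep_eq[OF inj_app])

lemma to_endo_add: "to_endo (x + y) = to_endo x + to_endo y"
  unfolding to_endo_def by (rule map_key_plus[OF inj_app])

lemma to_endo_scale: "to_endo (scale_ga c x) = scale_endo c (to_endo x)"
  by (rule poly_mapping_eqI) (simp add: lookup_to_endo lookup_scale_endo lookup_scale_ga)

lemma to_endo_sum: "to_endo (sum f I) = (\<Sum>i\<in>I. to_endo (f i))"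
  by (induction I rule: infinite_finite_induct) (simp_all add: to_endo_add, simp_all add: to_endo_def map_key_zero[OF inj_app])

lemma to_endo_inj: "to_endo x = to_endo y \<Longrightarrow> x = y"
  by (rule poly_mapping_eqI) (metis lookup_to_endo Endo_inverse UNIV_I)

lemma to_endo_left_translate: "to_endo (left_translate w x) = gr w * to_endo x"
proof -
  have "gr w * to_endo x = gr w * to_endo (\<Sum>u\<in>Poly_Mapping.keys x. Poly_Mapping.single u (Poly_Mapping.lookup x u))"
    by (subst (1) poly_mapping_expand[of x]) (rule refl)
  also have "\<dots> = to_endo (left_translate w x)"
    by (simp add: left_translate_def to_endo_sum to_endo_single sum_distrib_left scale_endo_mult gr_mult)
  finally show ?thesis ..
qed

interpretation specht: trace_space scale_ga ..

text \<open>A permutation g conjugates the Young subgroup of the transpose to the column group.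
  Right multiplication by g then turns the Young symmetrizer into a g b, where a and b are the Young
  elements for t = 1 and t = -1. This is a corner element, so the Specht module is carried to the
  left ideal of D nu, whose character \<open>Tr_T_D\<close> gives.\<close>

lemma sn_char_eq:
  assumes nu: "nu \<in> partitions n" and w: "w \<in> symgroup n"
  shows "sn_char nu w = perm_char n nu w"
proof -
  interpret G: deformed_group_algebra scale_endo n gr 1 "\<lambda>x c. x = c" by (rule group_algebra)
  let ?c = "young_symmetrizer nu" and ?nu' = "transpose_partition nu"
  have n: "sum_list nu = n" "sum_list ?nu' = n" using nu transpose_partition[OF nu] by (auto simp: partitions_def)
  obtain g where g: "g \<in> symgroup n"
    "bij_betw (\<lambda>v. g \<circ> v \<circ> pinv g) (young_subgroup ?nu') (column_group nu)"
    by (rule column_group_conjugate[OF nu])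
  let ?a = "G.young_elem 1 nu" and ?b = "G.young_elem (- 1) ?nu'" and ?\<Phi> = "\<lambda>x. to_endo x * gr g"
  note Y = young_subgroup_group(1)[OF n(1)] young_subgroup_group(1)[OF n(2)]
  have gg: "gr (pinv g) * gr g = 1" "gr g * gr (pinv g) = 1" using G.T_id by (simp_all only: gr_mult symgroup_inv_o[OF g(1)])
  have c: "to_endo ?c = ?a * gr g * ?b * gr (pinv g)"
  proof -
    have "(\<Sum>r\<in>column_group nu. scale_endo (of_int (sign r)) (gr r)) =
        (\<Sum>v\<in>young_subgroup ?nu'. scale_endo (of_int (sign (g \<circ> v \<circ> pinv g))) (gr (g \<circ> v \<circ> pinv g)))"
      by (rule sum.reindex_bij_betw[OF g(2), symmetric])
    also have "\<dots> = (\<Sum>v\<in>young_subgroup ?nu'. scale_endo ((- 1 / 1) ^ inv_count v) (gr g * gr v * gr (pinv g)))"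
    proof (rule sum.cong[OF refl])
      fix v assume v: "v \<in> young_subgroup ?nu'"
      then have vs: "v \<in> symgroup n" using Y(2) by blast
      have "of_int (sign (g \<circ> v \<circ> pinv g)) = (- 1 / 1 :: rat) ^ inv_count v"
        using sign_conj[OF vs symgroup_inv[OF g(1)]] g(1) by (simp flip: sign_inv_count[OF vs])
      then show "scale_endo (of_int (sign (g \<circ> v \<circ> pinv g))) (gr (g \<circ> v \<circ> pinv g)) =
          scale_endo ((- 1 / 1) ^ inv_count v) (gr g * gr v * gr (pinv g))" by (simp only: gr_mult)
    qed
    also have "\<dots> = gr g * ?b * gr (pinv g)"
      by (simp only: G.young_elem_def sum_distrib_left sum_distrib_right scale_endo_mult)
    finally have b: "(\<Sum>r\<in>column_group nu. scale_endo (of_int (sign r)) (gr r)) = gr g * ?b * gr (pinv g)" .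
    have "to_endo ?c = (\<Sum>p\<in>young_subgroup nu. gr p) * (\<Sum>r\<in>column_group nu. scale_endo (of_int (sign r)) (gr r))"
      by (simp add: young_symmetrizer_def to_endo_sum to_endo_single sum_product scale_endo_mult gr_mult)
    then show ?thesis unfolding b by (simp add: G.young_elem_def mult.assoc)
  qed
  \<comment> \<open>The coefficient at the identity is 1: a row and a column meet in at most one
    cell, so p r = id only for p = r = id.\<close>
  have c0: "to_endo ?c \<noteq> 0"
  proof
    assume "to_endo ?c = 0"
    then have "Poly_Mapping.lookup ?c id = 0" using lookup_to_endo[of ?c "Endo id"] by (simp add: Endo_inverse)
    moreover have "Poly_Mapping.lookup ?c id = (\<Sum>p\<in>young_subgroup nu. \<Sum>r\<in>column_group nu. if p = id \<and> r = id then 1 else 0)"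
      unfolding young_symmetrizer_def lookup_sum lookup_single
    proof (intro sum.cong refl)
      fix p r assume p: "p \<in> young_subgroup nu" and r: "r \<in> column_group nu"
      show "(of_int (sign r) when p \<circ> r = id) = (if p = id \<and> r = id then 1 else 0 :: rat)"
      proof (cases "p \<circ> r = id")
        case True
        have ps: "p \<in> symgroup n" using p Y by blast
        have "pinv p \<circ> (p \<circ> r) = (pinv p \<circ> p) \<circ> r" by (simp only: comp_assoc)
        then have "r = pinv p" unfolding True by (simp only: symgroup_inv_o[OF ps] comp_id id_comp)
        then have "r \<in> young_subgroup nu" using young_subgroup_group(4)[OF n(1) p] by simp
        then have "r = id" using r by (rule row_column_trivial)
        with True show ?thesis by (simp add: sign_id)
      qed auto
    qed
    moreover have "id \<in> column_group nu" unfolding column_group_stabilizer[OF n(1)] by simp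
    moreover have fin: "finite (column_group nu)"
      unfolding column_group_stabilizer[OF n(1)] by (rule finite_subset[OF Collect_restrict finite_symgroup])
    moreover have "finite (young_subgroup nu)" using Y(1) finite_subset finite_symgroup by blast
    moreover have "(\<Sum>r\<in>column_group nu. if p = id \<and> r = id then 1 else 0) = (if p = id then 1 else 0 :: rat)" for p :: "nat \<Rightarrow> nat"
      using fin \<open>id \<in> column_group nu\<close> by (cases "p = id") simp_all
    ultimately show False using young_subgroup_group(2)[OF n(1)] by simp
  qed
  define cg where "cg = ?\<Phi> ?c"
  have cg: "cg = ?a * gr g * ?b"
  proof -
    have "cg = ?a * gr g * ?b * (gr (pinv g) * gr g)" unfolding cg_def c by (simp only: mult.assoc)
    then show ?thesis unfolding gg by (simp only: mult_1_right)
  qed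
  have a_H: "?a \<in> G.H" and b_H: "?b \<in> G.H"
    using young_idempotents.young_elem_H[OF G.q_root n(1)] young_idempotents.young_elem_H[OF G.minus_one_root n(2)] by auto
  \<comment> \<open>Being multiples of idempotents, a is fixed by E nu from the left and b by F of
    the transpose from the right.\<close>
  have "G.corner nu cg"
    unfolding G.corner_def
  proof (intro conjI)
    show "cg \<in> G.H" unfolding cg by (intro G.mult_H a_H b_H G.T_H g(1))
    show "cg \<noteq> 0"
    proof
      assume "cg = 0"
      then have "to_endo ?c * (gr g * gr (pinv g)) = 0" unfolding cg_def by (simp flip: mult.assoc)
      with c0 show False unfolding gg by simp
    qed
    have "G.young_idem 1 nu * ?a = ?a"
      using young_idempotents.young_elem_square[OF G.q_root n(1)] young_idempotents.young_norm_pos[OF G.q_root n(1)]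
      by (simp add: G.young_idem_def scale_endo_mult)
    then show "G.young_idem 1 nu * cg = cg" unfolding cg by (simp flip: mult.assoc)
    have "?b * G.young_idem (- 1) ?nu' = ?b"
      using young_idempotents.young_elem_square[OF G.minus_one_root n(2)] young_idempotents.young_norm_pos[OF G.minus_one_root n(2)]
      by (simp add: G.young_idem_def scale_endo_mult)
    then show "cg * G.young_idem (- 1) ?nu' = cg" unfolding cg by (simp add: mult.assoc)
  qed
  note ideal = G.corner_ideal[OF nu this]
  let ?W = "{left_translate v ?c |v. v permutes {1..n}}"
  have W: "?W = (\<lambda>v. left_translate v ?c) ` symgroup n" by (auto simp: symgroup_def)
  interpret \<Phi>: module_hom scale_ga scale_endo ?\<Phi>
    by unfold_locales (simp_all add: to_endo_add to_endo_scale distrib_right scale_endo_mult)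
  interpret R: module_hom scale_endo scale_endo "\<lambda>x. x * cg"
    by unfold_locales (simp_all add: distrib_right scale_endo_mult)
  have inj: "inj ?\<Phi>"
  proof (rule injI)
    fix x y assume "?\<Phi> x = ?\<Phi> y"
    then have "to_endo x * (gr g * gr (pinv g)) = to_endo y * (gr g * gr (pinv g))" by (simp flip: mult.assoc)
    then show "x = y" unfolding gg by (simp add: to_endo_inj)
  qed
  have \<Phi>_translate: "?\<Phi> (left_translate v x) = gr v * ?\<Phi> x" for v x
    by (simp add: to_endo_left_translate mult.assoc)
  have "?\<Phi> ` specht_module nu = group_algebra.span (?\<Phi> ` ?W)"
    unfolding specht_module_def n by (rule \<Phi>.span_image[symmetric])
  also have "?\<Phi> ` ?W = (\<lambda>x. x * cg) ` gr ` symgroup n"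
    unfolding W image_image \<Phi>_translate cg_def ..
  also have "group_algebra.span \<dots> = (\<lambda>x. x * cg) ` G.H" by (rule R.span_image)
  also have "\<dots> = (\<lambda>x. x * G.D nu) ` G.H"
  proof (intro equalityI subsetI)
    fix z assume "z \<in> (\<lambda>x. x * cg) ` G.H"
    then obtain x where x: "x \<in> G.H" "z = x * cg" by blast
    have "z = (x * cg) * G.D nu" unfolding x(2) mult.assoc ideal(1) ..
    moreover have "x * cg \<in> G.H" unfolding cg by (intro G.mult_H a_H b_H G.T_H g(1) x(1))
    ultimately show "z \<in> (\<lambda>x. x * G.D nu) ` G.H" by blast
  next
    fix z assume "z \<in> (\<lambda>x. x * G.D nu) ` G.H"
    then obtain x where x: "x \<in> G.H" "z = x * G.D nu" by blast
    obtain y where y: "y \<in> G.H" "y * cg = G.D nu" using ideal(2) by blast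
    have "z = (x * y) * cg" unfolding x(2) y(2)[symmetric] by (rule mult.assoc[symmetric])
    then show "z \<in> (\<lambda>x. x * cg) ` G.H" using G.mult_H[OF x(1) y(1)] by blast
  qed
  finally have image: "?\<Phi> ` specht_module nu = (\<lambda>x. x * G.D nu) ` G.H" .
  have sub: "ga.subspace (specht_module nu)" unfolding specht_module_def by simp
  obtain D0 where D0: "finite D0" "ga.independent D0" "ga.span D0 = specht_module nu"
    using specht.subspace_basis[OF _ sub, of ?W] unfolding specht_module_def n W by auto
  have lin: "specht.lin (left_translate w)"
    unfolding specht.lin_def
    by (intro conjI allI to_endo_inj) (simp_all add: to_endo_left_translate to_endo_add to_endo_scale distrib_left scale_endo_mult)
  have maps: "left_translate w x \<in> specht_module nu" if "x \<in> specht_module nu" for x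
  proof -
    have "?\<Phi> x \<in> (\<lambda>x. x * G.D nu) ` G.H" using that unfolding image[symmetric] by (rule imageI)
    then obtain y where y: "y \<in> G.H" "?\<Phi> x = y * G.D nu" by blast
    have "?\<Phi> (left_translate w x) = (gr w * y) * G.D nu" unfolding \<Phi>_translate y(2) by (rule mult.assoc[symmetric])
    then have "?\<Phi> (left_translate w x) \<in> ?\<Phi> ` specht_module nu"
      unfolding image using G.T_mult_H[OF w y(1)] by blast
    then show ?thesis unfolding inj_image_mem_iff[OF inj] .
  qed
  \<comment> \<open>The subspace that is divided out is 0, so the projection in
    \<open>btrace_on_quotient\<close> is the identity.\<close>
  have "sn_char nu w = specht.btrace D0 (\<lambda>x. left_translate w x)"
    unfolding sn_char_def D0(3)[symmetric]
    by (rule specht.btrace_on_quotient[OF D0(1,2) _ _ lin])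
      (simp_all add: D0(3) maps specht.lin_def ga.subspace_0[OF sub] specht.lin_zero[OF lin])
  also have "\<dots> = (\<Sum>d\<in>D0. group_algebra.representation (?\<Phi> ` D0) (gr w * ?\<Phi> d) (?\<Phi> d))"
    unfolding specht.btrace_def
  proof (rule sum.cong[OF refl])
    fix d assume d: "d \<in> D0"
    have ind: "group_algebra.independent (?\<Phi> ` D0)"
      by (rule \<Phi>.independent_injective_image[OF D0(2) inj_on_subset[OF inj subset_UNIV]])
    have "left_translate w d \<in> ga.span D0" using d unfolding D0(3) by (intro maps) (simp add: D0(3)[symmetric] ga.span_base)
    then have "left_translate w d = (\<Sum>e\<in>D0. scale_ga (ga.representation D0 (left_translate w d) e) e)"
      by (rule specht.expand[OF D0(1,2)])
    then have "gr w * ?\<Phi> d = ?\<Phi> (\<Sum>e\<in>D0. scale_ga (ga.representation D0 (left_translate w d) e) e)"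
      by (simp only: \<Phi>_translate[symmetric])
    also have "\<dots> = (\<Sum>e\<in>D0. scale_endo (ga.representation D0 (left_translate w d) e) (?\<Phi> e))"
      by (simp only: \<Phi>.sum \<Phi>.scale)
    finally have "group_algebra.representation (?\<Phi> ` D0) (gr w * ?\<Phi> d) (?\<Phi> d) =
        (\<Sum>e\<in>D0. ga.representation D0 (left_translate w d) e * group_algebra.representation (?\<Phi> ` D0) (?\<Phi> e) (?\<Phi> d))"
      by (simp only:) (rule group_algebra.representation_combination[OF ind], simp add: group_algebra.span_base)
    also have "\<dots> = (\<Sum>e\<in>D0. if e = d then ga.representation D0 (left_translate w d) e else 0)"
      by (rule sum.cong) (use d in \<open>auto simp: group_algebra.representation_basis[OF ind] inj_eq[OF inj]\<close>)
    finally show "ga.representation D0 (left_translate w d) d = group_algebra.representation (?\<Phi> ` D0) (gr w * ?\<Phi> d) (?\<Phi> d)"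
      using D0(1) d by simp
  qed
  also have "\<dots> = group_algebra.btrace (?\<Phi> ` D0) (\<lambda>x. gr w * x)"
    unfolding group_algebra.btrace_def using inj by (simp add: sum.reindex inj_on_subset)
  also have "\<dots> = G.Tr (gr w) (G.D nu)"
    using D0(1) image \<Phi>.span_image[of D0] \<Phi>.independent_injective_image[OF D0(2) inj_on_subset[OF inj subset_UNIV]]
    by (intro G.Tr_ideal[symmetric] G.prim_proj G.D(1) nu G.T_H w) (simp_all add: D0(3))
  also have "\<dots> = perm_char n nu w" by (rule G.Tr_T_D[OF nu w])
  finally show ?thesis .
qed

lemma perm_char_of_int: "perm_char n mu u = of_int (\<Sum>la\<in>partitions n. kinv n la mu * int (fix_count n (part_content la) u))"
  by (simp add: perm_char_def)

text \<open>By \<open>perm_char_of_int\<close> the value is an integer, and so it is the same in the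
  rationals and in the rational functions.\<close>

lemma sn_char_value_eq:
  assumes mu: "mu \<in> partitions n" and u: "has_cycle_type n u la" and la: "la \<in> partitions n"
  shows "const_rf (sn_char_value mu la) = perm_char n mu u"
proof -
  let ?w = "SOME w. has_cycle_type (sum_list la) w la"
  have w: "has_cycle_type n ?w la"
    using someI[of "\<lambda>w. has_cycle_type n w la", OF u] la by (simp add: partitions_def)
  have ws: "?w \<in> symgroup n" using w unfolding has_cycle_type_iff by blast
  have "sn_char_value mu la = perm_char n mu u"
    unfolding sn_char_value_def sn_char_eq[OF mu ws] by (rule perm_char_cycle_type[OF w u])
  moreover have "const_rf (of_int k) = of_int k" for k
  proof -
    have "const_rf (of_nat m) = of_nat m" for m
      by (simp add: const_rf_def of_nat_fract of_nat_poly)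
    moreover have "const_rf (- x) = - const_rf x" for x by (simp add: const_rf_def)
    ultimately show ?thesis by (cases k rule: int_cases2) simp_all
  qed
  ultimately show ?thesis by (simp only: perm_char_of_int)
qed

text \<open>By Frobenius' formula equal characters give equal Schur functions and hence equal rows
  of the Kostka matrix; the diagonal entries 1 then make each partition dominate the other.\<close>

lemma perm_char_inject:
  assumes mu: "mu \<in> partitions n" and nu: "nu \<in> partitions n"
    and eq: "\<And>u. u \<in> symgroup n \<Longrightarrow> perm_char n mu u = (perm_char n nu u :: rat)"
  shows "mu = nu"
proof -
  let ?w = "\<lambda>la. SOME u. has_cycle_type n u la"
  have w: "has_cycle_type n (?w la) la" if "la \<in> partitions n" for la
    using exists_cycle_type[OF that] by (rule someI_ex)
  have "sym_s ka = (\<Sum>la\<in>partitions n. smult_ms (perm_char n ka (?w la) / of_nat (z_partition la)) (sym_p la) :: rat mseries)"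
    if "ka \<in> partitions n" for ka
    by (rule frobenius[symmetric, OF that]) (rule perm_char_cycle_type[OF w])
  from this[OF mu] this[OF nu] have "sym_s mu = (sym_s nu :: rat mseries)"
    using w eq by (simp add: has_cycle_type_iff)
  then have "of_int (kostka mu la) = (of_int (kostka nu la) :: rat)" for la
    by (simp flip: coeff_schur_part[OF mu] coeff_schur_part[OF nu])
  then have "kostka mu la = kostka nu la" for la by simp
  then have "kostka nu mu = 1" "kostka mu nu = 1" using kostka_diag[OF mu] kostka_diag[OF nu] by simp_all
  then show ?thesis
    using dominated_antisym[OF mu nu] kostka_nonzero[OF nu mu] kostka_nonzero[OF mu nu] by simp
qed

section \<open>The irreducible characters of the Hecke algebra and the expansions\<close>

context hecke_algebra
begin

text \<open>The classification leaves the characters of the D mu as the only candidates for the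
  definite description, and their specializations separate them.\<close>

lemma chi_q_eq:
  assumes nu: "nu \<in> partitions n"
  shows "chi_q nu = (\<lambda>g. Tr g (D nu))"
  unfolding chi_q_def
proof (rule the_equality)
  show "irreducible_char (\<lambda>g. Tr g (D nu)) \<and>
    (\<forall>w. w permutes {1..n} \<longrightarrow> specializes_at_1 (Tr (T w) (D nu)) (sn_char nu w))"
    using irreducible_char_D[OF nu] Tr_T_D[OF nu] sn_char_eq[OF nu] by (simp add: symgroup_def)
  fix \<theta>
  assume \<theta>: "irreducible_char \<theta> \<and> (\<forall>w. w permutes {1..n} \<longrightarrow> specializes_at_1 (\<theta> (T w)) (sn_char nu w))"
  then obtain mu where mu: "mu \<in> partitions n" "\<theta> = (\<lambda>g. Tr g (D mu))" using irreducible_char_is_D by blast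
  have "perm_char n mu u = (perm_char n nu u :: rat)" if u: "u \<in> symgroup n" for u
  proof (rule sp_unique[OF Tr_T_D[OF mu(1) u]])
    have "u permutes {1..n}" using u by (simp add: symgroup_def)
    from \<theta>[THEN conjunct2, rule_format, OF this]
    show "specializes_at_1 (Tr (T u) (D mu)) (perm_char n nu u)" unfolding mu(2) sn_char_eq[OF nu u] .
  qed
  then have "mu = nu" by (rule perm_char_inject[OF mu(1) nu])
  then show "\<theta> = (\<lambda>g. Tr g (D nu))" using mu(2) by simp
qed

lemma eta_q_chi_q: "la \<in> partitions n \<Longrightarrow> eta_q la g = (\<Sum>nu\<in>partitions n. chi_q nu g * of_int (kostka nu la))"
  by (simp add: eta_q_eq Tr_E chi_q_eq mult.commute)

lemma epsilon_q_chi_q: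
  "la \<in> partitions n \<Longrightarrow> epsilon_q la g = (\<Sum>nu\<in>partitions n. chi_q nu g * of_int (kostka (transpose_partition nu) la))"
  by (simp add: epsilon_q_eq Tr_F chi_q_eq mult.commute)

text \<open>The numbers that expand \<open>epsilon_q\<close> in the characters are the rows of the
  Kostka matrix for transposed shapes, which expand the transposed Schur functions in monomial
  ones.\<close>

lemma Y_q_schur: "Y_q g = (\<Sum>nu\<in>partitions n. smult_ms (chi_q nu g) (sym_s (transpose_partition nu)))"
proof -
  have "(\<Sum>nu\<in>partitions n. smult_ms (chi_q nu g) (sym_s (transpose_partition nu))) =
      (\<Sum>nu\<in>partitions n. smult_ms (chi_q nu g)
        (\<Sum>la\<in>partitions n. smult_ms (of_int (kostka (transpose_partition nu) la)) (sym_m la)))"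
    by (rule sum.cong) (simp_all only: sym_s_sym_m[OF transpose_partition])
  also have "\<dots> = Y_q g"
    unfolding sum_smult_swap Y_q_def by (rule sum.cong) (simp_all only: epsilon_q_chi_q)
  finally show ?thesis ..
qed

lemma omega_Y_q: "sym_omega (Y_q g) = (\<Sum>nu\<in>partitions n. smult_ms (chi_q nu g) (sym_s nu))"
  unfolding Y_q_schur
  by (subst sym_omega_sum) (auto simp: sym_s_functions[of _ n] sym_omega_sym_s[of _ n] intro!: sum.cong)

lemma eta_q_sum: "(\<Sum>la\<in>partitions n. smult_ms (eta_q la g) (sym_m la)) = (\<Sum>nu\<in>partitions n. smult_ms (chi_q nu g) (sym_s nu))"
proof -
  have "(\<Sum>nu\<in>partitions n. smult_ms (chi_q nu g) (sym_s nu)) =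
      (\<Sum>nu\<in>partitions n. smult_ms (chi_q nu g) (\<Sum>la\<in>partitions n. smult_ms (of_int (kostka nu la)) (sym_m la)))"
    by (rule sum.cong) (simp_all only: sym_s_sym_m)
  also have "\<dots> = (\<Sum>la\<in>partitions n. smult_ms (eta_q la g) (sym_m la))"
    unfolding sum_smult_swap by (rule sum.cong) (simp_all only: eta_q_chi_q)
  finally show ?thesis ..
qed

text \<open>One change of basis for two pairs of families: Schur functions with complete functions,
  and transposed Schur functions with elementary ones. Both have the inverse Kostka matrix as
  coefficients.\<close>

lemma phi_q_sum:
  assumes "\<And>mu. mu \<in> partitions n \<Longrightarrow> s mu = (\<Sum>la\<in>partitions n. smult_ms (of_int (kinv n la mu)) (b la))"
  shows "(\<Sum>la\<in>partitions n. smult_ms (phi_q la g) (b la)) = (\<Sum>mu\<in>partitions n. smult_ms (chi_q mu g) (s mu))"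
    and "(\<Sum>la\<in>partitions n. smult_ms (gamma_q la g) (b la)) =
      (\<Sum>mu\<in>partitions n. smult_ms (chi_q mu g) (s (transpose_partition mu)))"
proof -
  have "(\<Sum>mu\<in>partitions n. smult_ms (chi_q mu g) (s mu)) =
      (\<Sum>mu\<in>partitions n. smult_ms (chi_q mu g) (\<Sum>la\<in>partitions n. smult_ms (of_int (kinv n la mu)) (b la)))"
    by (rule sum.cong) (simp_all only: assms)
  also have "\<dots> = (\<Sum>la\<in>partitions n. smult_ms (phi_q la g) (b la))"
    unfolding sum_smult_swap phi_q_def by (intro sum.cong refl arg_cong2[of _ _ _ _ smult_ms]) (simp add: inv_kostka_eq[of _ n] mult.commute)
  finally show "(\<Sum>la\<in>partitions n. smult_ms (phi_q la g) (b la)) = (\<Sum>mu\<in>partitions n. smult_ms (chi_q mu g) (s mu))" ..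
  have "(\<Sum>mu\<in>partitions n. smult_ms (chi_q mu g) (s (transpose_partition mu))) =
      (\<Sum>mu\<in>partitions n. smult_ms (chi_q mu g) (\<Sum>la\<in>partitions n. smult_ms (of_int (kinv n la (transpose_partition mu))) (b la)))"
    by (rule sum.cong) (simp_all only: assms transpose_partition)
  also have "\<dots> = (\<Sum>la\<in>partitions n. smult_ms (gamma_q la g) (b la))"
    unfolding sum_smult_swap gamma_q_def by (intro sum.cong refl arg_cong2[of _ _ _ _ smult_ms]) (simp add: inv_kostka_eq[of _ n] mult.commute)
  finally show "(\<Sum>la\<in>partitions n. smult_ms (gamma_q la g) (b la)) =
      (\<Sum>mu\<in>partitions n. smult_ms (chi_q mu g) (s (transpose_partition mu)))" ..
qed

text \<open>Frobenius' formula over \<open>ratfun\<close>, with the values of the Specht characters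
  embedded as constants.\<close>

lemma psi_q_sum:
  "(\<Sum>la\<in>partitions n. smult_ms (psi_q la g / of_nat (z_partition la)) (sym_p la)) =
    (\<Sum>mu\<in>partitions n. smult_ms (chi_q mu g) (sym_s mu))"
proof -
  have "(\<Sum>mu\<in>partitions n. smult_ms (chi_q mu g) (sym_s mu)) = (\<Sum>mu\<in>partitions n. smult_ms (chi_q mu g)
      (\<Sum>la\<in>partitions n. smult_ms (const_rf (sn_char_value mu la) / of_nat (z_partition la)) (sym_p la)))"
    by (intro sum.cong refl arg_cong2[of _ _ _ _ smult_ms] frobenius[symmetric]) (simp_all add: sn_char_value_eq)
  also have "\<dots> = (\<Sum>la\<in>partitions n. smult_ms (psi_q la g / of_nat (z_partition la)) (sym_p la))"
    unfolding sum_smult_swap psi_q_def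
    by (intro sum.cong refl arg_cong2[of _ _ _ _ smult_ms]) (simp add: sum_divide_distrib mult.commute)
  finally show ?thesis ..
qed

lemma Y_q_expansions:
  "Y_q g = (\<Sum>la\<in>partitions n. smult_ms (eta_q la g) (sym_f la))"
  "Y_q g = (\<Sum>la\<in>partitions n. smult_ms ((- 1) ^ (n - length la) * psi_q la g / of_nat (z_partition la)) (sym_p la))"
  "Y_q g = (\<Sum>la\<in>partitions n. smult_ms (chi_q (transpose_partition la) g) (sym_s la))"
  "Y_q g = (\<Sum>la\<in>partitions n. smult_ms (phi_q la g) (sym_e la))"
  "Y_q g = (\<Sum>la\<in>partitions n. smult_ms (gamma_q la g) (sym_h la))"
  "sym_omega (Y_q g) = (\<Sum>la\<in>partitions n. smult_ms (epsilon_q la g) (sym_f la))"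
  "sym_omega (Y_q g) = (\<Sum>la\<in>partitions n. smult_ms (phi_q la g) (sym_h la))"
  "sym_omega (Y_q g) = (\<Sum>la\<in>partitions n. smult_ms (gamma_q la g) (sym_e la))"
proof -
  have m: "(sym_m la :: ratfun mseries) \<in> sym_functions" for la by (rule sym_m_functions)
  have "Y_q g \<in> sym_functions" unfolding Y_q_def by (intro sym_functions_sum sym_functions_smult m)
  \<comment> \<open>The f and p expansions are obtained for the image of \<open>Y_q g\<close> and
    carried back, the involution being its own inverse; on power sums this produces the
    signs.\<close>
  then have Y: "Y_q g = sym_omega (sym_omega (Y_q g))" by (simp only: sym_omega(2))
  show "Y_q g = (\<Sum>la\<in>partitions n. smult_ms (eta_q la g) (sym_f la))"
    by (subst Y) (simp only: omega_Y_q flip: eta_q_sum, simp only: sym_omega_sum m sym_f_def)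
  show "Y_q g = (\<Sum>la\<in>partitions n. smult_ms ((- 1) ^ (n - length la) * psi_q la g / of_nat (z_partition la)) (sym_p la))"
  proof -
    have p: "\<forall>k\<in>set la. 0 < k" "sum_list la = n" if "la \<in> partitions n" for la using that by (auto simp: partitions_def)
    have pf: "(sym_p la :: ratfun mseries) \<in> sym_functions" if "la \<in> partitions n" for la
      by (rule sym_p_functions[OF p(1)[OF that]])
    have "Y_q g = (\<Sum>la\<in>partitions n. smult_ms (psi_q la g / of_nat (z_partition la)) (sym_omega (sym_p la)))"
      by (subst Y) (simp only: omega_Y_q flip: psi_q_sum, simp only: sym_omega_sum pf)
    also have "\<dots> = (\<Sum>la\<in>partitions n. smult_ms ((- 1) ^ (n - length la) * psi_q la g / of_nat (z_partition la)) (sym_p la))"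
      by (rule sum.cong) (simp_all add: sym_omega_sym_p p smult_smult mult.commute)
    finally show ?thesis .
  qed
  show "Y_q g = (\<Sum>la\<in>partitions n. smult_ms (chi_q (transpose_partition la) g) (sym_s la))"
    unfolding Y_q_schur by (subst sum_partitions_transpose[symmetric]) (rule sum.cong, simp_all)
  note h = sym_s_sym_h and e = sym_s_transpose_sym_e
  show "Y_q g = (\<Sum>la\<in>partitions n. smult_ms (phi_q la g) (sym_e la))"
    unfolding Y_q_schur by (rule phi_q_sum(1)[symmetric]) (rule e)
  show "Y_q g = (\<Sum>la\<in>partitions n. smult_ms (gamma_q la g) (sym_h la))"
    unfolding Y_q_schur by (rule phi_q_sum(2)[symmetric]) (rule h)
  show "sym_omega (Y_q g) = (\<Sum>la\<in>partitions n. smult_ms (epsilon_q la g) (sym_f la))"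
    unfolding Y_q_def by (simp only: sym_omega_sum m sym_f_def)
  show "sym_omega (Y_q g) = (\<Sum>la\<in>partitions n. smult_ms (phi_q la g) (sym_h la))"
    unfolding omega_Y_q by (rule phi_q_sum(1)[symmetric]) (rule h)
  have "(\<Sum>la\<in>partitions n. smult_ms (gamma_q la g) (sym_e la)) =
      (\<Sum>mu\<in>partitions n. smult_ms (chi_q mu g) (sym_s (transpose_partition (transpose_partition mu))))"
    by (rule phi_q_sum(2)) (rule e)
  then show "sym_omega (Y_q g) = (\<Sum>la\<in>partitions n. smult_ms (gamma_q la g) (sym_e la))"
    by (simp add: omega_Y_q)
qed

end

theorem proposition2p1:
  fixes scale :: "ratfun \<Rightarrow> 'h::ring_1 \<Rightarrow> 'h"
    and n :: nat
    and T :: "(nat \<Rightarrow> nat) \<Rightarrow> 'h"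
    and g :: 'h
  assumes "hecke_algebra scale n T"
  defines "\<epsilon> \<equiv> hecke_algebra.epsilon_q scale n T"
    and "\<eta> \<equiv> hecke_algebra.eta_q scale n T"
    and "\<chi> \<equiv> hecke_algebra.chi_q scale n T"
    and "\<psi> \<equiv> hecke_algebra.psi_q scale n T"
    and "\<phi> \<equiv> hecke_algebra.phi_q scale n T"
    and "\<gamma> \<equiv> hecke_algebra.gamma_q scale n T"
    and "Y \<equiv> hecke_algebra.Y_q scale n T g"
  shows
    "(Y = (\<Sum>la\<in>partitions n. smult_ms (\<eta> la g) (sym_f la)) \<and>
      Y = (\<Sum>la\<in>partitions n.
             smult_ms ((- 1) ^ (n - length la) * \<psi> la g / of_nat (z_partition la)) (sym_p la)) \<and>
      Y = (\<Sum>la\<in>partitions n. smult_ms (\<chi> (transpose_partition la) g) (sym_s la)) \<and>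
      Y = (\<Sum>la\<in>partitions n. smult_ms (\<phi> la g) (sym_e la)) \<and>
      Y = (\<Sum>la\<in>partitions n. smult_ms (\<gamma> la g) (sym_h la)))
     \<and>
     (sym_omega Y = (\<Sum>la\<in>partitions n. smult_ms (\<epsilon> la g) (sym_f la)) \<and>
      sym_omega Y = (\<Sum>la\<in>partitions n. smult_ms (\<eta> la g) (sym_m la)) \<and>
      sym_omega Y = (\<Sum>la\<in>partitions n.
             smult_ms (\<psi> la g / of_nat (z_partition la)) (sym_p la)) \<and>
      sym_omega Y = (\<Sum>la\<in>partitions n. smult_ms (\<chi> la g) (sym_s la)) \<and>
      sym_omega Y = (\<Sum>la\<in>partitions n. smult_ms (\<phi> la g) (sym_h la)) \<and>
      sym_omega Y = (\<Sum>la\<in>partitions n. smult_ms (\<gamma> la g) (sym_e la)))"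
proof -
  interpret hecke_algebra scale n T by fact
  show ?thesis
    unfolding \<epsilon>_def \<eta>_def \<chi>_def \<psi>_def \<phi>_def \<gamma>_def Y_def
    by (intro conjI Y_q_expansions) (simp_all only: omega_Y_q eta_q_sum psi_q_sum)
qed

end
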